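(* Let $k\ge 1$, let $T>0$, and let $U$ (with the associated $P,R,M,S$) be an exact solution on $\Omega\times[0,T]$ of the modified Camassa--Holm equation with periodic boundary conditions and initial value $U_0$, satisfying $U,U_t\in L^\infty(0,T;H^{k+3}(\Omega))$. Let $(u,p,r,m,s)$ be the numerical solution of the semi-discrete LDG scheme described in the context, with initial conditions $u(0)=P_h^-U_0$ and $r(0)=P_h(U_0')$. Then $$\|U-u\|^2+\|R-r\|^2\le C h^{2k}\qquad\text{for } t\in[0,T],$$ where $C$ is a positive constant independent of $h$ and dependent on $\|U\|_{L^\infty([0,T],H^{k+3}(\Omega))}$.
   Context: Modified Camassa--Holm equation: $M_t+2\kappa^2U_x+((U^2-U_x^2)M)_x=0$, $M=U-U_{xx}$, with $\kappa\in\mathbb R$ constant and periodic boundary conditions on $\Omega=(x_l,x_r)$. With $R=U_x$, $P=(U^2R)_x$, $S=(\tfrac13R^3)_x$, $f(U)=2\kappa^2U+U^3$, $g(R)=\tfrac13R^3$, it is rewritten as $M_t+f(U)_x-P_x+(R^2U)_x+S_x=0$, $P-(U^2R)_x=0$, $R-U_x=0$, $M-U+R_x=0$, $S-g(R)_x=0$. Mesh and space: $\Omega$ is partitioned into cells $I_j=(x_{j-1/2},x_{j+1/2})$, $j=1,\dots,N$, $x_{1/2}=x_l$, $x_{N+1/2}=x_r$, $h_j=x_{j+1/2}-x_{j-1/2}$, $h=\max_jh_j$. The family of meshes is quasi-uniform: $h_j/h\ge\rho$ for all $j$ with a fixed $\rho>0$ as $h\to0$. $V_h^k=\{v\in L^2(\Omega):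 v|_{I_j}\in\mathcal P_k(I_j)\ \forall j\}$, where $\mathcal P_k(I_j)$ is the space of polynomials of degree at most $k$. $v^\pm_{j+1/2}$ are the right ($+$) and left ($-$) limits of $v$ at $x_{j+1/2}$, with periodic identification of the two end points; $\{v\}=\tfrac12(v^++v^-)$; $(w,v)_j=\int_{I_j}wv\,dx$; $\|\cdot\|$ is the $L^2(\Omega)$ norm. Scheme: for each $t\in(0,T]$ find $u,p,r,m,s\in V_h^k$ such that for every $j$ and all $v,q,\psi,\varphi,w\in V_h^k$ $$(m_t,v)_j-(f(u),v_x)_j+\hat f_{j+1/2}v^-_{j+1/2}-\hat f_{j-1/2}v^+_{j-1/2}+(p,v_x)_j-\hat p_{j+1/2}v^-_{j+1/2}+\hat p_{j-1/2}v^+_{j-1/2}$$ $$-(r^2u,v_x)_j+\widehat{(r^2u)}_{j+1/2}v^-_{j+1/2}-\widehat{(r^2u)}_{j-1/2}v^+_{j-1/2}-(s,v_x)_j+\hat s_{j+1/2}v^-_{j+1/2}-\hat s_{j-1/2}v^+_{j-1/2}=0,$$ $$(p,q)_j+(u^2r,q_x)_j-\widehat{(u^2r)}_{j+1/2}q^-_{j+1/2}+\widehat{(u^2r)}_{j-1/2}q^+_{j-1/2}=0,$$ $$(r,\psi)_j+(u,\psi_x)_j-\hat u_{j+1/2}\psi^-_{j+1/2}+\hat u_{j-1/2}\psi^+_{j-1/2}=0,$$ $$(m,\varphi)_j-(u,\varphi)_j-(r,\varphi_x)_j+\hat r_{j+1/2}\varphi^-_{j+1/2}-\hat r_{j-1/2}\varphi^+_{j-1/2}=0,$$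 $$(s,w)_j+(g(r),w_x)_j-\hat g_{j+1/2}w^-_{j+1/2}+\hat g_{j-1/2}w^+_{j-1/2}=0,$$ with fluxes (at each interface) $\hat p=p^+$, $\widehat{(r^2u)}=\{ur\}r^+$, $\widehat{(u^2r)}=\{ur\}u^-$, $\hat u=u^-$, $\hat r=r^+$, $\hat s=s^+$, and for $\hat f,\hat g$ one of the following two choices. Dissipative scheme: $\hat f=f(u^-)$, $\hat g=g(r^+)$. Conservative scheme: $\hat f=\kappa^2(u^++u^-)+\tfrac14(u^++u^-)((u^+)^2+(u^-)^2)$, $\hat g=\tfrac1{12}(r^++r^-)((r^+)^2+(r^-)^2)$. Projections: $P_h$ is the $L^2(\Omega)$-orthogonal projection onto $V_h^k$. The Gauss--Radau projection $P_h^-w\in V_h^k$ is defined cellwise by $(P_h^-w-w,v)_j=0$ for all $v\in\mathcal P_{k-1}(I_j)$ and $(P_h^-w)^-_{j+1/2}=w^-_{j+1/2}$. *)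

theory Defs
  imports "HOL-Analysis.Analysis" "HOL-Computational_Algebra.Polynomial"
begin

section \<open>Sobolev spaces on a bounded interval\<close>

definition L2_space :: "real set \<Rightarrow> (real \<Rightarrow> real) set" where
  "L2_space \<Omega> = {w. w \<in> borel_measurable (lebesgue_on \<Omega>) \<and>
                     integrable (lebesgue_on \<Omega>) (\<lambda>x. (w x)\<^sup>2)}"

definition L2_inner :: "real set \<Rightarrow> (real \<Rightarrow> real) \<Rightarrow> (real \<Rightarrow> real) \<Rightarrow> real" where
  "L2_inner \<Omega> w v = (LINT x|lebesgue_on \<Omega>. w x * v x)"

definition L2_norm :: "real set \<Rightarrow> (real \<Rightarrow> real) \<Rightarrow> real" where
  "L2_norm \<Omega> w = sqrt (L2_inner \<Omega> w w)"

definition test_function :: "real set \<Rightarrow> (real \<Rightarrow> real) \<Rightarrow> bool" where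
  "test_function \<Omega> \<phi> \<longleftrightarrow>
     (\<forall>n x. (deriv ^^ n) \<phi> differentiable (at x)) \<and>
     (\<exists>S. compact S \<and> S \<subseteq> \<Omega> \<and> (\<forall>x. x \<notin> S \<longrightarrow> \<phi> x = 0))"

definition weak_deriv :: "real set \<Rightarrow> nat \<Rightarrow> (real \<Rightarrow> real) \<Rightarrow> (real \<Rightarrow> real) \<Rightarrow> bool" where
  "weak_deriv \<Omega> i w d \<longleftrightarrow>
     (\<forall>\<phi>. test_function \<Omega> \<phi> \<longrightarrow>
        L2_inner \<Omega> w ((deriv ^^ i) \<phi>) = (- 1) ^ i * L2_inner \<Omega> d \<phi>)"

definition sobolev :: "nat \<Rightarrow> real set \<Rightarrow> (real \<Rightarrow> real) set" where
  "sobolev n \<Omega> = {w \<in> L2_space \<Omega>. \<forall>i\<le>n. \<exists>d\<in>L2_space \<Omega>. weak_deriv \<Omega> i w d}"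

text \<open>Weak derivatives are unique only up to null sets; the norm does not depend on the choice.\<close>

definition sobolev_norm :: "nat \<Rightarrow> real set \<Rightarrow> (real \<Rightarrow> real) \<Rightarrow> real" where
  "sobolev_norm n \<Omega> w =
     sqrt (\<Sum>i\<le>n. (L2_norm \<Omega> (SOME d. d \<in> L2_space \<Omega> \<and> weak_deriv \<Omega> i w d))\<^sup>2)"

text \<open>The Bochner space \<open>L\<^sup>\<infinity>(0,T; H\<^sup>n(\<Omega>))\<close> for functions \<open>w t x\<close>. Since \<open>H\<^sup>n(\<Omega>)\<close> is
  separable, joint measurability together with \<open>w t \<in> H\<^sup>n(\<Omega>)\<close> for a.e. \<open>t\<close> amounts to
  strong measurability of \<open>t \<mapsto> w t\<close> (Pettis).\<close>

definition Linf_sobolev :: "real \<Rightarrow> nat \<Rightarrow> real set \<Rightarrow> (real \<Rightarrow> real \<Rightarrow> real) set" where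
  "Linf_sobolev T n \<Omega> =
     {w. (\<lambda>(t, x). w t x) \<in> borel_measurable (lebesgue_on ({0..T} \<times> \<Omega>)) \<and>
         (\<exists>K. AE t in lebesgue_on {0..T}. w t \<in> sobolev n \<Omega> \<and> sobolev_norm n \<Omega> (w t) \<le> K)}"

definition Linf_sobolev_norm :: "real \<Rightarrow> nat \<Rightarrow> real set \<Rightarrow> (real \<Rightarrow> real \<Rightarrow> real) \<Rightarrow> real" where
  "Linf_sobolev_norm T n \<Omega> w =
     Inf {K. 0 \<le> K \<and> (AE t in lebesgue_on {0..T}. sobolev_norm n \<Omega> (w t) \<le> K)}"

section \<open>The modified Camassa--Holm equation\<close>

text \<open>Derivative in time on \<open>[0,T]\<close>, one-sided at the two ends.\<close>

definition time_deriv :: "real \<Rightarrow> (real \<Rightarrow> real \<Rightarrow> real) \<Rightarrow> real \<Rightarrow> real \<Rightarrow> real" where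
  "time_deriv T w t x = vector_derivative (\<lambda>\<tau>. w \<tau> x) (at t within {0..T})"

definition momentum :: "(real \<Rightarrow> real) \<Rightarrow> real \<Rightarrow> real" where
  "momentum U x = U x - deriv (deriv U) x"

text \<open>Classical solutions of \<open>M\<^sub>t + 2\<kappa>\<^sup>2 U\<^sub>x + ((U\<^sup>2 - U\<^sub>x\<^sup>2) M)\<^sub>x = 0\<close>,
  \<open>M = U - U\<^sub>x\<^sub>x\<close>, on \<open>[0,T]\<close>. Periodic boundary conditions on \<open>(x\<^sub>l,x\<^sub>r)\<close> are
  expressed by extending \<open>U\<close> periodically in \<open>x\<close> to the real line and imposing the equation there.
  For \<open>U, U\<^sub>t \<in> L\<^sup>\<infinity>(0,T; H\<^sup>n(\<Omega>))\<close> with \<open>n \<ge> 4\<close>, strong solutions are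
  classical: \<open>U\<close> is Lipschitz in time with values in \<open>H\<^sup>n(\<Omega>) \<subseteq> C\<^sup>3\<close>, and the equation
  then yields the continuity of \<open>M\<^sub>t\<close> and \<open>U\<^sub>t\<close>.\<close>

definition mCH_solution :: "real \<Rightarrow> real \<Rightarrow> real \<Rightarrow> real \<Rightarrow> (real \<Rightarrow> real \<Rightarrow> real) \<Rightarrow> bool" where
  "mCH_solution \<kappa> T xl xr U \<longleftrightarrow>
     (\<forall>t\<in>{0..T}. \<forall>x. U t (x + (xr - xl)) = U t x) \<and>
     continuous_on ({0..T} \<times> UNIV) (\<lambda>(t, x). U t x) \<and>
     continuous_on ({0..T} \<times> UNIV) (\<lambda>(t, x). deriv (U t) x) \<and>
     continuous_on ({0..T} \<times> UNIV) (\<lambda>(t, x). momentum (U t) x) \<and>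
     continuous_on ({0..T} \<times> UNIV) (\<lambda>(t, x). time_deriv T U t x) \<and>
     continuous_on ({0..T} \<times> UNIV) (\<lambda>(t, x). time_deriv T (\<lambda>\<tau>. momentum (U \<tau>)) t x) \<and>
     (\<forall>t\<in>{0..T}. \<forall>x.
        U t differentiable (at x) \<and>
        deriv (U t) differentiable (at x) \<and>
        (\<lambda>y. ((U t y)\<^sup>2 - (deriv (U t) y)\<^sup>2) * momentum (U t) y) differentiable (at x) \<and>
        (\<lambda>\<tau>. U \<tau> x) differentiable (at t within {0..T}) \<and>
        (\<lambda>\<tau>. momentum (U \<tau>) x) differentiable (at t within {0..T}) \<and>
        time_deriv T (\<lambda>\<tau>. momentum (U \<tau>)) t x + 2 * \<kappa>\<^sup>2 * deriv (U t) x
          + deriv (\<lambda>y. ((U t y)\<^sup>2 - (deriv (U t) y)\<^sup>2) * momentum (U t) y) x = 0)"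

section \<open>Meshes and the discontinuous finite element space\<close>

text \<open>A mesh with \<open>N\<close> cells is given by its nodes \<open>X 0 < \<dots> < X N\<close>, where \<open>X j\<close> is the
  interface \<open>x\<^bsub>j+1/2\<^esub>\<close>; the cells are \<open>I\<^sub>j = (X (j-1), X j)\<close> for \<open>j = 1,\<dots>,N\<close>.\<close>

definition is_mesh :: "real \<Rightarrow> real \<Rightarrow> nat \<Rightarrow> (nat \<Rightarrow> real) \<Rightarrow> bool" where
  "is_mesh xl xr N X \<longleftrightarrow> 1 \<le> N \<and> X 0 = xl \<and> X N = xr \<and> (\<forall>j\<in>{1..N}. X (j - 1) < X j)"

definition cell :: "(nat \<Rightarrow> real) \<Rightarrow> nat \<Rightarrow> real set" where
  "cell X j = {X (j - 1)<..<X j}"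

definition mesh_size :: "nat \<Rightarrow> (nat \<Rightarrow> real) \<Rightarrow> real" where
  "mesh_size N X = Max ((\<lambda>j. X j - X (j - 1)) ` {1..N})"

definition quasi_uniform :: "real \<Rightarrow> nat \<Rightarrow> (nat \<Rightarrow> real) \<Rightarrow> bool" where
  "quasi_uniform \<rho> N X \<longleftrightarrow> (\<forall>j\<in>{1..N}. (X j - X (j - 1)) / mesh_size N X \<ge> \<rho>)"

text \<open>The values at the interfaces are left unspecified, as the elements are \<open>L\<^sup>2\<close> functions.\<close>

definition Vh :: "nat \<Rightarrow> nat \<Rightarrow> (nat \<Rightarrow> real) \<Rightarrow> (real \<Rightarrow> real) set" where
  "Vh k N X = {v. \<forall>j\<in>{1..N}. \<exists>q :: real poly. degree q \<le> k \<and> (\<forall>x\<in>cell X j. v x = poly q x)}"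

text \<open>The one-sided limits \<open>v\<^sup>-\<close> and \<open>v\<^sup>+\<close> at the interface \<open>X j\<close>, with \<open>X 0\<close> and \<open>X N\<close> identified.\<close>

definition left_trace :: "nat \<Rightarrow> (nat \<Rightarrow> real) \<Rightarrow> (real \<Rightarrow> real) \<Rightarrow> nat \<Rightarrow> real" where
  "left_trace N X v j = Lim (at_left (X (if j = 0 then N else j))) v"

definition right_trace :: "nat \<Rightarrow> (nat \<Rightarrow> real) \<Rightarrow> (real \<Rightarrow> real) \<Rightarrow> nat \<Rightarrow> real" where
  "right_trace N X v j = Lim (at_right (X (if j = N then 0 else j))) v"

text \<open>The projections are stated as relations, because they determine an element of \<open>Vh\<close> only up to
  its values at the interfaces. For \<open>k \<ge> 1\<close>, \<open>degree q < k\<close> means \<open>q \<in> P\<^bsub>k-1\<^esub>\<close>.\<close>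

definition is_L2_projection ::
    "nat \<Rightarrow> nat \<Rightarrow> (nat \<Rightarrow> real) \<Rightarrow> (real \<Rightarrow> real) \<Rightarrow> (real \<Rightarrow> real) \<Rightarrow> bool" where
  "is_L2_projection k N X w z \<longleftrightarrow>
     z \<in> Vh k N X \<and> (\<forall>v\<in>Vh k N X. L2_inner {X 0<..<X N} (\<lambda>x. z x - w x) v = 0)"

definition is_Gauss_Radau_projection ::
    "nat \<Rightarrow> nat \<Rightarrow> (nat \<Rightarrow> real) \<Rightarrow> (real \<Rightarrow> real) \<Rightarrow> (real \<Rightarrow> real) \<Rightarrow> bool" where
  "is_Gauss_Radau_projection k N X w z \<longleftrightarrow>
     z \<in> Vh k N X \<and>
     (\<forall>j\<in>{1..N}.
        (\<forall>q :: real poly. degree q < k \<longrightarrow> L2_inner (cell X j) (\<lambda>x. z x - w x) (poly q) = 0) \<and>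
        left_trace N X z j = left_trace N X w j)"

section \<open>The semi-discrete LDG scheme\<close>

datatype scheme = Dissipative | Conservative

definition flux_f :: "real \<Rightarrow> real \<Rightarrow> real" where
  "flux_f \<kappa> a = 2 * \<kappa>\<^sup>2 * a + a ^ 3"

definition flux_g :: "real \<Rightarrow> real" where
  "flux_g a = a ^ 3 / 3"

text \<open>The arguments \<open>a\<close> and \<open>b\<close> are the left and the right trace, respectively.\<close>

fun num_flux_f :: "scheme \<Rightarrow> real \<Rightarrow> real \<Rightarrow> real \<Rightarrow> real" where
  "num_flux_f Dissipative \<kappa> a b = flux_f \<kappa> a"
| "num_flux_f Conservative \<kappa> a b = \<kappa>\<^sup>2 * (b + a) + 1 / 4 * (b + a) * (b\<^sup>2 + a\<^sup>2)"

fun num_flux_g :: "scheme \<Rightarrow> real \<Rightarrow> real \<Rightarrow> real" where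
  "num_flux_g Dissipative a b = flux_g b"
| "num_flux_g Conservative a b = 1 / 12 * (b + a) * (b\<^sup>2 + a\<^sup>2)"

text \<open>All five equations use the weak form of \<open>(F\<^sub>x, v)\<^sub>j\<close> with numerical flux \<open>Fh\<close>:
  \<open>- (F, v\<^sub>x)\<^sub>j + Fh\<^bsub>j+1/2\<^esub> v\<^sup>-\<^bsub>j+1/2\<^esub> - Fh\<^bsub>j-1/2\<^esub> v\<^sup>+\<^bsub>j-1/2\<^esub>\<close>.\<close>

definition dg_div ::
    "nat \<Rightarrow> (nat \<Rightarrow> real) \<Rightarrow> nat \<Rightarrow> (real \<Rightarrow> real) \<Rightarrow> (nat \<Rightarrow> real) \<Rightarrow> (real \<Rightarrow> real) \<Rightarrow> real" where
  "dg_div N X j F Fh v =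
     - L2_inner (cell X j) F (deriv v)
     + Fh j * left_trace N X v j - Fh (j - 1) * right_trace N X v (j - 1)"

text \<open>The spatial equations of the scheme at a fixed time; \<open>mt\<close> stands for \<open>m\<^sub>t\<close>.\<close>

definition ldg_equations ::
    "scheme \<Rightarrow> real \<Rightarrow> nat \<Rightarrow> nat \<Rightarrow> (nat \<Rightarrow> real) \<Rightarrow> (real \<Rightarrow> real) \<Rightarrow> (real \<Rightarrow> real) \<Rightarrow>
     (real \<Rightarrow> real) \<Rightarrow> (real \<Rightarrow> real) \<Rightarrow> (real \<Rightarrow> real) \<Rightarrow> (real \<Rightarrow> real) \<Rightarrow> bool" where
  "ldg_equations sch \<kappa> k N X u p r m s mt \<longleftrightarrow>
     (let um = left_trace N X u; up = right_trace N X u;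
          rm = left_trace N X r; rp = right_trace N X r;
          avg_ur = (\<lambda>i. (up i * rp i + um i * rm i) / 2);
          f_hat = (\<lambda>i. num_flux_f sch \<kappa> (um i) (up i));
          g_hat = (\<lambda>i. num_flux_g sch (rm i) (rp i));
          p_hat = right_trace N X p;
          s_hat = right_trace N X s;
          rru_hat = (\<lambda>i. avg_ur i * rp i);
          uur_hat = (\<lambda>i. avg_ur i * um i)
      in \<forall>j\<in>{1..N}. \<forall>v\<in>Vh k N X.
           L2_inner (cell X j) mt v
             + dg_div N X j (\<lambda>x. flux_f \<kappa> (u x)) f_hat v
             - dg_div N X j p p_hat v
             + dg_div N X j (\<lambda>x. (r x)\<^sup>2 * u x) rru_hat v
             + dg_div N X j s s_hat v = 0 \<and>
           L2_inner (cell X j) p v - dg_div N X j (\<lambda>x. (u x)\<^sup>2 * r x) uur_hat v = 0 \<and>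
           L2_inner (cell X j) r v - dg_div N X j u um v = 0 \<and>
           L2_inner (cell X j) m v - L2_inner (cell X j) u v + dg_div N X j r rp v = 0 \<and>
           L2_inner (cell X j) s v - dg_div N X j (\<lambda>x. flux_g (r x)) g_hat v = 0)"

text \<open>The equations hold on \<open>(0,T]\<close>; continuity of \<open>u\<close> and \<open>r\<close> up to \<open>t = 0\<close> is what ties the solution
  to its initial data. As \<open>Vh\<close> is finite dimensional, continuity and differentiability in time may be
  expressed pointwise inside the cells.\<close>

definition ldg_solution ::
    "scheme \<Rightarrow> real \<Rightarrow> real \<Rightarrow> nat \<Rightarrow> nat \<Rightarrow> (nat \<Rightarrow> real) \<Rightarrow> (real \<Rightarrow> real \<Rightarrow> real) \<Rightarrow>
     (real \<Rightarrow> real \<Rightarrow> real) \<Rightarrow> (real \<Rightarrow> real \<Rightarrow> real) \<Rightarrow> (real \<Rightarrow> real \<Rightarrow> real) \<Rightarrow> (real \<Rightarrow> real \<Rightarrow> real) \<Rightarrow> bool" where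
  "ldg_solution sch \<kappa> T k N X u p r m s \<longleftrightarrow>
     (\<forall>t\<in>{0..T}. u t \<in> Vh k N X \<and> r t \<in> Vh k N X) \<and>
     (\<forall>j\<in>{1..N}. \<forall>x\<in>cell X j.
        continuous_on {0..T} (\<lambda>t. u t x) \<and> continuous_on {0..T} (\<lambda>t. r t x)) \<and>
     (\<forall>t\<in>{0<..T}.
        p t \<in> Vh k N X \<and> m t \<in> Vh k N X \<and> s t \<in> Vh k N X \<and>
        (\<forall>j\<in>{1..N}. \<forall>x\<in>cell X j. (\<lambda>\<tau>. m \<tau> x) differentiable (at t within {0..T})) \<and>
        ldg_equations sch \<kappa> k N X (u t) (p t) (r t) (m t) (s t) (time_deriv T m t))"

end

theory Submission
  imports Defs
begin

text \<open>Let \<open>D\<close> be the discrete derivative with the flux \<open>u\<^sup>-\<close> and \<open>a(v,w) = (v,w) + (D v, D w)\<close>.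
  The scheme then says \<open>r = D u\<close>, \<open>(m,w) = a(u,w)\<close> and \<open>(m\<^sub>t,w) = SR(u,w)\<close>. Comparing \<open>u\<close> with the
  Ritz projection \<open>Z\<close> of \<open>U\<close>, defined by \<open>a(Z,w) = (M,w)\<close>, makes the error \<open>\<zeta> = Z - u\<close> satisfy
  \<open>d/dt a(\<zeta>,\<zeta>) = 2 ((M\<^sub>t,\<zeta>) - SR(u,\<zeta>))\<close> exactly, and no regularity of \<open>U\<^sub>t\<close> is lost to the
  projection. As long as \<open>a(\<zeta>,\<zeta>)\<close> is a small multiple of \<open>h\<close>, \<open>\<zeta>\<close> and \<open>D \<zeta>\<close> are pointwise bounded; the
  terms without a power of \<open>h\<close> are exact derivatives whose interface contributions are dissipated by
  the fluxes or absorbed, so the right-hand side is at most \<open>C (a(\<zeta>,\<zeta>) + h\<^bsup>2k\<^esup>)\<close>. Gronwall's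
  inequality keeps \<open>a(\<zeta>,\<zeta>)\<close> of size \<open>h\<^bsup>2k\<^esup>\<close>, below the threshold if \<open>h\<close> is small. On coarse
  meshes the bound follows from the energy \<open>a(u,u)\<close> being nonincreasing.\<close>

section \<open>Smooth approximation of Sobolev functions\<close>

text \<open>The obstacle that shapes the proof is the derivative of \<open>D \<zeta>\<close>. An
  inverse estimate bounds it only at the price of 1/\<open>len\<close>, and the jump of
  \<open>D \<zeta>\<close>, unlike that of \<open>\<zeta>\<close>, carries no factor
  \<open>len\<close>. No term that is merely quadratic in the error may therefore multiply either of
  them. Such terms are collected in the primitive \<open>Hf\<close>; beside these factors only the
  Ritz error is left, and Young's inequality turns the product into its square divided by
  \<open>h\<close>. This lowers the order 2k+2 of the Ritz energy to 2k. A second reason for 2k is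
  that U_xx has only k bounded derivatives, so the part of the flux containing it is approximated to
  order k. The barrier of size \<open>h\<close> lies above h^(2k) because 2k exceeds 1.

  A separate difficulty is that the regularity is given by weak derivatives at almost every time,
  while Taylor estimates need bounded classical derivatives at every time. No higher derivative of
  \<open>U\<close> is constructed: smooth functions with uniformly bounded derivatives, arbitrarily
  close to U, U_x and U_xx, take their place, and this description survives limits in time.\<close>

definition smooth :: "(real \<Rightarrow> real) \<Rightarrow> bool" where
  "smooth f \<longleftrightarrow> (\<forall>n x. (deriv ^^ n) f differentiable (at x))"

text \<open>Iterated derivatives never leave a family closed under differentiation, so smoothness
  reduces to exhibiting such a family. Sums, affine substitutions, products and the flat functions
  are all treated this way.\<close>

lemma smooth_coinduct:
  assumes "f \<in> F" "\<And>g. g \<in> F \<Longrightarrow> (\<forall>x. g differentiable (at x)) \<and> deriv g \<in> F"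
  shows "smooth f"
proof -
  have "(deriv ^^ n) f \<in> F" for n by (induction n) (use assms in auto)
  then show ?thesis using assms(2) by (auto simp: smooth_def)
qed

lemma smooth_coinduct_DERIV:
  assumes "f \<in> F" "\<And>g. g \<in> F \<Longrightarrow> \<exists>g'\<in>F. \<forall>x. (g has_field_derivative g' x) (at x)"
  shows "smooth f"
proof (rule smooth_coinduct[OF assms(1)])
  fix g assume "g \<in> F"
  then obtain g' where g': "g' \<in> F" "\<And>x. (g has_field_derivative g' x) (at x)" using assms(2) by blast
  then have "deriv g = g'" by (intro ext DERIV_imp_deriv)
  then show "(\<forall>x. g differentiable (at x)) \<and> deriv g \<in> F"
    using g' by (auto simp: real_differentiable_def)
qed

lemma smooth_DERIV: "smooth f \<Longrightarrow> (f has_field_derivative deriv f x) (at x)"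
  using spec[of "\<lambda>n. \<forall>x. (deriv ^^ n) f differentiable (at x)" 0]
  by (auto simp: smooth_def DERIV_deriv_iff_real_differentiable)

lemma smooth_deriv: "smooth f \<Longrightarrow> smooth (deriv f)"
  unfolding smooth_def by (metis funpow_Suc_right o_apply)

lemma smooth_higher_deriv: "smooth f \<Longrightarrow> smooth ((deriv ^^ n) f)"
  by (induction n) (auto intro: smooth_deriv)

lemma smooth_continuous: "smooth f \<Longrightarrow> continuous_on S f"
  by (intro continuous_at_imp_continuous_on ballI DERIV_isCont[OF smooth_DERIV])

lemma smooth_continuous_compose:
  fixes g :: "'a::topological_space \<Rightarrow> real"
  shows "smooth f \<Longrightarrow> continuous_on S g \<Longrightarrow> continuous_on S (\<lambda>x. f (g x))"
  by (rule continuous_on_compose2[OF smooth_continuous[of f UNIV]]) auto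

lemma smooth_add: "smooth f \<Longrightarrow> smooth g \<Longrightarrow> smooth (\<lambda>x. f x + g x)"
proof (rule smooth_coinduct_DERIV[of _ "{\<lambda>x. f x + g x | f g. smooth f \<and> smooth g}"])
  fix h assume "h \<in> {\<lambda>x. f x + g x | f g. smooth f \<and> smooth g}"
  then obtain f g where f: "smooth f" "smooth g" "h = (\<lambda>x. f x + g x)" by blast
  show "\<exists>g'\<in>{\<lambda>x. f x + g x | f g. smooth f \<and> smooth g}. \<forall>x. (h has_field_derivative g' x) (at x)"
  proof (intro bexI allI)
    show "(h has_field_derivative deriv f x + deriv g x) (at x)" for x
      unfolding f(3) by (intro DERIV_add smooth_DERIV f)
  qed (use smooth_deriv f in blast)
qed blast

lemma smooth_affine: "smooth f \<Longrightarrow> smooth (\<lambda>x. c * f (a + b * x))"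
proof (rule smooth_coinduct_DERIV[of _ "{\<lambda>x. c * f (a + b * x) | c f. smooth f}"])
  fix g assume "g \<in> {\<lambda>x. c * f (a + b * x) | c f. smooth f}"
  then obtain c f where f: "smooth f" "g = (\<lambda>x. c * f (a + b * x))" by blast
  have "(g has_field_derivative (c * b) * deriv f (a + b * x)) (at x)" for x
    unfolding f(2) by (rule derivative_eq_intros DERIV_chain2[OF smooth_DERIV[OF f(1)]] refl | simp)+
  then show "\<exists>g'\<in>{\<lambda>x. c * f (a + b * x) | c f. smooth f}. \<forall>x. (g has_field_derivative g' x) (at x)"
    using smooth_deriv[OF f(1)] by (intro bexI[of _ "\<lambda>x. (c * b) * deriv f (a + b * x)"]) auto
qed blast

lemma smooth_reflect: "smooth f \<Longrightarrow> smooth (\<lambda>y. f (x - y))"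
  using smooth_affine[of f 1 x "-1"] by simp

text \<open>Single products of smooth functions are not closed under differentiation, but their
  finite sums are, by the Leibniz rule.\<close>

inductive mult_span :: "(real \<Rightarrow> real) \<Rightarrow> bool" where
  "smooth f \<Longrightarrow> smooth g \<Longrightarrow> mult_span (\<lambda>x. f x * g x)"
| "mult_span f \<Longrightarrow> mult_span g \<Longrightarrow> mult_span (\<lambda>x. f x + g x)"

lemma mult_span_DERIV: "mult_span f \<Longrightarrow> \<exists>f'. mult_span f' \<and> (\<forall>x. (f has_field_derivative f' x) (at x))"
proof (induction rule: mult_span.induct)
  case (1 f g)
  show ?case
    by (intro exI[of _ "\<lambda>x. deriv f x * g x + f x * deriv g x"] conjI allI mult_span.intros smooth_deriv 1)
      (use DERIV_mult[OF smooth_DERIV[OF 1(1)] smooth_DERIV[OF 1(2)]] in \<open>simp add: ac_simps\<close>)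
next
  case (2 f g)
  then obtain f' g' where *: "mult_span f'" "mult_span g'" "\<And>x. (f has_field_derivative f' x) (at x)"
    "\<And>x. (g has_field_derivative g' x) (at x)" by blast
  show ?case
    by (intro exI[of _ "\<lambda>x. f' x + g' x"] conjI allI mult_span.intros(2) DERIV_add *)
qed

lemma smooth_mult: "smooth f \<Longrightarrow> smooth g \<Longrightarrow> smooth (\<lambda>x. f x * g x)"
proof (rule smooth_coinduct_DERIV[of _ "Collect mult_span"])
  fix h assume "h \<in> Collect mult_span"
  then show "\<exists>g'\<in>Collect mult_span. \<forall>x. (h has_field_derivative g' x) (at x)"
    using mult_span_DERIV[of h] by auto
qed (simp add: mult_span.intros(1))

section \<open>A compactly supported bump and its primitive\<close>

definition flat :: "real poly \<Rightarrow> real \<Rightarrow> real" where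
  "flat p x = (if 0 < x then poly p (1 / x) * exp (- (1 / x)) else 0)"

lemma poly_exp_tendsto: "((\<lambda>y. poly p y * exp (- y)) \<longlongrightarrow> 0) (at_top :: real filter)"
proof -
  have "((\<lambda>y. \<Sum>i\<le>degree p. coeff p i * (y ^ i / exp y)) \<longlongrightarrow> (\<Sum>i\<le>degree p. coeff p i * 0)) (at_top :: real filter)"
    by (intro tendsto_intros tendsto_power_div_exp_0)
  moreover have "poly p y * exp (- y) = (\<Sum>i\<le>degree p. coeff p i * (y ^ i / exp y))" for y :: real
    by (simp add: poly_altdef exp_minus sum_distrib_left divide_inverse ac_simps)
  ultimately show ?thesis by simp
qed

text \<open>The polynomial parameter keeps the family closed: with y = 1/x the chain rule turns
  \<open>p\<close> into y^2 (p - p'), and at 0 the exponential beats every polynomial.\<close>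

lemma flat_DERIV: "(flat p has_field_derivative flat ([:0, 0, 1:] * (p - pderiv p)) x) (at x)"
proof -
  consider "x > 0" | "x < 0" | "x = 0" by linarith
  then show ?thesis
  proof cases
    case 1
    have "((\<lambda>x. poly p (1 / x) * exp (- (1 / x))) has_field_derivative flat ([:0, 0, 1:] * (p - pderiv p)) x) (at x)"
      using 1 by (auto intro!: derivative_eq_intros DERIV_chain2[OF poly_DERIV] simp: flat_def power2_eq_square field_simps)
    then show ?thesis
      by (rule has_field_derivative_transform_within_open[of _ _ _ "{0<..}"]) (use 1 in \<open>auto simp: flat_def\<close>)
  next
    case 2
    have "((\<lambda>x. 0) has_field_derivative flat ([:0, 0, 1:] * (p - pderiv p)) x) (at x)"
      using 2 by (simp add: flat_def)
    then show ?thesis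
      by (rule has_field_derivative_transform_within_open[of _ _ _ "{..<0}"]) (use 2 in \<open>auto simp: flat_def\<close>)
  next
    case 3
    have "((\<lambda>y. (flat p y - flat p 0) / (y - 0)) \<longlongrightarrow> 0) (at 0)"
      unfolding filterlim_at_split
    proof
      show "((\<lambda>y. (flat p y - flat p 0) / (y - 0)) \<longlongrightarrow> 0) (at_left 0)"
        by (rule tendsto_eventually) (auto simp: eventually_at_left_field flat_def intro!: exI[of _ "-1"])
      \<comment> \<open>Under y = 1/x the difference quotient at 0 becomes y p(y) exp(-y);
        \<open>pCons 0 p\<close> supplies the factor y.\<close>
      have "((\<lambda>y. poly (pCons 0 p) y * exp (- y)) \<longlongrightarrow> 0) (at_top :: real filter)" by (rule poly_exp_tendsto)
      moreover have "\<forall>\<^sub>F y in at_top. poly (pCons 0 p) y * exp (- y) = (flat p (inverse y) - flat p 0) / (inverse y - 0)"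
        using eventually_gt_at_top[of 0] by eventually_elim (auto simp: flat_def field_simps)
      ultimately show "((\<lambda>y. (flat p y - flat p 0) / (y - 0)) \<longlongrightarrow> 0) (at_right 0)"
        unfolding filterlim_at_right_to_top by (rule Lim_transform_eventually)
    qed
    then show ?thesis unfolding 3 has_field_derivative_iff by (simp add: flat_def)
  qed
qed

lemma smooth_flat: "smooth (flat p)"
  by (rule smooth_coinduct_DERIV[of _ "range flat"]) (use flat_DERIV in blast)+

definition bump0 :: "real \<Rightarrow> real" where "bump0 x = flat 1 (1 + x) * flat 1 (1 - x)"

definition bump :: "real \<Rightarrow> real" where "bump x = bump0 x / integral {-1..1} bump0"

lemma smooth_bump0: "smooth bump0"
  using smooth_mult[OF smooth_affine[OF smooth_flat, of 1 1 1 1] smooth_affine[OF smooth_flat, of 1 1 1 "-1"]]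
  by (simp add: bump0_def [abs_def])

lemma bump0_nonneg: "0 \<le> bump0 x" and bump0_zero: "1 \<le> \<bar>x\<bar> \<Longrightarrow> bump0 x = 0"
  by (auto simp: bump0_def flat_def)

lemma bump0_integral_pos: "0 < integral {-1..1} bump0"
proof -
  have c: "continuous_on {-1..1} bump0" by (rule smooth_continuous[OF smooth_bump0])
  have "0 \<le> integral {-1..1} bump0"
    using bump0_nonneg by (intro integral_nonneg integrable_continuous_interval c) auto
  moreover have "integral {-1..1} bump0 \<noteq> 0"
  proof
    assume "integral {-1..1} bump0 = 0"
    then have "\<forall>x\<in>{-1..1}. bump0 x = 0"
      using bump0_nonneg c by (subst (asm) integral_eq_0_iff) auto
    then show False by (auto simp: bump0_def flat_def dest!: bspec[of _ _ 0])
  qed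
  ultimately show ?thesis by simp
qed

lemma smooth_bump: "smooth bump"
  using smooth_affine[OF smooth_bump0, of "1 / integral {-1..1} bump0" 0 1] by (simp add: bump_def [abs_def])

lemma bump_nonneg: "0 \<le> bump x" and bump_zero: "1 \<le> \<bar>x\<bar> \<Longrightarrow> bump x = 0"
  using bump0_integral_pos by (auto simp: bump_def bump0_nonneg bump0_zero)

lemma bump_integral: "integral {-1..1} bump = 1"
  using bump0_integral_pos by (simp add: bump_def [abs_def])

text \<open>A smooth Heaviside function. The lower limit lies strictly to the left of the support of
  \<open>bump\<close>, so the derivative is two-sided at -1 as well.\<close>

definition step :: "real \<Rightarrow> real" where "step s = integral {-2..s} bump"

lemma step_low: "s \<le> -1 \<Longrightarrow> step s = 0"
proof -
  assume "s \<le> -1"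
  then have "integral {-2..s} bump = integral {-2..s} (\<lambda>_. 0)" by (intro integral_cong bump_zero) auto
  then show ?thesis by (simp add: step_def)
qed

lemma step_DERIV: "(step has_field_derivative bump s) (at s)"
proof (cases "s < -1")
  case True
  have "((\<lambda>s. 0) has_field_derivative bump s) (at s)" using True bump_zero[of s] by simp
  then show ?thesis
    by (rule has_field_derivative_transform_within_open[of _ _ _ "{..<-1}"]) (use True step_low in auto)
next
  case False
  have "(step has_field_derivative bump s) (at s within {-2..s + 1})"
    unfolding step_def [abs_def] using False
    by (intro integral_has_real_derivative smooth_continuous smooth_bump) auto
  then have "(step has_field_derivative bump s) (at s within {-2<..<s + 1})"
    by (rule DERIV_subset) auto
  then show ?thesis using False by (subst (asm) at_within_open) auto
qed

lemma smooth_step: "smooth step"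
proof -
  have "deriv step = bump" by (intro ext DERIV_imp_deriv step_DERIV)
  then have "(deriv ^^ n) step differentiable (at x)" for n x
    using smooth_bump step_DERIV by (cases n) (auto simp: smooth_def real_differentiable_def funpow_Suc_right simp del: funpow.simps)
  then show ?thesis by (simp add: smooth_def)
qed

lemma step_diff: "a \<le> b \<Longrightarrow> step b - step a = integral {a..b} bump"
  by (rule integral_unique[symmetric, OF fundamental_theorem_of_calculus])
    (auto intro: has_field_derivative_at_within[OF step_DERIV] simp flip: has_real_derivative_iff_has_vector_derivative)

lemma step_high: "1 \<le> s \<Longrightarrow> step s = 1"
proof -
  assume s: "1 \<le> s"
  have "step s - step 1 = integral {1..s} bump" by (rule step_diff[OF s])
  also have "\<dots> = integral {1..s} (\<lambda>_. 0)" by (intro integral_cong bump_zero) auto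
  finally have "step s = step 1" by simp
  also have "\<dots> = 1" using step_diff[of "-1" 1] step_low[of "-1"] bump_integral by simp
  finally show ?thesis .
qed

lemma step_mono: "a \<le> b \<Longrightarrow> step a \<le> step b"
  using step_diff[of a b] integral_nonneg[OF integrable_continuous_interval[OF smooth_continuous[OF smooth_bump]], of a b] bump_nonneg
  by (auto simp: algebra_simps)

lemma step_bounds: "0 \<le> step s" "step s \<le> 1"
proof -
  show "0 \<le> step s" using step_mono[of "min s (-1)" s] step_low[of "min s (-1)"] by simp
  show "step s \<le> 1" using step_mono[of s "max s 1"] step_high[of "max s 1"] by simp
qed

text \<open>Fixed by choice once and for all. The constants built on it are then genuine functions
  of their arguments, as the order of quantifiers in the final statement requires;
  \<open>Binv\<close> and \<open>Clift\<close> are defined in the same way.\<close>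

definition Mbump :: real where "Mbump = (SOME M. \<forall>x. \<bar>bump x\<bar> \<le> M)"

lemma Mbump: "\<bar>bump x\<bar> \<le> Mbump"
proof -
  have "compact (bump ` {-1..1})" by (intro compact_continuous_image smooth_continuous smooth_bump) auto
  then obtain M where M: "\<forall>y\<in>bump ` {-1..1}. norm y \<le> M" using compact_imp_bounded bounded_iff by metis
  have "\<bar>bump x\<bar> \<le> max M 0" for x
  proof (cases "x \<in> {-1..1}")
    case True
    then have "\<bar>bump x\<bar> \<le> M" using M by auto
    then show ?thesis by simp
  next
    case False
    then show ?thesis using bump_zero[of x] by auto
  qed
  then have "\<exists>M. \<forall>x. \<bar>bump x\<bar> \<le> M" by blast
  from someI_ex[OF this] show ?thesis by (simp add: Mbump_def)
qed

section \<open>Mollification on an interval\<close>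

definition moll :: "real \<Rightarrow> real \<Rightarrow> real" where "moll e s = 1 / e * bump (0 + 1 / e * s)"

lemma smooth_moll: "smooth (moll e)"
  unfolding moll_def [abs_def] by (rule smooth_affine[OF smooth_bump])

lemma moll_zero: "0 < e \<Longrightarrow> e \<le> \<bar>s\<bar> \<Longrightarrow> moll e s = 0"
  using bump_zero[of "s / e"] by (simp add: moll_def abs_divide)

lemma moll_nonneg: "0 < e \<Longrightarrow> 0 \<le> moll e s"
  by (simp add: moll_def bump_nonneg)

lemma deriv_zero_outside:
  assumes "\<And>s. e < \<bar>s\<bar> \<Longrightarrow> f s = (0::real)" "e < \<bar>s\<bar>"
  shows "deriv f s = 0"
proof (rule DERIV_imp_deriv)
  have o: "open {s::real. e < \<bar>s\<bar>}" by (intro open_Collect_less continuous_intros)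
  have "((\<lambda>s. 0) has_field_derivative 0) (at s)" by simp
  then show "(f has_field_derivative 0) (at s)"
    by (rule has_field_derivative_transform_within_open[OF _ o]) (use assms in auto)
qed

lemma moll_higher_zero: "0 < e \<Longrightarrow> e < \<bar>s\<bar> \<Longrightarrow> (deriv ^^ i) (moll e) s = 0"
proof (induction i arbitrary: s)
  case 0
  then show ?case by (simp add: moll_zero)
next
  case (Suc i)
  have "deriv ((deriv ^^ i) (moll e)) s = 0"
    using Suc by (intro deriv_zero_outside[of e]) auto
  then show ?case by simp
qed

text \<open>Turns derivatives of the mollifier in the centre x into derivatives in the integration
  variable y, the form in which a test function enters \<open>weak_deriv\<close>.\<close>

lemma higher_deriv_reflect:
  assumes "smooth f"
  shows "(deriv ^^ i) (\<lambda>y. f (x - y)) = (\<lambda>y. (-1) ^ i * (deriv ^^ i) f (x - y))"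
proof (induction i)
  case (Suc i)
  have "((\<lambda>y. (-1) ^ i * (deriv ^^ i) f (x - y)) has_field_derivative (-1) ^ Suc i * (deriv ^^ Suc i) f (x - y)) (at y)" for y
  proof -
    note d = smooth_DERIV[OF smooth_higher_deriv[OF assms, of i]]
    show ?thesis by (rule derivative_eq_intros DERIV_chain2[OF d] refl | simp)+
  qed
  then have "deriv (\<lambda>y. (-1) ^ i * (deriv ^^ i) f (x - y)) = (\<lambda>y. (-1) ^ Suc i * (deriv ^^ Suc i) f (x - y))"
    by (intro ext DERIV_imp_deriv)
  then show ?case using Suc by simp
qed simp

lemma L2_inner_continuous:
  assumes "a < b" "continuous_on {a..b} f" "continuous_on {a..b} g"
  shows "L2_inner {a<..<b} f g = integral {a..b} (\<lambda>x. f x * g x)"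
proof -
  have "(\<lambda>x. f x * g x) absolutely_integrable_on {a..b}"
    by (rule absolutely_integrable_continuous_real) (intro continuous_intros assms)
  then have ai: "(\<lambda>x. f x * g x) absolutely_integrable_on {a<..<b}"
    by (rule set_integrable_subset) auto
  have "L2_inner {a<..<b} f g = integral {a<..<b} (\<lambda>x. f x * g x)"
    unfolding L2_inner_def
    by (intro lebesgue_integral_eq_integral absolutely_integrable_imp_integrable[OF ai]) simp_all
  also have "\<dots> = integral {a..b} (\<lambda>x. f x * g x)" by (rule integral_open_interval_real[symmetric])
  finally show ?thesis .
qed

text \<open>Young's inequality |d| \<le> (1 + d^2)/2 against a bounded factor is enough, and it
  yields the integrability of the product at the same time.\<close>

lemma L2_inner_bound:
  assumes ab: "a < b" and d: "d \<in> L2_space {a<..<b}" and g: "continuous_on {a..b} g" and M: "\<And>x. \<bar>g x\<bar> \<le> M"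
  shows "\<bar>L2_inner {a<..<b} d g\<bar> \<le> M * ((b - a) + (L2_norm {a<..<b} d)\<^sup>2) / 2"
proof -
  let ?m = "lebesgue_on {a<..<b}"
  have M0: "0 \<le> M" using M[of 0] by linarith
  have dm: "d \<in> borel_measurable ?m" and di: "integrable ?m (\<lambda>x. (d x)\<^sup>2)" using d by (auto simp: L2_space_def)
  have fm: "finite_measure ?m" by (rule finite_measureI) (simp add: emeasure_restrict_space ab less_imp_le)
  have c1: "integrable ?m (\<lambda>x. 1 :: real)" by (rule finite_measure.integrable_const[OF fm])
  have gm: "g \<in> borel_measurable ?m"
    by (rule continuous_imp_measurable_on_sets_lebesgue) (auto intro: continuous_on_subset[OF g])
  have dom: "integrable ?m (\<lambda>x. M * (1 + (d x)\<^sup>2) / 2)" using c1 di by simp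
  have pt: "\<bar>d x * g x\<bar> \<le> M * (1 + (d x)\<^sup>2) / 2" for x
  proof -
    have "0 \<le> (\<bar>d x\<bar> - 1)\<^sup>2" by simp
    then have "\<bar>d x\<bar> \<le> (1 + (d x)\<^sup>2) / 2" by (simp add: power2_eq_square algebra_simps)
    then have "\<bar>d x\<bar> * \<bar>g x\<bar> \<le> (1 + (d x)\<^sup>2) / 2 * M" using M by (intro mult_mono) auto
    then show ?thesis by (simp add: abs_mult mult.commute)
  qed
  have i: "integrable ?m (\<lambda>x. d x * g x)"
  proof (rule Bochner_Integration.integrable_bound[OF dom])
    show "AE x in ?m. norm (d x * g x) \<le> norm (M * (1 + (d x)\<^sup>2) / 2)"
      unfolding real_norm_def by (intro AE_I2 order.trans[OF pt abs_ge_self])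
  qed (use dm gm in auto)
  have "\<bar>L2_inner {a<..<b} d g\<bar> \<le> (LINT x|?m. \<bar>d x * g x\<bar>)"
    unfolding L2_inner_def by (rule integral_abs_bound)
  also have "\<dots> \<le> (LINT x|?m. M * (1 + (d x)\<^sup>2) / 2)"
    using i dom pt by (intro integral_mono) auto
  also have "\<dots> = M * ((LINT x|?m. 1) + (LINT x|?m. (d x)\<^sup>2)) / 2"
    using c1 di by simp
  also have "(LINT x|?m. (1::real)) = b - a"
    using ab by (simp add: measure_restrict_space)
  also have "(LINT x|?m. (d x)\<^sup>2) = (L2_norm {a<..<b} d)\<^sup>2"
    by (simp add: L2_norm_def L2_inner_def power2_eq_square)
  finally show ?thesis .
qed

lemma moll_integral:
  assumes e: "0 < e" and x: "a \<le> x - e" "x + e \<le> b"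
  shows "integral {a..b} (\<lambda>y. moll e (x - y)) = 1"
proof -
  have "((\<lambda>y. moll e (x - y)) has_integral (- step ((x - b) / e) - - step ((x - a) / e))) {a..b}"
  proof (rule fundamental_theorem_of_calculus)
    fix y
    have "((\<lambda>y. - step ((x - y) / e)) has_field_derivative moll e (x - y)) (at y)"
      using e by (auto intro!: derivative_eq_intros DERIV_chain2[OF step_DERIV] simp: moll_def)
    then show "((\<lambda>y. - step ((x - y) / e)) has_vector_derivative moll e (x - y)) (at y within {a..b})"
      unfolding has_real_derivative_iff_has_vector_derivative by (rule has_vector_derivative_at_within)
  qed (use e x in auto)
  moreover have "step ((x - b) / e) = 0" using e x by (intro step_low) (simp add: field_simps)
  moreover have "step ((x - a) / e) = 1" using e x by (intro step_high) (simp add: field_simps)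
  ultimately show ?thesis by (simp add: integral_unique)
qed

text \<open>The mollifier has mass 1, so the error is an average of f y - f x over a window of
  radius \<open>e\<close>.\<close>

lemma moll_approx:
  assumes e: "0 < e" and x: "a \<le> x - e" "x + e \<le> b" and f: "continuous_on {a..b} f"
    and d: "\<And>y. y \<in> {a..b} \<Longrightarrow> \<bar>y - x\<bar> \<le> e \<Longrightarrow> \<bar>f y - f x\<bar> \<le> \<delta>"
  shows "\<bar>integral {a..b} (\<lambda>y. f y * moll e (x - y)) - f x\<bar> \<le> \<delta>"
proof -
  have c: "continuous_on {a..b} (\<lambda>y. moll e (x - y))"
    by (rule smooth_continuous[OF smooth_reflect[OF smooth_moll]])
  have "integral {a..b} (\<lambda>y. f y * moll e (x - y)) - f x * integral {a..b} (\<lambda>y. moll e (x - y))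
    = integral {a..b} (\<lambda>y. f y * moll e (x - y) - f x * moll e (x - y))"
    by (subst integral_diff) (simp_all add: integrable_continuous_interval continuous_on_mult f c)
  also have "\<bar>\<dots>\<bar> \<le> integral {a..b} (\<lambda>y. \<delta> * moll e (x - y))"
  proof (subst real_norm_def[symmetric], rule integral_norm_bound_integral)
    fix y assume y: "y \<in> {a..b}"
    show "norm (f y * moll e (x - y) - f x * moll e (x - y)) \<le> \<delta> * moll e (x - y)"
    proof (cases "\<bar>y - x\<bar> \<le> e")
      case True
      then show ?thesis using d[OF y True] moll_nonneg[OF e, of "x - y"]
        by (simp add: left_diff_distrib[symmetric] abs_mult mult_right_mono)
    next
      case False
      then show ?thesis using moll_zero[OF e, of "x - y"] by simp
    qed
  qed (intro integrable_continuous_interval continuous_on_diff continuous_on_mult continuous_on_const f c)+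
  finally show ?thesis using moll_integral[OF e x] by simp
qed

lemma conv_by_parts:
  assumes ab: "a \<le> b" and f: "\<And>y. (f has_field_derivative f' y) (at y)" and f': "continuous_on {a..b} f'"
    and g: "smooth g" and g0: "g (x - a) = 0" "g (x - b) = 0"
  shows "integral {a..b} (\<lambda>y. f y * deriv g (x - y)) = integral {a..b} (\<lambda>y. f' y * g (x - y))"
proof -
  have cf: "continuous_on {a..b} f" by (intro continuous_at_imp_continuous_on ballI DERIV_isCont[OF f])
  have "((\<lambda>y. f' y * g (x - y) - f y * deriv g (x - y)) has_integral (f b * g (x - b) - f a * g (x - a))) {a..b}"
  proof (rule fundamental_theorem_of_calculus[OF ab])
    fix y
    have "((\<lambda>y. f y * g (x - y)) has_field_derivative (f' y * g (x - y) - f y * deriv g (x - y))) (at y)"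
      by (rule derivative_eq_intros f DERIV_chain2[OF smooth_DERIV[OF g]] refl | simp)+
    then show "((\<lambda>y. f y * g (x - y)) has_vector_derivative f' y * g (x - y) - f y * deriv g (x - y)) (at y within {a..b})"
      unfolding has_real_derivative_iff_has_vector_derivative by (rule has_vector_derivative_at_within)
  qed
  then have "integral {a..b} (\<lambda>y. f' y * g (x - y) - f y * deriv g (x - y)) = 0"
    using g0 by (simp add: integral_unique)
  moreover have "integral {a..b} (\<lambda>y. f' y * g (x - y) - f y * deriv g (x - y))
    = integral {a..b} (\<lambda>y. f' y * g (x - y)) - integral {a..b} (\<lambda>y. f y * deriv g (x - y))"
    by (intro integral_diff integrable_continuous_interval continuous_on_mult f' cf
        smooth_continuous[OF smooth_reflect[OF g]] smooth_continuous[OF smooth_reflect[OF smooth_deriv[OF g]]])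
  ultimately show ?thesis by simp
qed

lemma test_function_smooth:
  "smooth \<phi> \<Longrightarrow> compact S \<Longrightarrow> S \<subseteq> \<Omega> \<Longrightarrow> (\<And>x. x \<notin> S \<Longrightarrow> \<phi> x = 0) \<Longrightarrow> test_function \<Omega> \<phi>"
  by (auto simp: test_function_def smooth_def)

lemma test_moll:
  assumes "0 < e" "a < x - e" "x + e < b"
  shows "test_function {a<..<b} (\<lambda>y. moll e (x - y))"
  by (rule test_function_smooth[of _ "{x - e..x + e}"])
    (use assms smooth_reflect[OF smooth_moll] in \<open>auto intro!: moll_zero\<close>)

lemma higher_deriv_diff:
  assumes "smooth f" "smooth g"
  shows "(deriv ^^ i) (\<lambda>y. f y - g y) = (\<lambda>y. (deriv ^^ i) f y - (deriv ^^ i) g y)"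
proof (induction i)
  case (Suc i)
  have "deriv (\<lambda>y. (deriv ^^ i) f y - (deriv ^^ i) g y) = (\<lambda>y. (deriv ^^ Suc i) f y - (deriv ^^ Suc i) g y)"
    unfolding funpow.simps o_apply
    by (intro ext DERIV_imp_deriv DERIV_diff smooth_DERIV smooth_higher_deriv assms)
  then show ?case using Suc by simp
qed simp

text \<open>A weak fundamental theorem of calculus: the derivative of order i+1 of
  \<open>\<Phi>\<close> is the difference of the derivatives of order i of \<open>\<phi>\<close> and
  \<open>\<psi>\<close>, so testing \<open>U\<close> with it links \<open>d'\<close> to
  \<open>d\<close>. A concentrated test function is thereby traded for a harmless one and a bounded
  primitive.\<close>

lemma weak_deriv_shift:
  assumes ab: "a < b" and U: "continuous_on {a..b} U"
    and d: "weak_deriv {a<..<b} i U d" and d': "weak_deriv {a<..<b} (Suc i) U d'"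
    and t: "test_function {a<..<b} \<Phi>" "test_function {a<..<b} \<phi>" "test_function {a<..<b} \<psi>"
    and \<Phi>: "deriv \<Phi> = (\<lambda>y. \<phi> y - \<psi> y)"
  shows "L2_inner {a<..<b} d \<phi> = L2_inner {a<..<b} d \<psi> - L2_inner {a<..<b} d' \<Phi>"
proof -
  have s: "smooth \<phi>" "smooth \<psi>" using t by (auto simp: test_function_def smooth_def)
  have "(deriv ^^ Suc i) \<Phi> = (\<lambda>y. (deriv ^^ i) \<phi> y - (deriv ^^ i) \<psi> y)"
    unfolding funpow_Suc_right o_apply \<Phi> by (rule higher_deriv_diff[OF s])
  then have "L2_inner {a<..<b} U ((deriv ^^ Suc i) \<Phi>)
     = integral {a..b} (\<lambda>y. U y * (deriv ^^ i) \<phi> y - U y * (deriv ^^ i) \<psi> y)"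
    using s U by (subst L2_inner_continuous[OF ab])
      (auto intro!: continuous_on_diff smooth_continuous[OF smooth_higher_deriv] simp: right_diff_distrib)
  also have "\<dots> = L2_inner {a<..<b} U ((deriv ^^ i) \<phi>) - L2_inner {a<..<b} U ((deriv ^^ i) \<psi>)"
    using s U by (subst integral_diff)
      (auto intro!: integrable_continuous_interval continuous_on_mult smooth_continuous[OF smooth_higher_deriv] simp: L2_inner_continuous[OF ab U smooth_continuous[OF smooth_higher_deriv]])
  finally have "(- 1) ^ Suc i * L2_inner {a<..<b} d' \<Phi> = (- 1) ^ i * (L2_inner {a<..<b} d \<phi> - L2_inner {a<..<b} d \<psi>)"
    using d d' t by (simp add: weak_deriv_def right_diff_distrib)
  then have "- ((- 1) ^ i * L2_inner {a<..<b} d' \<Phi>) = (- 1) ^ i * (L2_inner {a<..<b} d \<phi> - L2_inner {a<..<b} d \<psi>)"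
    by simp
  then show ?thesis by (cases "even i") auto
qed

text \<open>All derivatives sit on the mollifier, so the function is defined and differentiable at
  every real x although \<open>U\<close> is merely continuous; index i is the i-th derivative of
  index 0.\<close>

definition conv :: "real \<Rightarrow> real \<Rightarrow> (real \<Rightarrow> real) \<Rightarrow> real \<Rightarrow> nat \<Rightarrow> real \<Rightarrow> real" where
  "conv a b U e i x = integral {a..b} (\<lambda>y. U y * (deriv ^^ i) (moll e) (x - y))"

lemma conv_DERIV:
  assumes U: "continuous_on {a..b} U"
  shows "(conv a b U e i has_field_derivative conv a b U e (Suc i) x) (at x)"
proof -
  have "((\<lambda>x. integral (cbox a b) (\<lambda>y. U y * (deriv ^^ i) (moll e) (x - y))) has_field_derivative
      integral (cbox a b) (\<lambda>y. U y * (deriv ^^ Suc i) (moll e) (x - y))) (at x within UNIV)"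
  proof (rule leibniz_rule_field_derivative)
    fix x y assume "y \<in> cbox a b"
    note D = smooth_DERIV[OF smooth_higher_deriv[OF smooth_moll]]
    show "((\<lambda>x. U y * (deriv ^^ i) (moll e) (x - y)) has_field_derivative U y * (deriv ^^ Suc i) (moll e) (x - y)) (at x within UNIV)"
      by (rule derivative_eq_intros DERIV_chain2[OF D] refl | simp)+
  next
    fix x
    show "(\<lambda>y. U y * (deriv ^^ i) (moll e) (x - y)) integrable_on cbox a b"
      by (intro integrable_continuous continuous_on_mult smooth_continuous[OF smooth_reflect[OF smooth_higher_deriv[OF smooth_moll]]])
        (use U in simp)
  next
    have "continuous_on (UNIV \<times> cbox a b) (\<lambda>z. U (snd z) * (deriv ^^ Suc i) (moll e) (fst z - snd z))"
      by (intro continuous_on_mult continuous_on_compose2[OF U] continuous_on_diff continuous_on_fst continuous_on_snd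
          continuous_on_id smooth_continuous_compose[OF smooth_higher_deriv[OF smooth_moll]]) auto
    then show "continuous_on (UNIV \<times> cbox a b) (\<lambda>(x, y). U y * (deriv ^^ Suc i) (moll e) (x - y))"
      by (simp add: case_prod_beta)
  qed auto
  then show ?thesis unfolding conv_def [abs_def] by simp
qed

text \<open>With a fixed bump \<open>\<chi>\<close> of width comparable to \<open>L\<close>, the difference of the mollifier \<open>\<eta>\<close> and \<open>\<chi>\<close> is a
  derivative \<open>\<Phi>'\<close> with \<open>\<Phi>\<close> bounded, hence \<open>(d\<^sub>i, \<eta>) = (d\<^sub>i, \<chi>) - (d\<^bsub>i+1\<^esub>, \<Phi>)\<close> is bounded by \<open>L\<^sup>2\<close> norms
  of two consecutive weak derivatives.\<close>

definition Csob :: "real \<Rightarrow> real \<Rightarrow> real" where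
  "Csob L K = (4 * Mbump / L + 1) * (L + K\<^sup>2) / 2"

lemma Mbump_nonneg: "0 \<le> Mbump"
  using Mbump[of 0] by linarith

lemma sobolev_derivs:
  assumes "U \<in> sobolev n \<Omega>" "sobolev_norm n \<Omega> U \<le> K" "i \<le> n"
  obtains d where "d \<in> L2_space \<Omega>" "weak_deriv \<Omega> i U d" "(L2_norm \<Omega> d)\<^sup>2 \<le> K\<^sup>2"
proof -
  let ?d = "\<lambda>i. SOME d. d \<in> L2_space \<Omega> \<and> weak_deriv \<Omega> i U d"
  have "\<exists>d. d \<in> L2_space \<Omega> \<and> weak_deriv \<Omega> i U d" using assms by (auto simp: sobolev_def)
  then have d: "?d i \<in> L2_space \<Omega> \<and> weak_deriv \<Omega> i U (?d i)" by (rule someI_ex)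
  have "(L2_norm \<Omega> (?d i))\<^sup>2 \<le> (\<Sum>i\<le>n. (L2_norm \<Omega> (?d i))\<^sup>2)"
    using assms(3) by (intro member_le_sum) auto
  also have "\<dots> = (sobolev_norm n \<Omega> U)\<^sup>2"
    unfolding sobolev_norm_def by (rule real_sqrt_pow2[symmetric]) (auto intro: sum_nonneg)
  also have "\<dots> \<le> K\<^sup>2"
    using assms(2) by (intro power_mono) (auto simp: sobolev_norm_def intro!: sum_nonneg)
  finally show thesis using that d by blast
qed

lemma conv_bound:
  assumes ab: "a < b" and U: "continuous_on {a..b} U" and S: "U \<in> sobolev n {a<..<b}" "sobolev_norm n {a<..<b} U \<le> K"
    and i: "i < n" and e: "0 < e" and x: "a < x - e" "x + e < b"
  shows "\<bar>conv a b U e i x\<bar> \<le> Csob (b - a) K"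
proof -
  obtain d where d: "d \<in> L2_space {a<..<b}" "weak_deriv {a<..<b} i U d" "(L2_norm {a<..<b} d)\<^sup>2 \<le> K\<^sup>2"
    using sobolev_derivs[OF S, of i] i by auto
  obtain d' where d': "d' \<in> L2_space {a<..<b}" "weak_deriv {a<..<b} (Suc i) U d'" "(L2_norm {a<..<b} d')\<^sup>2 \<le> K\<^sup>2"
    using sobolev_derivs[OF S, of "Suc i"] i by auto
  \<comment> \<open>The reference bump sits at the midpoint with radius a quarter of the length. It
    depends on the interval alone, and its height is at most 4 \<open>Mbump\<close> / (b -
    a).\<close>
  let ?c = "(a + b) / 2" and ?f = "(b - a) / 4"
  let ?\<phi> = "\<lambda>y. moll e (x - y)" and ?\<psi> = "\<lambda>y. moll ?f (?c - y)"
  \<comment> \<open>Both steps are 1 far to the left and 0 far to the right, so the difference has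
    compact support; its values stay in [-1, 1] however small \<open>e\<close> is.\<close>
  let ?\<Phi> = "\<lambda>y. step ((?c - y) / ?f) - step ((x - y) / e)"
  have f: "0 < ?f" using ab by simp
  have c: "a < ?c - ?f" "?c + ?f < b" using ab by (simp_all add: field_simps)
  have s: "smooth (\<lambda>y. step ((z - y) / g))" for z g
    using smooth_affine[OF smooth_step, of 1 "z / g" "- 1 / g"] by (simp add: diff_divide_distrib)
  have "smooth (\<lambda>y. step ((?c - y) / ?f) + -1 * step (x / e + (- 1 / e) * y))"
    by (intro smooth_add s smooth_affine smooth_step)
  then have s\<Phi>: "smooth ?\<Phi>" by (simp add: diff_divide_distrib)
  have t\<Phi>: "test_function {a<..<b} ?\<Phi>"
  proof (rule test_function_smooth[OF s\<Phi>, of "{min (x - e) (?c - ?f)..max (x + e) (?c + ?f)}"])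
    fix y assume y: "y \<notin> {min (x - e) (?c - ?f)..max (x + e) (?c + ?f)}"
    show "?\<Phi> y = 0"
    proof (cases "y < min (x - e) (?c - ?f)")
      case True
      then have "?f \<le> ?c - y" "e \<le> x - y" by linarith+
      then have "1 \<le> (?c - y) / ?f" "1 \<le> (x - y) / e"
        by (simp_all only: le_divide_eq_1_pos[OF f] le_divide_eq_1_pos[OF e])
      then show ?thesis by (simp only: step_high)
    next
      case False
      then have "max (x + e) (?c + ?f) < y" using y by auto
      then have "?c - y \<le> -1 * ?f" "x - y \<le> -1 * e" by linarith+
      then have "(?c - y) / ?f \<le> -1" "(x - y) / e \<le> -1"
        by (simp_all only: pos_divide_le_eq[OF f] pos_divide_le_eq[OF e])
      then show ?thesis by (simp only: step_low)
    qed
  qed (use x c in auto)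
  have dd: "deriv ?\<Phi> = (\<lambda>y. ?\<phi> y - ?\<psi> y)"
  proof (intro ext DERIV_imp_deriv)
    fix y
    have st: "((\<lambda>y. step ((z - y) / g)) has_field_derivative - moll g (z - y)) (at y)" if "0 < g" for z g
    proof -
      have "((\<lambda>y. step ((z - y) / g)) has_field_derivative bump ((z - y) / g) * (- 1 / g)) (at y)"
        by (rule DERIV_chain2[OF step_DERIV]) (use that in \<open>auto intro!: derivative_eq_intros\<close>)
      then show ?thesis by (simp add: moll_def)
    qed
    show "(?\<Phi> has_field_derivative ?\<phi> y - ?\<psi> y) (at y)"
      using DERIV_diff[OF st[OF f, of ?c] st[OF e, of x]] by simp
  qed
  have t\<phi>: "test_function {a<..<b} ?\<phi>" by (rule test_moll[OF e x])
  have t\<psi>: "test_function {a<..<b} ?\<psi>" by (rule test_moll[OF f c])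
  \<comment> \<open>The square of (-1)^i is inserted: one factor moves the derivatives from x to y,
    the other cancels the sign in the definition of the weak derivative.\<close>
  have "conv a b U e i x = (-1) ^ i * ((-1) ^ i * integral {a..b} (\<lambda>y. U y * (deriv ^^ i) (moll e) (x - y)))"
    by (simp add: conv_def flip: mult.assoc power_mult_distrib)
  also have "\<dots> = (-1) ^ i * integral {a..b} (\<lambda>y. U y * (deriv ^^ i) ?\<phi> y)"
    unfolding higher_deriv_reflect[OF smooth_moll] integral_mult_right[symmetric] by (simp add: ac_simps)
  also have "\<dots> = (-1) ^ i * L2_inner {a<..<b} U ((deriv ^^ i) ?\<phi>)"
    by (subst L2_inner_continuous[OF ab U])
      (rule smooth_continuous[OF smooth_higher_deriv[OF smooth_reflect[OF smooth_moll]]], rule refl)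
  also have "\<dots> = (-1) ^ i * ((-1) ^ i * L2_inner {a<..<b} d ?\<phi>)"
    using d(2) t\<phi> by (simp add: weak_deriv_def)
  also have "\<dots> = L2_inner {a<..<b} d ?\<phi>" by (simp flip: mult.assoc power_mult_distrib)
  also have "\<dots> = L2_inner {a<..<b} d ?\<psi> - L2_inner {a<..<b} d' ?\<Phi>"
    by (rule weak_deriv_shift[OF ab U d(2) d'(2) t\<Phi> t\<phi> t\<psi> dd])
  finally have eq: "conv a b U e i x = L2_inner {a<..<b} d ?\<psi> - L2_inner {a<..<b} d' ?\<Phi>" .
  have "\<bar>L2_inner {a<..<b} d ?\<psi>\<bar> \<le> 4 * Mbump / (b - a) * ((b - a) + (L2_norm {a<..<b} d)\<^sup>2) / 2"
  proof (rule L2_inner_bound[OF ab d(1)])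
    fix y
    have "\<bar>?\<psi> y\<bar> = 1 / ?f * \<bar>bump (0 + 1 / ?f * (?c - y))\<bar>"
      unfolding moll_def abs_mult using f by simp
    also have "\<dots> \<le> 1 / ?f * Mbump" using f by (intro mult_left_mono Mbump) auto
    finally show "\<bar>?\<psi> y\<bar> \<le> 4 * Mbump / (b - a)" by simp
  qed (rule smooth_continuous[OF smooth_reflect[OF smooth_moll]])
  also have "\<dots> \<le> 4 * Mbump / (b - a) * ((b - a) + K\<^sup>2) / 2"
    using d(3) ab Mbump_nonneg by (intro divide_right_mono mult_left_mono add_left_mono) auto
  finally have 1: "\<bar>L2_inner {a<..<b} d ?\<psi>\<bar> \<le> 4 * Mbump / (b - a) * ((b - a) + K\<^sup>2) / 2" .
  have "\<bar>L2_inner {a<..<b} d' ?\<Phi>\<bar> \<le> 1 * ((b - a) + (L2_norm {a<..<b} d')\<^sup>2) / 2"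
  proof (rule L2_inner_bound[OF ab d'(1)])
    fix y
    show "\<bar>?\<Phi> y\<bar> \<le> 1"
      using step_bounds[of "(?c - y) / ?f"] step_bounds[of "(x - y) / e"] by linarith
  qed (rule smooth_continuous[OF s\<Phi>])
  also have "\<dots> \<le> 1 * ((b - a) + K\<^sup>2) / 2" using d'(3) by simp
  finally have 2: "\<bar>L2_inner {a<..<b} d' ?\<Phi>\<bar> \<le> 1 * ((b - a) + K\<^sup>2) / 2" .
  have "Csob (b - a) K = 4 * Mbump / (b - a) * ((b - a) + K\<^sup>2) / 2 + 1 * ((b - a) + K\<^sup>2) / 2"
    by (simp only: Csob_def distrib_right add_divide_distrib)
  then show ?thesis using 1 2 unfolding eq by linarith
qed

text \<open>Mollifying near the ends of the interval would need values outside it. Contraction by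
  \<open>\<mu>\<close> about the midpoint puts the centre \<open>z\<close> at distance at least 2e
  from both ends while moving x by at most 2e. The i-th derivative of the contracted function
  carries the factor \<mu>^i, which for i \<le> 2 differs from 1 by at most 8e/(b - a); hypothesis
  \<open>eM\<close> pays for that.\<close>

lemma conv_dilated_approx:
  fixes f :: "real \<Rightarrow> real"
  assumes ab: "a < b" and e: "0 < e" "8 * e < b - a" and \<delta>: "0 < \<delta>" and f: "continuous_on {a..b} f"
    and uc: "\<And>x y. x \<in> {a..b} \<Longrightarrow> y \<in> {a..b} \<Longrightarrow> \<bar>y - x\<bar> \<le> 2 * e \<Longrightarrow> \<bar>f y - f x\<bar> \<le> \<delta> / 4"
    and M: "\<And>x. x \<in> {a..b} \<Longrightarrow> \<bar>f x\<bar> \<le> M" and eM: "8 * e / (b - a) * (M + \<delta>) \<le> \<delta> / 2"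
    and \<mu>: "\<mu> = 1 - 4 * e / (b - a)" and i: "i \<le> 2" and x: "x \<in> {a..b}"
    and z: "z = (a + b) / 2 + \<mu> * (x - (a + b) / 2)"
    and V: "V = integral {a..b} (\<lambda>y. f y * moll e (z - y))"
  shows "\<bar>f x - \<mu> ^ i * V\<bar> \<le> \<delta>"
proof -
  let ?c = "(a + b) / 2" and ?q = "4 * e / (b - a)"
  have q: "0 < ?q" "?q < 1" using ab e by (auto simp: field_simps)
  have xc: "\<bar>x - ?c\<bar> \<le> (b - a) / 2" using x by (auto simp: abs_le_iff field_simps)
  have "\<bar>z - x\<bar> = ?q * \<bar>x - ?c\<bar>"
  proof -
    have "z - x = - (?q * (x - ?c))" by (simp add: z \<mu> algebra_simps)
    then show ?thesis using q by (simp only: abs_minus_cancel abs_mult abs_of_pos)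
  qed
  also have "\<dots> \<le> ?q * ((b - a) / 2)" using xc q by (intro mult_left_mono) auto
  also have "\<dots> = 2 * e" using ab by simp
  finally have zx: "\<bar>z - x\<bar> \<le> 2 * e" .
  have "\<bar>z - ?c\<bar> \<le> \<mu> * ((b - a) / 2)" unfolding z using xc q \<mu> by (simp add: abs_mult mult_left_mono)
  also have "\<dots> = (b - a) / 2 - 2 * e" using ab by (simp add: \<mu> field_simps)
  finally have zb: "a + 2 * e \<le> z" "z \<le> b - 2 * e" by (auto simp: abs_le_iff field_simps)
  have zI: "z \<in> {a..b}" using zb e by auto
  have "\<bar>V - f z\<bar> \<le> \<delta> / 4"
    unfolding V using zb e zI by (intro moll_approx f uc) auto
  moreover have "\<bar>f z - f x\<bar> \<le> \<delta> / 4" by (rule uc[OF x zI zx])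
  ultimately have Vx: "\<bar>f x - V\<bar> \<le> \<delta> / 2" by linarith
  then have VM: "\<bar>V\<bar> \<le> M + \<delta>" using M[OF x] \<delta> by linarith
  have "\<mu> ^ i \<le> 1" "1 - \<mu> ^ i \<le> 2 * ?q"
  proof -
    have m: "0 \<le> \<mu>" "\<mu> \<le> 1" using q by (auto simp: \<mu>)
    then show "\<mu> ^ i \<le> 1" by (rule power_le_one)
    have "\<mu> ^ 2 \<le> \<mu> ^ i" using m i by (intro power_decreasing) auto
    moreover have "1 - (1 - p) ^ 2 \<le> 2 * p" for p :: real
      using zero_le_power2[of p] by (simp add: power2_eq_square algebra_simps)
    then have "1 - \<mu> ^ 2 \<le> 2 * ?q" unfolding \<mu> .
    ultimately show "1 - \<mu> ^ i \<le> 2 * ?q" by linarith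
  qed
  then have "\<bar>(1 - \<mu> ^ i) * V\<bar> \<le> (2 * ?q) * (M + \<delta>)"
    unfolding abs_mult using VM by (intro mult_mono) auto
  also have "\<dots> \<le> \<delta> / 2" using eM by simp
  finally have "\<bar>(1 - \<mu> ^ i) * V\<bar> \<le> \<delta> / 2" .
  moreover have "f x - \<mu> ^ i * V = (f x - V) + (1 - \<mu> ^ i) * V" by (simp add: algebra_simps)
  ultimately show ?thesis using Vx by linarith
qed

lemma scale_choice: "e * (16 * m) \<le> d * l \<Longrightarrow> 0 < l \<Longrightarrow> 8 * e / l * m \<le> d / (2::real)"
  by (simp add: field_simps)

text \<open>\<open>w\<close> takes the place of classical derivatives of order three and more, which
  are never constructed. The bounds do not depend on \<open>\<delta>\<close>; closeness is claimed
  only up to second order, where \<open>R\<close> and \<open>R2\<close> are classical.\<close>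

theorem sobolev_smooth_approx:
  assumes ab: "a < b" and U: "\<And>x. (U has_field_derivative R x) (at x)" and R: "\<And>x. (R has_field_derivative R2 x) (at x)"
    and R2: "continuous_on UNIV R2" and S: "U \<in> sobolev n {a<..<b}" "sobolev_norm n {a<..<b} U \<le> K" and \<delta>: "0 < \<delta>"
  shows "\<exists>w :: nat \<Rightarrow> real \<Rightarrow> real. (\<forall>i x. (w i has_field_derivative w (Suc i) x) (at x)) \<and>
    (\<forall>i<n. \<forall>x\<in>{a..b}. \<bar>w i x\<bar> \<le> Csob (b - a) K) \<and>
    (\<forall>x\<in>{a..b}. \<bar>U x - w 0 x\<bar> \<le> \<delta> \<and> \<bar>R x - w 1 x\<bar> \<le> \<delta> \<and> \<bar>R2 x - w 2 x\<bar> \<le> \<delta>)"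
proof -
  have cU: "continuous_on {a..b} U" by (intro continuous_at_imp_continuous_on ballI DERIV_isCont[OF U])
  have cR: "continuous_on {a..b} R" by (intro continuous_at_imp_continuous_on ballI DERIV_isCont[OF R])
  have cR2: "continuous_on {a..b} R2" using R2 continuous_on_subset by blast
  have ucb: "\<exists>\<eta> M. 0 < \<eta> \<and> 0 \<le> M \<and> (\<forall>x\<in>{a..b}. \<bar>f x\<bar> \<le> M) \<and>
      (\<forall>x\<in>{a..b}. \<forall>y\<in>{a..b}. \<bar>y - x\<bar> < \<eta> \<longrightarrow> \<bar>f y - f x\<bar> \<le> \<delta> / 4)"
    if f: "continuous_on {a..b} f" for f :: "real \<Rightarrow> real"
  proof -
    have "uniformly_continuous_on {a..b} f" by (rule compact_uniformly_continuous[OF f]) simp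
    then obtain \<eta> where \<eta>: "0 < \<eta>" "\<And>x y. x \<in> {a..b} \<Longrightarrow> y \<in> {a..b} \<Longrightarrow> dist y x < \<eta> \<Longrightarrow> dist (f y) (f x) < \<delta> / 4"
      using \<delta> unfolding uniformly_continuous_on_def by (metis divide_pos_pos zero_less_numeral)
    have "compact (f ` {a..b})" by (intro compact_continuous_image f) simp
    then obtain M where M: "\<forall>y\<in>f ` {a..b}. norm y \<le> M" using compact_imp_bounded bounded_iff by metis
    have "0 \<le> M" using M ab by (force intro: order.trans[OF norm_ge_zero])
    then show ?thesis using \<eta> M by (intro exI[of _ \<eta>] exI[of _ M]) (auto simp: dist_real_def intro: less_imp_le)
  qed
  obtain \<eta>0 M0 where 0: "0 < \<eta>0" "0 \<le> M0" "\<And>x. x \<in> {a..b} \<Longrightarrow> \<bar>U x\<bar> \<le> M0"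
      "\<And>x y. x \<in> {a..b} \<Longrightarrow> y \<in> {a..b} \<Longrightarrow> \<bar>y - x\<bar> < \<eta>0 \<Longrightarrow> \<bar>U y - U x\<bar> \<le> \<delta> / 4"
    using ucb[OF cU] by blast
  obtain \<eta>1 M1 where 1: "0 < \<eta>1" "0 \<le> M1" "\<And>x. x \<in> {a..b} \<Longrightarrow> \<bar>R x\<bar> \<le> M1"
      "\<And>x y. x \<in> {a..b} \<Longrightarrow> y \<in> {a..b} \<Longrightarrow> \<bar>y - x\<bar> < \<eta>1 \<Longrightarrow> \<bar>R y - R x\<bar> \<le> \<delta> / 4"
    using ucb[OF cR] by blast
  obtain \<eta>2 M2 where 2: "0 < \<eta>2" "0 \<le> M2" "\<And>x. x \<in> {a..b} \<Longrightarrow> \<bar>R2 x\<bar> \<le> M2"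
      "\<And>x y. x \<in> {a..b} \<Longrightarrow> y \<in> {a..b} \<Longrightarrow> \<bar>y - x\<bar> < \<eta>2 \<Longrightarrow> \<bar>R2 y - R2 x\<bar> \<le> \<delta> / 4"
    using ucb[OF cR2] by blast
  let ?L = "b - a" and ?M = "M0 + M1 + M2"
  have L: "0 < ?L" using ab by simp
  \<comment> \<open>The entries ensure, in this order, room for the contraction, 2e below the three
    moduli of continuity, and a loss of at most \<delta>/2 from replacing \<mu>^i by 1.\<close>
  define e where "e = Min {?L / 16, \<eta>0 / 4, \<eta>1 / 4, \<eta>2 / 4, \<delta> * ?L / (16 * (?M + \<delta>))}"
  have "e \<le> ?L / 16" "e \<le> \<eta>0 / 4" "e \<le> \<eta>1 / 4" "e \<le> \<eta>2 / 4" "e \<le> \<delta> * ?L / (16 * (?M + \<delta>))"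
    unfolding e_def by (rule Min_le; simp)+
  moreover have e0: "0 < e"
    unfolding e_def using L 0 1 2 \<delta> by (subst Min_gr_iff) auto
  ultimately have e: "8 * e < ?L" "2 * e < \<eta>0" "2 * e < \<eta>1" "2 * e < \<eta>2" "e * (16 * (?M + \<delta>)) \<le> \<delta> * ?L"
    using L 0(1,2) 1(1,2) 2(1,2) \<delta> by (auto simp: pos_le_divide_eq)
  have eM: "8 * e / ?L * (M' + \<delta>) \<le> \<delta> / 2" if "M' \<le> ?M" for M'
  proof -
    have "8 * e / ?L * (M' + \<delta>) \<le> 8 * e / ?L * (?M + \<delta>)"
      using that e0 L by (intro mult_left_mono) auto
    also have "\<dots> \<le> \<delta> / 2" using scale_choice[OF e(5) L] .
    finally show ?thesis .
  qed
  define \<mu> where "\<mu> = 1 - 4 * e / ?L"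
  let ?c = "(a + b) / 2"
  let ?z = "\<lambda>x. ?c + \<mu> * (x - ?c)"
  define w where "w i x = \<mu> ^ i * conv a b U e i (?z x)" for i x
  have m: "0 \<le> \<mu>" "\<mu> \<le> 1" using e(1) e0 L by (auto simp: \<mu>_def field_simps)
  have zb: "a + 2 * e \<le> ?z x" "?z x \<le> b - 2 * e" if x: "x \<in> {a..b}" for x
  proof -
    have "\<bar>x - ?c\<bar> \<le> ?L / 2" using x by (auto simp: abs_le_iff field_simps)
    then have "\<bar>\<mu> * (x - ?c)\<bar> \<le> \<mu> * (?L / 2)"
      unfolding abs_mult abs_of_nonneg[OF m(1)] using m by (intro mult_left_mono) auto
    also have "\<dots> = ?L / 2 - 2 * e" using L by (simp add: \<mu>_def field_simps)
    finally show "a + 2 * e \<le> ?z x" "?z x \<le> b - 2 * e" by (auto simp: abs_le_iff field_simps)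
  qed
  have w_der: "(w i has_field_derivative w (Suc i) x) (at x)" for i x
    unfolding w_def [abs_def]
    by (rule derivative_eq_intros DERIV_chain2[OF conv_DERIV[OF cU]] refl | simp)+
  have w_bd: "\<bar>w i x\<bar> \<le> Csob ?L K" if "i < n" "x \<in> {a..b}" for i x
  proof -
    have cb: "\<bar>conv a b U e i (?z x)\<bar> \<le> Csob ?L K"
      using zb[OF that(2)] e0 by (intro conv_bound[OF ab cU S that(1) e0]) auto
    have "\<bar>w i x\<bar> = \<mu> ^ i * \<bar>conv a b U e i (?z x)\<bar>" using m by (simp add: w_def abs_mult)
    also have "\<dots> \<le> 1 * \<bar>conv a b U e i (?z x)\<bar>" using m by (intro mult_right_mono power_le_one) auto
    finally show ?thesis using cb by simp
  qed
  have far: "e < \<bar>?z x - a\<bar>" "e < \<bar>?z x - b\<bar>" if "x \<in> {a..b}" for x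
    using zb[OF that] e0 by (auto simp: abs_if)
  \<comment> \<open>The derivative moves from the mollifier back to \<open>U\<close>;
    \<open>?z x\<close> is farther than \<open>e\<close> from both ends, so no boundary term
    appears.\<close>
  have c1: "conv a b U e 1 (?z x) = integral {a..b} (\<lambda>y. R y * moll e (?z x - y))" if "x \<in> {a..b}" for x
    unfolding conv_def using conv_by_parts[OF less_imp_le[OF ab] U cR smooth_moll[of e], of "?z x"] far[OF that] moll_zero[OF e0] by simp
  have c2: "conv a b U e 2 (?z x) = integral {a..b} (\<lambda>y. R2 y * moll e (?z x - y))" if "x \<in> {a..b}" for x
  proof -
    have "conv a b U e 2 (?z x) = integral {a..b} (\<lambda>y. R y * (deriv ^^ 1) (moll e) (?z x - y))"
      unfolding conv_def numeral_2_eq_2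
      using conv_by_parts[OF less_imp_le[OF ab] U cR smooth_higher_deriv[OF smooth_moll[of e], of 1], of "?z x"]
        far[OF that] moll_higher_zero[OF e0, of _ 1] by simp
    also have "\<dots> = integral {a..b} (\<lambda>y. R2 y * moll e (?z x - y))"
      using conv_by_parts[OF less_imp_le[OF ab] R cR2 smooth_moll[of e], of "?z x"] far[OF that] moll_zero[OF e0] by simp
    finally show ?thesis .
  qed
  have "\<bar>U x - w 0 x\<bar> \<le> \<delta> \<and> \<bar>R x - w 1 x\<bar> \<le> \<delta> \<and> \<bar>R2 x - w 2 x\<bar> \<le> \<delta>" if x: "x \<in> {a..b}" for x
  proof (intro conjI)
    show "\<bar>U x - w 0 x\<bar> \<le> \<delta>" unfolding w_def
      by (rule conv_dilated_approx[OF ab e0 e(1) \<delta> cU _ 0(3) eM \<mu>_def _ x refl])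
        (use 0 1 2 e in \<open>auto simp: conv_def\<close>)
    show "\<bar>R x - w 1 x\<bar> \<le> \<delta>" unfolding w_def
      by (rule conv_dilated_approx[OF ab e0 e(1) \<delta> cR _ 1(3) eM \<mu>_def _ x refl c1[OF x]])
        (use 0 1 2 e in auto)
    show "\<bar>R2 x - w 2 x\<bar> \<le> \<delta>" unfolding w_def
      by (rule conv_dilated_approx[OF ab e0 e(1) \<delta> cR2 _ 2(3) eM \<mu>_def _ x refl c2[OF x]])
        (use 0 1 2 e in auto)
  qed
  then show ?thesis using w_der w_bd by blast
qed

section \<open>Polynomials on an interval\<close>

text \<open>Elimination of the new index \<open>p\<close>: the equations of \<open>I\<close> are
  solved by induction, and the remaining scalar equation has the Schur complement as its
  coefficient, which is positive because it is the value of the form at a nonzero vector.\<close>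

lemma pos_def_solve:
  fixes A :: "'i \<Rightarrow> 'i \<Rightarrow> real"
  assumes "finite I"
    and "\<And>i l. i \<in> I \<Longrightarrow> l \<in> I \<Longrightarrow> A i l = A l i"
    and "\<And>c. \<exists>i\<in>I. c i \<noteq> 0 \<Longrightarrow> 0 < (\<Sum>i\<in>I. \<Sum>l\<in>I. A i l * c i * c l)"
  shows "\<exists>c. \<forall>i\<in>I. (\<Sum>l\<in>I. A i l * c l) = b i"
  using assms
proof (induction I arbitrary: b rule: finite_induct)
  case empty
  then show ?case by simp
next
  case (insert p I)
  have sym: "A i l = A l i" if "i \<in> insert p I" "l \<in> insert p I" for i l
    using insert.prems(1) that by blast
  have pd: "0 < (\<Sum>i\<in>I. \<Sum>l\<in>I. A i l * c i * c l)" if "\<exists>i\<in>I. c i \<noteq> 0" for c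
  proof -
    let ?c = "c(p := 0)"
    have "0 < (\<Sum>i\<in>insert p I. \<Sum>l\<in>insert p I. A i l * ?c i * ?c l)"
      using that insert.hyps by (intro insert.prems(2)) auto
    also have "\<dots> = (\<Sum>i\<in>I. \<Sum>l\<in>I. A i l * ?c i * ?c l)"
      using insert.hyps by simp
    also have "\<dots> = (\<Sum>i\<in>I. \<Sum>l\<in>I. A i l * c i * c l)"
      using insert.hyps by (intro sum.cong refl) auto
    finally show ?thesis .
  qed
  obtain e where e: "\<And>i. i \<in> I \<Longrightarrow> (\<Sum>l\<in>I. A i l * e l) = A i p"
    using insert.IH[of "\<lambda>i. A i p"] sym pd by blast
  obtain d where d: "\<And>i. i \<in> I \<Longrightarrow> (\<Sum>l\<in>I. A i l * d l) = b i"
    using insert.IH[of b] sym pd by blast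
  \<comment> \<open>The rows of \<open>I\<close> annihilate the vector (1, -e), so the form at it
    reduces to row \<open>p\<close>, that is, to the Schur complement.\<close>
  define x where "x = (\<lambda>l. if l = p then 1 else - e l)"
  have xI: "x l = - e l" if "l \<in> I" for l using that insert.hyps by (auto simp: x_def)
  have xp: "x p = 1" by (simp add: x_def)
  have "0 < (\<Sum>i\<in>insert p I. \<Sum>l\<in>insert p I. A i l * x i * x l)"
    by (intro insert.prems(2) bexI[of _ p]) (auto simp: xp)
  also have "\<dots> = (\<Sum>l\<in>insert p I. A p l * x l) + (\<Sum>i\<in>I. x i * (\<Sum>l\<in>insert p I. A i l * x l))"
    using insert.hyps by (simp add: xp sum_distrib_left sum.distrib algebra_simps)
  also have "(\<Sum>i\<in>I. x i * (\<Sum>l\<in>insert p I. A i l * x l)) = 0"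
  proof (intro sum.neutral ballI)
    fix i assume i: "i \<in> I"
    have "(\<Sum>l\<in>insert p I. A i l * x l) = A i p + (\<Sum>l\<in>I. - (A i l * e l))"
      using insert.hyps by (simp add: xp xI cong: sum.cong)
    also have "\<dots> = 0" using e[OF i] by (simp add: sum_negf)
    finally show "x i * (\<Sum>l\<in>insert p I. A i l * x l) = 0" by simp
  qed
  also have "(\<Sum>l\<in>insert p I. A p l * x l) = A p p - (\<Sum>l\<in>I. A p l * e l)"
    using insert.hyps by (simp add: xp xI sum_negf cong: sum.cong)
  finally have pos: "0 < A p p - (\<Sum>l\<in>I. A p l * e l)" by simp
  define \<tau> where "\<tau> = (b p - (\<Sum>l\<in>I. A p l * d l)) / (A p p - (\<Sum>l\<in>I. A p l * e l))"
  define c where "c = (\<lambda>l. if l = p then \<tau> else d l - \<tau> * e l)"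
  have row: "(\<Sum>l\<in>insert p I. A i l * c l) = A i p * \<tau> + ((\<Sum>l\<in>I. A i l * d l) - \<tau> * (\<Sum>l\<in>I. A i l * e l))" for i
  proof -
    have "(\<Sum>l\<in>I. A i l * c l) = (\<Sum>l\<in>I. A i l * d l - \<tau> * (A i l * e l))"
      using insert.hyps by (intro sum.cong) (auto simp: c_def algebra_simps)
    then show ?thesis using insert.hyps
      by (simp add: c_def sum_subtractf sum_distrib_left)
  qed
  have "(\<Sum>l\<in>insert p I. A i l * c l) = b i" if "i \<in> insert p I" for i
  proof (cases "i = p")
    case True
    have "\<tau> * (A p p - (\<Sum>l\<in>I. A p l * e l)) = b p - (\<Sum>l\<in>I. A p l * d l)"
      using pos by (simp add: \<tau>_def)
    then show ?thesis using True row[of p] by (simp add: algebra_simps)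
  next
    case False
    then have "i \<in> I" using that by simp
    then show ?thesis using row[of i] e d by simp
  qed
  then show ?case by blast
qed

lemma weighted_Cauchy_Schwarz:
  fixes W f g :: "real \<Rightarrow> real"
  assumes "a \<le> b" and cont: "continuous_on {a..b} W" "continuous_on {a..b} f" "continuous_on {a..b} g"
    and W: "\<And>x. x \<in> {a..b} \<Longrightarrow> 0 \<le> W x"
  shows "(integral {a..b} (\<lambda>x. W x * (f x * g x)))\<^sup>2
    \<le> integral {a..b} (\<lambda>x. W x * (f x)\<^sup>2) * integral {a..b} (\<lambda>x. W x * (g x)\<^sup>2)"
proof -
  let ?A = "integral {a..b} (\<lambda>x. W x * (f x)\<^sup>2)"
  let ?B = "integral {a..b} (\<lambda>x. W x * (f x * g x))"
  let ?C = "integral {a..b} (\<lambda>x. W x * (g x)\<^sup>2)"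
  note [continuous_intros] = cont
  have quad: "0 \<le> t\<^sup>2 * ?A + 2 * t * ?B + ?C" for t
  proof -
    have "0 \<le> integral {a..b} (\<lambda>x. W x * (t * f x + g x)\<^sup>2)"
      using W by (intro integral_nonneg integrable_continuous_interval continuous_intros) auto
    also have "(\<lambda>x. W x * (t * f x + g x)\<^sup>2)
       = (\<lambda>x. t\<^sup>2 * (W x * (f x)\<^sup>2) + (2 * t) * (W x * (f x * g x)) + W x * (g x)\<^sup>2)"
      by (intro ext) (simp add: power2_eq_square algebra_simps)
    also have "integral {a..b} \<dots> = t\<^sup>2 * ?A + 2 * t * ?B + ?C"
      by (simp add: integral_add integrable_continuous_interval continuous_intros)
    finally show ?thesis .
  qed
  have A0: "0 \<le> ?A"
    using W by (intro integral_nonneg integrable_continuous_interval continuous_intros) auto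
  show ?thesis
  proof (cases "?A = 0")
    case True
    have "?B = 0"
    proof (rule ccontr)
      assume "?B \<noteq> 0"
      \<comment> \<open>With A = 0 the quadratic is affine in t, and at this t it equals -1.\<close>
      then show False using quad[of "- (?C + 1) / (2 * ?B)"] True by (simp add: field_simps)
    qed
    then show ?thesis using True by simp
  next
    case False
    then have "?A > 0" using A0 by simp
    have "0 \<le> ?A * ((- ?B / ?A)\<^sup>2 * ?A + 2 * (- ?B / ?A) * ?B + ?C)"
      using quad[of "- ?B / ?A"] \<open>?A > 0\<close> by (intro mult_nonneg_nonneg) auto
    also have "\<dots> = ?A * ?C - ?B\<^sup>2"
      using \<open>?A > 0\<close> by (simp add: field_simps power2_eq_square)
    finally show ?thesis by simp
  qed
qed

section \<open>Polynomials of bounded degree on the unit interval\<close>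

lemma poly_eq_0_of_interval:
  fixes p :: "real poly"
  assumes "a < b" "\<And>x. x \<in> {a<..<b} \<Longrightarrow> poly p x = 0"
  shows "p = 0"
proof (rule ccontr)
  assume "p \<noteq> 0"
  then have "finite {x. poly p x = 0}" by (rule poly_roots_finite)
  moreover have "{a<..<b} \<subseteq> {x. poly p x = 0}" using assms by auto
  ultimately have "finite {a<..<b}" using finite_subset by blast
  then show False using assms(1) infinite_Ioo by blast
qed

lemma poly_as_sum_le:
  fixes p :: "real poly"
  assumes "degree p \<le> k"
  shows "p = (\<Sum>i\<le>k. monom (coeff p i) i)"
  by (rule poly_eqI) (use assms in \<open>auto simp: coeff_sum coeff_eq_0 sum.delta\<close>)

lemma poly_altdef_le:
  fixes p :: "real poly"
  assumes "degree p \<le> k"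
  shows "poly p x = (\<Sum>i\<le>k. coeff p i * x ^ i)"
  by (subst poly_as_sum_le[OF assms]) (simp add: poly_sum poly_monom)

text \<open>The exponent w = 0 serves the lifting of a jump, w = 1 the inverse estimates. The latter
  weight vanishes at the left end, where the jump sits, and estimates by this weaker norm are what
  makes the jump removable later.\<close>

definition wip :: "nat \<Rightarrow> real poly \<Rightarrow> real poly \<Rightarrow> real" where
  "wip w p q = integral {0..1} (\<lambda>s. s ^ w * (poly p s * poly q s))"

lemma wip_commute: "wip w p q = wip w q p"
  by (simp add: wip_def mult.commute)

lemma wip_sum_left: "wip w (\<Sum>i\<in>I. smult (c i) (p i)) q = (\<Sum>i\<in>I. c i * wip w (p i) q)"
proof (cases "finite I")
  case True
  have "wip w (\<Sum>i\<in>I. smult (c i) (p i)) q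
     = integral {0..1} (\<lambda>s. \<Sum>i\<in>I. c i * (s ^ w * (poly (p i) s * poly q s)))"
    by (simp add: wip_def poly_sum sum_distrib_left sum_distrib_right ac_simps)
  also have "\<dots> = (\<Sum>i\<in>I. integral {0..1} (\<lambda>s. c i * (s ^ w * (poly (p i) s * poly q s))))"
    using True by (intro integral_sum integrable_continuous_interval continuous_intros)
  finally show ?thesis by (simp add: wip_def)
next
  case False
  then show ?thesis by (simp add: wip_def)
qed

lemma wip_sum_monom: "wip w (\<Sum>i\<in>I. monom (c i) i) q = (\<Sum>i\<in>I. c i * wip w (monom 1 i) q)"
  using wip_sum_left[of w c "monom 1" I q] by (simp add: smult_monom)

lemma wip_pos:
  assumes "p \<noteq> 0"
  shows "0 < wip w p p"
proof -
  have "wip w p p \<noteq> 0"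
  proof
    assume *: "wip w p p = 0"
    have "\<forall>s\<in>{0..1}. s ^ w * (poly p s * poly p s) = 0"
      using * unfolding wip_def
      by (subst (asm) integral_eq_0_iff) (auto intro!: continuous_intros)
    then have "poly p s = 0" if "s \<in> {0<..<1}" for s
      using that by (auto dest!: bspec[of _ _ s])
    then show False using poly_eq_0_of_interval[of 0 1 p] assms by auto
  qed
  moreover have "0 \<le> wip w p p" unfolding wip_def
    by (intro integral_nonneg integrable_continuous_interval continuous_intros) auto
  ultimately show ?thesis by simp
qed

lemma degree_sum_monom_le: "degree (\<Sum>i\<le>k. monom (c i) i) \<le> k"
  by (rule degree_sum_le) (auto intro: order.trans[OF degree_monom_le])

text \<open>Riesz representation of a coefficient functional; the Gram matrix of the monomials is
  positive definite because a nonzero polynomial has only finitely many zeros.\<close>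

lemma coeff_dual_poly:
  "\<exists>l. degree l \<le> k \<and> (\<forall>p. degree p \<le> k \<longrightarrow> wip w l p = coeff p i)"
proof -
  let ?A = "\<lambda>i j. wip w (monom 1 i) (monom 1 j)"
  have "\<exists>c. \<forall>j\<in>{..k}. (\<Sum>l\<in>{..k}. ?A j l * c l) = (if j = i then 1 else 0)"
  proof (rule pos_def_solve)
    fix c :: "nat \<Rightarrow> real" assume "\<exists>i\<in>{..k}. c i \<noteq> 0"
    then obtain i where i: "i \<le> k" "c i \<noteq> 0" by auto
    let ?p = "\<Sum>i\<le>k. monom (c i) i"
    have "coeff ?p i = c i" using i by (simp add: coeff_sum)
    then have "?p \<noteq> 0" using i by auto
    then have "0 < wip w ?p ?p" by (rule wip_pos)
    also have "wip w ?p ?p = (\<Sum>i\<le>k. c i * wip w (monom 1 i) ?p)"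
      by (rule wip_sum_monom)
    also have "\<dots> = (\<Sum>i\<le>k. c i * (\<Sum>l\<le>k. c l * wip w (monom 1 i) (monom 1 l)))"
    proof (intro sum.cong refl)
      fix i
      have "wip w (monom 1 i) ?p = wip w ?p (monom 1 i)" by (rule wip_commute)
      also have "\<dots> = (\<Sum>l\<le>k. c l * wip w (monom 1 l) (monom 1 i))" by (rule wip_sum_monom)
      finally show "c i * wip w (monom 1 i) ?p = c i * (\<Sum>l\<le>k. c l * wip w (monom 1 i) (monom 1 l))"
        by (simp only: wip_commute[of w "monom 1 i"])
    qed
    also have "\<dots> = (\<Sum>i\<le>k. \<Sum>l\<le>k. ?A i l * c i * c l)"
      by (simp add: sum_distrib_left ac_simps)
    finally show "0 < (\<Sum>i\<le>k. \<Sum>l\<le>k. ?A i l * c i * c l)" .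
  qed (simp, rule wip_commute)
  then obtain c where c: "\<And>j. j \<le> k \<Longrightarrow> (\<Sum>l\<in>{..k}. ?A j l * c l) = (if j = i then 1 else 0)"
    by auto
  let ?l = "\<Sum>i\<le>k. monom (c i) i"
  have mon: "wip w ?l (monom 1 j) = (if j = i then 1 else 0)" if "j \<le> k" for j
    using c[OF that] by (simp only: wip_sum_monom) (simp add: wip_commute[of w "monom 1 j"] mult.commute)
  have "wip w ?l p = coeff p i" if p: "degree p \<le> k" for p
  proof -
    have "wip w ?l p = wip w p ?l" by (rule wip_commute)
    also have "\<dots> = wip w (\<Sum>j\<le>k. monom (coeff p j) j) ?l"
      using poly_as_sum_le[OF p] by simp
    also have "\<dots> = (\<Sum>j\<le>k. coeff p j * wip w ?l (monom 1 j))"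
      by (simp only: wip_sum_monom[of w "coeff p"] wip_commute[of w ?l])
    also have "\<dots> = (\<Sum>j\<le>k. if j = i then coeff p j else 0)"
      by (intro sum.cong) (auto simp: mon)
    also have "\<dots> = coeff p i"
      using p by (auto simp: coeff_eq_0)
    finally show ?thesis .
  qed
  then show ?thesis using degree_sum_monom_le by blast
qed

text \<open>Equivalence of norms in finite dimension, by Cauchy-Schwarz with the dual
  polynomials.\<close>

lemma coeff_bound_exists:
  "\<exists>C\<ge>1. \<forall>p i. degree p \<le> k \<longrightarrow> (coeff p i)\<^sup>2 \<le> C * wip w p p"
proof -
  have "\<forall>i. \<exists>l. degree l \<le> k \<and> (\<forall>p. degree p \<le> k \<longrightarrow> wip w l p = coeff p i)"
    using coeff_dual_poly by blast
  then obtain l where l: "\<And>i. degree (l i) \<le> k" "\<And>i p. degree p \<le> k \<Longrightarrow> wip w (l i) p = coeff p i"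
    by metis
  have nn: "0 \<le> wip w p p" for p using wip_pos[of p w] by (cases "p = 0") (auto simp: wip_def)
  define C where "C = 1 + (\<Sum>i\<le>k. wip w (l i) (l i))"
  have "(coeff p i)\<^sup>2 \<le> C * wip w p p" if p: "degree p \<le> k" for p i
  proof (cases "i \<le> k")
    case True
    have "(coeff p i)\<^sup>2 = (wip w (l i) p)\<^sup>2" using l(2)[OF p] by simp
    also have "\<dots> \<le> wip w (l i) (l i) * wip w p p"
      unfolding wip_def using weighted_Cauchy_Schwarz[of 0 1 "\<lambda>s. s ^ w" "poly (l i)" "poly p"]
      by (simp add: power2_eq_square continuous_intros)
    also have "\<dots> \<le> C * wip w p p"
    proof -
      have "wip w (l i) (l i) \<le> (\<Sum>i\<le>k. wip w (l i) (l i))"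
        using nn True by (intro member_le_sum) auto
      then show ?thesis unfolding C_def using nn[of p] by (intro mult_right_mono) auto
    qed
    finally show ?thesis .
  next
    case False
    then have "coeff p i = 0" using p by (intro coeff_eq_0) auto
    moreover have "0 \<le> C" unfolding C_def using nn by (intro add_nonneg_nonneg sum_nonneg) auto
    ultimately show ?thesis using nn by simp
  qed
  moreover have "C \<ge> 1" unfolding C_def using nn by (simp add: sum_nonneg)
  ultimately show ?thesis by blast
qed

text \<open>Represents the evaluation p(0) in the unweighted product. Scaled to a cell it is the LDG
  lifting, which turns a jump at the left node into a polynomial source inside the cell.\<close>

definition ref_lift :: "nat \<Rightarrow> real poly" where
  "ref_lift k = (SOME l. degree l \<le> k \<and> (\<forall>p. degree p \<le> k \<longrightarrow> wip 0 l p = coeff p 0))"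

lemma ref_lift: "degree (ref_lift k) \<le> k" "degree p \<le> k \<Longrightarrow> wip 0 (ref_lift k) p = poly p 0"
  using someI_ex[OF coeff_dual_poly[of k 0 0]] by (auto simp: ref_lift_def poly_0_coeff_0)

text \<open>If the leading coefficient vanished, then \<open>s\<lambda>\<close> would be an admissible test function, and
  \<open>\<integral> s \<lambda>\<^sup>2 = 0\<close>.\<close>

lemma coeff_ref_lift: "coeff (ref_lift k) k \<noteq> 0"
proof
  let ?l = "ref_lift k"
  assume 0: "coeff ?l k = 0"
  have nz: "?l \<noteq> 0"
  proof
    assume "?l = 0"
    then show False using ref_lift(2)[of "1" k] by (simp add: wip_def)
  qed
  have "k \<noteq> 0"
  proof
    assume "k = 0"
    then have "coeff ?l 0 = 0" "degree ?l = 0" using 0 ref_lift(1)[of k] by auto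
    then show False using nz by (metis leading_coeff_0_iff)
  qed
  have "degree ?l < k" using 0 ref_lift(1)[of k] nz
    by (metis leading_coeff_0_iff order_le_less)
  then have "degree (pCons 0 ?l) \<le> k" by (auto simp: degree_pCons_eq_if)
  then have "wip 0 ?l (pCons 0 ?l) = 0" using ref_lift(2)[of "pCons 0 ?l" k] by simp
  also have "wip 0 ?l (pCons 0 ?l) = wip 1 ?l ?l"
    by (simp add: wip_def ac_simps)
  finally show False using wip_pos[OF nz, of 1] by simp
qed

definition Binv :: "nat \<Rightarrow> real" where
  "Binv k = (SOME B. B \<ge> 1 \<and> (\<forall>p s. degree p \<le> k \<longrightarrow> s \<in> {0..1} \<longrightarrow>
      (poly p s)\<^sup>2 \<le> B * wip 1 p p \<and> (poly (pderiv p) s)\<^sup>2 \<le> B * wip 1 p p))"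

lemma poly_unit_abs_le:
  fixes p :: "real poly"
  assumes "degree p \<le> k" "s \<in> {0..1}" "\<And>i. \<bar>coeff p i\<bar> \<le> M"
  shows "\<bar>poly p s\<bar> \<le> (real k + 1) * M"
proof -
  have "\<bar>poly p s\<bar> \<le> (\<Sum>i\<le>k. \<bar>coeff p i * s ^ i\<bar>)"
    unfolding poly_altdef_le[OF assms(1)] by (rule sum_abs)
  also have "\<dots> \<le> (\<Sum>i\<le>k. M)"
  proof (intro sum_mono)
    fix i
    have "\<bar>coeff p i * s ^ i\<bar> = \<bar>coeff p i\<bar> * s ^ i" using assms(2) by (simp add: abs_mult)
    also have "\<dots> \<le> \<bar>coeff p i\<bar> * 1"
      using assms(2) by (intro mult_left_mono power_le_one) auto
    finally show "\<bar>coeff p i * s ^ i\<bar> \<le> M" using assms(3)[of i] by simp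
  qed
  finally show ?thesis by (simp add: add.commute)
qed

lemma Binv_unit:
  "Binv k \<ge> 1"
  "degree p \<le> k \<Longrightarrow> s \<in> {0..1} \<Longrightarrow> (poly p s)\<^sup>2 \<le> Binv k * wip 1 p p"
  "degree p \<le> k \<Longrightarrow> s \<in> {0..1} \<Longrightarrow> (poly (pderiv p) s)\<^sup>2 \<le> Binv k * wip 1 p p"
proof -
  obtain C where C: "C \<ge> 1" "\<And>p i. degree p \<le> k \<Longrightarrow> (coeff p i)\<^sup>2 \<le> C * wip 1 p p"
    using coeff_bound_exists[of k 1] by blast
  have k1: "(1::real) \<le> (real k + 1) ^ n" for n by simp
  have "\<exists>B. B \<ge> 1 \<and> (\<forall>p s. degree p \<le> k \<longrightarrow> s \<in> {0..1} \<longrightarrow>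
      (poly p s)\<^sup>2 \<le> B * wip 1 p p \<and> (poly (pderiv p) s)\<^sup>2 \<le> B * wip 1 p p)"
  \<comment> \<open>A bound \<open>M\<close> on the coefficients bounds p by (k+1) M.
    Differentiation multiplies coefficients by at most k+1, so p' is bounded by (k+1)^2 M; squaring
    gives the fourth power.\<close>
  proof (intro exI[of _ "(real k + 1) ^ 4 * C"] conjI allI impI)
    show "1 \<le> (real k + 1) ^ 4 * C" using k1[of 4] C(1) by (metis mult_mono' mult_1 zero_le_one)
    fix p :: "real poly" and s :: real assume p: "degree p \<le> k" and s: "s \<in> {0..1}"
    have nn: "0 \<le> wip 1 p p" using wip_pos[of p 1] by (cases "p = 0") (auto simp: wip_def)
    define M where "M = sqrt (C * wip 1 p p)"
    have M2: "M\<^sup>2 = C * wip 1 p p" using nn C(1) by (simp add: M_def)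
    have M0: "0 \<le> M" using nn C(1) by (simp add: M_def)
    have cM: "\<bar>coeff p i\<bar> \<le> M" for i
      using C(2)[OF p, of i] M0 M2 by (metis abs_le_square_iff abs_of_nonneg)
    have "\<bar>poly p s\<bar> \<le> (real k + 1) * M" by (rule poly_unit_abs_le[OF p s cM])
    also have "\<dots> \<le> (real k + 1)\<^sup>2 * M" using M0 by (intro mult_right_mono) (simp_all add: power2_eq_square)
    finally have 1: "\<bar>poly p s\<bar> \<le> (real k + 1)\<^sup>2 * M" .
    have "\<bar>poly (pderiv p) s\<bar> \<le> (real k + 1) * ((real k + 1) * M)"
    proof (rule poly_unit_abs_le[OF _ s])
      show "degree (pderiv p) \<le> k" using p by (simp add: degree_pderiv)
      fix i
      show "\<bar>coeff (pderiv p) i\<bar> \<le> (real k + 1) * M"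
      proof (cases "Suc i \<le> k")
        case True
        have "\<bar>coeff (pderiv p) i\<bar> = real (Suc i) * \<bar>coeff p (Suc i)\<bar>"
          by (simp add: coeff_pderiv abs_mult)
        also have "\<dots> \<le> (real k + 1) * M" using True cM by (intro mult_mono) auto
        finally show ?thesis .
      next
        case False
        then have "coeff p (Suc i) = 0" using p by (intro coeff_eq_0) auto
        then show ?thesis using M0 by (simp add: coeff_pderiv)
      qed
    qed
    then have 2: "\<bar>poly (pderiv p) s\<bar> \<le> (real k + 1)\<^sup>2 * M" by (simp add: power2_eq_square)
    have sq: "x\<^sup>2 \<le> (real k + 1) ^ 4 * C * wip 1 p p" if "\<bar>x\<bar> \<le> (real k + 1)\<^sup>2 * M" for x
    proof -
      have "x\<^sup>2 \<le> ((real k + 1)\<^sup>2 * M)\<^sup>2" using that by (metis power2_abs abs_ge_zero power_mono)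
      also have "\<dots> = (real k + 1) ^ 4 * C * wip 1 p p"
        by (simp add: power_mult_distrib M2 flip: power_mult)
      finally show ?thesis .
    qed
    show "(poly p s)\<^sup>2 \<le> (real k + 1) ^ 4 * C * wip 1 p p" by (rule sq[OF 1])
    show "(poly (pderiv p) s)\<^sup>2 \<le> (real k + 1) ^ 4 * C * wip 1 p p" by (rule sq[OF 2])
  qed
  from someI_ex[OF this] show
    "Binv k \<ge> 1"
    "degree p \<le> k \<Longrightarrow> s \<in> {0..1} \<Longrightarrow> (poly p s)\<^sup>2 \<le> Binv k * wip 1 p p"
    "degree p \<le> k \<Longrightarrow> s \<in> {0..1} \<Longrightarrow> (poly (pderiv p) s)\<^sup>2 \<le> Binv k * wip 1 p p"
    unfolding Binv_def[symmetric] by blast+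
qed

section \<open>Scaling to intervals of arbitrary length\<close>

lemma integral_unit:
  fixes f :: "real \<Rightarrow> real"
  assumes "a < b" "continuous_on {a..b} f"
  shows "integral {a..b} f = (b - a) * integral {0..1} (\<lambda>s. f (a + (b - a) * s))"
proof -
  have "(f has_integral integral {a..b} f) (cbox a b)"
    using integrable_continuous_interval[OF assms(2)] by (simp add: integrable_integral)
  from has_integral_affinity'[OF this, of "b - a" a] assms(1)
  have "((\<lambda>s. f (a + (b - a) * s)) has_integral integral {a..b} f / (b - a)) {0..1}"
    by (simp add: field_simps)
  then show ?thesis using assms(1) by (simp add: integral_unique)
qed

lemma wip_pcompose:
  fixes p q :: "real poly"
  assumes "a < b"
  shows "wip w (pcompose p [:a, b - a:]) (pcompose q [:a, b - a:])
    = integral {a..b} (\<lambda>x. (x - a) ^ w * (poly p x * poly q x)) / (b - a) ^ Suc w"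
proof -
  have "integral {a..b} (\<lambda>x. (x - a) ^ w * (poly p x * poly q x))
    = (b - a) * integral {0..1} (\<lambda>s. (b - a) ^ w * (s ^ w * (poly p (a + (b - a) * s) * poly q (a + (b - a) * s))))"
    using assms by (subst integral_unit) (auto intro!: continuous_intros simp: power_mult_distrib ac_simps)
  also have "\<dots> = (b - a) ^ Suc w * wip w (pcompose p [:a, b - a:]) (pcompose q [:a, b - a:])"
    by (simp add: wip_def poly_pcompose integral_mult_right mult.commute[of _ "b - a"])
  finally show ?thesis using assms by simp
qed

lemma degree_pcompose_linear_le: "degree (pcompose p [:a, b:]) \<le> degree p" for p :: "real poly"
proof -
  have "degree (pcompose p [:a, b:]) \<le> degree p * degree [:a, b:]" by (rule degree_pcompose_le)
  also have "\<dots> \<le> degree p * 1" by (intro mult_left_mono) auto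
  finally show ?thesis by simp
qed

lemma poly_le_weighted:
  fixes p :: "real poly"
  assumes "a < b" "degree p \<le> k" "x \<in> {a..b}"
  shows "(poly p x)\<^sup>2 \<le> Binv k / (b - a)\<^sup>2 * integral {a..b} (\<lambda>x. (x - a) * (poly p x)\<^sup>2)" (is "?P1")
    and "(poly (pderiv p) x)\<^sup>2 \<le> Binv k / (b - a) ^ 4 * integral {a..b} (\<lambda>x. (x - a) * (poly p x)\<^sup>2)" (is "?P2")
proof -
  let ?q = "pcompose p [:a, b - a:]" and ?s = "(x - a) / (b - a)"
  have s: "?s \<in> {0..1}" using assms by auto
  have x: "a + (b - a) * ?s = x" using assms by simp
  have dq: "degree ?q \<le> k" using degree_pcompose_linear_le assms(2) order.trans by blast
  have w: "wip 1 ?q ?q = integral {a..b} (\<lambda>x. (x - a) * (poly p x)\<^sup>2) / (b - a)\<^sup>2"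
    using wip_pcompose[OF assms(1), of 1 p p] by (simp add: power2_eq_square numeral_2_eq_2)
  have q: "poly ?q ?s = poly p x" using x by (simp add: poly_pcompose)
  have q': "poly (pderiv ?q) ?s = (b - a) * poly (pderiv p) x"
    using x by (simp add: pderiv_pcompose poly_pcompose pderiv_pCons)
  show ?P1 using Binv_unit(2)[OF dq s] unfolding w q by simp
  have "((b - a) * poly (pderiv p) x)\<^sup>2 \<le> Binv k * (integral {a..b} (\<lambda>x. (x - a) * (poly p x)\<^sup>2) / (b - a)\<^sup>2)"
    using Binv_unit(3)[OF dq s] unfolding w q' .
  then show ?P2
  proof -
    assume "((b - a) * poly (pderiv p) x)\<^sup>2 \<le> Binv k * (integral {a..b} (\<lambda>x. (x - a) * (poly p x)\<^sup>2) / (b - a)\<^sup>2)"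
    then have "((b - a) * poly (pderiv p) x)\<^sup>2 / (b - a)\<^sup>2
      \<le> Binv k * (integral {a..b} (\<lambda>x. (x - a) * (poly p x)\<^sup>2) / (b - a)\<^sup>2) / (b - a)\<^sup>2"
      by (rule divide_right_mono) simp
    then show ?thesis using assms(1) by (simp add: power_mult_distrib flip: power_add)
  qed
qed

lemma integral_weighted_le:
  fixes f :: "real \<Rightarrow> real"
  assumes "a \<le> b" "continuous_on {a..b} f"
  shows "integral {a..b} (\<lambda>x. (x - a) * (f x)\<^sup>2) \<le> (b - a) * integral {a..b} (\<lambda>x. (f x)\<^sup>2)"
proof -
  have "integral {a..b} (\<lambda>x. (x - a) * (f x)\<^sup>2) \<le> integral {a..b} (\<lambda>x. (b - a) * (f x)\<^sup>2)"
    using assms by (intro integral_le integrable_continuous_interval continuous_intros mult_right_mono) auto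
  then show ?thesis by simp
qed

lemma poly_inverse_ineq:
  fixes p :: "real poly"
  assumes "a < b" "degree p \<le> k" "x \<in> {a..b}"
  shows "(poly p x)\<^sup>2 \<le> Binv k / (b - a) * integral {a..b} (\<lambda>x. (poly p x)\<^sup>2)"
    and "(poly (pderiv p) x)\<^sup>2 \<le> Binv k / (b - a) ^ 3 * integral {a..b} (\<lambda>x. (poly p x)\<^sup>2)"
proof -
  have w: "integral {a..b} (\<lambda>x. (x - a) * (poly p x)\<^sup>2) \<le> (b - a) * integral {a..b} (\<lambda>x. (poly p x)\<^sup>2)"
    using assms by (intro integral_weighted_le continuous_intros) auto
  have B: "0 \<le> Binv k" using Binv_unit(1)[of k] by simp
  have "(poly p x)\<^sup>2 \<le> Binv k / (b - a)\<^sup>2 * ((b - a) * integral {a..b} (\<lambda>x. (poly p x)\<^sup>2))"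
    using poly_le_weighted(1)[OF assms] w B
    by (meson order.trans mult_left_mono divide_nonneg_nonneg zero_le_power2)
  then show "(poly p x)\<^sup>2 \<le> Binv k / (b - a) * integral {a..b} (\<lambda>x. (poly p x)\<^sup>2)"
    using assms(1) by (simp add: power2_eq_square)
  have "(poly (pderiv p) x)\<^sup>2 \<le> Binv k / (b - a) ^ 4 * ((b - a) * integral {a..b} (\<lambda>x. (poly p x)\<^sup>2))"
    using poly_le_weighted(2)[OF assms] w B
    by (meson order.trans mult_left_mono divide_nonneg_nonneg zero_le_even_power even_numeral)
  then show "(poly (pderiv p) x)\<^sup>2 \<le> Binv k / (b - a) ^ 3 * integral {a..b} (\<lambda>x. (poly p x)\<^sup>2)"
    using assms(1) by (simp add: power4_eq_xxxx power3_eq_cube mult.assoc)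
qed

text \<open>The factor 1/(b - a) compensates the change of variables, so that integration against
  the lifting over [a, b] reproduces p(a) for degree at most k.\<close>

definition lift :: "nat \<Rightarrow> real \<Rightarrow> real \<Rightarrow> real poly" where
  "lift k a b = smult (1 / (b - a)) (pcompose (ref_lift k) [:- a / (b - a), 1 / (b - a):])"

definition Clift :: "nat \<Rightarrow> real" where
  "Clift k = (SOME C. C \<ge> 1 \<and> (\<forall>s\<in>{0..1}. \<bar>poly (ref_lift k) s\<bar> \<le> C))"

lemma Clift: "Clift k \<ge> 1" "s \<in> {0..1} \<Longrightarrow> \<bar>poly (ref_lift k) s\<bar> \<le> Clift k"
proof -
  have "compact (poly (ref_lift k) ` {0..1})"
    by (intro compact_continuous_image continuous_intros) auto
  then obtain C where C: "\<forall>y\<in>poly (ref_lift k) ` {0..1}. norm y \<le> C"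
    using compact_imp_bounded bounded_iff by metis
  have "\<exists>C. C \<ge> 1 \<and> (\<forall>s\<in>{0..1}. \<bar>poly (ref_lift k) s\<bar> \<le> C)"
    by (rule exI[of _ "max 1 C"]) (use C in auto)
  from someI_ex[OF this] show "Clift k \<ge> 1" "s \<in> {0..1} \<Longrightarrow> \<bar>poly (ref_lift k) s\<bar> \<le> Clift k"
    unfolding Clift_def[symmetric] by blast+
qed

lemma degree_lift: "degree (lift k a b) \<le> k"
proof -
  have "degree (lift k a b) \<le> degree (ref_lift k)"
    unfolding lift_def by (rule order.trans[OF degree_smult_le degree_pcompose_linear_le])
  then show ?thesis using ref_lift(1)[of k] by simp
qed

lemma poly_lift: "poly (lift k a b) x = poly (ref_lift k) ((x - a) / (b - a)) / (b - a)"
  by (simp add: lift_def poly_pcompose diff_divide_distrib add.commute)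

lemma lift_bound:
  assumes "a < b" "x \<in> {a..b}"
  shows "\<bar>poly (lift k a b) x\<bar> \<le> Clift k / (b - a)"
  using assms Clift(2)[of "(x - a) / (b - a)" k] by (simp add: poly_lift divide_right_mono)

lemma integral_lift:
  fixes p :: "real poly"
  assumes "a < b" "degree p \<le> k"
  shows "integral {a..b} (\<lambda>x. poly (lift k a b) x * poly p x) = poly p a"
proof -
  have "integral {a..b} (\<lambda>x. poly (lift k a b) x * poly p x)
    = (b - a) * integral {0..1} (\<lambda>s. poly (lift k a b) (a + (b - a) * s) * poly p (a + (b - a) * s))"
    using assms by (intro integral_unit continuous_intros)
  also have "(\<lambda>s. poly (lift k a b) (a + (b - a) * s) * poly p (a + (b - a) * s))
    = (\<lambda>s. 1 / (b - a) * (s ^ 0 * (poly (ref_lift k) s * poly (pcompose p [:a, b - a:]) s)))"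
    using assms by (simp add: poly_lift poly_pcompose mult.commute)
  also have "(b - a) * integral {0..1} \<dots> = wip 0 (ref_lift k) (pcompose p [:a, b - a:])"
    using assms by (simp only: integral_mult_right wip_def) simp
  also have "\<dots> = poly p a"
    using ref_lift(2)[of "pcompose p [:a, b - a:]" k] degree_pcompose_linear_le[of p a "b - a"] assms
    by (simp add: poly_pcompose)
  finally show ?thesis .
qed

lemma coeff_pcompose_linear_top:
  fixes p :: "real poly"
  assumes "degree p \<le> k"
  shows "coeff (pcompose p [:a, b:]) k = coeff p k * b ^ k"
proof (cases "degree p = k")
  case True
  show ?thesis
  proof (cases "b = 0")
    case True
    then have "pcompose p [:a, b:] = [:poly p a:]"
      by (intro poly_ext) (simp add: poly_pcompose)
    then show ?thesis using True \<open>degree p = k\<close> by (cases k) (auto simp: poly_0_coeff_0 elim: degree_eq_zeroE)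
  next
    case False
    then have "degree (pcompose p [:a, b:]) = k" using True by (simp add: degree_pcompose)
    then show ?thesis using lead_coeff_comp[of "[:a, b:]" p] True False by simp
  qed
next
  case False
  then have "degree p < k" using assms by simp
  then have "degree (pcompose p [:a, b:]) < k" using degree_pcompose_linear_le[of p a b] by simp
  then show ?thesis using \<open>degree p < k\<close> by (simp add: coeff_eq_0)
qed

text \<open>This scaling of the leading coefficient is the source of the order k+1 in
  \<open>Jv_bound\<close>.\<close>

lemma coeff_lift: "a < b \<Longrightarrow> coeff (lift k a b) k = coeff (ref_lift k) k / (b - a) ^ Suc k"
  by (simp add: lift_def coeff_pcompose_linear_top[OF ref_lift(1)] power_one_over field_simps)

text \<open>Testing the broken derivative \<open>d = p' + J \<lambda>\<close> with \<open>(x - a) p'\<close> removes the jump \<open>J\<close>.\<close>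

lemma broken_deriv_bounds:
  fixes p :: "real poly"
  assumes ab: "a < b" and deg: "degree p \<le> k" and x: "x \<in> {a..b}"
    and d: "d = pderiv p + smult J (lift k a b)"
  shows "(poly (pderiv p) x)\<^sup>2 \<le> Binv k / (b - a) * integral {a..b} (\<lambda>x. (poly d x)\<^sup>2)"
    and "J\<^sup>2 \<le> 4 * Binv k * (b - a) * integral {a..b} (\<lambda>x. (poly d x)\<^sup>2)"
proof -
  let ?p' = "pderiv p" and ?D = "integral {a..b} (\<lambda>x. (poly d x)\<^sup>2)"
  have degd: "degree d \<le> k" unfolding d
    using deg degree_lift[of k a b] by (intro degree_add_le) (auto simp: degree_pderiv)
  define A where "A = integral {a..b} (\<lambda>x. (x - a) * (poly ?p' x)\<^sup>2)"
  have "integral {a..b} (\<lambda>x. (x - a) * (poly d x * poly ?p' x))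
      = integral {a..b} (\<lambda>x. (x - a) * (poly ?p' x)\<^sup>2
          + J * (poly (lift k a b) x * poly ([:- a, 1:] * ?p') x))"
    by (intro integral_cong) (simp add: d power2_eq_square algebra_simps)
  also have "\<dots> = A + J * integral {a..b} (\<lambda>x. poly (lift k a b) x * poly ([:- a, 1:] * ?p') x)"
    unfolding A_def by (subst integral_add)
      (auto intro!: integrable_continuous_interval continuous_intros)
  also have "integral {a..b} (\<lambda>x. poly (lift k a b) x * poly ([:- a, 1:] * ?p') x) = 0"
  proof -
    \<comment> \<open>The factor x - a restores the degree lost by differentiation, so the product
      is admissible for the lifting identity, whose right-hand side then vanishes at a.\<close>
    have "degree ([:- a, 1:] * ?p') \<le> k"
    proof (cases "degree p = 0")
      case True
      then have "?p' = 0" by (simp add: pderiv_eq_0_iff)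
      then show ?thesis by simp
    next
      case False
      have "degree ([:- a, 1:] * ?p') \<le> degree [:- a, 1:] + degree ?p'" by (rule degree_mult_le)
      then show ?thesis using deg False by (simp add: degree_pderiv)
    qed
    then show ?thesis using integral_lift[OF ab, of "[:- a, 1:] * ?p'" k] by simp
  qed
  finally have A: "integral {a..b} (\<lambda>x. (x - a) * (poly d x * poly ?p' x)) = A" by simp
  have A0: "0 \<le> A" unfolding A_def
    by (intro integral_nonneg integrable_continuous_interval continuous_intros) auto
  have "A\<^sup>2 \<le> integral {a..b} (\<lambda>x. (x - a) * (poly d x)\<^sup>2) * A"
    using weighted_Cauchy_Schwarz[of a b "\<lambda>x. x - a" "poly d" "poly ?p'"] ab
    unfolding A unfolding A_def by (simp add: continuous_intros)
  then have "A \<le> integral {a..b} (\<lambda>x. (x - a) * (poly d x)\<^sup>2)"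
    using A0 by (cases "A = 0")
      (auto simp: power2_eq_square intro!: integral_nonneg integrable_continuous_interval continuous_intros)
  also have "\<dots> \<le> (b - a) * ?D"
    using ab by (intro integral_weighted_le continuous_intros) auto
  finally have AD: "A \<le> (b - a) * ?D" .
  have D0: "0 \<le> ?D" by (intro integral_nonneg integrable_continuous_interval continuous_intros) auto
  have B: "0 \<le> Binv k" using Binv_unit(1)[of k] by simp
  have p': "(poly ?p' y)\<^sup>2 \<le> Binv k / (b - a) * ?D" if y: "y \<in> {a..b}" for y
  proof -
    have "(poly ?p' y)\<^sup>2 \<le> Binv k / (b - a)\<^sup>2 * A"
      unfolding A_def using deg by (intro poly_le_weighted(1)[OF ab _ y]) (simp add: degree_pderiv)
    also have "\<dots> \<le> Binv k / (b - a)\<^sup>2 * ((b - a) * ?D)"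
      using B by (intro mult_left_mono AD) auto
    also have "\<dots> = Binv k / (b - a) * ?D" using ab by (simp add: power2_eq_square)
    finally show ?thesis .
  qed
  show "(poly ?p' x)\<^sup>2 \<le> Binv k / (b - a) * ?D" by (rule p'[OF x])
  define s where "s = sqrt (Binv k / (b - a) * ?D)"
  have s2: "s\<^sup>2 = Binv k / (b - a) * ?D" and s0: "0 \<le> s"
    unfolding s_def using B ab D0 by auto
  \<comment> \<open>The lifting has mass 1, so integrating d - p' recovers the jump, and both terms
    have pointwise bounds.\<close>
  have "J = integral {a..b} (\<lambda>x. J * (poly (lift k a b) x * poly 1 x))"
    using integral_lift[OF ab, of 1 k] by simp
  also have "\<dots> = integral {a..b} (\<lambda>x. poly d x - poly ?p' x)"
    by (intro integral_cong) (simp add: d)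
  finally have "J = integral {a..b} (\<lambda>x. poly d x - poly ?p' x)" .
  moreover have "norm (integral {a..b} (\<lambda>x. poly d x - poly ?p' x)) \<le> (2 * s) * (b - a)"
  proof (rule integral_bound)
    fix y assume y: "y \<in> {a..b}"
    have "(poly d y)\<^sup>2 \<le> s\<^sup>2" using poly_inverse_ineq(1)[OF ab degd y] s2 by simp
    then have "\<bar>poly d y\<bar> \<le> s" using s0 by (metis abs_le_square_iff abs_of_nonneg)
    moreover have "(poly ?p' y)\<^sup>2 \<le> s\<^sup>2" using p'[OF y] s2 by simp
    then have "\<bar>poly ?p' y\<bar> \<le> s" using s0 by (metis abs_le_square_iff abs_of_nonneg)
    ultimately show "norm (poly d y - poly ?p' y) \<le> 2 * s" by simp
  qed (use ab in \<open>auto intro!: continuous_intros\<close>)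
  ultimately have "\<bar>J\<bar> \<le> 2 * s * (b - a)" by simp
  then have "J\<^sup>2 \<le> (2 * s * (b - a))\<^sup>2" by (metis power2_abs abs_ge_zero power_mono)
  also have "\<dots> = 4 * Binv k * (b - a) * ?D"
    using ab by (simp add: power_mult_distrib s2) (simp add: power2_eq_square)
  finally show "J\<^sup>2 \<le> 4 * Binv k * (b - a) * ?D" .
qed

section \<open>The LDG derivative and its energy form\<close>

declare One_nat_def [simp del]

locale dg_mesh =
  fixes xl xr \<rho> :: real and k N :: nat and X :: "nat \<Rightarrow> real"
  assumes xl_xr: "xl < xr" and k1: "k \<ge> 1" and rho: "\<rho> > 0"
    and mesh: "is_mesh xl xr N X" and quni: "quasi_uniform \<rho> N X"
begin

definition h :: real where "h = mesh_size N X"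
definition len :: "nat \<Rightarrow> real" where "len j = X j - X (j - 1)"

text \<open>The cell to the left, periodically. \<open>X (pr j)\<close> and \<open>X (j - 1)\<close>
  are the same interface, but for j = 1 they are the two different numbers \<open>xr\<close> and
  \<open>xl\<close>.\<close>

definition pr :: "nat \<Rightarrow> nat" where "pr j = (if j = 1 then N else j - 1)"

abbreviation cint :: "nat \<Rightarrow> (real \<Rightarrow> real) \<Rightarrow> real" where
  "cint j f \<equiv> integral {X (j - 1)..X j} f"

text \<open>An element of \<open>Vh\<close> is encoded by the family of its polynomials on the cells \<open>1,\<dots>,N\<close>.\<close>

definition fam :: "(nat \<Rightarrow> real poly) \<Rightarrow> bool" where
  "fam P \<longleftrightarrow> (\<forall>j\<in>{1..N}. degree (P j) \<le> k)"

text \<open>Right minus left value at the left node of cell j. Indexing interfaces by the cell to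
  their right lets a sum over cells meet every interface exactly once.\<close>

definition jmp :: "(nat \<Rightarrow> real poly) \<Rightarrow> nat \<Rightarrow> real" where
  "jmp P j = poly (P j) (X (j - 1)) - poly (P (pr j)) (X (pr j))"

definition lam :: "nat \<Rightarrow> real poly" where "lam j = lift k (X (j - 1)) (X j)"

text \<open>The flux is \<open>u\<^sup>-\<close>; the third equation of the scheme says \<open>r = D u\<close>.\<close>

definition D :: "(nat \<Rightarrow> real poly) \<Rightarrow> nat \<Rightarrow> real poly" where
  "D P j = pderiv (P j) + smult (jmp P j) (lam j)"

definition aform :: "(nat \<Rightarrow> real poly) \<Rightarrow> (nat \<Rightarrow> real poly) \<Rightarrow> real" where
  "aform P Q = (\<Sum>j=1..N. cint j (\<lambda>x. poly (P j) x * poly (Q j) x + poly (D P j) x * poly (D Q j) x))"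

definition en :: "(nat \<Rightarrow> real poly) \<Rightarrow> nat \<Rightarrow> real" where
  "en P j = cint j (\<lambda>x. (poly (P j) x)\<^sup>2 + (poly (D P j) x)\<^sup>2)"

text \<open>A pointwise bound on cell j that serves P, \<open>D P\<close> and the derivative of P at
  once, and with a power of \<open>len\<close> also the jump; the 4 comes from the jump. It is kept
  local so that its squares sum back to the energy.\<close>

definition sb :: "(nat \<Rightarrow> real poly) \<Rightarrow> nat \<Rightarrow> real" where
  "sb P j = sqrt (4 * Binv k * en P j / len j)"

lemma N1: "1 \<le> N" and X0: "X 0 = xl" and XN: "X N = xr"
  and X_step: "j \<in> {1..N} \<Longrightarrow> X (j - 1) < X j"
  using mesh by (auto simp: is_mesh_def)

lemma len_pos: "j \<in> {1..N} \<Longrightarrow> 0 < len j"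
  using X_step by (simp add: len_def)

lemma len_le_h: "j \<in> {1..N} \<Longrightarrow> len j \<le> h"
  unfolding h_def mesh_size_def len_def by (intro Max_ge) auto

lemma h_pos: "0 < h"
  using len_pos[of 1] len_le_h[of 1] N1 by simp

lemma h_le_len: "j \<in> {1..N} \<Longrightarrow> \<rho> * h \<le> len j"
  using quni h_pos by (auto simp: quasi_uniform_def h_def[symmetric] len_def pos_le_divide_eq)

lemma X_mono: "i \<le> j \<Longrightarrow> j \<le> N \<Longrightarrow> X i \<le> X j"
proof (induction j rule: dec_induct)
  case (step n)
  then show ?case using X_step[of "Suc n"] by auto
qed simp

lemma X_bounds: "j \<le> N \<Longrightarrow> X j \<in> {xl..xr}"
  using X_mono[of 0 j] X_mono[of j N] X0 XN by auto

lemma cell_subset: "j \<in> {1..N} \<Longrightarrow> x \<in> {X (j - 1)..X j} \<Longrightarrow> x \<in> {xl..xr}"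
  using X_bounds[of j] X_bounds[of "j - 1"] by (auto simp: le_diff_conv)

lemma X_le: "j \<in> {1..N} \<Longrightarrow> X (j - 1) \<le> X j"
  using X_step[of j] by simp

lemma sum_len: "(\<Sum>j=1..N. len j) = xr - xl"
proof -
  have "(\<Sum>j=1..N. len j) = (\<Sum>j<N. X (Suc j) - X j)"
    by (rule sum.reindex_bij_witness[of _ Suc "\<lambda>j. j - 1"]) (auto simp: len_def)
  also have "\<dots> = X N - X 0" by (rule sum_lessThan_telescope)
  finally show ?thesis using X0 XN by simp
qed

lemma h_le_L: "h \<le> xr - xl"
proof -
  have "h \<in> (\<lambda>j. X j - X (j - 1)) ` {1..N}"
    unfolding h_def mesh_size_def using N1 by (intro Max_in) auto
  then obtain j where j: "j \<in> {1..N}" "h = X j - X (j - 1)" by auto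
  then have "j \<le> N" "j - 1 \<le> N" by auto
  then show ?thesis using X_bounds[of j] X_bounds[of "j - 1"] j by auto
qed

lemma sum_h: "real N * h \<le> (xr - xl) / \<rho>"
proof -
  have "(\<Sum>j=1..N. \<rho> * h) \<le> (\<Sum>j=1..N. len j)" by (intro sum_mono h_le_len) auto
  then have "\<rho> * (real N * h) \<le> xr - xl" by (simp only: sum_len) (simp add: ac_simps)
  then show ?thesis using rho by (simp add: pos_le_divide_eq mult.commute)
qed

lemma pr_in: "j \<in> {1..N} \<Longrightarrow> pr j \<in> {1..N}"
  using N1 by (auto simp: pr_def)

lemma sum_pr: "(\<Sum>j=1..N. f (pr j)) = (\<Sum>j=1..N. (f j :: real))"
  by (rule sum.reindex_bij_witness[of _ "\<lambda>j. if j = N then 1 else Suc j" pr]) (use N1 in \<open>auto simp: pr_def\<close>)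

text \<open>Abel summation on the circle: the two traces at an interface meet one flux value and
  combine to a jump.\<close>

lemma sum_boundary:
  fixes F :: "nat \<Rightarrow> real"
  assumes "F 0 = F N"
  shows "(\<Sum>j=1..N. F j * poly (P j) (X j) - F (j - 1) * poly (P j) (X (j - 1)))
    = - (\<Sum>j=1..N. F (j - 1) * jmp P j)"
proof -
  have "(\<Sum>j=1..N. F j * poly (P j) (X j)) = (\<Sum>j=1..N. F (pr j) * poly (P (pr j)) (X (pr j)))"
    by (rule sum_pr[symmetric])
  also have "\<dots> = (\<Sum>j=1..N. F (j - 1) * poly (P (pr j)) (X (pr j)))"
    using assms by (intro sum.cong) (auto simp: pr_def)
  finally show ?thesis
    by (simp add: jmp_def sum_subtractf right_diff_distrib)
qed

lemma cint_abs_le: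
  assumes "j \<in> {1..N}" "continuous_on {X (j - 1)..X j} f" "\<And>x. x \<in> {X (j - 1)..X j} \<Longrightarrow> \<bar>f x\<bar> \<le> B"
  shows "\<bar>cint j f\<bar> \<le> B * len j"
  using integral_bound[of "X (j - 1)" "X j" f B] assms X_le by (simp add: len_def)

lemma cint_le:
  assumes "j \<in> {1..N}" "continuous_on {X (j - 1)..X j} f" "continuous_on {X (j - 1)..X j} g"
   "\<And>x. x \<in> {X (j - 1)..X j} \<Longrightarrow> f x \<le> g x"
  shows "cint j f \<le> cint j g"
  using assms by (intro integral_le integrable_continuous_interval) auto

lemma cint_nonneg:
  assumes "continuous_on {X (j - 1)..X j} f" "\<And>x. x \<in> {X (j - 1)..X j} \<Longrightarrow> 0 \<le> f x"
  shows "0 \<le> cint j f"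
  using assms by (intro integral_nonneg integrable_continuous_interval) auto

lemma cint_add:
  assumes "continuous_on {X (j - 1)..X j} f" "continuous_on {X (j - 1)..X j} g"
  shows "cint j (\<lambda>x. f x + g x) = cint j f + cint j g"
  using assms by (intro integral_add integrable_continuous_interval) auto

lemma cint_diff:
  assumes "continuous_on {X (j - 1)..X j} f" "continuous_on {X (j - 1)..X j} g"
  shows "cint j (\<lambda>x. f x - g x) = cint j f - cint j g"
  using assms by (intro integral_diff integrable_continuous_interval) auto

lemma cint_by_parts:
  assumes j: "j \<in> {1..N}" and F: "\<And>x. x \<in> {X (j - 1)..X j} \<Longrightarrow> (F has_field_derivative F' x) (at x)"
    and G: "\<And>x. x \<in> {X (j - 1)..X j} \<Longrightarrow> (G has_field_derivative G' x) (at x)"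
    and F': "continuous_on {X (j - 1)..X j} F'" and G': "continuous_on {X (j - 1)..X j} G'"
  shows "cint j (\<lambda>x. F' x * G x) = F (X j) * G (X j) - F (X (j - 1)) * G (X (j - 1)) - cint j (\<lambda>x. F x * G' x)"
proof -
  have cF: "continuous_on {X (j - 1)..X j} F" and cG: "continuous_on {X (j - 1)..X j} G"
    using F G DERIV_isCont continuous_at_imp_continuous_on by blast+
  have "((\<lambda>x. F' x * G x + F x * G' x) has_integral (F (X j) * G (X j) - F (X (j - 1)) * G (X (j - 1)))) {X (j - 1)..X j}"
  proof (rule fundamental_theorem_of_calculus[OF X_le[OF j]])
    fix x assume x: "x \<in> {X (j - 1)..X j}"
    have "((\<lambda>x. F x * G x) has_field_derivative F' x * G x + F x * G' x) (at x)"
      using DERIV_mult[OF F[OF x] G[OF x]] by (simp add: ac_simps)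
    then show "((\<lambda>x. F x * G x) has_vector_derivative F' x * G x + F x * G' x) (at x within {X (j - 1)..X j})"
      by (simp add: has_real_derivative_iff_has_vector_derivative has_vector_derivative_at_within)
  qed
  then have "cint j (\<lambda>x. F' x * G x + F x * G' x) = F (X j) * G (X j) - F (X (j - 1)) * G (X (j - 1))"
    by (rule integral_unique)
  moreover have "cint j (\<lambda>x. F' x * G x + F x * G' x) = cint j (\<lambda>x. F' x * G x) + cint j (\<lambda>x. F x * G' x)"
    using cF cG F' G' by (intro cint_add continuous_intros)
  ultimately show ?thesis by simp
qed

lemma degree_lam: "degree (lam j) \<le> k"
  by (simp add: lam_def degree_lift)

lemma fam_D: "fam P \<Longrightarrow> fam (D P)"
  unfolding fam_def D_def
  by (auto intro!: degree_add_le order.trans[OF degree_smult_le] degree_lam simp: degree_pderiv intro: le_trans diff_le_self)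

text \<open>The characterising property of the discrete derivative: integration against the lifting
  evaluates the test polynomial at the left node.\<close>

lemma D_test:
  assumes j: "j \<in> {1..N}" and q: "degree q \<le> k"
  shows "cint j (\<lambda>x. poly q x * poly (D P j) x)
    = cint j (\<lambda>x. poly q x * poly (pderiv (P j)) x) + jmp P j * poly q (X (j - 1))"
proof -
  have "cint j (\<lambda>x. poly q x * poly (D P j) x)
    = cint j (\<lambda>x. poly q x * poly (pderiv (P j)) x + jmp P j * (poly (lam j) x * poly q x))"
    by (simp add: D_def algebra_simps)
  also have "\<dots> = cint j (\<lambda>x. poly q x * poly (pderiv (P j)) x) + jmp P j * cint j (\<lambda>x. poly (lam j) x * poly q x)"
    by (subst cint_add) (auto intro!: continuous_intros)
  finally show ?thesis using integral_lift[OF X_step[OF j] q] by (simp add: lam_def)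
qed

lemma en_nonneg: "0 \<le> en P j"
  unfolding en_def by (intro cint_nonneg continuous_intros) auto

lemma aform_en: "aform P P = (\<Sum>j=1..N. en P j)"
  by (simp add: aform_def en_def power2_eq_square)

lemma en_le_aform: "j \<in> {1..N} \<Longrightarrow> en P j \<le> aform P P"
  unfolding aform_en by (rule member_le_sum) (auto simp: en_nonneg)

lemma aform_nonneg: "0 \<le> aform P P"
  unfolding aform_en by (intro sum_nonneg en_nonneg)

lemma sb_nonneg: "j \<in> {1..N} \<Longrightarrow> 0 \<le> sb P j"
  unfolding sb_def using Binv_unit(1)[of k] en_nonneg len_pos
  by (intro real_sqrt_ge_zero divide_nonneg_pos mult_nonneg_nonneg) auto

lemma sb_sq: "j \<in> {1..N} \<Longrightarrow> (sb P j)\<^sup>2 = 4 * Binv k * en P j / len j"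
  unfolding sb_def using Binv_unit(1)[of k] en_nonneg[of P j] len_pos[of j]
  by (intro real_sqrt_pow2 divide_nonneg_pos mult_nonneg_nonneg) auto

lemma abs_le_of_square: "0 \<le> s \<Longrightarrow> y\<^sup>2 \<le> s\<^sup>2 \<Longrightarrow> \<bar>y\<bar> \<le> (s::real)"
  by (metis abs_le_square_iff abs_of_nonneg)

text \<open>The derivative and the jump of P are controlled by \<open>D P\<close> alone through
  \<open>broken_deriv_bounds\<close>, which is how the jump gains a factor \<open>len\<close>. The
  derivative of \<open>D P\<close> has no such structure and pays the full inverse estimate.\<close>

lemma sb_bounds:
  assumes P: "fam P" and j: "j \<in> {1..N}" and x: "x \<in> {X (j - 1)..X j}"
  shows "\<bar>poly (P j) x\<bar> \<le> sb P j" "\<bar>poly (D P j) x\<bar> \<le> sb P j"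
    "\<bar>poly (pderiv (P j)) x\<bar> \<le> sb P j" "\<bar>poly (pderiv (D P j)) x\<bar> \<le> sb P j / len j"
    "\<bar>jmp P j\<bar> \<le> len j * sb P j"
proof -
  have B: "0 \<le> Binv k" using Binv_unit(1)[of k] by simp
  have l: "0 < len j" by (rule len_pos[OF j])
  have s0: "0 \<le> sb P j" by (rule sb_nonneg[OF j])
  have degP: "degree (P j) \<le> k" using P j by (auto simp: fam_def)
  have degD: "degree (D P j) \<le> k" using fam_D[OF P] j by (auto simp: fam_def)
  have nn1: "0 \<le> cint j (\<lambda>x. (poly (P j) x)\<^sup>2)" by (intro cint_nonneg continuous_intros) auto
  have nn2: "0 \<le> cint j (\<lambda>x. (poly (D P j) x)\<^sup>2)" by (intro cint_nonneg continuous_intros) auto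
  have en: "en P j = cint j (\<lambda>x. (poly (P j) x)\<^sup>2) + cint j (\<lambda>x. (poly (D P j) x)\<^sup>2)"
    unfolding en_def by (intro cint_add continuous_intros)
  have 4: "c / len j * Q \<le> 4 * c * en P j / len j" if "0 \<le> c" "0 \<le> Q" "Q \<le> en P j" for c Q
  proof -
    have "c * Q \<le> c * en P j" using that by (intro mult_left_mono) auto
    also have "\<dots> \<le> 4 * c * en P j" using that en_nonneg[of P j] by (simp add: mult_right_mono)
    finally show ?thesis using l by (simp add: divide_right_mono)
  qed
  have e: "cint j (\<lambda>x. (poly (P j) x)\<^sup>2) \<le> en P j" "cint j (\<lambda>x. (poly (D P j) x)\<^sup>2) \<le> en P j"
    using en nn1 nn2 by auto
  show "\<bar>poly (P j) x\<bar> \<le> sb P j"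
    using order.trans[OF poly_inverse_ineq(1)[OF X_step[OF j] degP x, folded len_def] 4[OF B nn1 e(1)]] s0
    by (intro abs_le_of_square) (simp_all add: sb_sq[OF j])
  show "\<bar>poly (D P j) x\<bar> \<le> sb P j"
    using order.trans[OF poly_inverse_ineq(1)[OF X_step[OF j] degD x, folded len_def] 4[OF B nn2 e(2)]] s0
    by (intro abs_le_of_square) (simp_all add: sb_sq[OF j])
  note br = broken_deriv_bounds[OF X_step[OF j] degP x, of "D P j" "jmp P j"]
  have brD: "D P j = pderiv (P j) + smult (jmp P j) (lift k (X (j - 1)) (X j))"
    by (simp add: D_def lam_def)
  show "\<bar>poly (pderiv (P j)) x\<bar> \<le> sb P j"
    using order.trans[OF br(1)[OF brD, folded len_def] 4[OF B nn2 e(2)]] s0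
    by (intro abs_le_of_square) (simp_all add: sb_sq[OF j])
  show "\<bar>jmp P j\<bar> \<le> len j * sb P j"
  proof (rule abs_le_of_square)
    have "(jmp P j)\<^sup>2 \<le> 4 * Binv k * len j * cint j (\<lambda>x. (poly (D P j) x)\<^sup>2)"
      using br(2)[OF brD] by (simp add: len_def)
    also have "\<dots> \<le> 4 * Binv k * len j * en P j"
      using B l e(2) by (intro mult_left_mono) auto
    also have "\<dots> = (len j * sb P j)\<^sup>2"
      using l by (simp add: power_mult_distrib sb_sq[OF j]) (simp add: power2_eq_square)
    finally show "(jmp P j)\<^sup>2 \<le> (len j * sb P j)\<^sup>2" .
  qed (use l s0 in auto)
  show "\<bar>poly (pderiv (D P j)) x\<bar> \<le> sb P j / len j"
  proof (rule abs_le_of_square)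
    have "(poly (pderiv (D P j)) x)\<^sup>2 \<le> Binv k / len j ^ 3 * cint j (\<lambda>x. (poly (D P j) x)\<^sup>2)"
      using poly_inverse_ineq(2)[OF X_step[OF j] degD x] by (simp add: len_def)
    also have "\<dots> = (Binv k / len j * cint j (\<lambda>x. (poly (D P j) x)\<^sup>2)) / (len j)\<^sup>2"
      by (simp add: power3_eq_cube power2_eq_square)
    also have "\<dots> \<le> (4 * Binv k * en P j / len j) / (len j)\<^sup>2"
      using 4[OF B nn2 e(2)] by (intro divide_right_mono) auto
    also have "\<dots> = (sb P j / len j)\<^sup>2" by (simp add: power_divide sb_sq[OF j])
    finally show "(poly (pderiv (D P j)) x)\<^sup>2 \<le> (sb P j / len j)\<^sup>2" .
  qed (use l s0 in auto)
qed

lemma len_sb_sq: "j \<in> {1..N} \<Longrightarrow> len j * (sb P j)\<^sup>2 = 4 * Binv k * en P j"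
  using len_pos[of j] by (simp add: sb_sq)

text \<open>Quasi-uniformity exchanges \<open>h\<close> for the local length at the cost 1/\<rho>,
  and that length cancels the one in \<open>sb\<close>.\<close>

lemma h_sb_sq: "j \<in> {1..N} \<Longrightarrow> h * (sb P j)\<^sup>2 \<le> 4 * Binv k / \<rho> * en P j"
proof -
  assume j: "j \<in> {1..N}"
  have "\<rho> * (h * (sb P j)\<^sup>2) \<le> len j * (sb P j)\<^sup>2"
    using mult_right_mono[OF h_le_len[OF j], of "(sb P j)\<^sup>2"] by (simp add: mult.assoc)
  then have "\<rho> * (h * (sb P j)\<^sup>2) \<le> 4 * Binv k * en P j" by (simp only: len_sb_sq[OF j])
  then show ?thesis using rho by (simp add: field_simps)
qed

lemma sum_h_sb_sq: "(\<Sum>j=1..N. h * (sb P j)\<^sup>2) \<le> 4 * Binv k / \<rho> * aform P P"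
  unfolding aform_en sum_distrib_left by (intro sum_mono h_sb_sq) auto

lemma aform_commute: "aform P Q = aform Q P"
  by (simp add: aform_def mult.commute)

lemma D_add: "D (\<lambda>j. P j + Q j) j = D P j + D Q j"
  by (simp add: D_def jmp_def pderiv_add algebra_simps smult_add_left smult_diff_left)

lemma D_smult: "D (\<lambda>j. smult c (P j)) j = smult c (D P j)"
  by (simp add: D_def jmp_def pderiv_smult smult_add_right right_diff_distrib)

lemma D_zero: "D (\<lambda>j. 0) j = 0"
  by (simp add: D_def jmp_def)

lemma D_diff: "D (\<lambda>j. P j - Q j) j = D P j - D Q j"
  by (simp add: D_def jmp_def pderiv_diff algebra_simps smult_add_left smult_diff_left)

lemma aform_add_left: "aform (\<lambda>j. P j + Q j) R = aform P R + aform Q R"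
proof -
  have "aform (\<lambda>j. P j + Q j) R = (\<Sum>j=1..N. cint j (\<lambda>x. (poly (P j) x * poly (R j) x + poly (D P j) x * poly (D R j) x)
     + (poly (Q j) x * poly (R j) x + poly (D Q j) x * poly (D R j) x)))"
    by (simp add: aform_def D_add algebra_simps)
  also have "\<dots> = aform P R + aform Q R"
    unfolding aform_def sum.distrib[symmetric]
    by (intro sum.cong refl cint_add continuous_intros)
  finally show ?thesis .
qed

lemma aform_smult_left: "aform (\<lambda>j. smult c (P j)) R = c * aform P R"
proof -
  have "aform (\<lambda>j. smult c (P j)) R = (\<Sum>j=1..N. cint j (\<lambda>x. c * (poly (P j) x * poly (R j) x + poly (D P j) x * poly (D R j) x)))"
    by (simp add: aform_def D_smult algebra_simps)
  then show ?thesis by (simp add: aform_def sum_distrib_left)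
qed

lemma aform_diff_left: "aform (\<lambda>j. P j - Q j) R = aform P R - aform Q R"
  using aform_add_left[of P "\<lambda>j. smult (-1) (Q j)" R] aform_smult_left[of "-1" Q R] by simp

lemma aform_diff_right: "aform R (\<lambda>j. P j - Q j) = aform R P - aform R Q"
  using aform_diff_left[of P Q R] by (simp add: aform_commute)

lemma aform_zero_left: "aform (\<lambda>j. 0) R = 0"
  by (simp add: aform_def D_zero)

lemma aform_sum_left: "finite A \<Longrightarrow> aform (\<lambda>j. \<Sum>i\<in>A. smult (c i) (P i j)) R = (\<Sum>i\<in>A. c i * aform (P i) R)"
  by (induction A rule: finite_induct) (simp_all add: aform_zero_left aform_add_left aform_smult_left)

lemma aform_sum_right: "finite A \<Longrightarrow> aform R (\<lambda>j. \<Sum>i\<in>A. smult (c i) (P i j)) = (\<Sum>i\<in>A. c i * aform R (P i))"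
  using aform_sum_left[of A c P R] by (simp add: aform_commute)

lemma D_cong:
  assumes "\<And>j. j \<in> {1..N} \<Longrightarrow> P j = Q j" "j \<in> {1..N}"
  shows "D P j = D Q j"
  using assms pr_in[OF assms(2)] by (simp add: D_def jmp_def)

lemma aform_cong:
  assumes "\<And>j. j \<in> {1..N} \<Longrightarrow> P j = P' j" "\<And>j. j \<in> {1..N} \<Longrightarrow> Q j = Q' j"
  shows "aform P Q = aform P' Q'"
proof -
  have "D P j = D P' j" "D Q j = D Q' j" if "j \<in> {1..N}" for j
    using D_cong[of P P' j] D_cong[of Q Q' j] assms that by blast+
  then show ?thesis using assms unfolding aform_def by (intro sum.cong) auto
qed

text \<open>The parallelogram identity without its nonnegative term a(P - Q, P - Q).\<close>

lemma aform_Cauchy_Schwarz_sq: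
  "aform (\<lambda>j. P j + Q j) (\<lambda>j. P j + Q j) \<le> 2 * aform P P + 2 * aform Q Q"
proof -
  have "0 \<le> aform (\<lambda>j. P j - Q j) (\<lambda>j. P j - Q j)" by (rule aform_nonneg)
  moreover have "aform (\<lambda>j. P j + Q j) (\<lambda>j. P j + Q j) = aform P P + 2 * aform P Q + aform Q Q"
    using aform_add_left[of P Q "\<lambda>j. P j + Q j"] aform_add_left[of P Q P] aform_add_left[of P Q Q]
    by (simp add: aform_commute)
  moreover have "aform (\<lambda>j. P j - Q j) (\<lambda>j. P j - Q j) = aform P P - 2 * aform P Q + aform Q Q"
    by (simp add: aform_diff_left aform_diff_right aform_commute)
  ultimately show ?thesis by simp
qed

section \<open>Coordinates and dual bases for the energy form\<close>

definition phi :: "nat \<times> nat \<Rightarrow> nat \<Rightarrow> real poly" where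
  "phi = (\<lambda>(m, i) j. if j = m then monom 1 i else 0)"

definition idx :: "(nat \<times> nat) set" where "idx = {1..N} \<times> {..k}"

lemma finite_idx: "finite idx" by (simp add: idx_def)

lemma phi_sum: "j \<in> {1..N} \<Longrightarrow> (\<Sum>e\<in>idx. smult (c e) (phi e j)) = (\<Sum>i\<le>k. monom (c (j, i)) i)"
proof -
  assume j: "j \<in> {1..N}"
  have "(\<Sum>e\<in>idx. smult (c e) (phi e j)) = (\<Sum>m=1..N. \<Sum>i\<le>k. smult (c (m, i)) (phi (m, i) j))"
    unfolding idx_def by (simp add: sum.cartesian_product)
  also have "\<dots> = (\<Sum>m=1..N. if m = j then \<Sum>i\<le>k. monom (c (m, i)) i else 0)"
    by (intro sum.cong) (auto simp: phi_def smult_monom)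
  finally show ?thesis using j by simp
qed

lemma fam_expand:
  assumes "fam P" "j \<in> {1..N}"
  shows "P j = (\<Sum>e\<in>idx. smult (coeff (P (fst e)) (snd e)) (phi e j))"
  unfolding phi_sum[OF assms(2)] using poly_as_sum_le[of "P j" k] assms by (auto simp: fam_def)

lemma fam_phi_sum: "fam (\<lambda>j. \<Sum>e\<in>idx. smult (c e) (phi e j))"
  unfolding fam_def by (intro ballI, subst phi_sum) (auto intro: degree_sum_monom_le)

lemma fam_phi: "e \<in> idx \<Longrightarrow> fam (phi e)"
  by (auto simp: fam_def phi_def idx_def intro: order.trans[OF degree_monom_le])

lemma aform_pos:
  assumes "fam P" "j \<in> {1..N}" "P j \<noteq> 0"
  shows "0 < aform P P"
proof -
  have "0 \<le> cint j (\<lambda>x. (poly (P j) x)\<^sup>2)" by (intro cint_nonneg continuous_intros) auto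
  moreover have "0 \<le> cint j (\<lambda>x. (poly (D P j) x)\<^sup>2)" by (intro cint_nonneg continuous_intros) auto
  moreover have "cint j (\<lambda>x. (poly (P j) x)\<^sup>2) \<noteq> 0"
  proof
    assume "cint j (\<lambda>x. (poly (P j) x)\<^sup>2) = 0"
    then have "\<forall>x\<in>{X (j - 1)..X j}. (poly (P j) x)\<^sup>2 = 0"
      using X_step[OF assms(2)] by (subst (asm) integral_eq_0_iff) (auto intro!: continuous_intros)
    then have "P j = 0" using X_step[OF assms(2)] by (intro poly_eq_0_of_interval[of "X (j - 1)" "X j"]) auto
    then show False using assms by simp
  qed
  moreover have "en P j = cint j (\<lambda>x. (poly (P j) x)\<^sup>2) + cint j (\<lambda>x. (poly (D P j) x)\<^sup>2)"
    unfolding en_def by (intro cint_add continuous_intros)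
  ultimately show ?thesis using en_le_aform[OF assms(2), of P] by simp
qed

definition cf :: "(nat \<Rightarrow> real poly) \<Rightarrow> nat \<times> nat \<Rightarrow> real" where
  "cf w e = coeff (w (fst e)) (snd e)"

lemma aform_expand: "fam w \<Longrightarrow> aform z w = (\<Sum>e\<in>idx. cf w e * aform z (phi e))"
proof -
  assume w: "fam w"
  have "aform z w = aform z (\<lambda>j. \<Sum>e\<in>idx. smult (cf w e) (phi e j))"
    unfolding cf_def by (intro aform_cong refl fam_expand[OF w])
  then show ?thesis by (simp only: aform_sum_right[OF finite_idx])
qed

text \<open>Positive definiteness of a makes the Gram system of the basis \<open>phi\<close>
  solvable. The result provides both the Ritz projection and the representers of the
  coordinates.\<close>

lemma dual_exists: "\<exists>Z. fam Z \<and> (\<forall>w. fam w \<longrightarrow> aform Z w = (\<Sum>e\<in>idx. cf w e * b e))"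
proof -
  have "\<exists>c. \<forall>e\<in>idx. (\<Sum>f\<in>idx. aform (phi e) (phi f) * c f) = b e"
  proof (rule pos_def_solve[OF finite_idx])
    fix c :: "nat \<times> nat \<Rightarrow> real" assume "\<exists>e\<in>idx. c e \<noteq> 0"
    then obtain j i where e: "j \<in> {1..N}" "i \<le> k" "c (j, i) \<noteq> 0" by (auto simp: idx_def)
    let ?P = "\<lambda>j. \<Sum>e\<in>idx. smult (c e) (phi e j)"
    have "coeff (?P j) i = c (j, i)" unfolding phi_sum[OF e(1)] using e by (simp add: coeff_sum)
    then have "?P j \<noteq> 0" using e by auto
    then have "0 < aform ?P ?P" using fam_phi_sum e by (intro aform_pos[of _ j]) auto
    also have "aform ?P ?P = (\<Sum>e\<in>idx. \<Sum>f\<in>idx. aform (phi e) (phi f) * c e * c f)"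
      by (subst aform_sum_left[OF finite_idx], subst aform_sum_right[OF finite_idx])
        (simp add: sum_distrib_left ac_simps)
    finally show "0 < (\<Sum>e\<in>idx. \<Sum>f\<in>idx. aform (phi e) (phi f) * c e * c f)" .
  qed (rule aform_commute)
  then obtain c where c: "\<And>e. e \<in> idx \<Longrightarrow> (\<Sum>f\<in>idx. aform (phi e) (phi f) * c f) = b e" by blast
  let ?Z = "\<lambda>j. \<Sum>e\<in>idx. smult (c e) (phi e j)"
  have Zphi: "aform ?Z (phi e) = b e" if "e \<in> idx" for e
  proof -
    have "aform ?Z (phi e) = (\<Sum>f\<in>idx. c f * aform (phi f) (phi e))" by (rule aform_sum_left[OF finite_idx])
    also have "\<dots> = (\<Sum>f\<in>idx. aform (phi e) (phi f) * c f)"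
      by (intro sum.cong refl) (simp add: aform_commute mult.commute)
    finally show ?thesis using c[OF that] by simp
  qed
  have "aform ?Z w = (\<Sum>e\<in>idx. cf w e * b e)" if w: "fam w" for w
    unfolding aform_expand[OF w] by (intro sum.cong refl) (simp only: Zphi)
  then show ?thesis using fam_phi_sum by blast
qed

lemma cint_expand:
  assumes w: "fam w" and M: "\<And>j. j \<in> {1..N} \<Longrightarrow> continuous_on {X (j - 1)..X j} (M j)"
  shows "(\<Sum>j=1..N. cint j (\<lambda>x. M j x * poly (w j) x)) = (\<Sum>e\<in>idx. cf w e * (\<Sum>j=1..N. cint j (\<lambda>x. M j x * poly (phi e j) x)))"
proof -
  have "(\<Sum>j=1..N. cint j (\<lambda>x. M j x * poly (w j) x)) = (\<Sum>j=1..N. cint j (\<lambda>x. \<Sum>e\<in>idx. cf w e * (M j x * poly (phi e j) x)))"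
  proof (intro sum.cong refl integral_cong)
    fix j x assume j: "j \<in> {1..N}"
    have "poly (w j) x = (\<Sum>e\<in>idx. cf w e * poly (phi e j) x)"
      by (subst fam_expand[OF w j]) (simp add: poly_sum cf_def)
    then show "M j x * poly (w j) x = (\<Sum>e\<in>idx. cf w e * (M j x * poly (phi e j) x))"
      by (simp add: sum_distrib_left ac_simps)
  qed
  also have "\<dots> = (\<Sum>j=1..N. \<Sum>e\<in>idx. cint j (\<lambda>x. cf w e * (M j x * poly (phi e j) x)))"
    using M by (intro sum.cong refl integral_sum integrable_continuous_interval continuous_intros finite_idx) auto
  also have "\<dots> = (\<Sum>e\<in>idx. cf w e * (\<Sum>j=1..N. cint j (\<lambda>x. M j x * poly (phi e j) x)))"
    by (subst sum.swap) (simp add: sum_distrib_left)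
  finally show ?thesis .
qed

lemma cell_continuous: "continuous_on {xl..xr} M \<Longrightarrow> j \<in> {1..N} \<Longrightarrow> continuous_on {X (j - 1)..X j} M"
  by (erule continuous_on_subset) (use cell_subset in auto)

lemma Ritz_exists:
  assumes M: "continuous_on {xl..xr} M"
  shows "\<exists>Z. fam Z \<and> (\<forall>w. fam w \<longrightarrow> aform Z w = (\<Sum>j=1..N. cint j (\<lambda>x. M x * poly (w j) x)))"
proof -
  from dual_exists[of "\<lambda>e. \<Sum>j=1..N. cint j (\<lambda>x. M x * poly (phi e j) x)"]
  show ?thesis
  proof (rule ex_forward, elim conjE, intro conjI allI impI)
    fix Z w
    assume Z: "\<forall>w. fam w \<longrightarrow> aform Z w = (\<Sum>e\<in>idx. cf w e * (\<Sum>j=1..N. cint j (\<lambda>x. M x * poly (phi e j) x)))"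
      and w: "fam w"
    show "aform Z w = (\<Sum>j=1..N. cint j (\<lambda>x. M x * poly (w j) x))"
      unfolding Z[rule_format, OF w] by (rule cint_expand[OF w, symmetric]) (rule cell_continuous[OF M])
  qed
qed

text \<open>Only the values \<open>a(\<zeta>, \<phi>\<^sub>e)\<close> have an explicit dependence on time.\<close>

lemma energy_quadratic_form:
  obtains c where "\<And>e f. c e f = c f e"
    "\<And>z e. fam z \<Longrightarrow> e \<in> idx \<Longrightarrow> cf z e = (\<Sum>f\<in>idx. c e f * aform z (phi f))"
    "\<And>z. fam z \<Longrightarrow> aform z z = (\<Sum>e\<in>idx. \<Sum>f\<in>idx. c e f * (aform z (phi e) * aform z (phi f)))"
proof -
  \<comment> \<open>\<open>Y e\<close> represents the coordinate \<open>cf _ e\<close>, and the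
    numbers a(Y e, Y f) form the inverse of the Gram matrix.\<close>
  define Y where "Y e = (SOME Y. fam Y \<and> (\<forall>w. fam w \<longrightarrow> aform Y w = (\<Sum>f\<in>idx. cf w f * (if f = e then 1 else 0))))" for e
  have Y: "fam (Y e) \<and> (\<forall>w. fam w \<longrightarrow> aform (Y e) w = (\<Sum>f\<in>idx. cf w f * (if f = e then 1 else 0)))" for e
    using someI_ex[OF dual_exists[of "\<lambda>f. if f = e then 1 else 0"]] unfolding Y_def .
  have fY: "fam (Y e)" for e by (rule conjunct1[OF Y])
  have Ye: "aform (Y e) w = cf w e" if w: "fam w" and e: "e \<in> idx" for e w
  proof -
    have "aform (Y e) w = (\<Sum>f\<in>idx. cf w f * (if f = e then 1 else 0))"
      by (rule conjunct2[OF Y, rule_format, OF w])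
    also have "\<dots> = (\<Sum>f\<in>idx. if f = e then cf w f else 0)" by (intro sum.cong refl) simp
    also have "\<dots> = cf w e" using e by (simp only: sum.delta[OF finite_idx] if_True)
    finally show ?thesis .
  qed
  have 1: "cf z e = (\<Sum>f\<in>idx. aform (Y e) (Y f) * aform z (phi f))" if z: "fam z" and e: "e \<in> idx" for z e
  proof -
    have "cf z e = aform z (Y e)" using Ye[OF z e] by (simp add: aform_commute)
    also have "\<dots> = (\<Sum>f\<in>idx. cf (Y e) f * aform z (phi f))" by (rule aform_expand[OF fY])
    also have "\<dots> = (\<Sum>f\<in>idx. aform (Y e) (Y f) * aform z (phi f))"
      by (intro sum.cong refl) (simp only: Ye[OF fY, symmetric] aform_commute[of "Y e"])
    finally show ?thesis .
  qed
  have 2: "aform z z = (\<Sum>e\<in>idx. \<Sum>f\<in>idx. aform (Y e) (Y f) * (aform z (phi e) * aform z (phi f)))" if z: "fam z" for z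
  proof -
    have "aform z z = (\<Sum>e\<in>idx. cf z e * aform z (phi e))" by (rule aform_expand[OF z])
    also have "\<dots> = (\<Sum>e\<in>idx. (\<Sum>f\<in>idx. aform (Y e) (Y f) * aform z (phi f)) * aform z (phi e))"
      by (intro sum.cong refl) (simp only: 1[OF z])
    finally show ?thesis by (simp add: sum_distrib_left sum_distrib_right ac_simps)
  qed
  show thesis by (rule that[of "\<lambda>e f. aform (Y e) (Y f)", OF aform_commute 1 2])
qed

end

section \<open>The Ritz projection\<close>

definition pint :: "real poly \<Rightarrow> real poly" where
  "pint p = (\<Sum>i\<le>degree p. monom (coeff p i / real (Suc i)) (Suc i))"

lemma pderiv_sum: "pderiv (sum f A) = (\<Sum>i\<in>A. pderiv (f i))"
  by (induction A rule: infinite_finite_induct) (simp_all add: pderiv_add)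

lemma pderiv_pint: "pderiv (pint p) = p"
proof -
  have "pderiv (pint p) = (\<Sum>i\<le>degree p. monom (coeff p i) i)"
    by (simp add: pint_def pderiv_sum pderiv_monom)
  then show ?thesis using poly_as_sum_le[of p "degree p"] by simp
qed

lemma degree_pint_le: "degree p \<le> n \<Longrightarrow> degree (pint p) \<le> Suc n"
  unfolding pint_def
  by (rule degree_sum_le) (auto intro!: order.trans[OF degree_monom_le])

lemma MVT_abs:
  fixes f f' :: "real \<Rightarrow> real"
  assumes "\<And>x. x \<in> {a..b} \<Longrightarrow> (f has_field_derivative f' x) (at x)" "\<And>x. x \<in> {a..b} \<Longrightarrow> \<bar>f' x\<bar> \<le> B"
    "x \<in> {a..b}" "y \<in> {a..b}"
  shows "\<bar>f x - f y\<bar> \<le> B * \<bar>x - y\<bar>"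
  using field_differentiable_bound[of "{a..b}" f f' B x y] assms
  by (auto intro: DERIV_subset)

lemma integral_pderiv: "a \<le> b \<Longrightarrow> integral {a..b} (poly (pderiv p)) = poly p b - poly p (a::real)"
  by (intro integral_unique fundamental_theorem_of_calculus)
    (auto intro: has_field_derivative_at_within[OF poly_DERIV] simp flip: has_real_derivative_iff_has_vector_derivative)

text \<open>L is the length of the domain and G the bound in \<open>dg_data\<close>.
  \<open>Cv\<close> bounds U - v for the interpolant v, \<open>CA\<close> the energy of Z - v for
  the Ritz projection Z, \<open>CZ\<close> the squared pointwise errors of Z, and \<open>CI\<close>
  the energy of the difference of v and the discrete initial value. None of them involves h or
  N.\<close>

definition Cv :: "nat \<Rightarrow> real \<Rightarrow> real \<Rightarrow> real" where
  "Cv k L G = G / \<bar>coeff (ref_lift k) k\<bar> * (1 + Clift k) + G * L"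

definition CA :: "nat \<Rightarrow> real \<Rightarrow> real \<Rightarrow> real" where
  "CA k L G = 4 * Binv k * L * (Cv k L G + 2 * G)\<^sup>2"

definition CZ :: "nat \<Rightarrow> real \<Rightarrow> real \<Rightarrow> real \<Rightarrow> real" where
  "CZ k L \<rho> G = 2 * (L / \<rho>) * (Cv k L G + G)\<^sup>2 + 8 * Binv k / \<rho> * CA k L G"

definition CI :: "nat \<Rightarrow> real \<Rightarrow> real \<Rightarrow> real" where
  "CI k L G = L * (G\<^sup>2 + L\<^sup>2 * Binv k * G\<^sup>2)"

text \<open>A snapshot at one time: \<open>Mt\<close> is the value of M_t, and the evolution
  equation enters only as \<open>Psi_der\<close>. The cellwise polynomials \<open>q\<close> and
  \<open>\<pi>q\<close> approximate U_x and (U^2 R - R^3/3)_x; one number \<open>G\<close> carries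
  all bounds on the exact solution.\<close>

locale dg_data = dg_mesh +
  fixes \<kappa> G :: real and U R R2 Mt :: "real \<Rightarrow> real" and q \<pi>q :: "nat \<Rightarrow> real poly"
  assumes G1: "G \<ge> 1"
    and U_der: "\<And>x. (U has_field_derivative R x) (at x)"
    and R_der: "\<And>x. (R has_field_derivative R2 x) (at x)"
    and R2_cont: "continuous_on UNIV R2"
    and Mt_cont: "continuous_on UNIV Mt"
    and U_per: "U xr = U xl" and R_per: "R xr = R xl" and R2_per: "R2 xr = R2 xl"
    and U_G: "\<And>x. x \<in> {xl..xr} \<Longrightarrow> \<bar>U x\<bar> \<le> G"
    and R_G: "\<And>x. x \<in> {xl..xr} \<Longrightarrow> \<bar>R x\<bar> \<le> G"
    and R2_G: "\<And>x. x \<in> {xl..xr} \<Longrightarrow> \<bar>R2 x\<bar> \<le> G"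
    and q_fam: "fam q"
    and q_R: "\<And>j x. j \<in> {1..N} \<Longrightarrow> x \<in> {X (j - 1)..X j} \<Longrightarrow> \<bar>R x - poly (q j) x\<bar> \<le> G * h ^ (k + 1)"
    and q_coeff: "\<And>j. j \<in> {1..N} \<Longrightarrow> \<bar>coeff (q j) k\<bar> \<le> G"
    and q_int: "\<And>j. j \<in> {1..N} \<Longrightarrow> cint j (poly (q j)) = U (X j) - U (X (j - 1))"
    and pi_fam: "fam \<pi>q"
    and pi_app: "\<And>j x. j \<in> {1..N} \<Longrightarrow> x \<in> {X (j - 1)..X j} \<Longrightarrow>
       \<bar>((U x)\<^sup>2 * R2 x + 2 * U x * (R x)\<^sup>2 - (R x)\<^sup>2 * R2 x) - poly (\<pi>q j) x\<bar> \<le> G * h ^ k"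
    and Psi_der: "\<And>x. ((\<lambda>x. 2 * \<kappa>\<^sup>2 * U x + ((U x)\<^sup>2 - (R x)\<^sup>2) * (U x - R2 x)) has_field_derivative - Mt x) (at x)"
begin

abbreviation L :: real where "L \<equiv> xr - xl"

lemma U_cont: "continuous_on S U" and R_cont: "continuous_on S R"
  using U_der R_der DERIV_isCont continuous_at_imp_continuous_on by blast+

lemma R2_cont': "continuous_on S R2"
  using R2_cont continuous_on_subset by blast

lemma Mt_cont': "continuous_on S Mt"
  using Mt_cont continuous_on_subset by blast

lemmas dcont [continuous_intros] = U_cont R_cont R2_cont' Mt_cont'

lemma h_pow_pos: "0 < h ^ n" using h_pos by simp

text \<open>As \<open>\<lambda>\<^sub>j\<close> has degree \<open>k\<close>, the jump \<open>Jv j\<close> can be chosen such that \<open>q - Jv \<lambda>\<^sub>j\<close> has degree less than \<open>k\<close>;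
  its primitive \<open>v\<close> then lies in \<open>Vh\<close> and satisfies \<open>D v = q\<close>.\<close>

definition Jv :: "nat \<Rightarrow> real" where "Jv j = coeff (q j) k / coeff (lam j) k"

definition v :: "nat \<Rightarrow> real poly" where
  "v j = (let p = pint (q j - smult (Jv j) (lam j))
          in p + [:U (X (j - 1)) + Jv j - poly p (X (j - 1)):])"

lemma pderiv_v: "pderiv (v j) = q j - smult (Jv j) (lam j)"
  by (simp add: v_def Let_def pderiv_add pderiv_pint pderiv_pCons)

lemma coeff_lam_nz: "j \<in> {1..N} \<Longrightarrow> coeff (lam j) k \<noteq> 0"
  using X_step[of j] coeff_ref_lift[of k] by (simp add: lam_def coeff_lift)

lemma v_fam: "fam v"
  unfolding fam_def
proof
  fix j assume j: "j \<in> {1..N}"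
  let ?d = "q j - smult (Jv j) (lam j)"
  have "degree ?d \<le> k"
    using q_fam j degree_lam[of j] by (intro degree_diff_le) (auto simp: fam_def intro: order.trans[OF degree_smult_le])
  moreover have "coeff ?d k = 0" using coeff_lam_nz[OF j] by (simp add: Jv_def)
  ultimately have "degree ?d \<le> k - 1"
  proof (cases "degree ?d = k")
    case True
    then have "?d = 0" using \<open>coeff ?d k = 0\<close> by (metis leading_coeff_0_iff)
    then show ?thesis by (metis degree_0 zero_le)
  qed linarith
  then have "degree (pint ?d) \<le> k" using degree_pint_le[of ?d "k - 1"] k1 by simp
  then show "degree (v j) \<le> k"
    unfolding v_def Let_def by (intro degree_add_le) auto
qed

lemma v_left: "poly (v j) (X (j - 1)) = U (X (j - 1)) + Jv j"
  by (simp add: v_def Let_def)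

text \<open>This is the purpose of \<open>q_int\<close>: the derivative of v integrates to the
  increment of U minus \<open>Jv j\<close>, because the lifting has mass 1. As v is exact at every
  right node, its jump at the left node is exactly \<open>Jv j\<close>, and D v = q holds without
  error.\<close>

lemma v_right: "j \<in> {1..N} \<Longrightarrow> poly (v j) (X j) = U (X j)"
proof -
  assume j: "j \<in> {1..N}"
  have "poly (v j) (X j) - poly (v j) (X (j - 1)) = cint j (poly (pderiv (v j)))"
    using integral_pderiv[OF X_le[OF j]] by simp
  also have "\<dots> = cint j (\<lambda>x. poly (q j) x - Jv j * (poly (lam j) x * poly 1 x))"
    by (intro integral_cong) (simp add: pderiv_v)
  also have "\<dots> = cint j (poly (q j)) - Jv j * cint j (\<lambda>x. poly (lam j) x * poly 1 x)"
    by (subst cint_diff) (auto intro!: continuous_intros)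
  also have "\<dots> = U (X j) - U (X (j - 1)) - Jv j"
    using integral_lift[OF X_step[OF j], of 1 k] q_int[OF j] by (simp add: lam_def)
  finally show ?thesis by (simp add: v_left)
qed

lemma U_pr: "j \<in> {1..N} \<Longrightarrow> U (X (pr j)) = U (X (j - 1))"
  using U_per X0 XN by (auto simp: pr_def)

lemma v_jmp: "j \<in> {1..N} \<Longrightarrow> jmp v j = Jv j"
  using v_right[OF pr_in] U_pr by (simp add: jmp_def v_left)

lemma D_v: "j \<in> {1..N} \<Longrightarrow> D v j = q j"
  by (simp add: D_def v_jmp pderiv_v)

lemma Jv_bound: "j \<in> {1..N} \<Longrightarrow> \<bar>Jv j\<bar> \<le> G / \<bar>coeff (ref_lift k) k\<bar> * len j ^ (k + 1)"
proof -
  assume j: "j \<in> {1..N}"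
  have "\<bar>Jv j\<bar> = \<bar>coeff (q j) k\<bar> / \<bar>coeff (ref_lift k) k\<bar> * len j ^ (k + 1)"
    using X_step[OF j] by (simp add: Jv_def lam_def coeff_lift len_def abs_mult abs_divide power_add)
  also have "\<dots> \<le> G / \<bar>coeff (ref_lift k) k\<bar> * len j ^ (k + 1)"
    using q_coeff[OF j] len_pos[OF j] by (intro mult_right_mono divide_right_mono) auto
  finally show ?thesis .
qed

text \<open>The lifting has size 1/\<open>len\<close>, but \<open>Jv\<close> is of order k+1 and the
  mean value theorem gains a factor \<open>len\<close>, so the correction does not lower the
  order.\<close>

lemma v_U:
  assumes j: "j \<in> {1..N}" and x: "x \<in> {X (j - 1)..X j}"
  shows "\<bar>U x - poly (v j) x\<bar> \<le> Cv k L G * h ^ (k + 1)"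
proof -
  have l: "0 < len j" by (rule len_pos[OF j])
  let ?C = "G / \<bar>coeff (ref_lift k) k\<bar>"
  have C0: "0 \<le> ?C" using G1 by simp
  have cl: "1 \<le> Clift k" by (rule Clift(1))
  have "\<bar>(poly (v j) x - U x) - (poly (v j) (X (j - 1)) - U (X (j - 1)))\<bar>
     \<le> (G * h ^ (k + 1) + \<bar>Jv j\<bar> * (Clift k / len j)) * \<bar>x - X (j - 1)\<bar>"
  proof (rule MVT_abs[of "X (j - 1)" "X j"])
    fix y assume y: "y \<in> {X (j - 1)..X j}"
    show "((\<lambda>x. poly (v j) x - U x) has_field_derivative (poly (pderiv (v j)) y - R y)) (at y)"
      by (intro DERIV_diff poly_DERIV U_der)
    have "\<bar>poly (lam j) y\<bar> \<le> Clift k / len j"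
      using lift_bound[OF X_step[OF j] y] by (simp add: lam_def len_def)
    then have "\<bar>Jv j * poly (lam j) y\<bar> \<le> \<bar>Jv j\<bar> * (Clift k / len j)"
      unfolding abs_mult by (rule mult_left_mono) simp
    then show "\<bar>poly (pderiv (v j)) y - R y\<bar> \<le> G * h ^ (k + 1) + \<bar>Jv j\<bar> * (Clift k / len j)"
      using q_R[OF j y] unfolding pderiv_v poly_diff poly_smult by linarith
  qed (use x X_le[OF j] in auto)
  also have "\<dots> \<le> (G * h ^ (k + 1) + \<bar>Jv j\<bar> * (Clift k / len j)) * len j"
    using x l cl G1 h_pos by (intro mult_left_mono) (auto simp: len_def)
  also have "\<dots> = G * h ^ (k + 1) * len j + \<bar>Jv j\<bar> * Clift k"
    using l by (simp add: field_simps)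
  also have "\<dots> \<le> G * h ^ (k + 1) * L + \<bar>Jv j\<bar> * Clift k"
    using len_le_h[OF j] h_le_L G1 h_pos by (intro add_right_mono mult_left_mono) auto
  finally have "\<bar>poly (v j) x - U x\<bar> \<le> G * h ^ (k + 1) * L + \<bar>Jv j\<bar> * (1 + Clift k)"
    by (simp add: v_left algebra_simps)
  also have "\<bar>Jv j\<bar> \<le> ?C * h ^ (k + 1)"
    by (rule order.trans[OF Jv_bound[OF j] mult_left_mono[OF power_mono C0]]) (use len_le_h[OF j] l in auto)
  then have "\<bar>Jv j\<bar> * (1 + Clift k) \<le> ?C * h ^ (k + 1) * (1 + Clift k)"
    using cl by (intro mult_right_mono) auto
  finally show ?thesis by (simp add: Cv_def algebra_simps)
qed

lemma Cv_nonneg: "0 \<le> Cv k L G"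
  unfolding Cv_def using G1 Clift(1)[of k] xl_xr
  by (intro add_nonneg_nonneg mult_nonneg_nonneg divide_nonneg_nonneg) auto

lemma R_pr: "j \<in> {1..N} \<Longrightarrow> R (X (pr j)) = R (X (j - 1))"
  using R_per X0 XN by (auto simp: pr_def)

lemma sum_cint_by_parts:
  assumes F: "\<And>x. (F has_field_derivative F' x) (at x)" and F': "continuous_on UNIV F'" and per: "F xr = F xl"
  shows "(\<Sum>j=1..N. cint j (\<lambda>x. F' x * poly (w j) x))
    = - (\<Sum>j=1..N. cint j (\<lambda>x. F x * poly (pderiv (w j)) x) + F (X (j - 1)) * jmp w j)"
proof -
  have "(\<Sum>j=1..N. cint j (\<lambda>x. F' x * poly (w j) x))
    = (\<Sum>j=1..N. (F (X j) * poly (w j) (X j) - F (X (j - 1)) * poly (w j) (X (j - 1)))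
         - cint j (\<lambda>x. F x * poly (pderiv (w j)) x))"
    by (intro sum.cong refl cint_by_parts F poly_DERIV continuous_intros)
      (use F' continuous_on_subset in auto)
  also have "\<dots> = - (\<Sum>j=1..N. F (X (j - 1)) * jmp w j) - (\<Sum>j=1..N. cint j (\<lambda>x. F x * poly (pderiv (w j)) x))"
    unfolding sum_subtractf[of "\<lambda>j. F (X j) * poly (w j) (X j) - F (X (j - 1)) * poly (w j) (X (j - 1))"]
    using sum_boundary[of "\<lambda>j. F (X j)" w] per X0 XN by simp
  finally show ?thesis by (simp add: sum.distrib)
qed

definition ritz :: "(nat \<Rightarrow> real poly) \<Rightarrow> bool" where
  "ritz Z \<longleftrightarrow> (\<forall>w. fam w \<longrightarrow> aform Z w = (\<Sum>j=1..N. cint j (\<lambda>x. (U x - R2 x) * poly (w j) x)))"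

text \<open>a(v, w) is explicit through D v = q, and M = U - R_x is integrated by parts. Only the
  local errors U - v and R - q survive, the latter at the nodes paired with jumps, which
  \<open>sb_bounds\<close> makes small.\<close>

lemma Ritz_residual:
  assumes Z: "ritz Z"
    and w: "fam w"
  shows "aform (\<lambda>j. Z j - v j) w = (\<Sum>j=1..N. cint j (\<lambda>x. (U x - poly (v j) x) * poly (w j) x)
     + cint j (\<lambda>x. (R x - poly (q j) x) * poly (pderiv (w j)) x)
     + (R (X (j - 1)) - poly (q j) (X (j - 1))) * jmp w j)"
proof -
  have 1: "aform Z w = (\<Sum>j=1..N. cint j (\<lambda>x. U x * poly (w j) x)) - (\<Sum>j=1..N. cint j (\<lambda>x. R2 x * poly (w j) x))"
    unfolding Z[unfolded ritz_def, rule_format, OF w] sum_subtractf[symmetric]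
    by (intro sum.cong refl) (simp add: left_diff_distrib cint_diff continuous_intros)
  have 2: "aform v w = (\<Sum>j=1..N. cint j (\<lambda>x. poly (v j) x * poly (w j) x)
      + (cint j (\<lambda>x. poly (q j) x * poly (pderiv (w j)) x) + jmp w j * poly (q j) (X (j - 1))))"
    unfolding aform_def
  proof (intro sum.cong refl)
    fix j assume j: "j \<in> {1..N}"
    have "degree (q j) \<le> k" using q_fam j by (auto simp: fam_def)
    from D_test[OF j this, of w] show "cint j (\<lambda>x. poly (v j) x * poly (w j) x + poly (D v j) x * poly (D w j) x)
      = cint j (\<lambda>x. poly (v j) x * poly (w j) x)
      + (cint j (\<lambda>x. poly (q j) x * poly (pderiv (w j)) x) + jmp w j * poly (q j) (X (j - 1)))"
      unfolding D_v[OF j] by (subst cint_add) (auto intro!: continuous_intros)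
  qed
  show ?thesis
    unfolding aform_diff_left 1 2 sum_cint_by_parts[OF R_der R2_cont R_per]
    unfolding diff_minus_eq_add sum.distrib[symmetric] sum_subtractf[symmetric]
    by (intro sum.cong refl) (simp add: left_diff_distrib cint_diff continuous_intros algebra_simps)
qed

text \<open>Young's inequality on each cell, balanced so that half of the energy is absorbed;
  \<open>len_sb_sq\<close> converts squares of \<open>sb\<close> into energy.\<close>

lemma aform_dual_bound:
  assumes H: "0 \<le> H" and b: "aform \<theta> \<theta> \<le> H * (\<Sum>j=1..N. len j * sb \<theta> j)"
  shows "aform \<theta> \<theta> \<le> 4 * Binv k * L * H\<^sup>2"
proof -
  have B: "1 \<le> Binv k" by (rule Binv_unit(1))
  have "H * (\<Sum>j=1..N. len j * sb \<theta> j) \<le> (\<Sum>j=1..N. en \<theta> j / 2 + 2 * Binv k * H\<^sup>2 * len j)"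
    unfolding sum_distrib_left
  proof (intro sum_mono)
    fix j assume j: "j \<in> {1..N}"
    have "0 \<le> (sb \<theta> j - 4 * Binv k * H)\<^sup>2" by simp
    then have "8 * Binv k * H * sb \<theta> j \<le> (sb \<theta> j)\<^sup>2 + 16 * (Binv k)\<^sup>2 * H\<^sup>2"
      by (simp add: power2_eq_square algebra_simps)
    then have "len j * (8 * Binv k * H * sb \<theta> j) \<le> len j * ((sb \<theta> j)\<^sup>2 + 16 * (Binv k)\<^sup>2 * H\<^sup>2)"
      using len_pos[OF j] by (intro mult_left_mono) auto
    also have "\<dots> = 4 * Binv k * en \<theta> j + 16 * (Binv k)\<^sup>2 * H\<^sup>2 * len j"
      unfolding distrib_left len_sb_sq[OF j] by simp
    finally have "8 * Binv k * (H * (len j * sb \<theta> j)) \<le> 8 * Binv k * (en \<theta> j / 2 + 2 * Binv k * H\<^sup>2 * len j)"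
      by (simp add: power2_eq_square algebra_simps)
    then show "H * (len j * sb \<theta> j) \<le> en \<theta> j / 2 + 2 * Binv k * H\<^sup>2 * len j"
      using B by (subst (asm) mult_le_cancel_left_pos) auto
  qed
  also have "\<dots> = aform \<theta> \<theta> / 2 + 2 * Binv k * H\<^sup>2 * L"
    unfolding sum.distrib sum_distrib_left[symmetric] sum_len aform_en sum_divide_distrib[symmetric] ..
  finally have "aform \<theta> \<theta> \<le> aform \<theta> \<theta> / 2 + 2 * Binv k * H\<^sup>2 * L" using b by linarith
  moreover have "4 * Binv k * L * H\<^sup>2 = 2 * (2 * Binv k * H\<^sup>2 * L)" by simp
  ultimately show ?thesis by linarith
qed

lemma Ritz_error:
  assumes Zf: "fam Z" and Z: "ritz Z"
  shows "aform (\<lambda>j. Z j - v j) (\<lambda>j. Z j - v j) \<le> CA k L G * h ^ (2 * k + 2)"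
proof -
  let ?\<theta> = "\<lambda>j. Z j - v j"
  have f: "fam ?\<theta>" using Zf v_fam by (auto simp: fam_def intro: degree_diff_le)
  let ?H = "(Cv k L G + 2 * G) * h ^ (k + 1)"
  have "aform ?\<theta> ?\<theta> \<le> ?H * (\<Sum>j=1..N. len j * sb ?\<theta> j)"
    unfolding Ritz_residual[OF Z f] sum_distrib_left
  proof (intro sum_mono)
    fix j assume j: "j \<in> {1..N}"
    let ?s = "sb ?\<theta> j"
    have s0: "0 \<le> ?s" by (rule sb_nonneg[OF j])
    note b = sb_bounds[OF f j]
    have 1: "\<bar>cint j (\<lambda>x. (U x - poly (v j) x) * poly (?\<theta> j) x)\<bar> \<le> (Cv k L G * h ^ (k + 1) * ?s) * len j"
      by (rule cint_abs_le[OF j]) (auto intro!: continuous_intros mult_mono v_U[OF j] b(1)[unfolded poly_diff] simp: abs_mult Cv_nonneg h_pow_pos less_imp_le)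
    have 2: "\<bar>cint j (\<lambda>x. (R x - poly (q j) x) * poly (pderiv (?\<theta> j)) x)\<bar> \<le> (G * h ^ (k + 1) * ?s) * len j"
      using G1 by (intro cint_abs_le[OF j]) (auto intro!: continuous_intros mult_mono q_R[OF j] b simp: abs_mult h_pow_pos less_imp_le)
    have 3: "\<bar>(R (X (j - 1)) - poly (q j) (X (j - 1))) * jmp ?\<theta> j\<bar> \<le> (G * h ^ (k + 1)) * (len j * ?s)"
      unfolding abs_mult using G1 X_le[OF j] by (intro mult_mono q_R[OF j] b) (auto simp: h_pow_pos less_imp_le)
    have "?H * (len j * ?s) = (Cv k L G * h ^ (k + 1) * ?s) * len j + (G * h ^ (k + 1) * ?s) * len j
      + (G * h ^ (k + 1)) * (len j * ?s)"
      by (simp add: algebra_simps)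
    then show "cint j (\<lambda>x. (U x - poly (v j) x) * poly (?\<theta> j) x)
     + cint j (\<lambda>x. (R x - poly (q j) x) * poly (pderiv (?\<theta> j)) x)
     + (R (X (j - 1)) - poly (q j) (X (j - 1))) * jmp ?\<theta> j \<le> ?H * (len j * ?s)"
      using abs_le_D1[OF 1] abs_le_D1[OF 2] abs_le_D1[OF 3] by linarith
  qed
  then have "aform ?\<theta> ?\<theta> \<le> 4 * Binv k * L * ?H\<^sup>2"
    using Cv_nonneg G1 h_pow_pos[of "k + 1"] by (intro aform_dual_bound) auto
  also have "\<dots> = CA k L G * h ^ (2 * k + 2)"
    by (simp add: CA_def power_mult_distrib flip: power_mult) (simp add: algebra_simps)
  finally show ?thesis .
qed

text \<open>The error splits into a uniform part from the interpolant and the inverse estimate of Z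
  - v, which varies from cell to cell. Bounding only the sum of the squares of \<open>A j\<close>
  avoids the power of h that a maximum over cells would cost.\<close>

lemma Ritz_sup:
  assumes Zf: "fam Z" and Z: "ritz Z"
  obtains A where "\<And>j x. j \<in> {1..N} \<Longrightarrow> x \<in> {X (j - 1)..X j} \<Longrightarrow> \<bar>U x - poly (Z j) x\<bar> \<le> A j"
    "\<And>j x. j \<in> {1..N} \<Longrightarrow> x \<in> {X (j - 1)..X j} \<Longrightarrow> \<bar>R x - poly (D Z j) x\<bar> \<le> A j"
    "h * (\<Sum>j=1..N. (A j)\<^sup>2) \<le> CZ k L \<rho> G * h ^ (2 * k + 2)"
    "\<And>j. j \<in> {1..N} \<Longrightarrow> 0 \<le> A j"
proof -
  let ?\<theta> = "\<lambda>j. Z j - v j"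
  have f: "fam ?\<theta>" using Zf v_fam by (auto simp: fam_def intro: degree_diff_le)
  have B: "1 \<le> Binv k" by (rule Binv_unit(1))
  define c where "c = (Cv k L G + G) * h ^ (k + 1)"
  define A where "A j = c + sb ?\<theta> j" for j
  have c: "Cv k L G * h ^ (k + 1) \<le> c" "G * h ^ (k + 1) \<le> c" "0 \<le> c"
    unfolding c_def using Cv_nonneg G1 h_pow_pos[of "k + 1"] by (auto intro!: mult_right_mono)
  show thesis
  proof (rule that[of A])
    fix j x assume j: "j \<in> {1..N}" and x: "x \<in> {X (j - 1)..X j}"
    show "\<bar>U x - poly (Z j) x\<bar> \<le> A j"
      using v_U[OF j x] sb_bounds(1)[OF f j x] c by (simp add: A_def)
    show "\<bar>R x - poly (D Z j) x\<bar> \<le> A j"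
      using q_R[OF j x] sb_bounds(2)[OF f j x] c by (simp add: A_def D_diff D_v[OF j])
  next
    fix j assume "j \<in> {1..N}" then show "0 \<le> A j" using c sb_nonneg by (simp add: A_def)
  next
    have "h * (\<Sum>j=1..N. (A j)\<^sup>2) \<le> (\<Sum>j=1..N. 2 * c\<^sup>2 * h + 2 * (h * (sb ?\<theta> j)\<^sup>2))"
      unfolding sum_distrib_left
    proof (intro sum_mono)
      fix j
      have "0 \<le> (c - sb ?\<theta> j)\<^sup>2" by simp
      then have "(A j)\<^sup>2 \<le> 2 * c\<^sup>2 + 2 * (sb ?\<theta> j)\<^sup>2" by (simp add: A_def power2_eq_square algebra_simps)
      then have "h * (A j)\<^sup>2 \<le> h * (2 * c\<^sup>2 + 2 * (sb ?\<theta> j)\<^sup>2)" using h_pos by (intro mult_left_mono) auto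
      then show "h * (A j)\<^sup>2 \<le> 2 * c\<^sup>2 * h + 2 * (h * (sb ?\<theta> j)\<^sup>2)" by (simp add: algebra_simps)
    qed
    also have "\<dots> = 2 * c\<^sup>2 * (real N * h) + 2 * (\<Sum>j=1..N. h * (sb ?\<theta> j)\<^sup>2)"
      by (simp add: sum.distrib sum_distrib_left)
    also have "\<dots> \<le> 2 * c\<^sup>2 * (L / \<rho>) + 2 * (4 * Binv k / \<rho> * (CA k L G * h ^ (2 * k + 2)))"
    proof (intro add_mono mult_left_mono)
      show "(\<Sum>j=1..N. h * (sb ?\<theta> j)\<^sup>2) \<le> 4 * Binv k / \<rho> * (CA k L G * h ^ (2 * k + 2))"
        using sum_h_sb_sq[of ?\<theta>] Ritz_error[OF Zf Z] B rho
        by (meson order.trans mult_left_mono divide_nonneg_pos mult_nonneg_nonneg zero_le_numeral zero_le_one)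
    qed (use sum_h in auto)
    also have "c\<^sup>2 = (Cv k L G + G)\<^sup>2 * h ^ (2 * k + 2)"
      by (simp add: c_def power_mult_distrib mult.commute[of _ k] flip: power_mult)
    finally show "h * (\<Sum>j=1..N. (A j)\<^sup>2) \<le> CZ k L \<rho> G * h ^ (2 * k + 2)"
      by (simp add: CZ_def algebra_simps)
  qed
qed

text \<open>By \<open>proj\<close>, D u0 is the projection of R, so D (v - u0) is controlled by R -
  q. Since v and u0 both equal U at the right nodes, v - u0 is recovered from its derivative, which
  \<open>broken_deriv_bounds\<close> controls by D (v - u0).\<close>

lemma initial_error:
  assumes u0: "fam u0" and tr: "\<And>j. j \<in> {1..N} \<Longrightarrow> poly (u0 j) (X j) = U (X j)"
    and proj: "\<And>j p. j \<in> {1..N} \<Longrightarrow> degree p \<le> k \<Longrightarrow> cint j (\<lambda>x. (poly (D u0 j) x - R x) * poly p x) = 0"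
  shows "aform (\<lambda>j. v j - u0 j) (\<lambda>j. v j - u0 j) \<le> CI k L G * h ^ (2 * k + 2)"
proof -
  let ?y = "\<lambda>j. v j - u0 j"
  have f: "fam ?y" using u0 v_fam by (auto simp: fam_def intro: degree_diff_le)
  have B: "1 \<le> Binv k" by (rule Binv_unit(1))
  let ?H = "G * h ^ (k + 1)"
  have H0: "0 \<le> ?H" using G1 h_pos by simp
  have "en ?y j \<le> (?H\<^sup>2 + L\<^sup>2 * Binv k * ?H\<^sup>2) * len j" if j: "j \<in> {1..N}" for j
  proof -
    let ?d = "D ?y j"
    have l: "0 < len j" by (rule len_pos[OF j])
    have degy: "degree (?y j) \<le> k" using f j by (auto simp: fam_def)
    have degd: "degree ?d \<le> k" using fam_D[OF f] j by (auto simp: fam_def)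
    have dq: "?d = q j - D u0 j" by (simp add: D_diff D_v[OF j])
    have "cint j (\<lambda>x. (poly ?d x)\<^sup>2) = cint j (\<lambda>x. (poly (q j) x - R x) * poly ?d x - (poly (D u0 j) x - R x) * poly ?d x)"
      by (simp add: dq power2_eq_square algebra_simps)
    also have "\<dots> = cint j (\<lambda>x. (poly (q j) x - R x) * poly ?d x)"
      by (subst cint_diff) (auto intro!: continuous_intros simp: proj[OF j degd])
    also have "\<dots> \<le> cint j (\<lambda>x. (poly ?d x)\<^sup>2 / 2 + ?H\<^sup>2 / 2)"
    proof (rule cint_le[OF j])
      fix x assume x: "x \<in> {X (j - 1)..X j}"
      have "(poly (q j) x - R x)\<^sup>2 \<le> ?H\<^sup>2"
        using power_mono[OF q_R[OF j x], of 2] by (simp add: power2_commute)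
      moreover have "0 \<le> (poly ?d x - (poly (q j) x - R x))\<^sup>2" by simp
      ultimately show "(poly (q j) x - R x) * poly ?d x \<le> (poly ?d x)\<^sup>2 / 2 + ?H\<^sup>2 / 2"
        by (simp add: power2_eq_square algebra_simps)
    qed (auto intro!: continuous_intros)
    also have "\<dots> = cint j (\<lambda>x. (poly ?d x)\<^sup>2) / 2 + ?H\<^sup>2 / 2 * len j"
      using X_le[OF j] by (subst cint_add) (auto intro!: continuous_intros simp: len_def)
    finally have dd: "cint j (\<lambda>x. (poly ?d x)\<^sup>2) \<le> ?H\<^sup>2 * len j" by simp
    have y': "\<bar>poly (pderiv (?y j)) x\<bar> \<le> sqrt (Binv k) * ?H" if x: "x \<in> {X (j - 1)..X j}" for x
    proof (rule abs_le_of_square)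
      have "(poly (pderiv (?y j)) x)\<^sup>2 \<le> Binv k / len j * cint j (\<lambda>x. (poly ?d x)\<^sup>2)"
        using broken_deriv_bounds(1)[OF X_step[OF j] degy x, of ?d "jmp ?y j"] by (simp add: D_def lam_def len_def)
      also have "\<dots> \<le> Binv k / len j * (?H\<^sup>2 * len j)" using B l by (intro mult_left_mono dd) auto
      also have "\<dots> = (sqrt (Binv k) * ?H)\<^sup>2" using B l by (simp add: power_mult_distrib)
      finally show "(poly (pderiv (?y j)) x)\<^sup>2 \<le> (sqrt (Binv k) * ?H)\<^sup>2" .
    qed (use B H0 in auto)
    have yy: "\<bar>poly (?y j) x\<bar> \<le> L * sqrt (Binv k) * ?H" if x: "x \<in> {X (j - 1)..X j}" for x
    proof -
      have "\<bar>poly (?y j) x - poly (?y j) (X j)\<bar> \<le> sqrt (Binv k) * ?H * \<bar>x - X j\<bar>"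
        by (rule MVT_abs[OF poly_DERIV y' x]) (use X_le[OF j] in auto)
      also have "\<dots> \<le> sqrt (Binv k) * ?H * L"
        using x len_le_h[OF j] h_le_L B H0 by (intro mult_left_mono) (auto simp: len_def)
      finally show ?thesis using tr[OF j] v_right[OF j] by (simp add: ac_simps)
    qed
    have "cint j (\<lambda>x. (poly (?y j) x)\<^sup>2) \<le> cint j (\<lambda>x. (L * sqrt (Binv k) * ?H)\<^sup>2)"
    proof (rule cint_le[OF j])
      fix x assume x: "x \<in> {X (j - 1)..X j}"
      show "(poly (?y j) x)\<^sup>2 \<le> (L * sqrt (Binv k) * ?H)\<^sup>2"
        using power_mono[OF yy[OF x], of 2] by simp
    qed (auto intro!: continuous_intros)
    also have "\<dots> = L\<^sup>2 * Binv k * ?H\<^sup>2 * len j"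
      using B X_le[OF j] by (simp add: power_mult_distrib len_def)
    finally have "cint j (\<lambda>x. (poly (?y j) x)\<^sup>2) \<le> L\<^sup>2 * Binv k * ?H\<^sup>2 * len j" .
    moreover have "en ?y j = cint j (\<lambda>x. (poly (?y j) x)\<^sup>2) + cint j (\<lambda>x. (poly ?d x)\<^sup>2)"
      unfolding en_def by (intro cint_add continuous_intros)
    ultimately show ?thesis using dd by (simp add: algebra_simps)
  qed
  then have "aform ?y ?y \<le> (\<Sum>j=1..N. (?H\<^sup>2 + L\<^sup>2 * Binv k * ?H\<^sup>2) * len j)"
    unfolding aform_en by (intro sum_mono) auto
  also have "\<dots> = (?H\<^sup>2 + L\<^sup>2 * Binv k * ?H\<^sup>2) * L" by (simp only: sum_distrib_left[symmetric] sum_len)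
  also have "\<dots> = CI k L G * h ^ (2 * k + 2)"
    by (simp add: CI_def power_mult_distrib algebra_simps flip: power_mult)
  finally show ?thesis .
qed

lemma interpolant_bound: "aform v v \<le> 2 * L * (G + (Cv k L G + G) * L ^ (k + 1))\<^sup>2"
proof -
  let ?c = "G + (Cv k L G + G) * L ^ (k + 1)"
  have hL: "h ^ (k + 1) \<le> L ^ (k + 1)" using h_pos h_le_L by (intro power_mono) auto
  have "en v j \<le> 2 * ?c\<^sup>2 * len j" if j: "j \<in> {1..N}" for j
  proof -
    have "en v j \<le> cint j (\<lambda>x. 2 * ?c\<^sup>2)"
      unfolding en_def
    proof (rule cint_le[OF j])
      fix x assume x: "x \<in> {X (j - 1)..X j}"
      have xx: "x \<in> {xl..xr}" by (rule cell_subset[OF j x])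
      have "Cv k L G * h ^ (k + 1) \<le> Cv k L G * L ^ (k + 1)" "G * h ^ (k + 1) \<le> G * L ^ (k + 1)"
        using hL Cv_nonneg G1 by (auto intro: mult_left_mono)
      moreover have "0 \<le> Cv k L G * L ^ (k + 1)" "0 \<le> G * L ^ (k + 1)"
        using Cv_nonneg G1 xl_xr by auto
      ultimately have "\<bar>poly (v j) x\<bar> \<le> ?c" "\<bar>poly (D v j) x\<bar> \<le> ?c"
        using v_U[OF j x] q_R[OF j x] U_G[OF xx] R_G[OF xx] unfolding D_v[OF j] distrib_right by linarith+
      then have "(poly (v j) x)\<^sup>2 \<le> ?c\<^sup>2" "(poly (D v j) x)\<^sup>2 \<le> ?c\<^sup>2"
        by (metis power2_abs abs_ge_zero power_mono)+
      then show "(poly (v j) x)\<^sup>2 + (poly (D v j) x)\<^sup>2 \<le> 2 * ?c\<^sup>2" by simp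
    qed (auto intro!: continuous_intros)
    also have "\<dots> = 2 * ?c\<^sup>2 * len j" using X_le[OF j] by (simp add: len_def)
    finally show ?thesis .
  qed
  then have "aform v v \<le> (\<Sum>j=1..N. 2 * ?c\<^sup>2 * len j)"
    unfolding aform_en by (intro sum_mono) auto
  also have "\<dots> = 2 * ?c\<^sup>2 * L" by (simp only: sum_distrib_left[symmetric] sum_len)
  finally show ?thesis by (simp only: ac_simps)
qed

end

section \<open>Dissipation of the error\<close>

lemma abs_mult_le: "\<bar>x\<bar> \<le> A \<Longrightarrow> \<bar>y\<bar> \<le> B \<Longrightarrow> \<bar>x * y\<bar> \<le> A * (B::real)"
  unfolding abs_mult by (rule mult_mono) (auto intro: order.trans[OF abs_ge_zero])

lemma abs_add3_le: "\<bar>x\<bar> \<le> A \<Longrightarrow> \<bar>y\<bar> \<le> B \<Longrightarrow> \<bar>z\<bar> \<le> C \<Longrightarrow> \<bar>x + y + z\<bar> \<le> A + B + (C::real)"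
  by linarith

lemma prod3_diff:
  fixes a b c a' b' c' M e :: real
  assumes "\<bar>a\<bar> \<le> M" "\<bar>b\<bar> \<le> M" "\<bar>c\<bar> \<le> M" "\<bar>a'\<bar> \<le> M" "\<bar>b'\<bar> \<le> M" "\<bar>c'\<bar> \<le> M"
    and "\<bar>a - a'\<bar> \<le> e" "\<bar>b - b'\<bar> \<le> e" "\<bar>c - c'\<bar> \<le> e"
  shows "\<bar>a * b * c - a' * b' * c'\<bar> \<le> 3 * M\<^sup>2 * e"
proof -
  have "a * b * c - a' * b' * c' = (a - a') * (b * c) + a' * ((b - b') * c) + a' * (b' * (c - c'))"
    by (simp add: algebra_simps)
  moreover have "\<bar>(a - a') * (b * c) + a' * ((b - b') * c) + a' * (b' * (c - c'))\<bar> \<le> e * (M * M) + M * (e * M) + M * (M * e)"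
    by (intro abs_add3_le abs_mult_le assms)
  moreover have "3 * M\<^sup>2 * e = e * (M * M) + M * (e * M) + M * (M * e)" by (simp add: power2_eq_square)
  ultimately show ?thesis by (simp only:)
qed

lemma abs_half_add: "\<bar>x\<bar> \<le> K \<Longrightarrow> \<bar>y\<bar> \<le> K \<Longrightarrow> \<bar>(x + y) / 2\<bar> \<le> (K::real)"
  by (simp add: abs_le_iff)

lemma abs_four_add:
  "\<bar>x\<bar> \<le> K \<Longrightarrow> \<bar>y\<bar> \<le> K \<Longrightarrow> \<bar>z\<bar> \<le> K \<Longrightarrow> \<bar>w\<bar> \<le> K \<Longrightarrow> \<bar>1 / 4 * (x + y + z + w)\<bar> \<le> (K::real)"
  by (simp add: abs_le_iff)

lemma abs_add_le: "\<bar>x\<bar> \<le> A \<Longrightarrow> \<bar>y\<bar> \<le> B \<Longrightarrow> \<bar>x + y\<bar> \<le> A + (B::real)"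
  by linarith

lemma flux_f_diff:
  assumes "\<bar>a\<bar> \<le> M" "\<bar>b\<bar> \<le> M" "\<bar>a - b\<bar> \<le> e"
  shows "\<bar>flux_f \<kappa> a - flux_f \<kappa> b\<bar> \<le> (2 * \<kappa>\<^sup>2 + 3 * M\<^sup>2) * e"
proof -
  have "\<bar>a * a * a - b * b * b\<bar> \<le> 3 * M\<^sup>2 * e" by (intro prod3_diff assms)
  moreover have "\<bar>2 * \<kappa>\<^sup>2 * (a - b)\<bar> \<le> 2 * \<kappa>\<^sup>2 * e" by (intro abs_mult_le[of "2 * \<kappa>\<^sup>2"] assms) simp
  moreover have "flux_f \<kappa> a - flux_f \<kappa> b = 2 * \<kappa>\<^sup>2 * (a - b) + (a * a * a - b * b * b)"
    by (simp add: flux_f_def power3_eq_cube algebra_simps)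
  ultimately show ?thesis unfolding distrib_right by (simp only: abs_add_le)
qed

text \<open>The cubic part of the conservative flux is the mean of four triple products of traces,
  so both schemes reduce to \<open>prod3_diff\<close>.\<close>

lemma num_flux_f_diff:
  assumes "\<bar>a\<bar> \<le> M" "\<bar>b\<bar> \<le> M" "\<bar>u\<bar> \<le> M" "\<bar>u - a\<bar> \<le> e" "\<bar>u - b\<bar> \<le> e"
  shows "\<bar>flux_f \<kappa> u - num_flux_f sch \<kappa> a b\<bar> \<le> (2 * \<kappa>\<^sup>2 + 3 * M\<^sup>2) * e"
proof (cases sch)
  case Dissipative
  then show ?thesis using flux_f_diff[of u M a e \<kappa>] assms by simp
next
  case Conservative
  have e1: "\<bar>u * u * u - b * b * b\<bar> \<le> 3 * M\<^sup>2 * e" "\<bar>u * u * u - b * b * a\<bar> \<le> 3 * M\<^sup>2 * e"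
    "\<bar>u * u * u - b * a * a\<bar> \<le> 3 * M\<^sup>2 * e" "\<bar>u * u * u - a * a * a\<bar> \<le> 3 * M\<^sup>2 * e"
    by (intro prod3_diff assms)+
  have "\<bar>(u - b) + (u - a)\<bar> \<le> 2 * e" using assms(4,5) by linarith
  then have "\<bar>\<kappa>\<^sup>2 * ((u - b) + (u - a))\<bar> \<le> \<kappa>\<^sup>2 * (2 * e)"
    by (intro abs_mult_le[of "\<kappa>\<^sup>2"]) simp_all
  moreover have "flux_f \<kappa> u - num_flux_f sch \<kappa> a b = \<kappa>\<^sup>2 * ((u - b) + (u - a))
      + 1 / 4 * ((u * u * u - b * b * b) + (u * u * u - b * b * a) + (u * u * u - b * a * a) + (u * u * u - a * a * a))"
    using Conservative by (simp add: flux_f_def power3_eq_cube power2_eq_square algebra_simps)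
  moreover have "\<bar>1 / 4 * ((u * u * u - b * b * b) + (u * u * u - b * b * a) + (u * u * u - b * a * a) + (u * u * u - a * a * a))\<bar>
      \<le> 3 * M\<^sup>2 * e"
    using e1 by (rule abs_four_add)
  moreover have "(2 * \<kappa>\<^sup>2 + 3 * M\<^sup>2) * e = \<kappa>\<^sup>2 * (2 * e) + 3 * M\<^sup>2 * e" by (simp add: algebra_simps)
  ultimately show ?thesis by (simp only: abs_add_le)
qed

lemma num_flux_g_diff:
  assumes "\<bar>a\<bar> \<le> M" "\<bar>b\<bar> \<le> M" "\<bar>a'\<bar> \<le> M" "\<bar>b'\<bar> \<le> M" "\<bar>a - a'\<bar> \<le> e" "\<bar>b - b'\<bar> \<le> e"
  shows "\<bar>num_flux_g sch a b - num_flux_g sch a' b'\<bar> \<le> M\<^sup>2 * e"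
proof (cases sch)
  case Dissipative
  have "\<bar>b * b * b - b' * b' * b'\<bar> \<le> 3 * M\<^sup>2 * e" by (intro prod3_diff assms)
  then have "\<bar>(b * b * b - b' * b' * b') / 3\<bar> \<le> M\<^sup>2 * e" by (simp add: abs_divide)
  moreover have "num_flux_g sch a b - num_flux_g sch a' b' = (b * b * b - b' * b' * b') / 3"
    using Dissipative by (simp add: flux_g_def power3_eq_cube diff_divide_distrib)
  ultimately show ?thesis by (simp only:)
next
  case Conservative
  have e1: "\<bar>b * b * b - b' * b' * b'\<bar> \<le> 3 * M\<^sup>2 * e" "\<bar>b * b * a - b' * b' * a'\<bar> \<le> 3 * M\<^sup>2 * e"
    "\<bar>b * a * a - b' * a' * a'\<bar> \<le> 3 * M\<^sup>2 * e" "\<bar>a * a * a - a' * a' * a'\<bar> \<le> 3 * M\<^sup>2 * e"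
    by (intro prod3_diff assms)+
  have "num_flux_g sch a b - num_flux_g sch a' b' =
      1 / 4 * ((b * b * b - b' * b' * b') + (b * b * a - b' * b' * a') + (b * a * a - b' * a' * a') + (a * a * a - a' * a' * a')) / 3"
    using Conservative by (simp add: power2_eq_square field_simps)
  moreover have "\<bar>1 / 4 * ((b * b * b - b' * b' * b') + (b * b * a - b' * b' * a') + (b * a * a - b' * a' * a') + (a * a * a - a' * a' * a')) / 3\<bar>
      \<le> 3 * M\<^sup>2 * e / 3"
    unfolding abs_divide using abs_four_add[OF e1] by simp
  ultimately show ?thesis by simp
qed

lemma avg_diff:
  fixes a b c d x :: real
  assumes "\<bar>a\<bar> \<le> M" "\<bar>b\<bar> \<le> M" "\<bar>c\<bar> \<le> M" "\<bar>d\<bar> \<le> M" "\<bar>x\<bar> \<le> M"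
    "\<bar>a'\<bar> \<le> M" "\<bar>b'\<bar> \<le> M" "\<bar>c'\<bar> \<le> M" "\<bar>d'\<bar> \<le> M" "\<bar>x'\<bar> \<le> M"
    "\<bar>a - a'\<bar> \<le> e" "\<bar>b - b'\<bar> \<le> e" "\<bar>c - c'\<bar> \<le> e" "\<bar>d - d'\<bar> \<le> e" "\<bar>x - x'\<bar> \<le> e"
  shows "\<bar>(a * b + c * d) / 2 * x - (a' * b' + c' * d') / 2 * x'\<bar> \<le> 3 * M\<^sup>2 * e"
proof -
  have "\<bar>a * b * x - a' * b' * x'\<bar> \<le> 3 * M\<^sup>2 * e" "\<bar>c * d * x - c' * d' * x'\<bar> \<le> 3 * M\<^sup>2 * e"
    by (intro prod3_diff assms)+
  moreover have "(a * b + c * d) / 2 * x - (a' * b' + c' * d') / 2 * x'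
      = ((a * b * x - a' * b' * x') + (c * d * x - c' * d' * x')) / 2"
    by (simp add: algebra_simps add_divide_distrib diff_divide_distrib)
  ultimately show ?thesis by (simp only: abs_half_add)
qed

text \<open>The primitive \<open>Hf\<close> collects everything in the volume terms that is an exact derivative of
  the errors \<open>a = \<zeta>\<close>, \<open>b = \<xi>\<close> when the smooth factors are frozen.\<close>

definition Gam :: "real \<Rightarrow> real \<Rightarrow> real" where
  "Gam R b = R\<^sup>2 * b\<^sup>2 / 2 - R * b ^ 3 / 3 + b ^ 4 / 12"

definition Hf :: "real \<Rightarrow> real \<Rightarrow> real \<Rightarrow> real \<Rightarrow> real" where
  "Hf U R a b = (2 * U - a) * a * R * b + (U - a)\<^sup>2 * b\<^sup>2 / 2 - Gam R b"

text \<open>\<open>Gam R\<close> is the primitive of g(R) - g(R - s) in s. The left side is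
  therefore the integral from a to b of the numerical flux minus g(R - s), an entropy condition: the
  upwind flux leaves minus a sum of squares, while the conservative flux is the exact mean of g and
  gives 0.\<close>

lemma interface_g:
  "Gam R b - Gam R a + (num_flux_g sch (R - a) (R - b) - flux_g R) * (b - a) \<le> 0"
proof (cases sch)
  case Dissipative
  have "Gam R b - Gam R a + (num_flux_g sch (R - a) (R - b) - flux_g R) * (b - a)
     = - ((b - a)\<^sup>2 * (((R - b) + (R - a))\<^sup>2 + 2 * (R - b)\<^sup>2) / 12)"
    using Dissipative
    by (simp add: Gam_def flux_g_def power2_eq_square power3_eq_cube power4_eq_xxxx field_simps)
  also have "\<dots> \<le> 0" by simp
  finally show ?thesis .
next
  case Conservative
  have "Gam R b - Gam R a + (num_flux_g sch (R - a) (R - b) - flux_g R) * (b - a) = 0"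
    using Conservative
    by (simp add: Gam_def flux_g_def power2_eq_square power3_eq_cube power4_eq_xxxx field_simps)
  then show ?thesis by simp
qed

text \<open>For a = c the whole expression vanishes, thanks to the fluxes built on {ur} with u^-.
  Hence the factor c - a, the jump of the error in u, splits off; the jump d - b alone would be too
  large.\<close>

lemma interface_u:
  fixes U R a b c d G :: real
  assumes G: "1 \<le> G" and "\<bar>U\<bar> \<le> G" "\<bar>R\<bar> \<le> G" "\<bar>a\<bar> \<le> 1" "\<bar>c\<bar> \<le> 1" "\<bar>b\<bar> \<le> 1" "\<bar>d\<bar> \<le> 1"
  shows "\<bar>((2 * U - a) * a * R * b + (U - a)\<^sup>2 * b\<^sup>2 / 2) - ((2 * U - c) * c * R * d + (U - c)\<^sup>2 * d\<^sup>2 / 2)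
      + (U\<^sup>2 * R - ((U - c) * (R - d) + (U - a) * (R - b)) / 2 * (U - a)) * (d - b)\<bar>
    \<le> 11 * G\<^sup>2 * \<bar>c - a\<bar> * (\<bar>b\<bar> + \<bar>d\<bar>)"
proof -
  let ?\<delta> = "c - a"
  \<comment> \<open>The quotient by c - a. Its three summands are bounded by 6, 3 and 2 times G^2
    (|b| + |d|), whence the 11.\<close>
  let ?K = "- ((2 * U - 2 * a - ?\<delta>) * R * d) + d * d * ((U - a) - ?\<delta> / 2) + (R - d) * (U - a) * (d - b) / 2"
  have eq: "((2 * U - a) * a * R * b + (U - a)\<^sup>2 * b\<^sup>2 / 2) - ((2 * U - c) * c * R * d + (U - c)\<^sup>2 * d\<^sup>2 / 2)
      + (U\<^sup>2 * R - ((U - c) * (R - d) + (U - a) * (R - b)) / 2 * (U - a)) * (d - b) = ?\<delta> * ?K"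
    by (simp add: power2_eq_square field_simps)
  have s: "\<bar>b\<bar> + \<bar>d\<bar> \<ge> 0" by simp
  have GG: "G \<le> G\<^sup>2" using G by (simp add: power2_eq_square)
  have d: "\<bar>d\<bar> \<le> \<bar>b\<bar> + \<bar>d\<bar>" "\<bar>d - b\<bar> \<le> \<bar>b\<bar> + \<bar>d\<bar>" by linarith+
  have "\<bar>2 * U - 2 * a - ?\<delta>\<bar> \<le> 6 * G" using assms(1,2,4,5) by linarith
  then have 1: "\<bar>- ((2 * U - 2 * a - ?\<delta>) * R * d)\<bar> \<le> (6 * G) * G * (\<bar>b\<bar> + \<bar>d\<bar>)"
    unfolding abs_minus_cancel by (intro abs_mult_le d assms)
  have "\<bar>- a / 2\<bar> \<le> 1 / 2" "\<bar>- c / 2\<bar> \<le> 1 / 2" using assms(4,5) by simp_all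
  then have "\<bar>U + - a / 2 + - c / 2\<bar> \<le> G + 1 / 2 + 1 / 2" by (intro abs_add3_le assms)
  moreover have "U + - a / 2 + - c / 2 = (U - a) - ?\<delta> / 2" by (simp add: field_simps)
  ultimately have "\<bar>(U - a) - ?\<delta> / 2\<bar> \<le> 3 * G" using G by simp
  then have 2: "\<bar>d * d * ((U - a) - ?\<delta> / 2)\<bar> \<le> (\<bar>b\<bar> + \<bar>d\<bar>) * 1 * (3 * G)"
    by (intro abs_mult_le d assms)
  have "\<bar>R - d\<bar> \<le> 2 * G" "\<bar>U - a\<bar> \<le> 2 * G" using assms(1,2,3,4,7) by linarith+
  then have 3: "\<bar>(R - d) * (U - a) * (d - b) * (1 / 2)\<bar> \<le> (2 * G) * (2 * G) * (\<bar>b\<bar> + \<bar>d\<bar>) * (1 / 2)"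
    by (intro abs_mult_le d) simp_all
  have 4: "(\<bar>b\<bar> + \<bar>d\<bar>) * 1 * (3 * G) \<le> 3 * (G\<^sup>2 * (\<bar>b\<bar> + \<bar>d\<bar>))"
    using mult_right_mono[OF GG s] by (simp add: algebra_simps)
  have "\<bar>?K\<bar> \<le> (6 * G) * G * (\<bar>b\<bar> + \<bar>d\<bar>) + (\<bar>b\<bar> + \<bar>d\<bar>) * 1 * (3 * G) + (2 * G) * (2 * G) * (\<bar>b\<bar> + \<bar>d\<bar>) * (1 / 2)"
    using abs_add3_le[OF 1 2 3] by simp
  also have "\<dots> \<le> (6 * G) * G * (\<bar>b\<bar> + \<bar>d\<bar>) + 3 * (G\<^sup>2 * (\<bar>b\<bar> + \<bar>d\<bar>)) + (2 * G) * (2 * G) * (\<bar>b\<bar> + \<bar>d\<bar>) * (1 / 2)"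
    using 4 by (intro add_mono order.refl)
  also have "\<dots> = 11 * G\<^sup>2 * (\<bar>b\<bar> + \<bar>d\<bar>)"
    by (simp add: power2_eq_square algebra_simps)
  finally have "\<bar>?K\<bar> \<le> 11 * G\<^sup>2 * (\<bar>b\<bar> + \<bar>d\<bar>)" .
  then have "\<bar>?\<delta>\<bar> * \<bar>?K\<bar> \<le> \<bar>?\<delta>\<bar> * (11 * G\<^sup>2 * (\<bar>b\<bar> + \<bar>d\<bar>))" by (intro mult_left_mono) auto
  then show ?thesis unfolding eq abs_mult by (simp add: ac_simps)
qed

context dg_mesh
begin

text \<open>Left and right trace at the left node of cell j; \<open>mi\<close> looks into the
  preceding cell, periodically.\<close>

definition mi :: "(nat \<Rightarrow> real poly) \<Rightarrow> nat \<Rightarrow> real" where "mi P j = poly (P (pr j)) (X (pr j))"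
definition pl :: "(nat \<Rightarrow> real poly) \<Rightarrow> nat \<Rightarrow> real" where "pl P j = poly (P j) (X (j - 1))"

lemma jmp_pl_mi: "jmp P j = pl P j - mi P j"
  by (simp add: jmp_def pl_def mi_def)

definition avg :: "(nat \<Rightarrow> real poly) \<Rightarrow> nat \<Rightarrow> real" where
  "avg u j = (pl u j * pl (D u) j + mi u j * mi (D u) j) / 2"

text \<open>The scheme with \<open>p\<close>, \<open>r\<close> and \<open>s\<close> eliminated reads \<open>(m\<^sub>t, w) = SR u w\<close>.\<close>

definition SR :: "scheme \<Rightarrow> real \<Rightarrow> (nat \<Rightarrow> real poly) \<Rightarrow> (nat \<Rightarrow> real poly) \<Rightarrow> real" where
  "SR sch \<kappa> u w = (\<Sum>j=1..N.
      cint j (\<lambda>x. (flux_f \<kappa> (poly (u j) x) + poly (u j) x * poly (D u j) x * poly (D u j) x) * poly (pderiv (w j)) x)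
    + (num_flux_f sch \<kappa> (mi u j) (pl u j) + avg u j * pl (D u) j) * jmp w j
    + cint j (\<lambda>x. (poly (u j) x * poly (u j) x * poly (D u j) x - flux_g (poly (D u j) x)) * poly (pderiv (D w j)) x)
    + (avg u j * mi u j - num_flux_g sch (mi (D u) j) (pl (D u) j)) * jmp (D w) j)"

end

lemma flux_g_diff:
  assumes "\<bar>a\<bar> \<le> M" "\<bar>b\<bar> \<le> M" "\<bar>a - b\<bar> \<le> e"
  shows "\<bar>flux_g a - flux_g b\<bar> \<le> M\<^sup>2 * e"
  using num_flux_g_diff[of a M a b b e Dissipative] assms by simp

text \<open>The coefficient of y' is exactly the change of U^2 R - g(R) when U and R are reduced by
  z and y. All remaining terms are at least quadratic in the errors and free of y', the one
  derivative that costs 1/\<open>len\<close>.\<close>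

lemma Hf_deriv:
  assumes "(U has_field_derivative R x) (at x)" "(R has_field_derivative R2 x) (at x)"
    "(z has_field_derivative z' x) (at x)" "(y has_field_derivative y' x) (at x)"
  shows "((\<lambda>x. Hf (U x) (R x) (z x) (y x)) has_field_derivative
     ((U x * U x * R x - flux_g (R x)) - ((U x - z x) * (U x - z x) * (R x - y x) - flux_g (R x - y x))) * y' x
     + ((2 * R x - z' x) * z x * R x * y x + (2 * U x - z x) * z' x * R x * y x + (2 * U x - z x) * z x * R2 x * y x
       + (U x - z x) * (R x - z' x) * y x * y x - R x * R2 x * y x * y x + R2 x * y x * y x * y x / 3)) (at x)"
  unfolding Hf_def Gam_def
  by (rule derivative_eq_intros assms refl | simp)+
    (simp add: flux_g_def power2_eq_square power3_eq_cube field_simps)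

lemma perturb_bounds:
  fixes U G Z z A s :: real
  assumes "\<bar>U\<bar> \<le> G" "\<bar>U - Z\<bar> \<le> A" "\<bar>z\<bar> \<le> s" "A \<le> 1" "s \<le> 1" "1 \<le> G"
  shows "\<bar>Z - z\<bar> \<le> 3 * G" "\<bar>U - (Z - z)\<bar> \<le> A + s" "\<bar>(U - z) - (Z - z)\<bar> \<le> A" "\<bar>U - z\<bar> \<le> 3 * G"
    "\<bar>U - z\<bar> \<le> 2 * G" "\<bar>2 * U - z\<bar> \<le> 3 * G"
  using assms by linarith+

text \<open>\<open>e\<close> and \<open>\<sigma>\<close> stand for Ritz errors and error bounds on
  two neighbouring cells, \<open>P\<close> for h^k. The terms without a length are at most multiples
  of e \<sigma>; the square h (e/h - \<sigma>)^2 distributes them over h \<sigma>^2 and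
  e^2/h.\<close>

lemma T_bound_algebra:
  fixes A s \<sigma> e G h L l K P T \<kappa> :: real
  assumes s: "0 \<le> s" "s \<le> \<sigma>" and A: "0 \<le> A" "A \<le> e" and l: "0 < l" "l \<le> h" "h \<le> L" and G: "1 \<le> G" and P: "0 \<le> P"
    and K: "K = 2 * \<kappa>\<^sup>2 + 60 * G\<^sup>2"
    and T: "T \<le> (2 * \<kappa>\<^sup>2 + 54 * G\<^sup>2) * (A + s) * s * l + (2 * \<kappa>\<^sup>2 + 54 * G\<^sup>2) * (e + \<sigma>) * (l * s) + 3 * (G * P * s * l)
        + 36 * G\<^sup>2 * A * s + 15 * G\<^sup>2 * (s * s) * l + 36 * G\<^sup>2 * e * \<sigma> + 11 * G\<^sup>2 * (l * s) * \<sigma>"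
  shows "T \<le> K * (L + 6) * (h * \<sigma>\<^sup>2 + e\<^sup>2 / h + h * P\<^sup>2)"
proof -
  have h: "0 < h" using l by linarith
  have \<sigma>: "0 \<le> \<sigma>" and e: "0 \<le> e" using s A by auto
  have K0: "0 \<le> K" "2 * \<kappa>\<^sup>2 + 54 * G\<^sup>2 \<le> K" "36 * G\<^sup>2 \<le> K" "15 * G\<^sup>2 \<le> K" "11 * G\<^sup>2 \<le> K" "3 * G \<le> K"
  proof -
    have "0 \<le> \<kappa>\<^sup>2" "1 \<le> G\<^sup>2" "G \<le> G\<^sup>2" using G by (auto simp: power2_eq_square mult_left_mono intro: order.trans[of 1 G] mult_mono[of 1 G 1 G, simplified])
    then show "0 \<le> K" "2 * \<kappa>\<^sup>2 + 54 * G\<^sup>2 \<le> K" "36 * G\<^sup>2 \<le> K" "15 * G\<^sup>2 \<le> K" "11 * G\<^sup>2 \<le> K" "3 * G \<le> K"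
      unfolding K using G by linarith+
  qed
  have G2: "0 \<le> G\<^sup>2" "0 \<le> 2 * \<kappa>\<^sup>2 + 54 * G\<^sup>2" by simp_all
  have ls: "l * s \<le> h * \<sigma>" using s l by (intro mult_mono) auto
  have ls0: "0 \<le> l * s" using s l by auto
  have t1: "(2 * \<kappa>\<^sup>2 + 54 * G\<^sup>2) * (A + s) * s * l \<le> K * (e + \<sigma>) * \<sigma> * h"
    using s A l K0 G2 by (intro mult_mono mult_nonneg_nonneg add_mono add_nonneg_nonneg) (auto intro: K0)
  have t2: "(2 * \<kappa>\<^sup>2 + 54 * G\<^sup>2) * (e + \<sigma>) * (l * s) \<le> K * (e + \<sigma>) * (h * \<sigma>)"
    using e \<sigma> s l h K0 G2 ls ls0 by (intro mult_mono mult_nonneg_nonneg) (auto intro: K0)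
  have t3: "3 * (G * P * s * l) \<le> K * P * \<sigma> * h"
  proof -
    have "(3 * G) * P * s * l \<le> K * P * \<sigma> * h" using s l K0 G P by (intro mult_mono mult_nonneg_nonneg) (auto intro: K0)
    then show ?thesis by simp
  qed
  have t4: "36 * G\<^sup>2 * A * s \<le> K * e * \<sigma>" using s A K0 G2 by (intro mult_mono mult_nonneg_nonneg) (auto intro: K0)
  have t5: "15 * G\<^sup>2 * (s * s) * l \<le> K * (\<sigma> * \<sigma>) * h" using s l K0 G2 by (intro mult_mono mult_nonneg_nonneg) (auto intro: K0)
  have t6: "36 * G\<^sup>2 * e * \<sigma> \<le> K * e * \<sigma>" using e \<sigma> K0 G2 by (intro mult_mono mult_nonneg_nonneg) (auto intro: K0)
  have t7: "11 * G\<^sup>2 * (l * s) * \<sigma> \<le> K * (h * \<sigma>) * \<sigma>" using \<sigma> s l h K0 G2 ls ls0 by (intro mult_mono mult_nonneg_nonneg) (auto intro: K0)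
  have "T \<le> K * (e + \<sigma>) * \<sigma> * h + K * (e + \<sigma>) * (h * \<sigma>) + K * P * \<sigma> * h + K * e * \<sigma> + K * (\<sigma> * \<sigma>) * h + K * e * \<sigma> + K * (h * \<sigma>) * \<sigma>"
    using T t1 t2 t3 t4 t5 t6 t7 by linarith
  also have "\<dots> = K * (2 * (h * (e * \<sigma>)) + 2 * (e * \<sigma>) + 4 * (h * \<sigma>\<^sup>2) + h * (P * \<sigma>))"
    by (simp add: power2_eq_square algebra_simps)
  also have "\<dots> \<le> K * ((L + 6) * (h * \<sigma>\<^sup>2 + e\<^sup>2 / h + h * P\<^sup>2))"
  proof (intro mult_left_mono)
    define X where "X = h * \<sigma>\<^sup>2"
    define Y where "Y = e\<^sup>2 / h"
    define W where "W = h * P\<^sup>2"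
    have nn: "0 \<le> X" "0 \<le> Y" "0 \<le> W" using h by (auto simp: X_def Y_def W_def)
    have "0 \<le> (e / h - \<sigma>)\<^sup>2 * h" using h by simp
    also have "(e / h - \<sigma>)\<^sup>2 * h = X + Y - 2 * (e * \<sigma>)"
      using h by (simp add: X_def Y_def power2_eq_square field_simps)
    finally have "2 * (e * \<sigma>) \<le> X + Y" by simp
    moreover then have "h * (2 * (e * \<sigma>)) \<le> L * (X + Y)"
      using l h e \<sigma> nn by (intro mult_mono) auto
    moreover have "0 \<le> h * (P - \<sigma>)\<^sup>2" using h by simp
    then have "2 * (h * (P * \<sigma>)) \<le> X + W" by (simp add: X_def W_def power2_eq_square algebra_simps)
    moreover have "(L + 6) * (X + Y + W) = L * (X + Y) + L * W + 6 * X + 6 * Y + 6 * W" by (simp add: algebra_simps)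
    moreover have "0 \<le> L * W" using nn l h by auto
    ultimately show "2 * (h * (e * \<sigma>)) + 2 * (e * \<sigma>) + 4 * (h * \<sigma>\<^sup>2) + h * (P * \<sigma>) \<le> (L + 6) * (h * \<sigma>\<^sup>2 + e\<^sup>2 / h + h * P\<^sup>2)"
      using nn unfolding X_def[symmetric] Y_def[symmetric] W_def[symmetric] by linarith
  qed (use K0 in auto)
  finally show ?thesis by (simp only: mult.assoc)
qed

lemma dissipation_algebra:
  fixes p c l a g :: real
  assumes "0 \<le> p" "0 \<le> l" "0 \<le> c" "0 \<le> g" "0 \<le> a"
  shows "4 * (p * a) + 4 * (c * g) + l * g \<le> 4 * ((p + c + l) * (a + g))"
proof -
  have "0 \<le> p * g" "0 \<le> c * a" "0 \<le> l * a" "0 \<le> l * g" using assms by simp_all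
  moreover have "4 * ((p + c + l) * (a + g)) = 4 * (p * a) + 4 * (p * g) + 4 * (c * a) + 4 * (c * g) + 4 * (l * a) + 4 * (l * g)"
    by (simp add: algebra_simps)
  ultimately show ?thesis by linarith
qed

text \<open>The cell identity behind \<open>main_identity\<close> with all integrals opaque. The
  first premise is an instance of \<open>D_test\<close>, the second of
  \<open>Hf_by_parts\<close>.\<close>

lemma cell_algebra:
  fixes PD :: real
  assumes "PD = PZ + jz * pj" and "WD - GtD = Hb - Hpj - rm"
  shows "FZ - PiZ + (Fj - Pj) * jz - (FuZ + fh * jz + GuD + gh * jD) + (PiD + (WD + Wj * jD)) + (Hmj - Hb)
    = FZ - FuZ + (Fj - fh) * jz - (PiZ - PZ + (Pj - pj) * jz - (PiD - PD)) + (GtD - GuD) - rm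
      + (Hmj - Hpj + (Wj - gh) * jD)"
  using assms by (simp add: algebra_simps)

definition CM :: "real \<Rightarrow> real \<Rightarrow> real \<Rightarrow> real" where
  "CM \<kappa> L G = 4 * ((2 * \<kappa>\<^sup>2 + 60 * G\<^sup>2) * (L + 6))"

context dg_data
begin

text \<open>The exact flux is split as FU - Pi', so that the equation reads M_t + (FU - Pi')_x = 0;
  here \<open>Pi'\<close> is P - S and \<open>W\<close> is its primitive. \<open>Fu\<close> and
  \<open>Gu\<close> are the counterparts of \<open>FU\<close> and \<open>W\<close> for the discrete
  solution.\<close>

definition FU :: "real \<Rightarrow> real" where "FU x = flux_f \<kappa> (U x) + U x * R x * R x"
definition Pi' :: "real \<Rightarrow> real" where "Pi' x = (U x)\<^sup>2 * R2 x + 2 * U x * (R x)\<^sup>2 - (R x)\<^sup>2 * R2 x"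
definition W :: "real \<Rightarrow> real" where "W x = U x * U x * R x - flux_g (R x)"
definition Fu :: "(nat \<Rightarrow> real poly) \<Rightarrow> nat \<Rightarrow> real \<Rightarrow> real" where
  "Fu u j x = flux_f \<kappa> (poly (u j) x) + poly (u j) x * poly (D u j) x * poly (D u j) x"
definition Gu :: "(nat \<Rightarrow> real poly) \<Rightarrow> nat \<Rightarrow> real \<Rightarrow> real" where
  "Gu u j x = poly (u j) x * poly (u j) x * poly (D u j) x - flux_g (poly (D u j) x)"
text \<open>\<open>W\<close> with U and R reduced by z and D z. The step from \<open>W\<close> to
  \<open>Gt\<close> is integrated exactly by \<open>Hf\<close>; the step from \<open>Gt\<close> to
  \<open>Gu\<close> involves only the Ritz error if u = Z - z.\<close>

definition Gt :: "(nat \<Rightarrow> real poly) \<Rightarrow> nat \<Rightarrow> real \<Rightarrow> real" where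
  "Gt z j x = (U x - poly (z j) x) * (U x - poly (z j) x) * (R x - poly (D z j) x) - flux_g (R x - poly (D z j) x)"
definition rem :: "(nat \<Rightarrow> real poly) \<Rightarrow> nat \<Rightarrow> real \<Rightarrow> real" where
  "rem z j x = (2 * R x - poly (pderiv (z j)) x) * poly (z j) x * R x * poly (D z j) x
     + (2 * U x - poly (z j) x) * poly (pderiv (z j)) x * R x * poly (D z j) x
     + (2 * U x - poly (z j) x) * poly (z j) x * R2 x * poly (D z j) x
     + (U x - poly (z j) x) * (R x - poly (pderiv (z j)) x) * poly (D z j) x * poly (D z j) x
     - R x * R2 x * poly (D z j) x * poly (D z j) x + R2 x * poly (D z j) x * poly (D z j) x * poly (D z j) x / 3"
definition Hp :: "(nat \<Rightarrow> real poly) \<Rightarrow> nat \<Rightarrow> real" where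
  "Hp z j = Hf (U (X (j - 1))) (R (X (j - 1))) (pl z j) (pl (D z) j)"
definition Hm :: "(nat \<Rightarrow> real poly) \<Rightarrow> nat \<Rightarrow> real" where
  "Hm z j = Hf (U (X (j - 1))) (R (X (j - 1))) (mi z j) (mi (D z) j)"

lemma flux_cont [continuous_intros]:
  "continuous_on S f \<Longrightarrow> continuous_on S (\<lambda>x. flux_f c (f x))"
  "continuous_on S f \<Longrightarrow> continuous_on S (\<lambda>x. flux_g (f x))"
  unfolding flux_f_def flux_g_def by (auto intro!: continuous_intros)

lemma aux_cont [continuous_intros]:
  "continuous_on S FU" "continuous_on S Pi'" "continuous_on S W"
  "continuous_on S (Fu u j)" "continuous_on S (Gu u j)" "continuous_on S (Gt u j)" "continuous_on S (rem u j)"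
  unfolding FU_def [abs_def] Pi'_def [abs_def] W_def [abs_def] Fu_def [abs_def] Gu_def [abs_def] Gt_def [abs_def] rem_def [abs_def]
  by (intro continuous_intros; simp)+

lemma W_der: "(W has_field_derivative Pi' x) (at x)"
  unfolding W_def [abs_def] flux_g_def
  by (rule derivative_eq_intros U_der R_der refl | simp)+
    (simp add: Pi'_def power2_eq_square algebra_simps)

text \<open>Trades the derivative of D z, which would cost 1/\<open>len\<close>, for boundary values
  of \<open>Hf\<close> and the quadratic remainder \<open>rem\<close>.\<close>

lemma Hf_by_parts:
  assumes j: "j \<in> {1..N}"
  shows "cint j (\<lambda>x. W x * poly (pderiv (D z j)) x) - cint j (\<lambda>x. Gt z j x * poly (pderiv (D z j)) x)
    = Hf (U (X j)) (R (X j)) (poly (z j) (X j)) (poly (D z j) (X j)) - Hp z j - cint j (rem z j)"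
proof -
  have "((\<lambda>x. (W x - Gt z j x) * poly (pderiv (D z j)) x + rem z j x) has_integral
     (Hf (U (X j)) (R (X j)) (poly (z j) (X j)) (poly (D z j) (X j)) - Hp z j)) {X (j - 1)..X j}"
    unfolding Hp_def pl_def
  proof (rule fundamental_theorem_of_calculus[OF X_le[OF j]])
    fix x
    show "((\<lambda>x. Hf (U x) (R x) (poly (z j) x) (poly (D z j) x)) has_vector_derivative
       (W x - Gt z j x) * poly (pderiv (D z j)) x + rem z j x) (at x within {X (j - 1)..X j})"
      unfolding W_def Gt_def rem_def has_real_derivative_iff_has_vector_derivative[symmetric]
      by (rule has_field_derivative_at_within, rule Hf_deriv) (intro U_der R_der poly_DERIV)+
  qed
  then have "Hf (U (X j)) (R (X j)) (poly (z j) (X j)) (poly (D z j) (X j)) - Hp z j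
    = cint j (\<lambda>x. (W x * poly (pderiv (D z j)) x - Gt z j x * poly (pderiv (D z j)) x) + rem z j x)"
    by (simp add: integral_unique left_diff_distrib)
  also have "\<dots> = cint j (\<lambda>x. W x * poly (pderiv (D z j)) x) - cint j (\<lambda>x. Gt z j x * poly (pderiv (D z j)) x) + cint j (rem z j)"
    by (subst cint_add, (intro continuous_intros)+, subst cint_diff, (intro continuous_intros)+) simp
  finally show ?thesis by simp
qed

lemma sum_Hf: "(\<Sum>j=1..N. Hf (U (X j)) (R (X j)) (poly (z j) (X j)) (poly (D z j) (X j))) = (\<Sum>j=1..N. Hm z j)"
proof -
  have "(\<Sum>j=1..N. Hf (U (X j)) (R (X j)) (poly (z j) (X j)) (poly (D z j) (X j)))
    = (\<Sum>j=1..N. Hf (U (X (pr j))) (R (X (pr j))) (poly (z (pr j)) (X (pr j))) (poly (D z (pr j)) (X (pr j))))"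
    by (rule sum_pr[symmetric])
  also have "\<dots> = (\<Sum>j=1..N. Hm z j)"
    by (intro sum.cong refl) (simp add: Hm_def mi_def U_pr R_pr)
  finally show ?thesis .
qed

text \<open>What is left on a cell after all cancellations, grouped by estimate: convective flux
  differences, approximation of \<open>Pi'\<close> by polynomials, Ritz error against the derivative
  of D z, quadratic remainder, and the interface terms of \<open>Hf\<close>.\<close>

definition T :: "scheme \<Rightarrow> (nat \<Rightarrow> real poly) \<Rightarrow> (nat \<Rightarrow> real poly) \<Rightarrow> nat \<Rightarrow> real" where
  "T sch u z j = cint j (\<lambda>x. (FU x - Fu u j x) * poly (pderiv (z j)) x)
     + (FU (X (j - 1)) - (num_flux_f sch \<kappa> (mi u j) (pl u j) + avg u j * pl (D u) j)) * jmp z j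
     - (cint j (\<lambda>x. (Pi' x - poly (\<pi>q j) x) * poly (pderiv (z j)) x)
        + (Pi' (X (j - 1)) - poly (\<pi>q j) (X (j - 1))) * jmp z j
        - cint j (\<lambda>x. (Pi' x - poly (\<pi>q j) x) * poly (D z j) x))
     + cint j (\<lambda>x. (Gt z j x - Gu u j x) * poly (pderiv (D z j)) x) - cint j (rem z j)
     + (Hm z j - Hp z j + (W (X (j - 1)) - (avg u j * mi u j - num_flux_g sch (mi (D u) j) (pl (D u) j))) * jmp (D z) j)"

text \<open>Two vanishing sums are added: the integration by parts of W' = Pi' against D z, which is
  the exact counterpart of the equations for p and s, and the periodic shift of the boundary values
  of \<open>Hf\<close>.\<close>

lemma main_identity:
  assumes z: "fam z"
  shows "(\<Sum>j=1..N. cint j (\<lambda>x. Mt x * poly (z j) x)) - SR sch \<kappa> u z = (\<Sum>j=1..N. T sch u z j)"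
proof -
  let ?\<Psi> = "\<lambda>x. 2 * \<kappa>\<^sup>2 * U x + ((U x)\<^sup>2 - (R x)\<^sup>2) * (U x - R2 x)"
  have Psi: "?\<Psi> x = FU x - Pi' x" for x
    by (simp add: FU_def Pi'_def flux_f_def power2_eq_square power3_eq_cube algebra_simps)
  have "(\<Sum>j=1..N. cint j (\<lambda>x. (- Mt x) * poly (z j) x))
    = - (\<Sum>j=1..N. cint j (\<lambda>x. ?\<Psi> x * poly (pderiv (z j)) x) + ?\<Psi> (X (j - 1)) * jmp z j)"
    by (rule sum_cint_by_parts[OF Psi_der]) (auto intro!: continuous_intros simp: U_per R_per R2_per)
  then have E1: "(\<Sum>j=1..N. cint j (\<lambda>x. Mt x * poly (z j) x))
    = (\<Sum>j=1..N. cint j (\<lambda>x. (FU x - Pi' x) * poly (pderiv (z j)) x) + (FU (X (j - 1)) - Pi' (X (j - 1))) * jmp z j)"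
    unfolding Psi by (simp add: sum_negf)
  have E2: "(\<Sum>j=1..N. cint j (\<lambda>x. Pi' x * poly (D z j) x))
    + (\<Sum>j=1..N. cint j (\<lambda>x. W x * poly (pderiv (D z j)) x) + W (X (j - 1)) * jmp (D z) j) = 0"
    using sum_cint_by_parts[OF W_der, of "D z"] aux_cont(2)
    by (simp add: W_def U_per R_per)
  have E3: "(\<Sum>j=1..N. Hm z j) - (\<Sum>j=1..N. Hf (U (X j)) (R (X j)) (poly (z j) (X j)) (poly (D z j) (X j))) = 0"
    unfolding sum_Hf by simp
  have cell: "cint j (\<lambda>x. (FU x - Pi' x) * poly (pderiv (z j)) x) + (FU (X (j - 1)) - Pi' (X (j - 1))) * jmp z j
     - (cint j (\<lambda>x. Fu u j x * poly (pderiv (z j)) x)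
       + (num_flux_f sch \<kappa> (mi u j) (pl u j) + avg u j * pl (D u) j) * jmp z j
       + cint j (\<lambda>x. Gu u j x * poly (pderiv (D z j)) x)
       + (avg u j * mi u j - num_flux_g sch (mi (D u) j) (pl (D u) j)) * jmp (D z) j)
     + (cint j (\<lambda>x. Pi' x * poly (D z j) x)
       + (cint j (\<lambda>x. W x * poly (pderiv (D z j)) x) + W (X (j - 1)) * jmp (D z) j))
     + (Hm z j - Hf (U (X j)) (R (X j)) (poly (z j) (X j)) (poly (D z j) (X j))) = T sch u z j"
    if j: "j \<in> {1..N}" for j
  proof -
    have d: "cint j (\<lambda>x. (f x - g x) * w x) = cint j (\<lambda>x. f x * w x) - cint j (\<lambda>x. g x * w x)"
      if "\<And>S. continuous_on S f" "\<And>S. continuous_on S g" "\<And>S. continuous_on S w" for f g w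
      unfolding left_diff_distrib using that by (intro cint_diff continuous_intros)
    \<comment> \<open>For a polynomial of the space the three \<open>Pi'\<close> terms cancel by
      \<open>D_test\<close>, so \<open>Pi'\<close> may be replaced by its approximation
      error.\<close>
    have "degree (\<pi>q j) \<le> k" using pi_fam j by (auto simp: fam_def)
    note pt = D_test[OF j this, of z]
    note hp = Hf_by_parts[OF j, of z]
    have d1: "cint j (\<lambda>x. (FU x - Pi' x) * poly (pderiv (z j)) x)
        = cint j (\<lambda>x. FU x * poly (pderiv (z j)) x) - cint j (\<lambda>x. Pi' x * poly (pderiv (z j)) x)"
      "cint j (\<lambda>x. (FU x - Fu u j x) * poly (pderiv (z j)) x)
        = cint j (\<lambda>x. FU x * poly (pderiv (z j)) x) - cint j (\<lambda>x. Fu u j x * poly (pderiv (z j)) x)"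
      "cint j (\<lambda>x. (Pi' x - poly (\<pi>q j) x) * poly (pderiv (z j)) x)
        = cint j (\<lambda>x. Pi' x * poly (pderiv (z j)) x) - cint j (\<lambda>x. poly (\<pi>q j) x * poly (pderiv (z j)) x)"
      "cint j (\<lambda>x. (Pi' x - poly (\<pi>q j) x) * poly (D z j) x)
        = cint j (\<lambda>x. Pi' x * poly (D z j) x) - cint j (\<lambda>x. poly (\<pi>q j) x * poly (D z j) x)"
      "cint j (\<lambda>x. (Gt z j x - Gu u j x) * poly (pderiv (D z j)) x)
        = cint j (\<lambda>x. Gt z j x * poly (pderiv (D z j)) x) - cint j (\<lambda>x. Gu u j x * poly (pderiv (D z j)) x)"
      by (intro d continuous_intros; simp)+
    show ?thesis
      unfolding T_def d1 by (rule cell_algebra[OF pt hp])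
  qed
  have "(\<Sum>j=1..N. cint j (\<lambda>x. Mt x * poly (z j) x)) - SR sch \<kappa> u z =
    (\<Sum>j=1..N. cint j (\<lambda>x. (FU x - Pi' x) * poly (pderiv (z j)) x) + (FU (X (j - 1)) - Pi' (X (j - 1))) * jmp z j)
    - SR sch \<kappa> u z
    + ((\<Sum>j=1..N. cint j (\<lambda>x. Pi' x * poly (D z j) x))
    + (\<Sum>j=1..N. cint j (\<lambda>x. W x * poly (pderiv (D z j)) x) + W (X (j - 1)) * jmp (D z) j))
    + ((\<Sum>j=1..N. Hm z j) - (\<Sum>j=1..N. Hf (U (X j)) (R (X j)) (poly (z j) (X j)) (poly (D z j) (X j))))"
    unfolding E1 E2 E3 by simp
  also have "\<dots> = (\<Sum>j=1..N. T sch u z j)"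
    unfolding SR_def Fu_def[symmetric] Gu_def[symmetric] sum.distrib[symmetric] sum_subtractf[symmetric]
    by (rule sum.cong[OF refl]) (rule cell)
  finally show ?thesis .
qed

lemma T_bound:
  assumes Zf: "fam Z" and zf: "fam z" and u: "u = (\<lambda>j. Z j - z j)"
    and AU: "\<And>j x. j \<in> {1..N} \<Longrightarrow> x \<in> {X (j - 1)..X j} \<Longrightarrow> \<bar>U x - poly (Z j) x\<bar> \<le> A j"
    and AR: "\<And>j x. j \<in> {1..N} \<Longrightarrow> x \<in> {X (j - 1)..X j} \<Longrightarrow> \<bar>R x - poly (D Z j) x\<bar> \<le> A j"
    and A0: "\<And>j. j \<in> {1..N} \<Longrightarrow> 0 \<le> A j" and A1: "\<And>j. j \<in> {1..N} \<Longrightarrow> A j \<le> 1"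
    and s1: "\<And>j. j \<in> {1..N} \<Longrightarrow> sb z j \<le> 1"
    and j: "j \<in> {1..N}"
  shows "T sch u z j \<le> (2 * \<kappa>\<^sup>2 + 60 * G\<^sup>2) * (L + 6) *
     (h * (sb z j + sb z (pr j))\<^sup>2 + (A j + A (pr j))\<^sup>2 / h + h * (h ^ k)\<^sup>2)"
proof -
  let ?M = "3 * G" and ?c = "2 * \<kappa>\<^sup>2 + 54 * G\<^sup>2" and ?s = "sb z j" and ?s' = "sb z (pr j)"
  let ?e = "A j + A (pr j)" and ?\<sigma> = "sb z j + sb z (pr j)"
  have Du: "D u i = D Z i - D z i" for i unfolding u by (rule D_diff)
  have s0: "0 \<le> ?s" "0 \<le> ?s'" using sb_nonneg j pr_in by auto
  have l: "0 < len j" "len j \<le> h" using len_pos len_le_h j by auto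
  have aA: "0 \<le> A j" "0 \<le> A (pr j)" using A0 j pr_in by auto
  have bu: "\<bar>poly (u i) x\<bar> \<le> ?M" "\<bar>U x - poly (u i) x\<bar> \<le> A i + sb z i"
      "\<bar>(U x - poly (z i) x) - poly (u i) x\<bar> \<le> A i" "\<bar>U x - poly (z i) x\<bar> \<le> ?M"
      "\<bar>U x - poly (z i) x\<bar> \<le> 2 * G" "\<bar>2 * U x - poly (z i) x\<bar> \<le> 3 * G"
    if i: "i \<in> {1..N}" and x: "x \<in> {X (i - 1)..X i}" for i x
    using perturb_bounds[OF U_G[OF cell_subset[OF i x]] AU[OF i x] sb_bounds(1)[OF zf i x] A1[OF i] s1[OF i] G1]
    unfolding u poly_diff by simp_all
  have br: "\<bar>poly (D u i) x\<bar> \<le> ?M" "\<bar>R x - poly (D u i) x\<bar> \<le> A i + sb z i"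
      "\<bar>(R x - poly (D z i) x) - poly (D u i) x\<bar> \<le> A i" "\<bar>R x - poly (D z i) x\<bar> \<le> ?M"
    if i: "i \<in> {1..N}" and x: "x \<in> {X (i - 1)..X i}" for i x
    using perturb_bounds(1-4)[OF R_G[OF cell_subset[OF i x]] AR[OF i x] sb_bounds(2)[OF zf i x] A1[OF i] s1[OF i] G1]
    unfolding Du poly_diff by simp_all
  have UM: "\<bar>U x\<bar> \<le> ?M" "\<bar>R x\<bar> \<le> ?M" if "i \<in> {1..N}" "x \<in> {X (i - 1)..X i}" for i x
    using U_G[OF cell_subset[OF that]] R_G[OF cell_subset[OF that]] G1 by linarith+
  have xj: "X (j - 1) \<in> {X (j - 1)..X j}" using X_le[OF j] by auto
  have xp: "X (pr j) \<in> {X (pr j - 1)..X (pr j)}" using X_le[OF pr_in[OF j]] by auto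
  let ?x = "X (j - 1)"
  have bz: "\<bar>poly (z j) x\<bar> \<le> ?s" "\<bar>poly (D z j) x\<bar> \<le> ?s" "\<bar>poly (pderiv (z j)) x\<bar> \<le> ?s" "\<bar>poly (pderiv (D z j)) x\<bar> \<le> ?s / len j"
    if "x \<in> {X (j - 1)..X j}" for x
    using sb_bounds[OF zf j that] by auto
  have jz: "\<bar>jmp z j\<bar> \<le> len j * ?s" by (rule sb_bounds(5)[OF zf j xj])
  have pz: "\<bar>pl z j\<bar> \<le> ?s" "\<bar>pl (D z) j\<bar> \<le> ?s" unfolding pl_def using bz(1,2)[OF xj] by auto
  have mz: "\<bar>mi z j\<bar> \<le> ?s'" "\<bar>mi (D z) j\<bar> \<le> ?s'" unfolding mi_def using sb_bounds(1,2)[OF zf pr_in[OF j] xp] by auto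
  have jD: "\<bar>jmp (D z) j\<bar> \<le> ?\<sigma>" unfolding jmp_pl_mi using pz(2) mz(2) by linarith
  have le: "A j + sb z j \<le> ?e + ?\<sigma>" "A j \<le> ?e" "A (pr j) + sb z (pr j) \<le> ?e + ?\<sigma>" "A (pr j) \<le> ?e"
    using s0 aA by auto
  note bm = bu[OF pr_in[OF j] xp, unfolded U_pr[OF j]]
  note rm = br[OF pr_in[OF j] xp, unfolded R_pr[OF j]]
  have pu: "\<bar>pl u j\<bar> \<le> ?M" "\<bar>pl (D u) j\<bar> \<le> ?M" "\<bar>U ?x - pl u j\<bar> \<le> ?e + ?\<sigma>" "\<bar>R ?x - pl (D u) j\<bar> \<le> ?e + ?\<sigma>"
      "\<bar>(U ?x - pl z j) - pl u j\<bar> \<le> ?e" "\<bar>(R ?x - pl (D z) j) - pl (D u) j\<bar> \<le> ?e"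
      "\<bar>U ?x - pl z j\<bar> \<le> ?M" "\<bar>R ?x - pl (D z) j\<bar> \<le> ?M"
    unfolding pl_def by (rule bu(1)[OF j xj] br(1)[OF j xj] order.trans[OF bu(2)[OF j xj] le(1)]
        order.trans[OF br(2)[OF j xj] le(1)] order.trans[OF bu(3)[OF j xj] le(2)]
        order.trans[OF br(3)[OF j xj] le(2)] bu(4)[OF j xj] br(4)[OF j xj])+
  have mu: "\<bar>mi u j\<bar> \<le> ?M" "\<bar>mi (D u) j\<bar> \<le> ?M" "\<bar>U ?x - mi u j\<bar> \<le> ?e + ?\<sigma>" "\<bar>R ?x - mi (D u) j\<bar> \<le> ?e + ?\<sigma>"
      "\<bar>(U ?x - mi z j) - mi u j\<bar> \<le> ?e" "\<bar>(R ?x - mi (D z) j) - mi (D u) j\<bar> \<le> ?e"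
      "\<bar>U ?x - mi z j\<bar> \<le> ?M" "\<bar>R ?x - mi (D z) j\<bar> \<le> ?M"
    unfolding mi_def by (rule bm(1) rm(1) order.trans[OF bm(2) le(3)] order.trans[OF rm(2) le(3)]
        order.trans[OF bm(3) le(4)] order.trans[OF rm(3) le(4)] bm(4) rm(4))+
  have cM: "2 * \<kappa>\<^sup>2 + 3 * ?M\<^sup>2 + 3 * ?M\<^sup>2 = ?c" by (simp add: power2_eq_square)

  have t1: "\<bar>cint j (\<lambda>x. (FU x - Fu u j x) * poly (pderiv (z j)) x)\<bar> \<le> (?c * (A j + ?s) * ?s) * len j"
  proof (rule cint_abs_le[OF j])
    fix x assume x: "x \<in> {X (j - 1)..X j}"
    have "\<bar>flux_f \<kappa> (U x) - flux_f \<kappa> (poly (u j) x)\<bar> \<le> (2 * \<kappa>\<^sup>2 + 3 * ?M\<^sup>2) * (A j + ?s)"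
      by (intro flux_f_diff UM[OF j x] bu[OF j x])
    moreover have "\<bar>U x * R x * R x - poly (u j) x * poly (D u j) x * poly (D u j) x\<bar> \<le> 3 * ?M\<^sup>2 * (A j + ?s)"
      by (intro prod3_diff UM[OF j x] bu[OF j x] br[OF j x])
    ultimately have "\<bar>(flux_f \<kappa> (U x) - flux_f \<kappa> (poly (u j) x)) + (U x * R x * R x - poly (u j) x * poly (D u j) x * poly (D u j) x)\<bar>
       \<le> (2 * \<kappa>\<^sup>2 + 3 * ?M\<^sup>2) * (A j + ?s) + 3 * ?M\<^sup>2 * (A j + ?s)" by (rule abs_add_le)
    also have "\<dots> = ?c * (A j + ?s)" unfolding cM[symmetric] by (simp only: distrib_right)
    finally have "\<bar>FU x - Fu u j x\<bar> \<le> ?c * (A j + ?s)" by (simp add: FU_def Fu_def algebra_simps)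
    then show "\<bar>(FU x - Fu u j x) * poly (pderiv (z j)) x\<bar> \<le> ?c * (A j + ?s) * ?s"
      by (rule abs_mult_le[OF _ bz(3)[OF x]])
  qed (intro continuous_intros)
  have t2: "\<bar>(FU ?x - (num_flux_f sch \<kappa> (mi u j) (pl u j) + avg u j * pl (D u) j)) * jmp z j\<bar> \<le> ?c * (?e + ?\<sigma>) * (len j * ?s)"
  proof -
    have "\<bar>flux_f \<kappa> (U ?x) - num_flux_f sch \<kappa> (mi u j) (pl u j)\<bar> \<le> (2 * \<kappa>\<^sup>2 + 3 * ?M\<^sup>2) * (?e + ?\<sigma>)"
      by (intro num_flux_f_diff mu pu UM[OF j xj])
    moreover have "\<bar>(U ?x * R ?x + U ?x * R ?x) / 2 * R ?x - (pl u j * pl (D u) j + mi u j * mi (D u) j) / 2 * pl (D u) j\<bar> \<le> 3 * ?M\<^sup>2 * (?e + ?\<sigma>)"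
      by (intro avg_diff mu pu UM[OF j xj])
    ultimately have "\<bar>(flux_f \<kappa> (U ?x) - num_flux_f sch \<kappa> (mi u j) (pl u j))
       + ((U ?x * R ?x + U ?x * R ?x) / 2 * R ?x - (pl u j * pl (D u) j + mi u j * mi (D u) j) / 2 * pl (D u) j)\<bar>
       \<le> (2 * \<kappa>\<^sup>2 + 3 * ?M\<^sup>2) * (?e + ?\<sigma>) + 3 * ?M\<^sup>2 * (?e + ?\<sigma>)" by (rule abs_add_le)
    also have "\<dots> = ?c * (?e + ?\<sigma>)" unfolding cM[symmetric] by (simp only: distrib_right)
    finally have "\<bar>FU ?x - (num_flux_f sch \<kappa> (mi u j) (pl u j) + avg u j * pl (D u) j)\<bar> \<le> ?c * (?e + ?\<sigma>)"
      by (simp add: FU_def avg_def algebra_simps)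
    then show ?thesis by (rule abs_mult_le[OF _ jz])
  qed
  have pj: "\<bar>Pi' x - poly (\<pi>q j) x\<bar> \<le> G * h ^ k" if "x \<in> {X (j - 1)..X j}" for x
    using pi_app[OF j that] by (simp add: Pi'_def)
  have t3a: "\<bar>cint j (\<lambda>x. (Pi' x - poly (\<pi>q j) x) * poly (pderiv (z j)) x)\<bar> \<le> (G * h ^ k * ?s) * len j"
    by (rule cint_abs_le[OF j]) (intro continuous_intros, intro abs_mult_le pj bz)
  have t3b: "\<bar>(Pi' ?x - poly (\<pi>q j) ?x) * jmp z j\<bar> \<le> G * h ^ k * (len j * ?s)"
    by (intro abs_mult_le pj xj jz)
  have t3c: "\<bar>cint j (\<lambda>x. (Pi' x - poly (\<pi>q j) x) * poly (D z j) x)\<bar> \<le> (G * h ^ k * ?s) * len j"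
    by (rule cint_abs_le[OF j]) (intro continuous_intros, intro abs_mult_le pj bz)
  \<comment> \<open>The 1/\<open>len\<close> of the inverse estimate cancels the length of the cell.
    No power of h is gained, but the cofactor is the Ritz error alone.\<close>
  have t4: "\<bar>cint j (\<lambda>x. (Gt z j x - Gu u j x) * poly (pderiv (D z j)) x)\<bar> \<le> ((36 * G\<^sup>2 * A j) * (?s / len j)) * len j"
  proof (rule cint_abs_le[OF j])
    fix x assume x: "x \<in> {X (j - 1)..X j}"
    let ?a = "U x - poly (z j) x" and ?b = "R x - poly (D z j) x"
    have "\<bar>?a * ?a * ?b - poly (u j) x * poly (u j) x * poly (D u j) x\<bar> \<le> 3 * ?M\<^sup>2 * A j"
      by (intro prod3_diff bu[OF j x] br[OF j x])
    moreover have "\<bar>flux_g (poly (D u j) x) - flux_g ?b\<bar> \<le> ?M\<^sup>2 * A j"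
      by (intro flux_g_diff br[OF j x]) (use br(3)[OF j x] abs_minus_commute in simp)
    ultimately have "\<bar>(?a * ?a * ?b - poly (u j) x * poly (u j) x * poly (D u j) x) + (flux_g (poly (D u j) x) - flux_g ?b)\<bar>
        \<le> 3 * ?M\<^sup>2 * A j + ?M\<^sup>2 * A j" by (rule abs_add_le)
    also have "\<dots> = 36 * G\<^sup>2 * A j" by (simp add: power2_eq_square)
    finally have "\<bar>Gt z j x - Gu u j x\<bar> \<le> 36 * G\<^sup>2 * A j" by (simp add: Gt_def Gu_def algebra_simps)
    then show "\<bar>(Gt z j x - Gu u j x) * poly (pderiv (D z j)) x\<bar> \<le> (36 * G\<^sup>2 * A j) * (?s / len j)"
      by (rule abs_mult_le[OF _ bz(4)[OF x]])
  qed (intro continuous_intros)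
  have t5: "\<bar>cint j (rem z j)\<bar> \<le> (15 * G\<^sup>2 * (?s * ?s)) * len j"
  proof (rule cint_abs_le[OF j])
    fix x assume x: "x \<in> {X (j - 1)..X j}"
    note xx = cell_subset[OF j x]
    have s1': "?s \<le> 1" by (rule s1[OF j])
    have r: "\<bar>2 * R x - poly (pderiv (z j)) x\<bar> \<le> 3 * G" "\<bar>R x - poly (pderiv (z j)) x\<bar> \<le> 2 * G"
      using R_G[OF xx] bz(3)[OF x] s1' G1 by linarith+
    have b1: "\<bar>poly (D z j) x\<bar> \<le> 1" using bz(2)[OF x] s1' by linarith
    have 1: "\<bar>(2 * R x - poly (pderiv (z j)) x) * poly (z j) x * R x * poly (D z j) x\<bar> \<le> (3 * G) * ?s * G * ?s"
      by (intro abs_mult_le r bz[OF x] R_G xx)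
    have 2: "\<bar>(2 * U x - poly (z j) x) * poly (pderiv (z j)) x * R x * poly (D z j) x\<bar> \<le> (3 * G) * ?s * G * ?s"
      by (intro abs_mult_le bu(6)[OF j x] bz[OF x] R_G xx)
    have 3: "\<bar>(2 * U x - poly (z j) x) * poly (z j) x * R2 x * poly (D z j) x\<bar> \<le> (3 * G) * ?s * G * ?s"
      by (intro abs_mult_le bu(6)[OF j x] bz[OF x] R2_G xx)
    have 4: "\<bar>(U x - poly (z j) x) * (R x - poly (pderiv (z j)) x) * poly (D z j) x * poly (D z j) x\<bar> \<le> (2 * G) * (2 * G) * ?s * ?s"
      by (intro abs_mult_le bu(5)[OF j x] bz[OF x] r)
    have 5: "\<bar>R x * R2 x * poly (D z j) x * poly (D z j) x\<bar> \<le> G * G * ?s * ?s"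
      by (intro abs_mult_le R_G R2_G xx bz[OF x])
    have 6: "\<bar>R2 x * poly (D z j) x * poly (D z j) x * poly (D z j) x\<bar> \<le> G * 1 * ?s * ?s"
      by (intro abs_mult_le R2_G xx b1 bz[OF x])
    have "\<bar>rem z j x\<bar> \<le> (3 * G) * ?s * G * ?s + (3 * G) * ?s * G * ?s + (3 * G) * ?s * G * ?s + (2 * G) * (2 * G) * ?s * ?s + G * G * ?s * ?s + G * 1 * ?s * ?s"
    proof -
      have q5: "\<bar>- (R x * R2 x * poly (D z j) x * poly (D z j) x)\<bar> \<le> G * G * ?s * ?s" using 5 by simp
      have q6: "\<bar>R2 x * poly (D z j) x * poly (D z j) x * poly (D z j) x / 3\<bar> \<le> G * 1 * ?s * ?s"
        using 6 unfolding abs_divide by linarith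
      show ?thesis using abs_add_le[OF abs_add_le[OF abs_add_le[OF abs_add3_le[OF 1 2 3] 4] q5] q6]
        unfolding rem_def by simp
    qed
    also have "\<dots> \<le> 15 * G\<^sup>2 * (?s * ?s)"
    proof -
      have "G * (?s * ?s) \<le> G * G * (?s * ?s)" using G1 s0 by (intro mult_right_mono) auto
      then show ?thesis by (simp add: power2_eq_square algebra_simps)
    qed
    finally show "\<bar>rem z j x\<bar> \<le> 15 * G\<^sup>2 * (?s * ?s)" .
  qed (intro continuous_intros)
  \<comment> \<open>\<open>?at\<close> and \<open>?gt\<close> are the interface fluxes at the traces
    of U - z and R - D z, inserted between the exact and the numerical fluxes: one difference is of
    the size of the Ritz error, the other is matched by \<open>Hf\<close>.\<close>
  let ?ut = "\<lambda>\<alpha> \<beta>. U ?x - \<alpha>" and ?gt = "num_flux_g sch (R ?x - mi (D z) j) (R ?x - pl (D z) j)"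
  let ?at = "((U ?x - pl z j) * (R ?x - pl (D z) j) + (U ?x - mi z j) * (R ?x - mi (D z) j)) / 2 * (U ?x - mi z j)"
  let ?au = "avg u j * mi u j" and ?gu = "num_flux_g sch (mi (D u) j) (pl (D u) j)"
  have t6: "\<bar>((?at - ?au) + (?gu - ?gt)) * jmp (D z) j\<bar> \<le> 36 * G\<^sup>2 * ?e * ?\<sigma>"
  proof -
    have "\<bar>?at - ?au\<bar> \<le> 3 * ?M\<^sup>2 * ?e" unfolding avg_def by (intro avg_diff mu pu)
    moreover have "\<bar>?gu - ?gt\<bar> \<le> ?M\<^sup>2 * ?e"
      by (intro num_flux_g_diff mu pu) (use mu(6) pu(6) abs_minus_commute in auto)
    ultimately have "\<bar>(?at - ?au) + (?gu - ?gt)\<bar> \<le> 3 * ?M\<^sup>2 * ?e + ?M\<^sup>2 * ?e" by (rule abs_add_le)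
    also have "\<dots> = 36 * G\<^sup>2 * ?e" by (simp add: power2_eq_square)
    finally show ?thesis by (rule abs_mult_le[OF _ jD])
  qed
  \<comment> \<open>\<open>?J\<close> has a sign by \<open>interface_g\<close>, while
    \<open>?I\<close> contains the jump of z as a factor and is small of order
    \<open>len\<close>.\<close>
  have t7: "Hm z j - Hp z j + (W ?x - (?at - ?gt)) * jmp (D z) j \<le> 11 * G\<^sup>2 * (len j * ?s) * ?\<sigma>"
  proof -
    let ?U = "U ?x" and ?R = "R ?x" and ?a = "mi z j" and ?c = "pl z j" and ?b = "mi (D z) j" and ?d = "pl (D z) j"
    let ?I = "((2 * ?U - ?a) * ?a * ?R * ?b + (?U - ?a)\<^sup>2 * ?b\<^sup>2 / 2) - ((2 * ?U - ?c) * ?c * ?R * ?d + (?U - ?c)\<^sup>2 * ?d\<^sup>2 / 2)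
      + (?U\<^sup>2 * ?R - ((?U - ?c) * (?R - ?d) + (?U - ?a) * (?R - ?b)) / 2 * (?U - ?a)) * (?d - ?b)"
    let ?J = "Gam ?R ?d - Gam ?R ?b + (?gt - flux_g ?R) * (?d - ?b)"
    have "Hm z j - Hp z j + (W ?x - (?at - ?gt)) * jmp (D z) j = ?I + ?J"
      unfolding Hm_def Hp_def Hf_def W_def jmp_pl_mi by (simp add: power2_eq_square algebra_simps)
    also have "\<dots> \<le> ?I" using interface_g[of ?R ?d ?b sch] by simp
    also have "\<dots> \<le> \<bar>?I\<bar>" by (rule abs_ge_self)
    also have "\<dots> \<le> 11 * G\<^sup>2 * \<bar>?c - ?a\<bar> * (\<bar>?b\<bar> + \<bar>?d\<bar>)"
      by (rule interface_u[OF G1 U_G[OF cell_subset[OF j xj]] R_G[OF cell_subset[OF j xj]]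
            order.trans[OF mz(1) s1[OF pr_in[OF j]]] order.trans[OF pz(1) s1[OF j]]
            order.trans[OF mz(2) s1[OF pr_in[OF j]]] order.trans[OF pz(2) s1[OF j]]])
    also have "\<dots> \<le> 11 * G\<^sup>2 * (len j * ?s) * ?\<sigma>"
    proof (intro mult_mono order.refl)
      show "\<bar>?c - ?a\<bar> \<le> len j * ?s" using jz unfolding jmp_pl_mi .
      show "\<bar>?b\<bar> + \<bar>?d\<bar> \<le> ?\<sigma>" using pz(2) mz(2) by linarith
    qed (use s0 l in auto)
    finally show ?thesis .
  qed
  have Teq: "T sch u z j = cint j (\<lambda>x. (FU x - Fu u j x) * poly (pderiv (z j)) x)
     + (FU ?x - (num_flux_f sch \<kappa> (mi u j) (pl u j) + avg u j * pl (D u) j)) * jmp z j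
     - (cint j (\<lambda>x. (Pi' x - poly (\<pi>q j) x) * poly (pderiv (z j)) x)
        + (Pi' ?x - poly (\<pi>q j) ?x) * jmp z j
        - cint j (\<lambda>x. (Pi' x - poly (\<pi>q j) x) * poly (D z j) x))
     + cint j (\<lambda>x. (Gt z j x - Gu u j x) * poly (pderiv (D z j)) x) - cint j (rem z j)
     + ((Hm z j - Hp z j + (W ?x - (?at - ?gt)) * jmp (D z) j) + ((?at - ?au) + (?gu - ?gt)) * jmp (D z) j)"
    unfolding T_def by (simp add: algebra_simps)
  show ?thesis
  proof (rule T_bound_algebra[OF _ _ _ _ l h_le_L G1 _ refl])
    have "((36 * G\<^sup>2 * A j) * (?s / len j)) * len j = 36 * G\<^sup>2 * A j * ?s" using l by simp
    with t4 have t4': "\<bar>cint j (\<lambda>x. (Gt z j x - Gu u j x) * poly (pderiv (D z j)) x)\<bar> \<le> 36 * G\<^sup>2 * A j * ?s" by simp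
    have t3b': "\<bar>(Pi' ?x - poly (\<pi>q j) ?x) * jmp z j\<bar> \<le> (G * h ^ k * ?s) * len j" using t3b by (simp add: ac_simps)
    show "T sch u z j \<le> ?c * (A j + ?s) * ?s * len j + ?c * (?e + ?\<sigma>) * (len j * ?s) + 3 * (G * h ^ k * ?s * len j)
        + 36 * G\<^sup>2 * A j * ?s + 15 * G\<^sup>2 * (?s * ?s) * len j + 36 * G\<^sup>2 * ?e * ?\<sigma> + 11 * G\<^sup>2 * (len j * ?s) * ?\<sigma>"
      unfolding Teq
      using abs_le_D1[OF t1] abs_le_D1[OF t2] abs_le_D2[OF t3a] abs_le_D2[OF t3b'] abs_le_D1[OF t3c]
        abs_le_D1[OF t4'] abs_le_D2[OF t5] abs_le_D1[OF t6] t7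
      by linarith
  qed (use s0 aA h_pow_pos[of k] in auto)
qed

text \<open>The smallness hypotheses provide the pointwise bounds: \<open>hs\<close> gives A j \<le>
  1 and \<open>Q\<close> gives sb z j \<le> 1. In the sum over cells, A^2/h produces h^(2k).\<close>

lemma error_dissipation:
  assumes Zf: "fam Z" and Z: "ritz Z" and zf: "fam z" and u: "u = (\<lambda>j. Z j - z j)"
    and hs: "CZ k L \<rho> G * h ^ (2 * k + 1) \<le> 1" and Q: "4 * Binv k * aform z z \<le> \<rho> * h"
  shows "(\<Sum>j=1..N. cint j (\<lambda>x. Mt x * poly (z j) x)) - SR sch \<kappa> u z
    \<le> CM \<kappa> L G * ((4 * Binv k / \<rho> + CZ k L \<rho> G + L / \<rho>) * (aform z z + h ^ (2 * k)))"
proof -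
  obtain A where A: "\<And>j x. j \<in> {1..N} \<Longrightarrow> x \<in> {X (j - 1)..X j} \<Longrightarrow> \<bar>U x - poly (Z j) x\<bar> \<le> A j"
    "\<And>j x. j \<in> {1..N} \<Longrightarrow> x \<in> {X (j - 1)..X j} \<Longrightarrow> \<bar>R x - poly (D Z j) x\<bar> \<le> A j"
    and hA: "h * (\<Sum>j=1..N. (A j)\<^sup>2) \<le> CZ k L \<rho> G * h ^ (2 * k + 2)"
    and A0: "\<And>j. j \<in> {1..N} \<Longrightarrow> 0 \<le> A j"
    using Ritz_sup[OF Zf Z] by blast
  have B: "1 \<le> Binv k" by (rule Binv_unit(1))
  have SA: "(\<Sum>j=1..N. (A j)\<^sup>2) \<le> CZ k L \<rho> G * h ^ (2 * k + 1)"
  proof -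
    have "h * (\<Sum>j=1..N. (A j)\<^sup>2) \<le> h * (CZ k L \<rho> G * h ^ (2 * k + 1))"
    proof -
      have e: "h ^ (2 * k + 2) = h * h ^ (2 * k + 1)" by (simp only: power_Suc[symmetric]) simp
      show ?thesis using hA unfolding e by (simp only: ac_simps)
    qed
    then show ?thesis using h_pos by simp
  qed
  have A1: "A j \<le> 1" if j: "j \<in> {1..N}" for j
  proof -
    have "(A j)\<^sup>2 \<le> (\<Sum>j=1..N. (A j)\<^sup>2)" by (rule member_le_sum[OF j]) auto
    then have "(A j)\<^sup>2 \<le> 1\<^sup>2" using SA hs by simp
    then show ?thesis by (rule power2_le_imp_le) simp
  qed
  have s1: "sb z j \<le> 1" if j: "j \<in> {1..N}" for j
  proof -
    have "4 * Binv k * en z j \<le> 4 * Binv k * aform z z" using B en_le_aform[OF j] by (intro mult_left_mono) auto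
    also have "\<dots> \<le> \<rho> * h" by (rule Q)
    also have "\<dots> \<le> len j" by (rule h_le_len[OF j])
    finally have "(sb z j)\<^sup>2 \<le> 1\<^sup>2" using len_pos[OF j] by (simp add: sb_sq[OF j])
    then show ?thesis by (rule power2_le_imp_le) simp
  qed
  let ?K = "2 * \<kappa>\<^sup>2 + 60 * G\<^sup>2" and ?P = "h * (h ^ k)\<^sup>2"
  have L0: "0 \<le> L" using xl_xr by simp
  have "(\<Sum>j=1..N. cint j (\<lambda>x. Mt x * poly (z j) x)) - SR sch \<kappa> u z = (\<Sum>j=1..N. T sch u z j)"
    by (rule main_identity[OF zf])
  also have "\<dots> \<le> (\<Sum>j=1..N. ?K * (L + 6) * (h * (sb z j + sb z (pr j))\<^sup>2 + (A j + A (pr j))\<^sup>2 / h + ?P))"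
    by (intro sum_mono T_bound[OF Zf zf u A A0 A1 s1])
  also have "\<dots> = ?K * (L + 6) * (\<Sum>j=1..N. h * (sb z j + sb z (pr j))\<^sup>2 + (A j + A (pr j))\<^sup>2 / h + ?P)"
    by (rule sum_distrib_left[symmetric])
  also have "\<dots> \<le> ?K * (L + 6) * (4 * ((4 * Binv k / \<rho> + CZ k L \<rho> G + L / \<rho>) * (aform z z + h ^ (2 * k))))"
  proof (rule mult_left_mono)
    have sq: "(a + b)\<^sup>2 \<le> 2 * a\<^sup>2 + 2 * b\<^sup>2" for a b :: real
    proof -
      have "0 \<le> (a - b)\<^sup>2" by simp
      then show ?thesis by (simp add: power2_eq_square algebra_simps)
    qed
    have "(\<Sum>j=1..N. h * (sb z j + sb z (pr j))\<^sup>2 + (A j + A (pr j))\<^sup>2 / h + ?P)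
      \<le> (\<Sum>j=1..N. 2 * (h * (sb z j)\<^sup>2) + 2 * (h * (sb z (pr j))\<^sup>2) + (2 * (A j)\<^sup>2 / h + 2 * (A (pr j))\<^sup>2 / h) + ?P)"
    proof (intro sum_mono add_mono order.refl)
      fix j
      have "h * (sb z j + sb z (pr j))\<^sup>2 \<le> h * (2 * (sb z j)\<^sup>2 + 2 * (sb z (pr j))\<^sup>2)"
        using h_pos by (intro mult_left_mono sq) auto
      then show "h * (sb z j + sb z (pr j))\<^sup>2 \<le> 2 * (h * (sb z j)\<^sup>2) + 2 * (h * (sb z (pr j))\<^sup>2)"
        by (simp add: algebra_simps)
      have "(A j + A (pr j))\<^sup>2 / h \<le> (2 * (A j)\<^sup>2 + 2 * (A (pr j))\<^sup>2) / h"
        using h_pos by (intro divide_right_mono sq) auto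
      then show "(A j + A (pr j))\<^sup>2 / h \<le> 2 * (A j)\<^sup>2 / h + 2 * (A (pr j))\<^sup>2 / h" by (simp add: add_divide_distrib)
    qed
    also have "\<dots> = 4 * (\<Sum>j=1..N. h * (sb z j)\<^sup>2) + 4 * ((\<Sum>j=1..N. (A j)\<^sup>2) / h) + real N * ?P"
      unfolding sum.distrib sum_pr[of "\<lambda>j. h * (sb z j)\<^sup>2"] sum_distrib_left[symmetric] sum_divide_distrib[symmetric]
        sum_pr[of "\<lambda>j. (A j)\<^sup>2"] sum_pr[of "\<lambda>j. (sb z j)\<^sup>2"] by simp
    also have "\<dots> \<le> 4 * (4 * Binv k / \<rho> * aform z z) + 4 * (CZ k L \<rho> G * h ^ (2 * k)) + L / \<rho> * h ^ (2 * k)"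
    proof (intro add_mono mult_left_mono sum_h_sb_sq)
      show "(\<Sum>j=1..N. (A j)\<^sup>2) / h \<le> CZ k L \<rho> G * h ^ (2 * k)"
        using SA h_pos by (simp add: divide_le_eq power_add ac_simps)
      have "real N * h * h ^ (2 * k) \<le> L / \<rho> * h ^ (2 * k)"
        using sum_h h_pow_pos[of "2 * k"] by (intro mult_right_mono) auto
      then show "real N * (h * (h ^ k)\<^sup>2) \<le> L / \<rho> * h ^ (2 * k)"
        by (simp add: ac_simps power_mult)
    qed auto
    also have "\<dots> \<le> 4 * ((4 * Binv k / \<rho> + CZ k L \<rho> G + L / \<rho>) * (aform z z + h ^ (2 * k)))"
    proof -
      have "0 \<le> 4 * Binv k / \<rho>" "0 \<le> L / \<rho>" using B rho L0 by auto
      moreover have "0 \<le> CZ k L \<rho> G"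
        unfolding CZ_def CA_def using rho L0 B by (intro add_nonneg_nonneg mult_nonneg_nonneg divide_nonneg_pos) auto
      moreover have "0 \<le> h ^ (2 * k)" using h_pow_pos less_imp_le by blast
      ultimately show ?thesis using aform_nonneg by (intro dissipation_algebra)
    qed
    finally show "(\<Sum>j=1..N. h * (sb z j + sb z (pr j))\<^sup>2 + (A j + A (pr j))\<^sup>2 / h + ?P)
      \<le> 4 * ((4 * Binv k / \<rho> + CZ k L \<rho> G + L / \<rho>) * (aform z z + h ^ (2 * k)))" .
    show "0 \<le> ?K * (L + 6)" using L0 by simp
  qed
  finally show ?thesis by (simp only: CM_def ac_simps)
qed

end

section \<open>Decay of the discrete energy\<close>

lemma energy_interface_f:
  "(\<kappa>\<^sup>2 * a\<^sup>2 + a ^ 4 / 4) - (\<kappa>\<^sup>2 * b\<^sup>2 + b ^ 4 / 4) + num_flux_f sch \<kappa> a b * (b - a) \<le> 0"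
proof (cases sch)
  case Dissipative
  have "(\<kappa>\<^sup>2 * a\<^sup>2 + a ^ 4 / 4) - (\<kappa>\<^sup>2 * b\<^sup>2 + b ^ 4 / 4) + num_flux_f sch \<kappa> a b * (b - a)
    = - (\<kappa>\<^sup>2 * (b - a)\<^sup>2 + (b - a)\<^sup>2 * ((a + b)\<^sup>2 + 2 * a\<^sup>2) / 4)"
    using Dissipative by (simp add: flux_f_def power2_eq_square power3_eq_cube power4_eq_xxxx field_simps)
  also have "\<dots> \<le> 0"
  proof -
    have "0 \<le> \<kappa>\<^sup>2 * (b - a)\<^sup>2 + (b - a)\<^sup>2 * ((a + b)\<^sup>2 + 2 * a\<^sup>2) / 4"
      by (intro add_nonneg_nonneg mult_nonneg_nonneg divide_nonneg_nonneg) auto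
    then show ?thesis by linarith
  qed
  finally show ?thesis .
next
  case Conservative
  have "(\<kappa>\<^sup>2 * a\<^sup>2 + a ^ 4 / 4) - (\<kappa>\<^sup>2 * b\<^sup>2 + b ^ 4 / 4) + num_flux_f sch \<kappa> a b * (b - a) = 0"
    using Conservative by (simp add: power2_eq_square power4_eq_xxxx field_simps)
  then show ?thesis by simp
qed

text \<open>A primitive of the volume integrands of \<open>SR\<close>: its partial derivatives in u
  and r are the factors in front of the derivatives of u and D u.\<close>

definition Ef :: "real \<Rightarrow> real \<Rightarrow> real \<Rightarrow> real" where
  "Ef \<kappa> u r = \<kappa>\<^sup>2 * u\<^sup>2 + u ^ 4 / 4 + u\<^sup>2 * r\<^sup>2 / 2 - r ^ 4 / 12"

lemma energy_interface:
  "Ef \<kappa> a c - Ef \<kappa> b d + (num_flux_f sch \<kappa> a b + (b * d + a * c) / 2 * d) * (b - a)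
     + ((b * d + a * c) / 2 * a - num_flux_g sch c d) * (d - c) \<le> 0"
proof -
  \<comment> \<open>At R = 0 with reversed signs \<open>Gam\<close> is the quartic part of
    \<open>Ef\<close> in r, so the estimate for g is reused.\<close>
  have "Gam 0 (- d) - Gam 0 (- c) + (num_flux_g sch (0 - - c) (0 - - d) - flux_g 0) * (- d - - c) \<le> 0"
    by (rule interface_g)
  then have "d ^ 4 / 12 - c ^ 4 / 12 - num_flux_g sch c d * (d - c) \<le> 0"
    by (simp add: Gam_def flux_g_def algebra_simps)
  moreover have "Ef \<kappa> a c - Ef \<kappa> b d + (num_flux_f sch \<kappa> a b + (b * d + a * c) / 2 * d) * (b - a)
     + ((b * d + a * c) / 2 * a - num_flux_g sch c d) * (d - c)
    = ((\<kappa>\<^sup>2 * a\<^sup>2 + a ^ 4 / 4) - (\<kappa>\<^sup>2 * b\<^sup>2 + b ^ 4 / 4) + num_flux_f sch \<kappa> a b * (b - a))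
     + (d ^ 4 / 12 - c ^ 4 / 12 - num_flux_g sch c d * (d - c))"
    by (simp add: Ef_def power2_eq_square field_simps)
  ultimately show ?thesis using energy_interface_f[of \<kappa> a b sch] by linarith
qed

context dg_mesh
begin

text \<open>Tested with u itself, the volume terms are exact derivatives of \<open>Ef\<close>; after
  a periodic shift only interface terms remain, each nonpositive by
  \<open>energy_interface\<close>.\<close>

lemma energy_dissipation: "SR sch \<kappa> u u \<le> 0"
proof -
  let ?E = "\<lambda>j x. Ef \<kappa> (poly (u j) x) (poly (D u j) x)"
  have vol: "cint j (\<lambda>x. (flux_f \<kappa> (poly (u j) x) + poly (u j) x * poly (D u j) x * poly (D u j) x) * poly (pderiv (u j)) x)
     + cint j (\<lambda>x. (poly (u j) x * poly (u j) x * poly (D u j) x - flux_g (poly (D u j) x)) * poly (pderiv (D u j)) x)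
     = ?E j (X j) - ?E j (X (j - 1))" if j: "j \<in> {1..N}" for j
  proof -
    have "((\<lambda>x. (flux_f \<kappa> (poly (u j) x) + poly (u j) x * poly (D u j) x * poly (D u j) x) * poly (pderiv (u j)) x
      + (poly (u j) x * poly (u j) x * poly (D u j) x - flux_g (poly (D u j) x)) * poly (pderiv (D u j)) x)
      has_integral (?E j (X j) - ?E j (X (j - 1)))) {X (j - 1)..X j}"
    proof (rule fundamental_theorem_of_calculus[OF X_le[OF j]])
      fix x
      show "(?E j has_vector_derivative (flux_f \<kappa> (poly (u j) x) + poly (u j) x * poly (D u j) x * poly (D u j) x) * poly (pderiv (u j)) x
      + (poly (u j) x * poly (u j) x * poly (D u j) x - flux_g (poly (D u j) x)) * poly (pderiv (D u j)) x) (at x within {X (j - 1)..X j})"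
        unfolding Ef_def has_real_derivative_iff_has_vector_derivative[symmetric]
        by (rule has_field_derivative_at_within) (rule derivative_eq_intros poly_DERIV refl | simp add: flux_f_def flux_g_def power2_eq_square power3_eq_cube field_simps)+
    qed
    from integral_unique[OF this] show ?thesis
      by (subst (asm) cint_add) (auto intro!: continuous_intros simp: flux_f_def flux_g_def)
  qed
  have "(\<Sum>j=1..N. ?E j (X j)) = (\<Sum>j=1..N. ?E (pr j) (X (pr j)))" by (rule sum_pr[symmetric])
  then have pr: "(\<Sum>j=1..N. ?E j (X j)) = (\<Sum>j=1..N. Ef \<kappa> (mi u j) (mi (D u) j))" by (simp add: mi_def)
  have "SR sch \<kappa> u u = (\<Sum>j=1..N. (?E j (X j) - ?E j (X (j - 1)))
      + ((num_flux_f sch \<kappa> (mi u j) (pl u j) + avg u j * pl (D u) j) * jmp u j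
      + (avg u j * mi u j - num_flux_g sch (mi (D u) j) (pl (D u) j)) * jmp (D u) j))"
    unfolding SR_def by (rule sum.cong[OF refl]) (use vol in \<open>simp add: algebra_simps\<close>)
  also have "\<dots> = (\<Sum>j=1..N. Ef \<kappa> (mi u j) (mi (D u) j) - Ef \<kappa> (pl u j) (pl (D u) j)
      + (num_flux_f sch \<kappa> (mi u j) (pl u j) + (pl u j * pl (D u) j + mi u j * mi (D u) j) / 2 * pl (D u) j) * (pl u j - mi u j)
      + ((pl u j * pl (D u) j + mi u j * mi (D u) j) / 2 * mi u j - num_flux_g sch (mi (D u) j) (pl (D u) j)) * (pl (D u) j - mi (D u) j))"
    unfolding sum.distrib sum_subtractf pr by (simp add: avg_def jmp_pl_mi pl_def)
  also have "\<dots> \<le> 0"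
    by (intro sum_nonpos energy_interface)
  finally show ?thesis .
qed

end

section \<open>Local polynomial approximation\<close>

text \<open>Bounds for all derivatives up to order \<open>n\<close>; the derivatives exist everywhere, the bounds
  hold on \<open>S\<close>.\<close>

fun bd :: "real set \<Rightarrow> nat \<Rightarrow> real \<Rightarrow> (real \<Rightarrow> real) \<Rightarrow> bool" where
  "bd S 0 B f \<longleftrightarrow> (\<forall>x\<in>S. \<bar>f x\<bar> \<le> B)"
| "bd S (Suc n) B f \<longleftrightarrow> (\<forall>x\<in>S. \<bar>f x\<bar> \<le> B) \<and>
     (\<exists>f'. (\<forall>x. (f has_field_derivative f' x) (at x)) \<and> bd S n B f')"

lemma bd_abs: "bd S n B f \<Longrightarrow> x \<in> S \<Longrightarrow> \<bar>f x\<bar> \<le> B"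
  by (cases n) auto

lemma bd_Suc: "bd S (Suc n) B f \<Longrightarrow> bd S n B f"
proof (induction n arbitrary: f)
  case (Suc n)
  from Suc.prems obtain f' where "\<forall>x. (f has_field_derivative f' x) (at x)" "bd S (Suc n) B f'" by auto
  moreover then have "bd S n B f'" using Suc.IH by blast
  ultimately show ?case using Suc.prems by auto
qed simp

lemma bd_add: "bd S n A f \<Longrightarrow> bd S n B g \<Longrightarrow> bd S n (A + B) (\<lambda>x. f x + g x)"
proof (induction n arbitrary: f g)
  case 0
  then show ?case by (auto intro: abs_add_le)
next
  case (Suc n)
  from Suc.prems obtain f' g' where fg: "\<forall>x. (f has_field_derivative f' x) (at x)" "bd S n A f'"
    "\<forall>x. (g has_field_derivative g' x) (at x)" "bd S n B g'" by auto
  have 1: "\<forall>x\<in>S. \<bar>f x + g x\<bar> \<le> A + B" using bd_abs[OF Suc.prems(1)] bd_abs[OF Suc.prems(2)] by (auto intro: abs_add_le)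
  have 2: "\<forall>x. ((\<lambda>x. f x + g x) has_field_derivative f' x + g' x) (at x)" using fg by (auto intro: DERIV_add)
  have 3: "bd S n (A + B) (\<lambda>x. f' x + g' x)" by (rule Suc.IH[OF fg(2,4)])
  show ?case unfolding bd.simps(2)
    by (rule conjI[OF 1], rule exI[where x = "\<lambda>x. f' x + g' x"], rule conjI, rule 2, rule 3)
qed

text \<open>Leibniz rule; each differentiation doubles the number of products, whence 2^n.\<close>

lemma bd_mult:
  assumes "0 \<le> A" "0 \<le> B"
  shows "bd S n A f \<Longrightarrow> bd S n B g \<Longrightarrow> bd S n (2 ^ n * (A * B)) (\<lambda>x. f x * g x)"
proof (induction n arbitrary: f g)
  case 0
  then show ?case by (auto intro: abs_mult_le)
next
  case (Suc n)
  from Suc.prems obtain f' g' where fg: "\<forall>x. (f has_field_derivative f' x) (at x)" "bd S n A f'"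
    "\<forall>x. (g has_field_derivative g' x) (at x)" "bd S n B g'" by auto
  have 1: "\<forall>x\<in>S. \<bar>f x * g x\<bar> \<le> 2 ^ Suc n * (A * B)"
  proof
    fix x assume x: "x \<in> S"
    have "\<bar>f x * g x\<bar> \<le> 1 * (A * B)"
      using abs_mult_le[OF bd_abs[OF Suc.prems(1) x] bd_abs[OF Suc.prems(2) x]] by simp
    also have "\<dots> \<le> 2 ^ Suc n * (A * B)" using assms by (intro mult_right_mono one_le_power mult_nonneg_nonneg) auto
    finally show "\<bar>f x * g x\<bar> \<le> 2 ^ Suc n * (A * B)" .
  qed
  have 2: "\<forall>x. ((\<lambda>x. f x * g x) has_field_derivative f' x * g x + f x * g' x) (at x)"
    using DERIV_mult[OF fg(1)[rule_format] fg(3)[rule_format]] by (simp add: ac_simps)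
  have "bd S n (2 ^ n * (A * B) + 2 ^ n * (A * B)) (\<lambda>x. f' x * g x + f x * g' x)"
    by (rule bd_add[OF Suc.IH[OF fg(2) bd_Suc[OF Suc.prems(2)]] Suc.IH[OF bd_Suc[OF Suc.prems(1)] fg(4)]])
  moreover have "2 ^ n * (A * B) + 2 ^ n * (A * B) = 2 ^ Suc n * (A * B)" by simp
  ultimately have 3: "bd S n (2 ^ Suc n * (A * B)) (\<lambda>x. f' x * g x + f x * g' x)" by (simp only:)
  show ?case unfolding bd.simps(2)
    by (rule conjI[OF 1], rule exI[where x = "\<lambda>x. f' x * g x + f x * g' x"], rule conjI, rule 2, rule 3)
qed

lemma bd_const: "\<bar>c\<bar> \<le> B \<Longrightarrow> bd S n B (\<lambda>_. c)"
proof (induction n arbitrary: c)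
  case (Suc n)
  have "bd S n B (\<lambda>_. 0)" using Suc.prems by (intro Suc.IH) simp
  then show ?case unfolding bd.simps using Suc.prems by (intro conjI exI[of _ "\<lambda>_. 0"]) auto
qed simp

lemma bd_seq:
  assumes "\<And>i x. (w i has_field_derivative w (Suc i) x) (at x)" "\<And>i x. i \<le> m + n \<Longrightarrow> x \<in> S \<Longrightarrow> \<bar>w i x\<bar> \<le> B"
  shows "bd S n B (w m)"
  using assms(2)
proof (induction n arbitrary: m)
  case (Suc n)
  have "bd S n B (w (Suc m))" by (rule Suc.IH) (use Suc.prems in auto)
  then show ?case using assms(1) Suc.prems[of m] by auto
qed auto

text \<open>Induction through the primitive of the polynomial for f'. The bound on the top
  coefficient comes along because \<open>Jv\<close> is defined by it.\<close>

lemma bd_Taylor: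
  assumes "bd {a..b} (Suc n) B f" "a \<le> b"
  shows "\<exists>q. degree q \<le> n \<and> \<bar>coeff q n\<bar> \<le> B \<and> (\<forall>x\<in>{a..b}. \<bar>f x - poly q x\<bar> \<le> B * (x - a) ^ Suc n)"
  using assms(1)
proof (induction n arbitrary: f)
  case 0
  then obtain f' where f': "\<forall>x. (f has_field_derivative f' x) (at x)" "\<forall>x\<in>{a..b}. \<bar>f' x\<bar> \<le> B" by auto
  have "\<bar>f x - f a\<bar> \<le> B * (x - a)" if "x \<in> {a..b}" for x
    using MVT_abs[of a b f f' B x a] f' that assms(2) by auto
  moreover have "\<bar>f a\<bar> \<le> B" using 0 assms(2) by auto
  ultimately show ?case by (intro exI[of _ "[:f a:]"]) auto
next
  case (Suc n)
  from Suc.prems obtain f' where f': "\<And>x. (f has_field_derivative f' x) (at x)" "bd {a..b} (Suc n) B f'" by auto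
  from Suc.IH[OF f'(2)] obtain q where q: "degree q \<le> n" "\<bar>coeff q n\<bar> \<le> B"
    "\<And>x. x \<in> {a..b} \<Longrightarrow> \<bar>f' x - poly q x\<bar> \<le> B * (x - a) ^ Suc n" by auto
  let ?p = "pint q + [:f a - poly (pint q) a:]"
  have B0: "0 \<le> B" using q(2) by linarith
  have cp: "coeff (pint q) (Suc n) = coeff q n / real (Suc n)"
  proof -
    have "coeff (pderiv (pint q)) n = coeff q n" by (simp add: pderiv_pint)
    then show ?thesis by (simp add: coeff_pderiv field_simps)
  qed
  have "\<bar>coeff ?p (Suc n)\<bar> \<le> B"
  proof -
    have "\<bar>coeff q n\<bar> / real (Suc n) \<le> \<bar>coeff q n\<bar> / 1" by (intro divide_left_mono) auto
    then show ?thesis using q(2) cp by (simp add: abs_divide)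
  qed
  moreover have "degree ?p \<le> Suc n" using degree_pint_le[OF q(1)] by (intro degree_add_le) auto
  moreover have "\<bar>f x - poly ?p x\<bar> \<le> B * (x - a) ^ Suc (Suc n)" if x: "x \<in> {a..b}" for x
  proof -
    have "\<bar>(f x - poly ?p x) - (f a - poly ?p a)\<bar> \<le> (B * (x - a) ^ Suc n) * \<bar>x - a\<bar>"
    proof (rule MVT_abs[of a x])
      fix y assume y: "y \<in> {a..x}"
      show "((\<lambda>x. f x - poly ?p x) has_field_derivative f' y - poly (pderiv ?p) y) (at y)"
        by (intro DERIV_diff f' poly_DERIV)
      have "\<bar>f' y - poly q y\<bar> \<le> B * (y - a) ^ Suc n" using y x by (intro q(3)) auto
      also have "\<dots> \<le> B * (x - a) ^ Suc n" using y B0 by (intro mult_left_mono power_mono) auto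
      finally show "\<bar>f' y - poly (pderiv ?p) y\<bar> \<le> B * (x - a) ^ Suc n"
        by (simp add: pderiv_add pderiv_pint pderiv_pCons)
    qed (use x in auto)
    then show ?thesis using x by (simp add: ac_simps)
  qed
  ultimately show ?case by blast
qed

text \<open>Says that U behaves like a function with derivatives up to order n - 1 bounded by B,
  without asserting that those beyond \<open>R2\<close> exist. In this form the property survives
  uniform limits with the same bound.\<close>

definition smooth_approximable :: "real \<Rightarrow> real \<Rightarrow> nat \<Rightarrow> real \<Rightarrow> (real \<Rightarrow> real) \<Rightarrow> (real \<Rightarrow> real) \<Rightarrow> (real \<Rightarrow> real) \<Rightarrow> bool" where
  "smooth_approximable a b n B U R R2 \<longleftrightarrow> (\<forall>\<delta>>0. \<exists>w :: nat \<Rightarrow> real \<Rightarrow> real.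
     (\<forall>i x. (w i has_field_derivative w (Suc i) x) (at x)) \<and> (\<forall>i<n. \<forall>x\<in>{a..b}. \<bar>w i x\<bar> \<le> B) \<and>
     (\<forall>x\<in>{a..b}. \<bar>U x - w 0 x\<bar> \<le> \<delta> \<and> \<bar>R x - w 1 x\<bar> \<le> \<delta> \<and> \<bar>R2 x - w 2 x\<bar> \<le> \<delta>))"

lemma smooth_approximableE:
  assumes "smooth_approximable a b n B U R R2" "0 < \<delta>"
  obtains w :: "nat \<Rightarrow> real \<Rightarrow> real" where "\<And>i x. (w i has_field_derivative w (Suc i) x) (at x)"
    "\<And>i x. i < n \<Longrightarrow> x \<in> {a..b} \<Longrightarrow> \<bar>w i x\<bar> \<le> B"
    "\<And>x. x \<in> {a..b} \<Longrightarrow> \<bar>U x - w 0 x\<bar> \<le> \<delta>" "\<And>x. x \<in> {a..b} \<Longrightarrow> \<bar>R x - w 1 x\<bar> \<le> \<delta>"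
    "\<And>x. x \<in> {a..b} \<Longrightarrow> \<bar>R2 x - w 2 x\<bar> \<le> \<delta>"
proof -
  have "\<exists>w :: nat \<Rightarrow> real \<Rightarrow> real.
     (\<forall>i x. (w i has_field_derivative w (Suc i) x) (at x)) \<and> (\<forall>i<n. \<forall>x\<in>{a..b}. \<bar>w i x\<bar> \<le> B) \<and>
     (\<forall>x\<in>{a..b}. \<bar>U x - w 0 x\<bar> \<le> \<delta> \<and> \<bar>R x - w 1 x\<bar> \<le> \<delta> \<and> \<bar>R2 x - w 2 x\<bar> \<le> \<delta>)"
    by (rule assms(1)[unfolded smooth_approximable_def, THEN spec, THEN mp, OF assms(2)])
  then obtain w :: "nat \<Rightarrow> real \<Rightarrow> real" where w:
     "(\<forall>i x. (w i has_field_derivative w (Suc i) x) (at x)) \<and> (\<forall>i<n. \<forall>x\<in>{a..b}. \<bar>w i x\<bar> \<le> B) \<and>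
     (\<forall>x\<in>{a..b}. \<bar>U x - w 0 x\<bar> \<le> \<delta> \<and> \<bar>R x - w 1 x\<bar> \<le> \<delta> \<and> \<bar>R2 x - w 2 x\<bar> \<le> \<delta>)" ..
  note w1 = conjunct1[OF w] and w2 = conjunct1[OF conjunct2[OF w]] and w3 = conjunct2[OF conjunct2[OF w]]
  show thesis
  proof (rule that[of w])
    show "(w i has_field_derivative w (Suc i) x) (at x)" for i x by (rule w1[rule_format])
    show "\<bar>w i x\<bar> \<le> B" if "i < n" "x \<in> {a..b}" for i x by (rule w2[rule_format, OF that])
    show "\<bar>U x - w 0 x\<bar> \<le> \<delta>" "\<bar>R x - w 1 x\<bar> \<le> \<delta>" "\<bar>R2 x - w 2 x\<bar> \<le> \<delta>" if "x \<in> {a..b}" for x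
      using bspec[OF w3 that] by simp_all
  qed
qed

lemma smooth_approximable_limit:
  assumes "\<And>\<delta>. 0 < \<delta> \<Longrightarrow> \<exists>V S S2. smooth_approximable a b n B V S S2 \<and>
     (\<forall>x\<in>{a..b}. \<bar>U x - V x\<bar> \<le> \<delta> \<and> \<bar>R x - S x\<bar> \<le> \<delta> \<and> \<bar>R2 x - S2 x\<bar> \<le> \<delta>)"
  shows "smooth_approximable a b n B U R R2"
  unfolding smooth_approximable_def
proof (intro allI impI)
  fix \<delta> :: real assume d: "0 < \<delta>"
  then have d2: "0 < \<delta> / 2" by simp
  from assms[OF d2] obtain V S S2 where V: "smooth_approximable a b n B V S S2 \<and>
     (\<forall>x\<in>{a..b}. \<bar>U x - V x\<bar> \<le> \<delta> / 2 \<and> \<bar>R x - S x\<bar> \<le> \<delta> / 2 \<and> \<bar>R2 x - S2 x\<bar> \<le> \<delta> / 2)"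
    by (elim exE)
  obtain w :: "nat \<Rightarrow> real \<Rightarrow> real" where w: "\<And>i x. (w i has_field_derivative w (Suc i) x) (at x)"
    "\<And>i x. i < n \<Longrightarrow> x \<in> {a..b} \<Longrightarrow> \<bar>w i x\<bar> \<le> B"
    "\<And>x. x \<in> {a..b} \<Longrightarrow> \<bar>V x - w 0 x\<bar> \<le> \<delta> / 2" "\<And>x. x \<in> {a..b} \<Longrightarrow> \<bar>S x - w 1 x\<bar> \<le> \<delta> / 2"
    "\<And>x. x \<in> {a..b} \<Longrightarrow> \<bar>S2 x - w 2 x\<bar> \<le> \<delta> / 2"
    by (rule smooth_approximableE[OF conjunct1[OF V] d2]) (rule that)
  have tr: "\<bar>x - y\<bar> \<le> \<delta> / 2 \<Longrightarrow> \<bar>y - z\<bar> \<le> \<delta> / 2 \<Longrightarrow> \<bar>x - z\<bar> \<le> \<delta>" for x y z :: real by linarith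
  show "\<exists>w. (\<forall>i x. (w i has_field_derivative w (Suc i) x) (at x)) \<and> (\<forall>i<n. \<forall>x\<in>{a..b}. \<bar>w i x\<bar> \<le> B) \<and>
     (\<forall>x\<in>{a..b}. \<bar>U x - w 0 x\<bar> \<le> \<delta> \<and> \<bar>R x - w 1 x\<bar> \<le> \<delta> \<and> \<bar>R2 x - w 2 x\<bar> \<le> \<delta>)"
  proof (rule exI[where x = w], intro conjI allI ballI impI)
    show "(w i has_field_derivative w (Suc i) x) (at x)" for i x by (rule w(1))
    show "\<bar>w i x\<bar> \<le> B" if "i < n" "x \<in> {a..b}" for i x by (rule w(2)[OF that])
    fix x assume x: "x \<in> {a..b}"
    have V3: "\<bar>U x - V x\<bar> \<le> \<delta> / 2" "\<bar>R x - S x\<bar> \<le> \<delta> / 2" "\<bar>R2 x - S2 x\<bar> \<le> \<delta> / 2"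
      using bspec[OF conjunct2[OF V] x] by simp_all
    show "\<bar>U x - w 0 x\<bar> \<le> \<delta>" by (rule tr[OF V3(1) w(3)[OF x]])
    show "\<bar>R x - w 1 x\<bar> \<le> \<delta>" by (rule tr[OF V3(2) w(4)[OF x]])
    show "\<bar>R2 x - w 2 x\<bar> \<le> \<delta>" by (rule tr[OF V3(3) w(5)[OF x]])
  qed
qed

lemma smooth_approximable_bounds:
  assumes s: "smooth_approximable a b n B U R R2" and n: "3 \<le> n" and x: "x \<in> {a..b}"
  shows "\<bar>U x\<bar> \<le> B + 1" "\<bar>R x\<bar> \<le> B + 1" "\<bar>R2 x\<bar> \<le> B + 1"
proof -
  obtain w :: "nat \<Rightarrow> real \<Rightarrow> real" where w: "\<And>i x. (w i has_field_derivative w (Suc i) x) (at x)"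
    "\<And>i x. i < n \<Longrightarrow> x \<in> {a..b} \<Longrightarrow> \<bar>w i x\<bar> \<le> B"
    "\<And>x. x \<in> {a..b} \<Longrightarrow> \<bar>U x - w 0 x\<bar> \<le> 1" "\<And>x. x \<in> {a..b} \<Longrightarrow> \<bar>R x - w 1 x\<bar> \<le> 1"
    "\<And>x. x \<in> {a..b} \<Longrightarrow> \<bar>R2 x - w 2 x\<bar> \<le> 1"
    by (rule smooth_approximableE[OF s zero_less_one]) (rule that)
  have tr: "\<bar>y\<bar> \<le> B \<Longrightarrow> \<bar>z - y\<bar> \<le> 1 \<Longrightarrow> \<bar>z\<bar> \<le> B + 1" for y z :: real by linarith
  show "\<bar>U x\<bar> \<le> B + 1" using n by (intro tr[OF w(2)[OF _ x] w(3)[OF x]]) simp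
  show "\<bar>R x\<bar> \<le> B + 1" using n by (intro tr[OF w(2)[OF _ x] w(4)[OF x]]) simp
  show "\<bar>R2 x\<bar> \<le> B + 1" using n by (intro tr[OF w(2)[OF _ x] w(5)[OF x]]) simp
qed

text \<open>Follows literally the way \<open>bd_add\<close> and \<open>bd_mult\<close> bound the
  expression \<open>?W\<close> in \<open>approx_Pi\<close>.\<close>

definition CP :: "nat \<Rightarrow> real \<Rightarrow> real" where
  "CP k B = (let C = 2 ^ k * (2 ^ k * (B * B) * B) in C + (C + C) + 2 ^ k * (1 * C))"

lemma CP_nonneg: "0 \<le> B \<Longrightarrow> 0 \<le> CP k B"
  by (simp add: CP_def Let_def)

text \<open>One number for all demands of \<open>dg_data\<close>: 2(B+1) for the approximation of R,
  \<open>CP\<close> and 12(B+1)^2 for that of the second-order flux, and 1 for the normalisation G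
  \<ge> 1.\<close>

definition GG :: "nat \<Rightarrow> real \<Rightarrow> real" where
  "GG k B = 2 * (B + 1) + CP k B + 12 * (B + 1)\<^sup>2 + 1"

lemma GG_ge:
  assumes "0 \<le> B"
  shows "B + 1 \<le> GG k B" "1 \<le> GG k B"
proof -
  have "0 \<le> 12 * (B + 1)\<^sup>2" by simp
  moreover have "b + 1 \<le> 2 * (b + 1) + c + d + 1" "1 \<le> 2 * (b + 1) + c + d + 1" if "0 \<le> b" "0 \<le> c" "0 \<le> d" for b c d :: real
    using that by auto
  ultimately show "B + 1 \<le> GG k B" "1 \<le> GG k B" using assms CP_nonneg[OF assms, of k] unfolding GG_def by blast+
qed

context dg_mesh
begin

lemma approx_R:
  assumes s: "smooth_approximable xl xr (k + 3) B U R R2" and B: "0 \<le> B"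
    and U: "\<And>x. (U has_field_derivative R x) (at x)" and R: "continuous_on UNIV R"
  shows "\<exists>q. fam q \<and> (\<forall>j\<in>{1..N}. (\<forall>x\<in>{X (j - 1)..X j}. \<bar>R x - poly (q j) x\<bar> \<le> GG k B * h ^ (k + 1)) \<and>
      \<bar>coeff (q j) k\<bar> \<le> GG k B \<and> cint j (poly (q j)) = U (X j) - U (X (j - 1)))"
proof -
  have hp: "0 < h ^ (k + 1)" using h_pos by simp
  obtain w :: "nat \<Rightarrow> real \<Rightarrow> real" where w: "\<And>i x. (w i has_field_derivative w (Suc i) x) (at x)"
    "\<And>i x. i < k + 3 \<Longrightarrow> x \<in> {xl..xr} \<Longrightarrow> \<bar>w i x\<bar> \<le> B"
    "\<And>x. x \<in> {xl..xr} \<Longrightarrow> \<bar>U x - w 0 x\<bar> \<le> h ^ (k + 1)" "\<And>x. x \<in> {xl..xr} \<Longrightarrow> \<bar>R x - w 1 x\<bar> \<le> h ^ (k + 1)"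
    "\<And>x. x \<in> {xl..xr} \<Longrightarrow> \<bar>R2 x - w 2 x\<bar> \<le> h ^ (k + 1)"
    by (rule smooth_approximableE[OF s hp]) (rule that)
  have GB: "2 * (B + 1) \<le> GG k B" "B \<le> GG k B" unfolding GG_def using B CP_nonneg[OF B, of k] by auto
  have "\<exists>p. degree p \<le> k \<and> (\<forall>x\<in>{X (j - 1)..X j}. \<bar>R x - poly p x\<bar> \<le> GG k B * h ^ (k + 1)) \<and>
      \<bar>coeff p k\<bar> \<le> GG k B \<and> cint j (poly p) = U (X j) - U (X (j - 1))" if j: "j \<in> {1..N}" for j
  proof -
    have sub: "x \<in> {X (j - 1)..X j} \<Longrightarrow> x \<in> {xl..xr}" for x by (rule cell_subset[OF j])
    have l: "0 < len j" by (rule len_pos[OF j])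
    have "bd {X (j - 1)..X j} (Suc k) B (w 1)"
      by (rule bd_seq[where w = w, OF w(1)]) (rule w(2), simp, rule sub)
    from bd_Taylor[OF this X_le[OF j]] obtain q where q: "degree q \<le> k" "\<bar>coeff q k\<bar> \<le> B"
      "\<forall>x\<in>{X (j - 1)..X j}. \<bar>w 1 x - poly q x\<bar> \<le> B * (x - X (j - 1)) ^ Suc k" by blast
    have Rq: "\<bar>R x - poly q x\<bar> \<le> (B + 1) * h ^ (k + 1)" if x: "x \<in> {X (j - 1)..X j}" for x
    proof -
      have "B * (x - X (j - 1)) ^ Suc k \<le> B * h ^ Suc k"
        using x B len_le_h[OF j] by (intro mult_left_mono power_mono) (auto simp: len_def)
      with bspec[OF q(3) x] have "\<bar>w 1 x - poly q x\<bar> \<le> B * h ^ Suc k" by (rule order.trans)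
      then have "\<bar>w 1 x - poly q x\<bar> \<le> B * h ^ (k + 1)" by (simp only: Suc_eq_plus1)
      moreover have "\<bar>R x - w 1 x\<bar> \<le> h ^ (k + 1)" by (rule w(4)[OF sub[OF x]])
      ultimately show ?thesis unfolding distrib_right by linarith
    qed
    \<comment> \<open>Adding the mean of R - q makes the integral over the cell exact. The pointwise
      error at most doubles, and as k \<ge> 1 the top coefficient is unchanged.\<close>
    define c where "c = cint j (\<lambda>x. R x - poly q x) / len j"
    have cR: "continuous_on S R" for S using R continuous_on_subset by blast
    have "\<bar>cint j (\<lambda>x. R x - poly q x)\<bar> \<le> (B + 1) * h ^ (k + 1) * len j"
      by (rule cint_abs_le[OF j]) (intro continuous_intros cR, rule Rq)
    then have c: "\<bar>c\<bar> \<le> (B + 1) * h ^ (k + 1)" using l by (simp add: c_def abs_divide divide_le_eq)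
    let ?p = "q + [:c:]"
    have UR: "cint j R = U (X j) - U (X (j - 1))"
      by (intro integral_unique fundamental_theorem_of_calculus X_le[OF j])
        (auto intro!: has_field_derivative_at_within U simp flip: has_real_derivative_iff_has_vector_derivative)
    have "cint j (poly ?p) = cint j (\<lambda>x. poly q x + c)" by (intro integral_cong) simp
    also have "\<dots> = cint j (poly q) + c * len j"
      using X_le[OF j] by (subst cint_add) (auto intro!: continuous_intros simp: len_def)
    also have "c * len j = cint j R - cint j (poly q)"
      using l by (simp add: c_def cint_diff cR continuous_intros)
    finally have "cint j (poly ?p) = cint j (poly q) + (cint j R - cint j (poly q))" .
    then have "cint j (poly ?p) = U (X j) - U (X (j - 1))" unfolding UR by linarith
    moreover have "\<bar>R x - poly ?p x\<bar> \<le> GG k B * h ^ (k + 1)" if x: "x \<in> {X (j - 1)..X j}" for x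
    proof -
      have "\<bar>R x - poly ?p x\<bar> \<le> 2 * ((B + 1) * h ^ (k + 1))" using Rq[OF x] c by simp
      also have "\<dots> \<le> GG k B * h ^ (k + 1)" using mult_right_mono[OF GB(1) less_imp_le[OF hp]] by (simp only: mult.assoc)
      finally show ?thesis .
    qed
    moreover have "degree ?p \<le> k" using q(1) by (intro degree_add_le) auto
    moreover have "coeff ?p k = coeff q k" using k1 by (simp add: coeff_pCons split: nat.splits)
    ultimately show ?thesis using q(2) GB(2) by (intro exI[of _ ?p]) auto
  qed
  then have "\<exists>q. \<forall>j\<in>{1..N}. degree (q j) \<le> k \<and> (\<forall>x\<in>{X (j - 1)..X j}. \<bar>R x - poly (q j) x\<bar> \<le> GG k B * h ^ (k + 1)) \<and>
      \<bar>coeff (q j) k\<bar> \<le> GG k B \<and> cint j (poly (q j)) = U (X j) - U (X (j - 1))"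
    by (intro bchoice) blast
  then show ?thesis unfolding fam_def by blast
qed

text \<open>\<open>R2\<close> is represented by \<open>w 2\<close>, which has only k further bounded
  derivatives; the Taylor polynomial has degree k - 1 and the order is k.\<close>

lemma approx_Pi:
  assumes s: "smooth_approximable xl xr (k + 3) B U R R2" and B: "0 \<le> B"
  shows "\<exists>q. fam q \<and> (\<forall>j\<in>{1..N}. \<forall>x\<in>{X (j - 1)..X j}.
     \<bar>((U x)\<^sup>2 * R2 x + 2 * U x * (R x)\<^sup>2 - (R x)\<^sup>2 * R2 x) - poly (q j) x\<bar> \<le> GG k B * h ^ k)"
proof -
  \<comment> \<open>The 1 keeps the perturbed functions below B + 1, the other entry keeps the
    perturbation within the target order.\<close>
  define \<delta> where "\<delta> = min 1 (h ^ k)"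
  have d: "0 < \<delta>" "\<delta> \<le> 1" "\<delta> \<le> h ^ k" using zero_less_power[OF h_pos, of k] by (auto simp: \<delta>_def)
  obtain w :: "nat \<Rightarrow> real \<Rightarrow> real" where w: "\<And>i x. (w i has_field_derivative w (Suc i) x) (at x)"
    "\<And>i x. i < k + 3 \<Longrightarrow> x \<in> {xl..xr} \<Longrightarrow> \<bar>w i x\<bar> \<le> B"
    "\<And>x. x \<in> {xl..xr} \<Longrightarrow> \<bar>U x - w 0 x\<bar> \<le> \<delta>" "\<And>x. x \<in> {xl..xr} \<Longrightarrow> \<bar>R x - w 1 x\<bar> \<le> \<delta>"
    "\<And>x. x \<in> {xl..xr} \<Longrightarrow> \<bar>R2 x - w 2 x\<bar> \<le> \<delta>"
    by (rule smooth_approximableE[OF s d(1)]) (rule that)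
  let ?C = "2 ^ k * (2 ^ k * (B * B) * B)"
  let ?W = "\<lambda>x. w 0 x * w 0 x * w 2 x + (w 0 x * w 1 x * w 1 x + w 0 x * w 1 x * w 1 x) + - 1 * (w 1 x * w 1 x * w 2 x)"
  obtain n where n: "k = Suc n" using Suc_le_D[OF k1[unfolded One_nat_def]] by blast
  have "\<exists>p. degree p \<le> k \<and> (\<forall>x\<in>{X (j - 1)..X j}.
     \<bar>((U x)\<^sup>2 * R2 x + 2 * U x * (R x)\<^sup>2 - (R x)\<^sup>2 * R2 x) - poly p x\<bar> \<le> GG k B * h ^ k)" if j: "j \<in> {1..N}" for j
  proof -
    have sub: "x \<in> {X (j - 1)..X j} \<Longrightarrow> x \<in> {xl..xr}" for x by (rule cell_subset[OF j])
    let ?S = "{X (j - 1)..X j}"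
    have b: "bd ?S k B (w 0)" "bd ?S k B (w 1)" "bd ?S k B (w 2)"
    proof -
      have m: "bd ?S k B (w m)" if "m \<le> 2" for m
      proof (rule bd_seq[where w = w])
        show "(w i has_field_derivative w (Suc i) x) (at x)" for i x by (rule w(1))
        show "\<bar>w i x\<bar> \<le> B" if "i \<le> m + k" "x \<in> ?S" for i x
          by (rule w(2)[OF _ sub[OF that(2)]]) (use that(1) \<open>m \<le> 2\<close> in simp)
      qed
      show "bd ?S k B (w 0)" "bd ?S k B (w 1)" "bd ?S k B (w 2)" by (rule m; simp)+
    qed
    have nn: "0 \<le> 2 ^ k * (B * B)" "0 \<le> ?C" using B by auto
    have m1: "bd ?S k 1 (\<lambda>x. - 1)" by (rule bd_const) simp
    have "bd ?S k (?C + (?C + ?C) + 2 ^ k * (1 * ?C)) ?W"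
      by (intro bd_add bd_mult b m1 nn B zero_le_one)
    then have "bd ?S (Suc n) (?C + (?C + ?C) + 2 ^ k * (1 * ?C)) ?W" using n by simp
    from bd_Taylor[OF this X_le[OF j]] obtain p where p: "degree p \<le> n"
      "\<forall>x\<in>?S. \<bar>?W x - poly p x\<bar> \<le> CP k B * (x - X (j - 1)) ^ Suc n"
      unfolding CP_def Let_def by blast
    show ?thesis
    proof (intro exI[of _ p] conjI ballI)
      show "degree p \<le> k" using p(1) n by simp
      fix x assume x: "x \<in> ?S"
      have wB: "\<bar>w 0 x\<bar> \<le> B" "\<bar>w 1 x\<bar> \<le> B" "\<bar>w 2 x\<bar> \<le> B" by (rule w(2)[OF _ sub[OF x]], simp)+
      have e: "\<bar>U x - w 0 x\<bar> \<le> \<delta>" "\<bar>R x - w 1 x\<bar> \<le> \<delta>" "\<bar>R2 x - w 2 x\<bar> \<le> \<delta>" by (rule w(3-5)[OF sub[OF x]])+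
      have wB1: "\<bar>w 0 x\<bar> \<le> B + 1" "\<bar>w 1 x\<bar> \<le> B + 1" "\<bar>w 2 x\<bar> \<le> B + 1" using wB by auto
      have UB: "\<bar>U x\<bar> \<le> B + 1" using wB(1) e(1) d(2) by linarith
      have RB: "\<bar>R x\<bar> \<le> B + 1" using wB(2) e(2) d(2) by linarith
      have R2B: "\<bar>R2 x\<bar> \<le> B + 1" using wB(3) e(3) d(2) by linarith
      have t1: "\<bar>U x * U x * R2 x - w 0 x * w 0 x * w 2 x\<bar> \<le> 3 * (B + 1)\<^sup>2 * \<delta>"
        by (intro prod3_diff UB RB R2B wB1 e)
      have t2: "\<bar>U x * R x * R x - w 0 x * w 1 x * w 1 x\<bar> \<le> 3 * (B + 1)\<^sup>2 * \<delta>"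
        by (intro prod3_diff UB RB R2B wB1 e)
      have t3: "\<bar>R x * R x * R2 x - w 1 x * w 1 x * w 2 x\<bar> \<le> 3 * (B + 1)\<^sup>2 * \<delta>"
        by (intro prod3_diff UB RB R2B wB1 e)
      have Pd: "((U x)\<^sup>2 * R2 x + 2 * U x * (R x)\<^sup>2 - (R x)\<^sup>2 * R2 x) - poly p x
        = (U x * U x * R2 x - w 0 x * w 0 x * w 2 x) + 2 * (U x * R x * R x - w 0 x * w 1 x * w 1 x)
         - (R x * R x * R2 x - w 1 x * w 1 x * w 2 x) + (?W x - poly p x)"
        by (simp add: power2_eq_square algebra_simps)
      have "CP k B * (x - X (j - 1)) ^ Suc n \<le> CP k B * h ^ k"
        unfolding n[symmetric] using x CP_nonneg[OF B] len_le_h[OF j]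
        by (intro mult_left_mono power_mono) (auto simp: len_def)
      then have tw: "\<bar>?W x - poly p x\<bar> \<le> CP k B * h ^ k" by (rule order.trans[OF bspec[OF p(2) x]])
      have four: "\<bar>a + 2 * b - c + w\<bar> \<le> 4 * K + K'" if "\<bar>a\<bar> \<le> K" "\<bar>b\<bar> \<le> K" "\<bar>c\<bar> \<le> K" "\<bar>w\<bar> \<le> K'" for a b c w K K' :: real
        using that by linarith
      have "\<bar>((U x)\<^sup>2 * R2 x + 2 * U x * (R x)\<^sup>2 - (R x)\<^sup>2 * R2 x) - poly p x\<bar> \<le> 4 * (3 * (B + 1)\<^sup>2 * \<delta>) + CP k B * h ^ k"
        unfolding Pd by (rule four[OF t1 t2 t3 tw])
      also have "\<dots> \<le> 12 * (B + 1)\<^sup>2 * h ^ k + CP k B * h ^ k"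
        using mult_left_mono[OF d(3), of "12 * (B + 1)\<^sup>2"] by simp
      also have "\<dots> = (12 * (B + 1)\<^sup>2 + CP k B) * h ^ k" by (simp only: distrib_right)
      also have "\<dots> \<le> GG k B * h ^ k"
        unfolding GG_def using B h_pos by (intro mult_right_mono) auto
      finally show "\<bar>((U x)\<^sup>2 * R2 x + 2 * U x * (R x)\<^sup>2 - (R x)\<^sup>2 * R2 x) - poly p x\<bar> \<le> GG k B * h ^ k" .
    qed
  qed
  then have "\<exists>q. \<forall>j\<in>{1..N}. degree (q j) \<le> k \<and> (\<forall>x\<in>{X (j - 1)..X j}.
     \<bar>((U x)\<^sup>2 * R2 x + 2 * U x * (R x)\<^sup>2 - (R x)\<^sup>2 * R2 x) - poly (q j) x\<bar> \<le> GG k B * h ^ k)"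
    by (intro bchoice) blast
  then show ?thesis unfolding fam_def by blast
qed

end

text \<open>A continuation argument: the differential inequality is known only while Q stays below
  \<open>\<eta>\<close>. At the first contact with that level, Gronwall's inequality on the
  preceding interval contradicts \<open>bar\<close>.\<close>

lemma gronwall_barrier:
  fixes Q Q' :: "real \<Rightarrow> real"
  assumes T: "0 < T" and cQ: "continuous_on {0..T} Q"
    and dQ: "\<And>t. 0 < t \<Longrightarrow> t < T \<Longrightarrow> (Q has_field_derivative Q' t) (at t)"
    and bQ: "\<And>t. 0 < t \<Longrightarrow> t < T \<Longrightarrow> Q t \<le> \<eta> \<Longrightarrow> Q' t \<le> C * (Q t + \<epsilon>)"
    and C: "0 \<le> C" and \<epsilon>: "0 \<le> \<epsilon>" "0 \<le> Q 0" and bar: "(Q 0 + \<epsilon>) * exp (C * T) < \<eta>" and t: "t \<in> {0..T}"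
  shows "Q t \<le> \<eta>" "Q t + \<epsilon> \<le> (Q 0 + \<epsilon>) * exp (C * T)"
proof -
  have step: "Q s + \<epsilon> \<le> (Q 0 + \<epsilon>) * exp (C * T)" if s: "s \<in> {0..T}" and le: "\<And>r. 0 \<le> r \<Longrightarrow> r < s \<Longrightarrow> Q r \<le> \<eta>" for s
  proof -
    let ?w = "\<lambda>r. (Q r + \<epsilon>) * exp (- (C * r))"
    have "?w s \<le> ?w 0"
    proof (rule DERIV_nonpos_imp_decreasing_open[where f = ?w])
      fix r assume r: "0 < r" "r < s"
      have "(?w has_field_derivative (Q' r - C * (Q r + \<epsilon>)) * exp (- (C * r))) (at r)"
        using dQ[of r] r s by (auto intro!: derivative_eq_intros simp: algebra_simps)
      moreover have "(Q' r - C * (Q r + \<epsilon>)) * exp (- (C * r)) \<le> 0"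
        using bQ[of r] le[of r] r s by (intro mult_nonpos_nonneg) auto
      ultimately show "\<exists>y. (?w has_field_derivative y) (at r) \<and> y \<le> 0" by blast
    next
      show "continuous_on {0..s} ?w"
        using s by (intro continuous_intros continuous_on_subset[OF cQ]) auto
    qed (use s in auto)
    then have "(Q s + \<epsilon>) * exp (- (C * s)) * exp (C * s) \<le> (Q 0 + \<epsilon>) * exp (C * s)"
      by (intro mult_right_mono) auto
    then have "Q s + \<epsilon> \<le> (Q 0 + \<epsilon>) * exp (C * s)" by (simp add: mult.assoc flip: exp_add)
    also have "\<dots> \<le> (Q 0 + \<epsilon>) * exp (C * T)" using s C \<epsilon> by (intro mult_left_mono) (auto intro: mult_left_mono)
    finally show ?thesis .
  qed
  have all: "Q s < \<eta>" if s: "s \<in> {0..T}" for s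
  proof (rule ccontr)
    assume "\<not> Q s < \<eta>"
    define S where "S = {r \<in> {0..T}. \<eta> \<le> Q r}"
    have sS: "s \<in> S" using s \<open>\<not> Q s < \<eta>\<close> by (simp add: S_def)
    have "S = {0..T} \<inter> Q -` {\<eta>..}" by (auto simp: S_def)
    then have "closed S" using continuous_closed_preimage[OF cQ closed_atLeastAtMost closed_atLeast] by simp
    moreover have bb: "bdd_below S" unfolding S_def by (rule bdd_belowI[of _ 0]) auto
    ultimately have i: "Inf S \<in> S" using sS by (intro closed_contains_Inf) auto
    have "Q r \<le> \<eta>" if "0 \<le> r" "r < Inf S" for r
    proof (rule ccontr)
      assume "\<not> Q r \<le> \<eta>"
      then have "r \<in> S" using that i by (auto simp: S_def)
      then have "Inf S \<le> r" by (rule cInf_lower[OF _ bb])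
      then show False using that by simp
    qed
    then have "Q (Inf S) + \<epsilon> \<le> (Q 0 + \<epsilon>) * exp (C * T)" using i by (intro step) (auto simp: S_def)
    then show False using i bar \<epsilon> by (auto simp: S_def)
  qed
  show "Q t \<le> \<eta>" using all[OF t] by simp
  show "Q t + \<epsilon> \<le> (Q 0 + \<epsilon>) * exp (C * T)"
    by (rule step[OF t]) (use all t in \<open>auto intro: less_imp_le\<close>)
qed

text \<open>Values at k+1 points determine the polynomial linearly, so pointwise continuity or
  differentiability in time passes to linear functionals of the cell polynomials.\<close>

lemma lagrange_basis:
  fixes x :: "nat \<Rightarrow> real"
  assumes inj: "inj_on x {..k}"
  obtains l :: "nat \<Rightarrow> real poly" where "\<And>i. i \<le> k \<Longrightarrow> degree (l i) \<le> k"
    "\<And>p. degree p \<le> k \<Longrightarrow> p = (\<Sum>i\<le>k. smult (poly p (x i)) (l i))"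
proof -
  define l where "l i = (\<Prod>m\<in>{..k} - {i}. smult (1 / (x i - x m)) [:- x m, 1:])" for i
  have deg: "degree (l i) \<le> k" if "i \<le> k" for i
  proof -
    have "degree (l i) \<le> sum (degree \<circ> (\<lambda>m. smult (1 / (x i - x m)) [:- x m, 1:])) ({..k} - {i})"
      unfolding l_def by (rule degree_prod_sum_le) simp
    also have "\<dots> \<le> (\<Sum>m\<in>{..k} - {i}. 1)"
      unfolding o_def by (intro sum_mono order.trans[OF degree_smult_le]) simp
    also have "\<dots> = k" using that by simp
    finally show ?thesis .
  qed
  have val: "poly (l i) (x m) = (if i = m then 1 else 0)" if "i \<le> k" "m \<le> k" for i m
  proof (cases "i = m")
    case True
    have "x i - x n \<noteq> 0" if "n \<in> {..k} - {i}" for n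
      using inj that \<open>i \<le> k\<close> by (auto simp: inj_on_def)
    then have "(\<Prod>n\<in>{..k} - {i}. poly (smult (1 / (x i - x n)) [:- x n, 1:]) (x i)) = (\<Prod>n\<in>{..k} - {i}. 1)"
      by (intro prod.cong refl) (simp add: diff_divide_distrib[symmetric])
    then show ?thesis using True by (simp add: l_def poly_prod)
  next
    case False
    then have "(\<Prod>n\<in>{..k} - {i}. poly (smult (1 / (x i - x n)) [:- x n, 1:]) (x m)) = 0"
      using that by (intro prod_zero) (auto intro!: bexI[of _ m])
    then show ?thesis using False by (simp add: l_def poly_prod)
  qed
  have "p = (\<Sum>i\<le>k. smult (poly p (x i)) (l i))" if p: "degree p \<le> k" for p
  proof (rule poly_eqI_degree[of "x ` {..k}"])
    fix y assume "y \<in> x ` {..k}"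
    then obtain m where m: "m \<le> k" "y = x m" by auto
    have "poly (\<Sum>i\<le>k. smult (poly p (x i)) (l i)) y = (\<Sum>i\<le>k. if i = m then poly p (x i) else 0)"
      unfolding poly_sum m(2) by (intro sum.cong) (auto simp: val m(1))
    then show "poly p y = poly (\<Sum>i\<le>k. smult (poly p (x i)) (l i)) y" using m by simp
  next
    have c: "card (x ` {..k}) = Suc k" using card_image[OF inj] by simp
    show "degree p < card (x ` {..k})" using p c by simp
    have "degree (\<Sum>i\<le>k. smult (poly p (x i)) (l i)) \<le> k"
      by (intro degree_sum_le order.trans[OF degree_smult_le] deg) auto
    then show "degree (\<Sum>i\<le>k. smult (poly p (x i)) (l i)) < card (x ` {..k})" using c by simp
  qed
  then show thesis using that deg by blast
qed

context dg_mesh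
begin

lemma energy_continuous:
  assumes z: "\<And>t. t \<in> S \<Longrightarrow> fam (z t)" and c: "\<And>e. e \<in> idx \<Longrightarrow> continuous_on S (\<lambda>t. aform (z t) (phi e))"
  shows "continuous_on S (\<lambda>t. aform (z t) (z t))"
proof -
  obtain c' where "\<And>e f. c' e f = c' f e"
    "\<And>z e. fam z \<Longrightarrow> e \<in> idx \<Longrightarrow> cf z e = (\<Sum>f\<in>idx. c' e f * aform z (phi f))"
    and c': "\<And>z. fam z \<Longrightarrow> aform z z = (\<Sum>e\<in>idx. \<Sum>f\<in>idx. c' e f * (aform z (phi e) * aform z (phi f)))"
    by (rule energy_quadratic_form) (rule that)
  have "continuous_on S (\<lambda>t. \<Sum>e\<in>idx. \<Sum>f\<in>idx. c' e f * (aform (z t) (phi e) * aform (z t) (phi f)))"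
    by (intro continuous_intros c)
  then show ?thesis by (rule continuous_on_eq) (use c' z in auto)
qed

text \<open>In terms of the moments a(z, phi e) the energy is a quadratic form with constant
  symmetric coefficients. Differentiating the moments is enough, and symmetry merges the two
  product-rule terms.\<close>

lemma energy_derivative:
  assumes z: "\<And>t. t \<in> S \<Longrightarrow> fam (z t)" and S: "open S" "t \<in> S"
    and d: "\<And>e. e \<in> idx \<Longrightarrow> ((\<lambda>t. aform (z t) (phi e)) has_field_derivative b e) (at t)"
  shows "((\<lambda>t. aform (z t) (z t)) has_field_derivative 2 * (\<Sum>e\<in>idx. cf (z t) e * b e)) (at t)"
proof -
  obtain c where cs: "\<And>e f. c e f = c f e"
    and c1: "\<And>z e. fam z \<Longrightarrow> e \<in> idx \<Longrightarrow> cf z e = (\<Sum>f\<in>idx. c e f * aform z (phi f))"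
    and c2: "\<And>z. fam z \<Longrightarrow> aform z z = (\<Sum>e\<in>idx. \<Sum>f\<in>idx. c e f * (aform z (phi e) * aform z (phi f)))"
    by (rule energy_quadratic_form) (rule that)
  let ?b = "\<lambda>e. aform (z t) (phi e)"
  have "((\<lambda>t. \<Sum>e\<in>idx. \<Sum>f\<in>idx. c e f * (aform (z t) (phi e) * aform (z t) (phi f))) has_field_derivative
      (\<Sum>e\<in>idx. \<Sum>f\<in>idx. c e f * (b e * ?b f + b f * ?b e))) (at t)"
    by (intro DERIV_sum DERIV_cmult DERIV_mult d)
  also have "(\<Sum>e\<in>idx. \<Sum>f\<in>idx. c e f * (b e * ?b f + b f * ?b e))
    = (\<Sum>e\<in>idx. \<Sum>f\<in>idx. c e f * (b e * ?b f)) + (\<Sum>e\<in>idx. \<Sum>f\<in>idx. c e f * (b f * ?b e))"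
    by (simp only: distrib_left sum.distrib)
  also have "(\<Sum>e\<in>idx. \<Sum>f\<in>idx. c e f * (b f * ?b e)) = (\<Sum>e\<in>idx. \<Sum>f\<in>idx. c e f * (b e * ?b f))"
    by (subst sum.swap) (simp only: cs[symmetric])
  also have "(\<Sum>e\<in>idx. \<Sum>f\<in>idx. c e f * (b e * ?b f)) = (\<Sum>e\<in>idx. cf (z t) e * b e)"
    by (intro sum.cong refl) (simp add: c1[OF z[OF S(2)]] sum_distrib_left sum_distrib_right ac_simps)
  finally have "((\<lambda>t. \<Sum>e\<in>idx. \<Sum>f\<in>idx. c e f * (aform (z t) (phi e) * aform (z t) (phi f))) has_field_derivative
      2 * (\<Sum>e\<in>idx. cf (z t) e * b e)) (at t)" by simp
  then show ?thesis
    by (rule has_field_derivative_transform_within_open[OF _ S]) (simp add: c2[OF z])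
qed

end

section \<open>The scheme in terms of polynomial families\<close>

context dg_mesh
begin

definition reps :: "(real \<Rightarrow> real) \<Rightarrow> (nat \<Rightarrow> real poly) \<Rightarrow> bool" where
  "reps v P \<longleftrightarrow> fam P \<and> (\<forall>j\<in>{1..N}. \<forall>x\<in>cell X j. v x = poly (P j) x)"

text \<open>A function with prescribed cell polynomials, to be inserted as a test function of the
  scheme; inside cell j the least index with x < X j is j.\<close>

definition fn :: "(nat \<Rightarrow> real poly) \<Rightarrow> real \<Rightarrow> real" where
  "fn P x = poly (P (LEAST j. x < X j)) x"

lemma reps_fam: "reps v P \<Longrightarrow> fam P"
  by (simp add: reps_def)

lemma reps_degree: "reps v P \<Longrightarrow> j \<in> {1..N} \<Longrightarrow> degree (P j) \<le> k"
  by (auto simp: reps_def fam_def)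

lemma repsD: "reps v P \<Longrightarrow> j \<in> {1..N} \<Longrightarrow> x \<in> cell X j \<Longrightarrow> v x = poly (P j) x"
  by (auto simp: reps_def)

lemma Vh_reps: "v \<in> Vh k N X \<Longrightarrow> \<exists>P. reps v P"
proof -
  assume "v \<in> Vh k N X"
  then have "\<forall>j\<in>{1..N}. \<exists>q. degree q \<le> k \<and> (\<forall>x\<in>cell X j. v x = poly q x)" by (simp add: Vh_def)
  from bchoice[OF this] obtain P where "\<forall>j\<in>{1..N}. degree (P j) \<le> k \<and> (\<forall>x\<in>cell X j. v x = poly (P j) x)" ..
  then show ?thesis by (intro exI[where x = P]) (simp add: reps_def fam_def)
qed

lemma cell_Least: "j \<in> {1..N} \<Longrightarrow> x \<in> cell X j \<Longrightarrow> (LEAST j. x < X j) = j"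
proof (rule Least_equality)
  assume j: "j \<in> {1..N}" and x: "x \<in> cell X j"
  show "x < X j" using x by (simp add: cell_def)
  fix i assume i: "x < X i"
  show "j \<le> i"
  proof (rule ccontr)
    assume "\<not> j \<le> i"
    then have "X i \<le> X (j - 1)" using j by (intro X_mono) auto
    then show False using i x by (simp add: cell_def)
  qed
qed

lemma fn_reps: "fam P \<Longrightarrow> reps (fn P) P"
  by (simp add: reps_def fn_def cell_Least)

lemma fn_Vh: "fam P \<Longrightarrow> fn P \<in> Vh k N X"
  unfolding Vh_def fam_def by (auto simp: fn_def cell_Least)

lemma left_limit:
  assumes j: "j \<in> {1..N}" and v: "\<And>x. x \<in> cell X j \<Longrightarrow> v x = g x" and g: "isCont g (X j)"
  shows "Lim (at_left (X j)) v = g (X j)"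
proof (rule tendsto_Lim)
  have "(g \<longlongrightarrow> g (X j)) (at_left (X j))"
    using g unfolding isCont_def by (rule filterlim_mono) (auto simp: at_le)
  moreover have "\<forall>\<^sub>F x in at_left (X j). g x = v x"
    unfolding eventually_at_left_field
    by (rule exI[where x = "X (j - 1)"]) (use X_step[OF j] v in \<open>auto simp: cell_def\<close>)
  ultimately show "(v \<longlongrightarrow> g (X j)) (at_left (X j))" by (rule Lim_transform_eventually)
qed simp

lemma right_limit:
  assumes j: "j \<in> {1..N}" and v: "\<And>x. x \<in> cell X j \<Longrightarrow> v x = g x" and g: "isCont g (X (j - 1))"
  shows "Lim (at_right (X (j - 1))) v = g (X (j - 1))"
proof (rule tendsto_Lim)
  have "(g \<longlongrightarrow> g (X (j - 1))) (at_right (X (j - 1)))"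
    using g unfolding isCont_def by (rule filterlim_mono) (auto simp: at_le)
  moreover have "\<forall>\<^sub>F x in at_right (X (j - 1)). g x = v x"
    unfolding eventually_at_right_field
    by (rule exI[where x = "X j"]) (use X_step[OF j] v in \<open>auto simp: cell_def\<close>)
  ultimately show "(v \<longlongrightarrow> g (X (j - 1))) (at_right (X (j - 1)))" by (rule Lim_transform_eventually)
qed simp

lemma traces:
  assumes v: "reps v P" and j: "j \<in> {1..N}"
  shows "left_trace N X v j = poly (P j) (X j)" "left_trace N X v (j - 1) = mi P j"
    "right_trace N X v (j - 1) = pl P j"
proof -
  have l: "Lim (at_left (X i)) v = poly (P i) (X i)" if "i \<in> {1..N}" for i
    by (rule left_limit[OF that]) (use repsD[OF v that] in auto)
  show "left_trace N X v j = poly (P j) (X j)" using j l[OF j] by (auto simp: left_trace_def)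
  show "left_trace N X v (j - 1) = mi P j"
    using j l[of "pr j"] pr_in[OF j] by (auto simp: left_trace_def mi_def pr_def)
  have "Lim (at_right (X (j - 1))) v = poly (P j) (X (j - 1))"
    by (rule right_limit[OF j]) (use repsD[OF v j] in auto)
  then show "right_trace N X v (j - 1) = pl P j" using j by (auto simp: right_trace_def pl_def)
qed

lemma trace_periodic: "left_trace N X v 0 = left_trace N X v N" "right_trace N X v 0 = right_trace N X v N"
  using N1 by (auto simp: left_trace_def right_trace_def)

lemma L2_cell:
  assumes j: "j \<in> {1..N}" and f: "\<And>x. x \<in> cell X j \<Longrightarrow> f x = F x" and g: "\<And>x. x \<in> cell X j \<Longrightarrow> g x = H x"
    and c: "continuous_on {X (j - 1)..X j} F" "continuous_on {X (j - 1)..X j} H"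
  shows "L2_inner (cell X j) f g = cint j (\<lambda>x. F x * H x)"
proof -
  have "L2_inner (cell X j) f g = L2_inner (cell X j) F H"
    unfolding L2_inner_def by (rule Bochner_Integration.integral_cong) (auto simp: f g)
  then show ?thesis unfolding cell_def using L2_inner_continuous[OF X_step[OF j] c] by simp
qed

lemma reps_deriv:
  assumes v: "reps v P" and j: "j \<in> {1..N}" and x: "x \<in> cell X j"
  shows "deriv v x = poly (pderiv (P j)) x"
proof (rule DERIV_imp_deriv)
  show "(v has_field_derivative poly (pderiv (P j)) x) (at x)"
    by (rule has_field_derivative_transform_within_open[OF poly_DERIV, of "cell X j"])
      (use repsD[OF v j] x in \<open>auto simp: cell_def\<close>)
qed

lemma dg_div_reps:
  assumes v: "reps v P" and j: "j \<in> {1..N}" and F: "\<And>x. x \<in> cell X j \<Longrightarrow> F x = F' x"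
    and c: "continuous_on {X (j - 1)..X j} F'"
  shows "dg_div N X j F Fh v = - cint j (\<lambda>x. F' x * poly (pderiv (P j)) x)
    + Fh j * poly (P j) (X j) - Fh (j - 1) * poly (P j) (X (j - 1))"
  unfolding dg_div_def traces[OF v j] pl_def
  by (subst L2_cell[OF j F reps_deriv[OF v j] c]) (auto intro!: continuous_intros)

lemma dg_div_sum:
  assumes v: "reps v P" and F: "\<And>j x. j \<in> {1..N} \<Longrightarrow> x \<in> cell X j \<Longrightarrow> F x = F' j x"
    and c: "\<And>j. j \<in> {1..N} \<Longrightarrow> continuous_on {X (j - 1)..X j} (F' j)" and per: "Fh 0 = Fh N"
    and H: "\<And>j. j \<in> {1..N} \<Longrightarrow> Fh (j - 1) = H j"
  shows "(\<Sum>j=1..N. dg_div N X j F Fh v) = - (\<Sum>j=1..N. cint j (\<lambda>x. F' j x * poly (pderiv (P j)) x) + H j * jmp P j)"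
proof -
  have "(\<Sum>j=1..N. dg_div N X j F Fh v) = (\<Sum>j=1..N. - cint j (\<lambda>x. F' j x * poly (pderiv (P j)) x)
    + (Fh j * poly (P j) (X j) - Fh (j - 1) * poly (P j) (X (j - 1))))"
  proof (rule sum.cong[OF refl])
    fix j assume j: "j \<in> {1..N}"
    show "dg_div N X j F Fh v = - cint j (\<lambda>x. F' j x * poly (pderiv (P j)) x)
      + (Fh j * poly (P j) (X j) - Fh (j - 1) * poly (P j) (X (j - 1)))"
      using dg_div_reps[OF v j F[OF j] c[OF j], where Fh = Fh] by simp
  qed
  also have "\<dots> = - (\<Sum>j=1..N. cint j (\<lambda>x. F' j x * poly (pderiv (P j)) x)) - (\<Sum>j=1..N. Fh (j - 1) * jmp P j)"
    unfolding sum.distrib sum_boundary[OF per] by (simp add: sum_negf)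
  also have "(\<Sum>j=1..N. Fh (j - 1) * jmp P j) = (\<Sum>j=1..N. H j * jmp P j)"
    by (rule sum.cong[OF refl]) (simp add: H)
  finally show ?thesis by (simp add: sum.distrib)
qed

lemma cint_square_zero:
  assumes "j \<in> {1..N}" "cint j (\<lambda>x. poly p x * poly p x) = 0"
  shows "p = 0"
proof -
  have "\<forall>x\<in>{X (j - 1)..X j}. poly p x * poly p x = 0"
    using X_step[OF assms(1)] assms(2) by (subst (asm) integral_eq_0_iff) (auto intro!: continuous_intros)
  then show ?thesis using X_step[OF assms(1)] by (intro poly_eq_0_of_interval[of "X (j - 1)" "X j"]) auto
qed

lemma ldg_cell:
  assumes "ldg_equations sch \<kappa> k N X u p r m s mt" "j \<in> {1..N}" "v \<in> Vh k N X"
  shows "L2_inner (cell X j) mt v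
       + dg_div N X j (\<lambda>x. flux_f \<kappa> (u x)) (\<lambda>i. num_flux_f sch \<kappa> (left_trace N X u i) (right_trace N X u i)) v
       - dg_div N X j p (right_trace N X p) v
       + dg_div N X j (\<lambda>x. (r x)\<^sup>2 * u x) (\<lambda>i. (right_trace N X u i * right_trace N X r i + left_trace N X u i * left_trace N X r i) / 2 * right_trace N X r i) v
       + dg_div N X j s (right_trace N X s) v = 0"
    and "L2_inner (cell X j) p v - dg_div N X j (\<lambda>x. (u x)\<^sup>2 * r x) (\<lambda>i. (right_trace N X u i * right_trace N X r i + left_trace N X u i * left_trace N X r i) / 2 * left_trace N X u i) v = 0"
    and "L2_inner (cell X j) r v - dg_div N X j u (left_trace N X u) v = 0"
    and "L2_inner (cell X j) m v - L2_inner (cell X j) u v + dg_div N X j r (right_trace N X r) v = 0"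
    and "L2_inner (cell X j) s v - dg_div N X j (\<lambda>x. flux_g (r x)) (\<lambda>i. num_flux_g sch (left_trace N X r i) (right_trace N X r i)) v = 0"
  using assms unfolding ldg_equations_def Let_def by blast+

context
  fixes sch \<kappa> u p r m s mt uP pP rP mP sP mtP
  assumes eq: "ldg_equations sch \<kappa> k N X u p r m s mt"
    and u: "reps u uP" and p: "reps p pP" and r: "reps r rP" and m: "reps m mP" and s: "reps s sP" and mt: "reps mt mtP"
begin

text \<open>The third equation is tested with r - D u itself. Integrating by parts back to
  \<open>D_test\<close> leaves the squared norm of that difference, which must vanish.\<close>

lemma ldg_D: "j \<in> {1..N} \<Longrightarrow> D uP j = rP j"
proof -
  assume j: "j \<in> {1..N}"
  let ?d = "rP j - D uP j"
  have degd: "degree ?d \<le> k"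
    using reps_degree[OF r j] fam_D[OF reps_fam[OF u]] j by (intro degree_diff_le) (auto simp: fam_def)
  have f: "fam (\<lambda>_. ?d)" using degd by (simp add: fam_def)
  have "cint j (\<lambda>x. poly (rP j) x * poly ?d x) = L2_inner (cell X j) r (fn (\<lambda>_. ?d))"
    by (rule L2_cell[OF j repsD[OF r j] repsD[OF fn_reps[OF f] j], symmetric]) (auto intro!: continuous_intros)
  also have "\<dots> = dg_div N X j u (left_trace N X u) (fn (\<lambda>_. ?d))"
    using ldg_cell(3)[OF eq j fn_Vh[OF f]] by simp
  also have "\<dots> = - cint j (\<lambda>x. poly (uP j) x * poly (pderiv ?d) x)
      + poly (uP j) (X j) * poly ?d (X j) - mi uP j * poly ?d (X (j - 1))"
    unfolding traces[OF u j, symmetric]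
    by (rule dg_div_reps[OF fn_reps[OF f] j, where F' = "poly (uP j)"]) (auto simp: repsD[OF u j] intro!: continuous_intros)
  also have "\<dots> = cint j (\<lambda>x. poly (pderiv (uP j)) x * poly ?d x) + jmp uP j * poly ?d (X (j - 1))"
    by (subst cint_by_parts[OF j poly_DERIV poly_DERIV]) (auto intro!: continuous_intros simp: jmp_pl_mi pl_def left_diff_distrib)
  also have "cint j (\<lambda>x. poly (pderiv (uP j)) x * poly ?d x) = cint j (\<lambda>x. poly ?d x * poly (pderiv (uP j)) x)"
    by (simp only: mult.commute)
  also have "\<dots> + jmp uP j * poly ?d (X (j - 1)) = cint j (\<lambda>x. poly ?d x * poly (D uP j) x)"
    by (rule D_test[OF j degd, symmetric])
  finally have "cint j (\<lambda>x. poly (rP j) x * poly ?d x - poly ?d x * poly (D uP j) x) = 0"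
    by (subst cint_diff) (auto intro!: continuous_intros)
  moreover have "(\<lambda>x. poly (rP j) x * poly ?d x - poly ?d x * poly (D uP j) x) = (\<lambda>x. poly ?d x * poly ?d x)"
    by (simp add: fun_eq_iff algebra_simps)
  ultimately have "cint j (\<lambda>x. poly ?d x * poly ?d x) = 0" by (simp only:)
  then have "?d = 0" by (rule cint_square_zero[OF j])
  then show ?thesis by simp
qed

lemma L2_reps:
  assumes "reps f fP" "fam w" "j \<in> {1..N}"
  shows "L2_inner (cell X j) f (fn w) = cint j (\<lambda>x. poly (fP j) x * poly (w j) x)"
  by (rule L2_cell[OF assms(3) repsD[OF assms(1,3)] repsD[OF fn_reps[OF assms(2)] assms(3)]]) (auto intro!: continuous_intros)

text \<open>The flux f^+ is opposite to the one in \<open>D\<close>, which makes the discrete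
  divergence the negative adjoint of \<open>D\<close>. These alternating fluxes are what allows p, r
  and s to be eliminated.\<close>

lemma dg_plus_flux:
  assumes f: "reps f fP" and w: "fam w"
  shows "(\<Sum>j=1..N. dg_div N X j f (right_trace N X f) (fn w)) = - (\<Sum>j=1..N. cint j (\<lambda>x. poly (fP j) x * poly (D w j) x))"
proof -
  have "(\<Sum>j=1..N. dg_div N X j f (right_trace N X f) (fn w))
      = - (\<Sum>j=1..N. cint j (\<lambda>x. poly (fP j) x * poly (pderiv (w j)) x) + pl fP j * jmp w j)"
    by (rule dg_div_sum[OF fn_reps[OF w] repsD[OF f] continuous_on_poly[OF continuous_on_id] trace_periodic(2) traces(3)[OF f]])
  also have "(\<Sum>j=1..N. cint j (\<lambda>x. poly (fP j) x * poly (pderiv (w j)) x) + pl fP j * jmp w j)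
      = (\<Sum>j=1..N. cint j (\<lambda>x. poly (fP j) x * poly (D w j) x))"
    by (intro sum.cong refl) (simp add: D_test[OF _ reps_degree[OF f]] pl_def)
  finally show ?thesis .
qed

lemma ldg_momentum: "fam w \<Longrightarrow> (\<Sum>j=1..N. cint j (\<lambda>x. poly (mP j) x * poly (w j) x)) = aform uP w"
proof -
  assume w: "fam w"
  have "cint j (\<lambda>x. poly (mP j) x * poly (w j) x) = cint j (\<lambda>x. poly (uP j) x * poly (w j) x)
     - dg_div N X j r (right_trace N X r) (fn w)" if j: "j \<in> {1..N}" for j
    using ldg_cell(4)[OF eq j fn_Vh[OF w]] unfolding L2_reps[OF m w j] L2_reps[OF u w j] by linarith
  then have "(\<Sum>j=1..N. cint j (\<lambda>x. poly (mP j) x * poly (w j) x)) = (\<Sum>j=1..N. cint j (\<lambda>x. poly (uP j) x * poly (w j) x)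
     - dg_div N X j r (right_trace N X r) (fn w))" by (intro sum.cong refl)
  also have "\<dots> = (\<Sum>j=1..N. cint j (\<lambda>x. poly (uP j) x * poly (w j) x)) + (\<Sum>j=1..N. cint j (\<lambda>x. poly (rP j) x * poly (D w j) x))"
    unfolding sum_subtractf dg_plus_flux[OF r w] by simp
  also have "\<dots> = aform uP w"
    unfolding aform_def sum.distrib[symmetric]
  proof (intro sum.cong refl)
    fix j assume j: "j \<in> {1..N}"
    show "cint j (\<lambda>x. poly (uP j) x * poly (w j) x) + cint j (\<lambda>x. poly (rP j) x * poly (D w j) x)
      = cint j (\<lambda>x. poly (uP j) x * poly (w j) x + poly (D uP j) x * poly (D w j) x)"
      unfolding ldg_D[OF j] by (rule cint_add[symmetric]) (auto intro!: continuous_intros)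
  qed
  finally show ?thesis .
qed

text \<open>p and s enter the first equation only as (p, D w) and (s, D w). Since D w lies in the
  discrete space, it is a legitimate test function in the equations that define p and s.\<close>

lemma ldg_momentum_deriv: "fam w \<Longrightarrow> (\<Sum>j=1..N. cint j (\<lambda>x. poly (mtP j) x * poly (w j) x)) = SR sch \<kappa> uP w"
proof -
  assume w: "fam w"
  have Dw: "fam (D w)" by (rule fam_D[OF w])
  let ?ff = "\<lambda>i. num_flux_f sch \<kappa> (left_trace N X u i) (right_trace N X u i)"
  let ?fr = "\<lambda>i. (right_trace N X u i * right_trace N X r i + left_trace N X u i * left_trace N X r i) / 2 * right_trace N X r i"
  let ?fu = "\<lambda>i. (right_trace N X u i * right_trace N X r i + left_trace N X u i * left_trace N X r i) / 2 * left_trace N X u i"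
  let ?fg = "\<lambda>i. num_flux_g sch (left_trace N X r i) (right_trace N X r i)"
  have av: "(pl uP j * pl rP j + mi uP j * mi rP j) / 2 = avg uP j" if j: "j \<in> {1..N}" for j
    using ldg_D[OF j] ldg_D[OF pr_in[OF j]] by (simp add: avg_def pl_def mi_def)
  have trD: "pl rP j = pl (D uP) j" "mi rP j = mi (D uP) j" if j: "j \<in> {1..N}" for j
    using ldg_D[OF j] ldg_D[OF pr_in[OF j]] by (simp_all add: pl_def mi_def)
  have fc: "continuous_on A f \<Longrightarrow> continuous_on A (\<lambda>x. flux_f c (f x))" "continuous_on A f \<Longrightarrow> continuous_on A (\<lambda>x. flux_g (f x))" for A f c
    unfolding flux_f_def flux_g_def by (auto intro!: continuous_intros)
  have s1: "(\<Sum>j=1..N. dg_div N X j (\<lambda>x. flux_f \<kappa> (u x)) ?ff (fn w))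
     = - (\<Sum>j=1..N. cint j (\<lambda>x. flux_f \<kappa> (poly (uP j) x) * poly (pderiv (w j)) x) + num_flux_f sch \<kappa> (mi uP j) (pl uP j) * jmp w j)"
    by (rule dg_div_sum[OF fn_reps[OF w]])
      (auto simp: repsD[OF u] trace_periodic traces[OF u] intro!: fc continuous_intros)
  have s2: "(\<Sum>j=1..N. dg_div N X j (\<lambda>x. (r x)\<^sup>2 * u x) ?fr (fn w))
     = - (\<Sum>j=1..N. cint j (\<lambda>x. (poly (uP j) x * poly (rP j) x * poly (rP j) x) * poly (pderiv (w j)) x) + (avg uP j * pl (D uP) j) * jmp w j)"
    by (rule dg_div_sum[OF fn_reps[OF w]])
      (auto simp: repsD[OF u] repsD[OF r] trace_periodic traces[OF u] traces[OF r] av trD(1)[symmetric] power2_eq_square intro!: continuous_intros)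
  have s3: "(\<Sum>j=1..N. dg_div N X j (\<lambda>x. (u x)\<^sup>2 * r x) ?fu (fn (D w)))
     = - (\<Sum>j=1..N. cint j (\<lambda>x. (poly (uP j) x * poly (uP j) x * poly (rP j) x) * poly (pderiv (D w j)) x) + (avg uP j * mi uP j) * jmp (D w) j)"
    by (rule dg_div_sum[OF fn_reps[OF Dw]])
      (auto simp: repsD[OF u] repsD[OF r] trace_periodic traces[OF u] traces[OF r] av power2_eq_square intro!: continuous_intros)
  have s4: "(\<Sum>j=1..N. dg_div N X j (\<lambda>x. flux_g (r x)) ?fg (fn (D w)))
     = - (\<Sum>j=1..N. cint j (\<lambda>x. flux_g (poly (rP j) x) * poly (pderiv (D w j)) x) + num_flux_g sch (mi (D uP) j) (pl (D uP) j) * jmp (D w) j)"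
    by (rule dg_div_sum[OF fn_reps[OF Dw]])
      (auto simp: repsD[OF r] trace_periodic traces[OF r] trD intro!: fc continuous_intros)
  have P: "(\<Sum>j=1..N. cint j (\<lambda>x. poly (pP j) x * poly (D w j) x)) = (\<Sum>j=1..N. dg_div N X j (\<lambda>x. (u x)\<^sup>2 * r x) ?fu (fn (D w)))"
  proof (rule sum.cong[OF refl])
    fix j assume j: "j \<in> {1..N}"
    show "cint j (\<lambda>x. poly (pP j) x * poly (D w j) x) = dg_div N X j (\<lambda>x. (u x)\<^sup>2 * r x) ?fu (fn (D w))"
      using ldg_cell(2)[OF eq j fn_Vh[OF Dw]] unfolding L2_reps[OF p Dw j] by linarith
  qed
  have S: "(\<Sum>j=1..N. cint j (\<lambda>x. poly (sP j) x * poly (D w j) x)) = (\<Sum>j=1..N. dg_div N X j (\<lambda>x. flux_g (r x)) ?fg (fn (D w)))"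
  proof (rule sum.cong[OF refl])
    fix j assume j: "j \<in> {1..N}"
    show "cint j (\<lambda>x. poly (sP j) x * poly (D w j) x) = dg_div N X j (\<lambda>x. flux_g (r x)) ?fg (fn (D w))"
      using ldg_cell(5)[OF eq j fn_Vh[OF Dw]] unfolding L2_reps[OF s Dw j] by linarith
  qed
  have "(\<Sum>j=1..N. cint j (\<lambda>x. poly (mtP j) x * poly (w j) x)) = (\<Sum>j=1..N.
      - dg_div N X j (\<lambda>x. flux_f \<kappa> (u x)) ?ff (fn w) + dg_div N X j p (right_trace N X p) (fn w)
      - dg_div N X j (\<lambda>x. (r x)\<^sup>2 * u x) ?fr (fn w) - dg_div N X j s (right_trace N X s) (fn w))"
  proof (rule sum.cong[OF refl])
    fix j assume j: "j \<in> {1..N}"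
    show "cint j (\<lambda>x. poly (mtP j) x * poly (w j) x) =
      - dg_div N X j (\<lambda>x. flux_f \<kappa> (u x)) ?ff (fn w) + dg_div N X j p (right_trace N X p) (fn w)
      - dg_div N X j (\<lambda>x. (r x)\<^sup>2 * u x) ?fr (fn w) - dg_div N X j s (right_trace N X s) (fn w)"
      using ldg_cell(1)[OF eq j fn_Vh[OF w]] unfolding L2_reps[OF mt w j] by linarith
  qed
  also have "\<dots> = - (\<Sum>j=1..N. dg_div N X j (\<lambda>x. flux_f \<kappa> (u x)) ?ff (fn w)) + (\<Sum>j=1..N. dg_div N X j p (right_trace N X p) (fn w))
      - (\<Sum>j=1..N. dg_div N X j (\<lambda>x. (r x)\<^sup>2 * u x) ?fr (fn w)) - (\<Sum>j=1..N. dg_div N X j s (right_trace N X s) (fn w))"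
    by (simp only: sum.distrib sum_subtractf sum_negf)
  also have "\<dots> = (\<Sum>j=1..N.
      (cint j (\<lambda>x. flux_f \<kappa> (poly (uP j) x) * poly (pderiv (w j)) x) + num_flux_f sch \<kappa> (mi uP j) (pl uP j) * jmp w j)
      + (cint j (\<lambda>x. (poly (uP j) x * poly (uP j) x * poly (rP j) x) * poly (pderiv (D w j)) x) + (avg uP j * mi uP j) * jmp (D w) j)
      + (cint j (\<lambda>x. (poly (uP j) x * poly (rP j) x * poly (rP j) x) * poly (pderiv (w j)) x) + (avg uP j * pl (D uP) j) * jmp w j)
      - (cint j (\<lambda>x. flux_g (poly (rP j) x) * poly (pderiv (D w j)) x) + num_flux_g sch (mi (D uP) j) (pl (D uP) j) * jmp (D w) j))"
    unfolding dg_plus_flux[OF p w] dg_plus_flux[OF s w] P S s1 s2 s3 s4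
    by (simp only: sum.distrib sum_subtractf)
  also have "\<dots> = SR sch \<kappa> uP w"
    unfolding SR_def
  proof (rule sum.cong[OF refl])
    fix j assume j: "j \<in> {1..N}"
    have a: "cint j (\<lambda>x. (flux_f \<kappa> (poly (uP j) x) + poly (uP j) x * poly (rP j) x * poly (rP j) x) * poly (pderiv (w j)) x)
      = cint j (\<lambda>x. flux_f \<kappa> (poly (uP j) x) * poly (pderiv (w j)) x) + cint j (\<lambda>x. (poly (uP j) x * poly (rP j) x * poly (rP j) x) * poly (pderiv (w j)) x)"
      unfolding distrib_right by (rule cint_add) (auto intro!: fc continuous_intros)
    have b: "cint j (\<lambda>x. (poly (uP j) x * poly (uP j) x * poly (rP j) x - flux_g (poly (rP j) x)) * poly (pderiv (D w j)) x)
      = cint j (\<lambda>x. (poly (uP j) x * poly (uP j) x * poly (rP j) x) * poly (pderiv (D w j)) x) - cint j (\<lambda>x. flux_g (poly (rP j) x) * poly (pderiv (D w j)) x)"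
      unfolding left_diff_distrib by (rule cint_diff) (auto intro!: fc continuous_intros)
    show "(cint j (\<lambda>x. flux_f \<kappa> (poly (uP j) x) * poly (pderiv (w j)) x) + num_flux_f sch \<kappa> (mi uP j) (pl uP j) * jmp w j)
      + (cint j (\<lambda>x. (poly (uP j) x * poly (uP j) x * poly (rP j) x) * poly (pderiv (D w j)) x) + (avg uP j * mi uP j) * jmp (D w) j)
      + (cint j (\<lambda>x. (poly (uP j) x * poly (rP j) x * poly (rP j) x) * poly (pderiv (w j)) x) + (avg uP j * pl (D uP) j) * jmp w j)
      - (cint j (\<lambda>x. flux_g (poly (rP j) x) * poly (pderiv (D w j)) x) + num_flux_g sch (mi (D uP) j) (pl (D uP) j) * jmp (D w) j)
      = cint j (\<lambda>x. (flux_f \<kappa> (poly (uP j) x) + poly (uP j) x * poly (D uP j) x * poly (D uP j) x) * poly (pderiv (w j)) x)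
    + (num_flux_f sch \<kappa> (mi uP j) (pl uP j) + avg uP j * pl (D uP) j) * jmp w j
    + cint j (\<lambda>x. (poly (uP j) x * poly (uP j) x * poly (D uP j) x - flux_g (poly (D uP j) x)) * poly (pderiv (D w j)) x)
    + (avg uP j * mi uP j - num_flux_g sch (mi (D uP) j) (pl (D uP) j)) * jmp (D w) j"
      unfolding ldg_D[OF j] a b distrib_right[of "num_flux_f sch \<kappa> (mi uP j) (pl uP j)"] left_diff_distrib[of "avg uP j * mi uP j"]
      by simp
  qed
  finally show ?thesis .
qed

end

section \<open>Time dependence through nodal values\<close>

lemma cell_nodes:
  assumes j: "j \<in> {1..N}"
  obtains x :: "nat \<Rightarrow> real" and l :: "nat \<Rightarrow> real poly" where "\<And>i. i \<le> k \<Longrightarrow> x i \<in> cell X j"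
    "\<And>i. i \<le> k \<Longrightarrow> degree (l i) \<le> k" "\<And>p. degree p \<le> k \<Longrightarrow> p = (\<Sum>i\<le>k. smult (poly p (x i)) (l i))"
proof -
  \<comment> \<open>The numerators run from 1 to k+1 over k+2, so all nodes are strictly inside the
    cell.\<close>
  define x where "x i = X (j - 1) + (real i + 1) / (real k + 2) * len j" for i :: nat
  have l: "0 < len j" by (rule len_pos[OF j])
  have inj: "inj_on x {..k}"
  proof (rule inj_onI)
    fix i i' assume "x i = x i'"
    then have "(real i + 1) / (real k + 2) * len j = (real i' + 1) / (real k + 2) * len j" by (simp add: x_def)
    then show "i = i'" using l by simp
  qed
  have xc: "x i \<in> cell X j" if "i \<le> k" for i
  proof -
    have "0 < (real i + 1) / (real k + 2)" "(real i + 1) / (real k + 2) < 1" using that by (auto simp: field_simps)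
    then have "0 < (real i + 1) / (real k + 2) * len j" "(real i + 1) / (real k + 2) * len j < 1 * len j"
      using l by (simp_all only: mult_pos_pos mult_strict_right_mono)
    then show ?thesis by (simp add: x_def cell_def len_def)
  qed
  show thesis
    by (rule lagrange_basis[OF inj]) (rule that[OF xc])
qed

lemma nodal_expansion:
  assumes v: "reps v P" and j: "j \<in> {1..N}" and x: "\<And>i. i \<le> k \<Longrightarrow> x i \<in> cell X j"
    and l: "\<And>p. degree p \<le> k \<Longrightarrow> p = (\<Sum>i\<le>k. smult (poly p (x i)) (l i))"
  shows "P j = (\<Sum>i\<le>k. smult (v (x i)) (l i))"
proof -
  have "P j = (\<Sum>i\<le>k. smult (poly (P j) (x i)) (l i))" by (rule l[OF reps_degree[OF v j]])
  also have "\<dots> = (\<Sum>i\<le>k. smult (v (x i)) (l i))"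
    by (intro sum.cong refl) (simp add: repsD[OF v j x])
  finally show ?thesis .
qed

lemma functional_continuous:
  fixes \<Lambda> :: "real poly \<Rightarrow> real"
  assumes P: "\<And>t. t \<in> S \<Longrightarrow> reps (v t) (P t)" and j: "j \<in> {1..N}"
    and c: "\<And>x. x \<in> cell X j \<Longrightarrow> continuous_on S (\<lambda>t. v t x)"
    and lin: "\<And>c l. \<Lambda> (\<Sum>i\<le>k. smult (c i) (l i)) = (\<Sum>i\<le>k. c i * \<Lambda> (l i))"
  shows "continuous_on S (\<lambda>t. \<Lambda> (P t j))"
proof -
  obtain x l where x: "\<And>i. i \<le> k \<Longrightarrow> x i \<in> cell X j" and "\<And>i. i \<le> k \<Longrightarrow> degree (l i) \<le> k"
    and l: "\<And>p. degree p \<le> k \<Longrightarrow> p = (\<Sum>i\<le>k. smult (poly p (x i)) (l i))"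
    by (rule cell_nodes[OF j]) (rule that)
  have "continuous_on S (\<lambda>t. \<Sum>i\<le>k. v t (x i) * \<Lambda> (l i))"
    by (intro continuous_on_sum continuous_on_mult continuous_on_const c x) simp
  then show ?thesis
    by (rule continuous_on_eq) (simp only: nodal_expansion[OF P j x l] lin)
qed

lemma cint_poly_linear:
  assumes j: "j \<in> {1..N}"
  shows "cint j (\<lambda>x. poly (\<Sum>i\<le>k. smult (c i) (l i)) x * poly q x) = (\<Sum>i\<le>k. c i * cint j (\<lambda>x. poly (l i) x * poly q x))"
proof -
  have "cint j (\<lambda>x. poly (\<Sum>i\<le>k. smult (c i) (l i)) x * poly q x) = cint j (\<lambda>x. \<Sum>i\<le>k. c i * (poly (l i) x * poly q x))"
    by (simp add: poly_sum sum_distrib_right mult.assoc)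
  also have "\<dots> = (\<Sum>i\<le>k. cint j (\<lambda>x. c i * (poly (l i) x * poly q x)))"
    by (intro integral_sum integrable_continuous_interval continuous_intros) simp
  finally show ?thesis by simp
qed

text \<open>By nodal expansion the pointwise time derivative is again a polynomial of degree at most
  k on each cell, and the moments are differentiated along with the nodal values.\<close>

lemma time_deriv_reps:
  assumes P: "\<And>s. 0 < s \<Longrightarrow> s < T \<Longrightarrow> reps (m s) (P s)" and t: "0 < t" "t < T"
    and d: "\<And>j x. j \<in> {1..N} \<Longrightarrow> x \<in> cell X j \<Longrightarrow> (\<lambda>\<tau>. m \<tau> x) differentiable (at t within {0..T})"
  shows "\<exists>Q. reps (time_deriv T m t) Q \<and>
    (\<forall>j\<in>{1..N}. \<forall>q. ((\<lambda>s. cint j (\<lambda>x. poly (P s j) x * poly q x)) has_field_derivative cint j (\<lambda>x. poly (Q j) x * poly q x)) (at t))"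
proof -
  have at: "at t within {0..T} = at t" using t by (simp add: at_within_Icc_at)
  have tI: "t \<in> {0<..<T}" using t by simp
  have der: "((\<lambda>\<tau>. m \<tau> x) has_field_derivative time_deriv T m t x) (at t)" if "j \<in> {1..N}" "x \<in> cell X j" for j x
    using d[OF that] unfolding time_deriv_def at vector_derivative_works has_real_derivative_iff_has_vector_derivative .
  have "\<exists>p. degree p \<le> k \<and> (\<forall>x\<in>cell X j. time_deriv T m t x = poly p x) \<and>
    (\<forall>q. ((\<lambda>s. cint j (\<lambda>x. poly (P s j) x * poly q x)) has_field_derivative cint j (\<lambda>x. poly p x * poly q x)) (at t))"
    if j: "j \<in> {1..N}" for j
  proof -
    obtain x l where x: "\<And>i. i \<le> k \<Longrightarrow> x i \<in> cell X j" and dl: "\<And>i. i \<le> k \<Longrightarrow> degree (l i) \<le> k"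
      and l: "\<And>p. degree p \<le> k \<Longrightarrow> p = (\<Sum>i\<le>k. smult (poly p (x i)) (l i))"
      by (rule cell_nodes[OF j]) (rule that)
    define p where "p = (\<Sum>i\<le>k. smult (time_deriv T m t (x i)) (l i))"
    have ex: "P s j = (\<Sum>i\<le>k. smult (m s (x i)) (l i))" if "s \<in> {0<..<T}" for s
      by (rule nodal_expansion[OF P j x l]) (use that in auto)
    show ?thesis
    proof (rule exI[where x = p], intro conjI ballI allI)
      show "degree p \<le> k"
        unfolding p_def by (intro degree_sum_le order.trans[OF degree_smult_le] dl) auto
    next
      fix y assume y: "y \<in> cell X j"
      have "((\<lambda>s. \<Sum>i\<le>k. m s (x i) * poly (l i) y) has_field_derivative (\<Sum>i\<le>k. time_deriv T m t (x i) * poly (l i) y)) (at t)"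
        by (intro DERIV_sum DERIV_cmult_right der[OF j] x) simp
      then have "((\<lambda>s. m s y) has_field_derivative (\<Sum>i\<le>k. time_deriv T m t (x i) * poly (l i) y)) (at t)"
      proof (rule has_field_derivative_transform_within_open[OF _ _ tI])
        fix s assume s: "s \<in> {0<..<T}"
        have "m s y = poly (P s j) y" using s by (intro repsD[OF P j y]) auto
        then show "(\<Sum>i\<le>k. m s (x i) * poly (l i) y) = m s y" by (simp add: ex[OF s] poly_sum)
      qed simp
      then have "time_deriv T m t y = (\<Sum>i\<le>k. time_deriv T m t (x i) * poly (l i) y)"
        using der[OF j y] by (rule DERIV_unique[symmetric])
      then show "time_deriv T m t y = poly p y" by (simp add: p_def poly_sum)
    next
      fix q
      have "((\<lambda>s. \<Sum>i\<le>k. m s (x i) * cint j (\<lambda>x. poly (l i) x * poly q x)) has_field_derivative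
          (\<Sum>i\<le>k. time_deriv T m t (x i) * cint j (\<lambda>x. poly (l i) x * poly q x))) (at t)"
        by (intro DERIV_sum DERIV_cmult_right der[OF j] x) simp
      then show "((\<lambda>s. cint j (\<lambda>x. poly (P s j) x * poly q x)) has_field_derivative cint j (\<lambda>x. poly p x * poly q x)) (at t)"
        unfolding p_def cint_poly_linear[OF j]
        by (rule has_field_derivative_transform_within_open[OF _ _ tI]) (simp_all only: ex cint_poly_linear[OF j] open_greaterThanLessThan)
    qed
  qed
  then have "\<forall>j\<in>{1..N}. \<exists>p. degree p \<le> k \<and> (\<forall>x\<in>cell X j. time_deriv T m t x = poly p x) \<and>
    (\<forall>q. ((\<lambda>s. cint j (\<lambda>x. poly (P s j) x * poly q x)) has_field_derivative cint j (\<lambda>x. poly p x * poly q x)) (at t))" ..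
  from bchoice[OF this] obtain Q where Q: "\<forall>j\<in>{1..N}. degree (Q j) \<le> k \<and> (\<forall>x\<in>cell X j. time_deriv T m t x = poly (Q j) x) \<and>
    (\<forall>q. ((\<lambda>s. cint j (\<lambda>x. poly (P s j) x * poly q x)) has_field_derivative cint j (\<lambda>x. poly (Q j) x * poly q x)) (at t))" ..
  show ?thesis
    by (rule exI[where x = Q]) (use Q in \<open>simp add: reps_def fam_def\<close>)
qed

text \<open>Node values form a negligible set. Absolute integrability is carried through the
  induction because \<open>L2_inner\<close> is a Lebesgue integral while the cell integrals are
  gauge integrals.\<close>

lemma L2_inner_split:
  assumes f: "\<And>j x. j \<in> {1..N} \<Longrightarrow> x \<in> cell X j \<Longrightarrow> f x = F j x" and g: "\<And>j x. j \<in> {1..N} \<Longrightarrow> x \<in> cell X j \<Longrightarrow> g x = H j x"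
    and F: "\<And>j. j \<in> {1..N} \<Longrightarrow> continuous_on {X (j - 1)..X j} (F j)"
    and H: "\<And>j. j \<in> {1..N} \<Longrightarrow> continuous_on {X (j - 1)..X j} (H j)"
  shows "L2_inner {xl<..<xr} f g = (\<Sum>j=1..N. cint j (\<lambda>x. F j x * H j x))"
proof -
  let ?p = "\<lambda>x. f x * g x"
  have cell: "?p absolutely_integrable_on {X (j - 1)..X j}" "(?p has_integral cint j (\<lambda>x. F j x * H j x)) {X (j - 1)..X j}"
    if j: "j \<in> {1..N}" for j
  proof -
    have c: "continuous_on {X (j - 1)..X j} (\<lambda>x. F j x * H j x)" by (intro continuous_on_mult F H j)
    have neg: "negligible {X (j - 1), X j}" by (rule negligible_finite) simp
    have e: "?p x = F j x * H j x" if "x \<in> {X (j - 1)..X j} - {X (j - 1), X j}" for x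
    proof -
      have "x \<in> cell X j" using that by (auto simp: cell_def)
      then show ?thesis using f[OF j] g[OF j] by simp
    qed
    show "?p absolutely_integrable_on {X (j - 1)..X j}"
      by (rule absolutely_integrable_spike[OF absolutely_integrable_continuous_real[OF c] neg e])
    show "(?p has_integral cint j (\<lambda>x. F j x * H j x)) {X (j - 1)..X j}"
      by (rule has_integral_spike[OF neg e integrable_integral[OF integrable_continuous_interval[OF c]]])
  qed
  have "n \<le> N \<Longrightarrow> ?p absolutely_integrable_on {X 0..X n} \<and> (?p has_integral (\<Sum>j=1..n. cint j (\<lambda>x. F j x * H j x))) {X 0..X n}" for n
  proof (induction n)
    case 0
    have "?p absolutely_integrable_on {X 0..X 0}"
      by (rule absolutely_integrable_spike[where f = "\<lambda>_. 0" and S = "{X 0}"]) auto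
    then show ?case by (simp add: has_integral_refl)
  next
    case (Suc n)
    have j: "Suc n \<in> {1..N}" using Suc.prems by (auto simp: One_nat_def)
    have i: "X 0 \<le> X n" "X n \<le> X (Suc n)" using Suc.prems by (auto intro: X_mono)
    note cj = cell[OF j, simplified diff_Suc_1]
    have IH: "?p absolutely_integrable_on {X 0..X n}" "(?p has_integral (\<Sum>j=1..n. cint j (\<lambda>x. F j x * H j x))) {X 0..X n}"
      using Suc by simp_all
    have un: "{X 0..X n} \<union> {X n..X (Suc n)} = {X 0..X (Suc n)}" using i by auto
    have "?p absolutely_integrable_on ({X 0..X n} \<union> {X n..X (Suc n)})"
      by (rule set_integrable_Un[OF IH(1) cj(1)]) simp_all
    moreover have "(?p has_integral ((\<Sum>j=1..n. cint j (\<lambda>x. F j x * H j x)) + integral {X n..X (Suc n)} (\<lambda>x. F (Suc n) x * H (Suc n) x))) {X 0..X (Suc n)}"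
      by (rule has_integral_combine[OF i IH(2) cj(2)])
    ultimately show ?case unfolding un by (simp add: sum.nat_ivl_Suc' One_nat_def)
  qed
  from this[OF order.refl] have a: "?p absolutely_integrable_on {xl..xr}"
    and i: "(?p has_integral (\<Sum>j=1..N. cint j (\<lambda>x. F j x * H j x))) {xl..xr}"
    unfolding X0 XN by blast+
  have ai: "?p absolutely_integrable_on {xl<..<xr}" by (rule set_integrable_subset[OF a]) auto
  have "L2_inner {xl<..<xr} f g = integral {xl<..<xr} ?p"
    unfolding L2_inner_def
    by (intro lebesgue_integral_eq_integral absolutely_integrable_imp_integrable[OF ai]) simp_all
  also have "\<dots> = integral {xl..xr} ?p" by (rule integral_open_interval_real[symmetric])
  finally show ?thesis using integral_unique[OF i] by simp
qed

end

section \<open>Classical solutions\<close>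

lemma continuous_on_slice:
  assumes "continuous_on ({0..T} \<times> UNIV) (\<lambda>(t, x). f t x)" "t \<in> {0..T}"
  shows "continuous_on UNIV (f t :: real \<Rightarrow> real)"
proof -
  have "continuous_on UNIV ((\<lambda>(t, x). f t x) \<circ> (\<lambda>x. (t, x)))"
    by (rule continuous_on_compose) (use assms(2) in \<open>auto intro!: continuous_intros continuous_on_subset[OF assms(1)]\<close>)
  then show ?thesis by (simp add: o_def)
qed

lemma periodic_deriv:
  fixes f f' :: "real \<Rightarrow> real"
  assumes "\<And>x. (f has_field_derivative f' x) (at x)" "\<And>x. f (x + c) = f x"
  shows "f' (x + c) = f' x"
proof -
  have "((\<lambda>x. f (x + c)) has_field_derivative f' (x + c)) (at x)"
    using assms(1)[of "x + c"] unfolding DERIV_shift .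
  then show ?thesis unfolding assms(2) by (rule DERIV_unique[OF _ assms(1)])
qed

context
  fixes \<kappa> T xl xr :: real and U :: "real \<Rightarrow> real \<Rightarrow> real"
  assumes sol: "mCH_solution \<kappa> T xl xr U"
begin

lemma mCH_der:
  assumes "t \<in> {0..T}"
  shows "(U t has_field_derivative deriv (U t) x) (at x)"
    and "(deriv (U t) has_field_derivative deriv (deriv (U t)) x) (at x)"
  using sol assms unfolding mCH_solution_def
  by (auto simp: field_differentiable_derivI field_differentiable_def real_differentiable_def DERIV_imp_deriv)

lemma mCH_continuous:
  shows "continuous_on ({0..T} \<times> UNIV) (\<lambda>(t, x). U t x)"
    and "continuous_on ({0..T} \<times> UNIV) (\<lambda>(t, x). deriv (U t) x)"
    and "continuous_on ({0..T} \<times> UNIV) (\<lambda>(t, x). momentum (U t) x)"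
    and "continuous_on ({0..T} \<times> UNIV) (\<lambda>(t, x). deriv (deriv (U t)) x)"
    and "continuous_on ({0..T} \<times> UNIV) (\<lambda>(t, x). time_deriv T (\<lambda>\<tau>. momentum (U \<tau>)) t x)"
proof -
  show U: "continuous_on ({0..T} \<times> UNIV) (\<lambda>(t, x). U t x)"
    and M: "continuous_on ({0..T} \<times> UNIV) (\<lambda>(t, x). momentum (U t) x)"
    using sol unfolding mCH_solution_def by blast+
  show "continuous_on ({0..T} \<times> UNIV) (\<lambda>(t, x). deriv (U t) x)"
    and "continuous_on ({0..T} \<times> UNIV) (\<lambda>(t, x). time_deriv T (\<lambda>\<tau>. momentum (U \<tau>)) t x)"
    using sol unfolding mCH_solution_def by blast+
  have "continuous_on ({0..T} \<times> UNIV) (\<lambda>z. (case z of (t, x) \<Rightarrow> U t x) - (case z of (t, x) \<Rightarrow> momentum (U t) x))"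
    by (rule continuous_on_diff[OF U M])
  then show "continuous_on ({0..T} \<times> UNIV) (\<lambda>(t, x). deriv (deriv (U t)) x)"
    by (simp add: momentum_def case_prod_unfold)
qed

lemma mCH_periodic:
  assumes t: "t \<in> {0..T}"
  shows "U t xr = U t xl" "deriv (U t) xr = deriv (U t) xl" "deriv (deriv (U t)) xr = deriv (deriv (U t)) xl"
proof -
  have p: "U t (x + (xr - xl)) = U t x" for x using sol t unfolding mCH_solution_def by blast
  have p1: "deriv (U t) (x + (xr - xl)) = deriv (U t) x" for x
    by (rule periodic_deriv[OF mCH_der(1)[OF t] p])
  have p2: "deriv (deriv (U t)) (x + (xr - xl)) = deriv (deriv (U t)) x" for x
    by (rule periodic_deriv[OF mCH_der(2)[OF t] p1])
  show "U t xr = U t xl" "deriv (U t) xr = deriv (U t) xl" "deriv (deriv (U t)) xr = deriv (deriv (U t)) xl"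
    using p[of xl] p1[of xl] p2[of xl] by simp_all
qed

lemma mCH_flux_der:
  assumes t: "t \<in> {0..T}"
  shows "((\<lambda>x. 2 * \<kappa>\<^sup>2 * U t x + ((U t x)\<^sup>2 - (deriv (U t) x)\<^sup>2) * (U t x - deriv (deriv (U t)) x)) has_field_derivative
     - time_deriv T (\<lambda>\<tau>. momentum (U \<tau>)) t x) (at x)"
proof -
  let ?F = "\<lambda>y. ((U t y)\<^sup>2 - (deriv (U t) y)\<^sup>2) * momentum (U t) y"
  have d: "?F differentiable (at x)" and e: "time_deriv T (\<lambda>\<tau>. momentum (U \<tau>)) t x + 2 * \<kappa>\<^sup>2 * deriv (U t) x + deriv ?F x = 0"
    using sol t unfolding mCH_solution_def by blast+
  have "(?F has_field_derivative deriv ?F x) (at x)"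
    using d by (auto simp: real_differentiable_def DERIV_imp_deriv)
  then have "((\<lambda>x. 2 * \<kappa>\<^sup>2 * U t x + ?F x) has_field_derivative 2 * \<kappa>\<^sup>2 * deriv (U t) x + deriv ?F x) (at x)"
    by (intro DERIV_add DERIV_cmult mCH_der(1)[OF t])
  moreover have "2 * \<kappa>\<^sup>2 * deriv (U t) x + deriv ?F x = - time_deriv T (\<lambda>\<tau>. momentum (U \<tau>)) t x" using e by linarith
  ultimately show ?thesis by (simp only: momentum_def)
qed

text \<open>Joint continuity of M_t permits differentiation under the integral, so the data of the
  Ritz projection are differentiable in time.\<close>

lemma momentum_moment_der:
  assumes t: "t \<in> {0..T}" and ab: "continuous_on {a..b} g"
  shows "((\<lambda>s. integral {a..b} (\<lambda>x. momentum (U s) x * g x)) has_field_derivative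
    integral {a..b} (\<lambda>x. time_deriv T (\<lambda>\<tau>. momentum (U \<tau>)) t x * g x)) (at t within {0..T})"
proof -
  have "((\<lambda>s. integral (cbox a b) (\<lambda>x. momentum (U s) x * g x)) has_field_derivative
    integral (cbox a b) (\<lambda>x. time_deriv T (\<lambda>\<tau>. momentum (U \<tau>)) t x * g x)) (at t within {0..T})"
  proof (rule leibniz_rule_field_derivative)
    fix s x assume s: "s \<in> {0..T}"
    have "(\<lambda>\<tau>. momentum (U \<tau>) x) differentiable (at s within {0..T})"
      using sol s unfolding mCH_solution_def by blast
    then have "((\<lambda>\<tau>. momentum (U \<tau>) x) has_field_derivative time_deriv T (\<lambda>\<tau>. momentum (U \<tau>)) s x) (at s within {0..T})"
      unfolding time_deriv_def vector_derivative_works has_real_derivative_iff_has_vector_derivative .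
    then show "((\<lambda>\<tau>. momentum (U \<tau>) x * g x) has_field_derivative time_deriv T (\<lambda>\<tau>. momentum (U \<tau>)) s x * g x) (at s within {0..T})"
      by (rule DERIV_cmult_right)
  next
    fix s assume s: "s \<in> {0..T}"
    have "continuous_on {a..b} (momentum (U s))"
      using continuous_on_slice[OF mCH_continuous(3) s] continuous_on_subset by blast
    then show "(\<lambda>x. momentum (U s) x * g x) integrable_on cbox a b"
      unfolding cbox_interval by (intro integrable_continuous_interval continuous_on_mult ab)
  next
    have "continuous_on ({0..T} \<times> {a..b}) (\<lambda>z. (case z of (t, x) \<Rightarrow> time_deriv T (\<lambda>\<tau>. momentum (U \<tau>)) t x) * g (snd z))"
      by (intro continuous_on_mult continuous_on_subset[OF mCH_continuous(5)] continuous_on_compose2[OF ab] continuous_intros) auto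
    then show "continuous_on ({0..T} \<times> cbox a b) (\<lambda>(s, x). time_deriv T (\<lambda>\<tau>. momentum (U \<tau>)) s x * g x)"
      unfolding cbox_interval by (simp only: case_prod_unfold)
  qed (use t in simp_all)
  then show ?thesis unfolding cbox_interval .
qed

end

lemma (in dg_mesh) dg_data_exists:
  assumes sol: "mCH_solution \<kappa> T xl xr U" and t: "t \<in> {0..T}" and B: "0 \<le> B"
    and s: "smooth_approximable xl xr (k + 3) B (U t) (deriv (U t)) (deriv (deriv (U t)))"
  shows "\<exists>q \<pi>q. dg_data xl xr \<rho> k N X \<kappa> (GG k B) (U t) (deriv (U t)) (deriv (deriv (U t)))
    (time_deriv T (\<lambda>\<tau>. momentum (U \<tau>)) t) q \<pi>q"
proof -
  have cR: "continuous_on UNIV (deriv (U t))" by (rule continuous_on_slice[OF mCH_continuous(2)[OF sol] t])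
  from approx_R[OF s B mCH_der(1)[OF sol t] cR] obtain q where q: "fam q \<and>
    (\<forall>j\<in>{1..N}. (\<forall>x\<in>{X (j - 1)..X j}. \<bar>deriv (U t) x - poly (q j) x\<bar> \<le> GG k B * h ^ (k + 1)) \<and>
      \<bar>coeff (q j) k\<bar> \<le> GG k B \<and> cint j (poly (q j)) = U t (X j) - U t (X (j - 1)))" ..
  from approx_Pi[OF s B] obtain \<pi>q where p: "fam \<pi>q \<and> (\<forall>j\<in>{1..N}. \<forall>x\<in>{X (j - 1)..X j}.
     \<bar>((U t x)\<^sup>2 * deriv (deriv (U t)) x + 2 * U t x * (deriv (U t) x)\<^sup>2 - (deriv (U t) x)\<^sup>2 * deriv (deriv (U t)) x) - poly (\<pi>q j) x\<bar> \<le> GG k B * h ^ k)" ..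
  note G = GG_ge[OF B, of k]
  have n3: "3 \<le> k + 3" by simp
  have "dg_data xl xr \<rho> k N X \<kappa> (GG k B) (U t) (deriv (U t)) (deriv (deriv (U t)))
    (time_deriv T (\<lambda>\<tau>. momentum (U \<tau>)) t) q \<pi>q"
  proof
    show "1 \<le> GG k B" by (rule G(2))
    show "(U t has_field_derivative deriv (U t) x) (at x)"
      "(deriv (U t) has_field_derivative deriv (deriv (U t)) x) (at x)" for x by (rule mCH_der[OF sol t])+
    show "continuous_on UNIV (deriv (deriv (U t)))" by (rule continuous_on_slice[OF mCH_continuous(4)[OF sol] t])
    show "continuous_on UNIV (time_deriv T (\<lambda>\<tau>. momentum (U \<tau>)) t)" by (rule continuous_on_slice[OF mCH_continuous(5)[OF sol] t])
    show "U t xr = U t xl" "deriv (U t) xr = deriv (U t) xl" "deriv (deriv (U t)) xr = deriv (deriv (U t)) xl"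
      by (rule mCH_periodic[OF sol t])+
    show "\<bar>U t x\<bar> \<le> GG k B" "\<bar>deriv (U t) x\<bar> \<le> GG k B" "\<bar>deriv (deriv (U t)) x\<bar> \<le> GG k B" if "x \<in> {xl..xr}" for x
      using smooth_approximable_bounds[OF s n3 that] G(1) by linarith+
    show "fam q" "fam \<pi>q" using q p by blast+
    show "((\<lambda>x. 2 * \<kappa>\<^sup>2 * U t x + ((U t x)\<^sup>2 - (deriv (U t) x)\<^sup>2) * (U t x - deriv (deriv (U t)) x)) has_field_derivative
     - time_deriv T (\<lambda>\<tau>. momentum (U \<tau>)) t x) (at x)" for x by (rule mCH_flux_der[OF sol t])
    fix j assume j: "j \<in> {1..N}"
    show "\<bar>coeff (q j) k\<bar> \<le> GG k B" "cint j (poly (q j)) = U t (X j) - U t (X (j - 1))" using q j by blast+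
    fix x assume x: "x \<in> {X (j - 1)..X j}"
    show "\<bar>deriv (U t) x - poly (q j) x\<bar> \<le> GG k B * h ^ (k + 1)" using q j x by blast
    show "\<bar>((U t x)\<^sup>2 * deriv (deriv (U t)) x + 2 * U t x * (deriv (U t) x)\<^sup>2 - (deriv (U t) x)\<^sup>2 * deriv (deriv (U t)) x) - poly (\<pi>q j) x\<bar> \<le> GG k B * h ^ k"
      using p j x by blast
  qed
  then show ?thesis by (rule exI[where x = q, OF exI[where x = \<pi>q]])
qed

lemma (in dg_mesh) norm_cells:
  assumes v: "reps v P" and U: "continuous_on UNIV U"
  shows "(L2_norm {xl<..<xr} (\<lambda>x. U x - v x))\<^sup>2 = (\<Sum>j=1..N. cint j (\<lambda>x. (U x - poly (P j) x)\<^sup>2))"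
proof -
  have c: "continuous_on {X (j - 1)..X j} (\<lambda>x. U x - poly (P j) x)" for j
    by (intro continuous_intros continuous_on_subset[OF U]) simp
  have e: "U x - v x = U x - poly (P j) x" if "j \<in> {1..N}" "x \<in> cell X j" for j x
    using repsD[OF v that] by simp
  have "L2_inner {xl<..<xr} (\<lambda>x. U x - v x) (\<lambda>x. U x - v x)
    = (\<Sum>j=1..N. cint j (\<lambda>x. (U x - poly (P j) x) * (U x - poly (P j) x)))"
    by (rule L2_inner_split[OF e e c c])
  moreover have "0 \<le> (\<Sum>j=1..N. cint j (\<lambda>x. (U x - poly (P j) x) * (U x - poly (P j) x)))"
    by (intro sum_nonneg cint_nonneg continuous_on_mult c) simp
  ultimately show ?thesis by (simp only: L2_norm_def real_sqrt_pow2 power2_eq_square[of "_ - _"])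
qed

section \<open>Evolution of the error\<close>

definition (in dg_mesh) rep :: "(real \<Rightarrow> real) \<Rightarrow> nat \<Rightarrow> real poly" where
  "rep v = (SOME P. reps v P)"

lemma (in dg_mesh) reps_rep: "v \<in> Vh k N X \<Longrightarrow> reps v (rep v)"
  unfolding rep_def by (rule someI_ex[OF Vh_reps])

locale ldg_error = dg_mesh +
  fixes \<kappa> T B :: real and sch :: scheme and U u p r m s :: "real \<Rightarrow> real \<Rightarrow> real"
  assumes T: "0 < T" and B: "0 \<le> B" and sol: "mCH_solution \<kappa> T xl xr U"
    and smooth: "\<And>t. t \<in> {0..T} \<Longrightarrow> smooth_approximable xl xr (k + 3) B (U t) (deriv (U t)) (deriv (deriv (U t)))"
    and ldg: "ldg_solution sch \<kappa> T k N X u p r m s"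
    and init_u: "is_Gauss_Radau_projection k N X (U 0) (u 0)"
    and init_r: "is_L2_projection k N X (deriv (U 0)) (r 0)"
begin

abbreviation L :: real where "L \<equiv> xr - xl"
abbreviation G :: real where "G \<equiv> GG k B"
abbreviation Mt :: "real \<Rightarrow> real \<Rightarrow> real" where "Mt \<equiv> time_deriv T (\<lambda>\<tau>. momentum (U \<tau>))"

lemma reps_u: "t \<in> {0..T} \<Longrightarrow> reps (u t) (rep (u t))"
  and reps_r: "t \<in> {0..T} \<Longrightarrow> reps (r t) (rep (r t))"
  using ldg unfolding ldg_solution_def by (blast intro: reps_rep)+

lemma reps_pms:
  assumes "0 < t" "t \<le> T"
  shows "reps (p t) (rep (p t))" "reps (m t) (rep (m t))" "reps (s t) (rep (s t))"
  using ldg assms unfolding ldg_solution_def by (auto intro!: reps_rep)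

lemma fam_u: "t \<in> {0..T} \<Longrightarrow> fam (rep (u t))"
  by (rule reps_fam[OF reps_u])

lemma ldg_u_continuous:
  assumes "j \<in> {1..N}" "\<And>c l. \<Lambda> (\<Sum>i\<le>k. smult (c i) (l i)) = (\<Sum>i\<le>k. c i * \<Lambda> (l i))"
  shows "continuous_on {0..T} (\<lambda>t. \<Lambda> (rep (u t) j) :: real)" "continuous_on {0..T} (\<lambda>t. \<Lambda> (rep (r t) j) :: real)"
proof -
  have c: "continuous_on {0..T} (\<lambda>t. u t x)" "continuous_on {0..T} (\<lambda>t. r t x)" if "x \<in> cell X j" for x
    using ldg assms(1) that unfolding ldg_solution_def by blast+
  show "continuous_on {0..T} (\<lambda>t. \<Lambda> (rep (u t) j))" "continuous_on {0..T} (\<lambda>t. \<Lambda> (rep (r t) j))"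
    by (rule functional_continuous[OF reps_u assms(1) c(1) assms(2)] functional_continuous[OF reps_r assms(1) c(2) assms(2)];
      assumption)+
qed

lemma scheme_at:
  assumes t: "0 < t" "t < T"
  obtains mtP where "reps (time_deriv T m t) mtP" "ldg_equations sch \<kappa> k N X (u t) (p t) (r t) (m t) (s t) (time_deriv T m t)"
    "\<And>j q. j \<in> {1..N} \<Longrightarrow> ((\<lambda>s. cint j (\<lambda>x. poly (rep (m s) j) x * poly q x)) has_field_derivative cint j (\<lambda>x. poly (mtP j) x * poly q x)) (at t)"
proof -
  have tI: "t \<in> {0<..T}" using t by simp
  have d: "(\<lambda>\<tau>. m \<tau> x) differentiable (at t within {0..T})" if "j \<in> {1..N}" "x \<in> cell X j" for j x
    using ldg tI that unfolding ldg_solution_def by blast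
  have eq: "ldg_equations sch \<kappa> k N X (u t) (p t) (r t) (m t) (s t) (time_deriv T m t)"
    using ldg tI unfolding ldg_solution_def by blast
  have rm: "reps (m s) (rep (m s))" if "0 < s" "s < T" for s using that by (intro reps_pms) auto
  from time_deriv_reps[OF rm t d] obtain mtP where Q: "reps (time_deriv T m t) mtP \<and>
    (\<forall>j\<in>{1..N}. \<forall>q. ((\<lambda>s. cint j (\<lambda>x. poly (rep (m s) j) x * poly q x)) has_field_derivative cint j (\<lambda>x. poly (mtP j) x * poly q x)) (at t))" ..
  show thesis
    by (rule that[OF conjunct1[OF Q] eq]) (rule conjunct2[OF Q, rule_format])
qed

lemma D_u_interior:
  assumes t: "0 < t" "t < T" and j: "j \<in> {1..N}"
  shows "D (rep (u t)) j = rep (r t) j"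
proof -
  have tI: "t \<in> {0..T}" "t \<le> T" using t by auto
  obtain mtP where "reps (time_deriv T m t) mtP" "ldg_equations sch \<kappa> k N X (u t) (p t) (r t) (m t) (s t) (time_deriv T m t)"
    by (rule scheme_at[OF t]) (rule that)
  then show ?thesis
    by (intro ldg_D[OF _ reps_u[OF tI(1)] reps_pms(1)[OF t(1) tI(2)] reps_r[OF tI(1)] reps_pms(2,3)[OF t(1) tI(2)] _ j])
qed

text \<open>The scheme is imposed for positive times, whereas the initial error needs r(0) = D u(0).
  Both sides are continuous in time, so the identity extends from the open interval to its
  closure.\<close>

lemma D_u:
  assumes t: "t \<in> {0..T}" and j: "j \<in> {1..N}"
  shows "D (rep (u t)) j = rep (r t) j"
proof -
  have lin: "poly (\<Sum>i\<le>k. smult (c i) (l i)) x = (\<Sum>i\<le>k. c i * poly (l i) x)"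
    "poly (pderiv (\<Sum>i\<le>k. smult (c i) (l i))) x = (\<Sum>i\<le>k. c i * poly (pderiv (l i)) x)" for c l and x :: real
    by (simp_all add: poly_sum pderiv_sum pderiv_smult)
  have cl: "closure {0<..<T} = {0..T}" using T by simp
  have "poly (D (rep (u t)) j) x - poly (rep (r t) j) x = 0" for x
  proof -
    have "continuous_on {0..T} (\<lambda>t. poly (pderiv (rep (u t) j)) x
        + (poly (rep (u t) j) (X (j - 1)) - poly (rep (u t) (pr j)) (X (pr j))) * poly (lam j) x - poly (rep (r t) j) x)"
      by (intro continuous_intros ldg_u_continuous(1)[OF j lin(1)] ldg_u_continuous(1)[OF j lin(2)]
        ldg_u_continuous(1)[OF pr_in[OF j] lin(1)] ldg_u_continuous(2)[OF j lin(1)])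
    then have "continuous_on (closure {0<..<T}) (\<lambda>t. poly (D (rep (u t)) j) x - poly (rep (r t) j) x)"
      unfolding cl by (simp add: D_def jmp_def)
    then show ?thesis
      by (rule continuous_constant_on_closure) (use t cl in \<open>auto simp: D_u_interior[OF _ _ j]\<close>)
  qed
  then have "poly (D (rep (u t)) j) = poly (rep (r t) j)" by (simp add: fun_eq_iff)
  then show ?thesis by (simp only: poly_eq_poly_eq_iff)
qed

lemma aform_u_continuous: "continuous_on {0..T} (\<lambda>t. aform (rep (u t)) w)"
proof -
  have "continuous_on {0..T} (\<lambda>t. \<Sum>j=1..N. cint j (\<lambda>x. poly (rep (u t) j) x * poly (w j) x)
    + cint j (\<lambda>x. poly (rep (r t) j) x * poly (D w j) x))"
    by (intro continuous_on_sum continuous_on_add ldg_u_continuous(1)[OF _ cint_poly_linear] ldg_u_continuous(2)[OF _ cint_poly_linear])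
  then show ?thesis
  proof (rule continuous_on_eq)
    fix t assume t: "t \<in> {0..T}"
    show "(\<Sum>j=1..N. cint j (\<lambda>x. poly (rep (u t) j) x * poly (w j) x) + cint j (\<lambda>x. poly (rep (r t) j) x * poly (D w j) x))
      = aform (rep (u t)) w"
      unfolding aform_def
    proof (intro sum.cong refl)
      fix j assume j: "j \<in> {1..N}"
      show "cint j (\<lambda>x. poly (rep (u t) j) x * poly (w j) x) + cint j (\<lambda>x. poly (rep (r t) j) x * poly (D w j) x)
        = cint j (\<lambda>x. poly (rep (u t) j) x * poly (w j) x + poly (D (rep (u t)) j) x * poly (D w j) x)"
        unfolding D_u[OF t j] by (rule cint_add[symmetric]) (auto intro!: continuous_intros)
    qed
  qed
qed

text \<open>Differentiability in time is given for m; the identity (m, w) = a(u, w) transfers it to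
  the moments of u. The expansion of \<open>SR\<close> in w is likewise read off from (m_t,
  w).\<close>

lemma aform_u_derivative:
  assumes t: "0 < t" "t < T" and w: "fam w"
  shows "((\<lambda>t. aform (rep (u t)) w) has_field_derivative SR sch \<kappa> (rep (u t)) w) (at t)"
    and "SR sch \<kappa> (rep (u t)) w = (\<Sum>e\<in>idx. cf w e * SR sch \<kappa> (rep (u t)) (phi e))"
proof -
  have tI: "t \<in> {0..T}" "t \<le> T" and tI': "t \<in> {0<..<T}" using t by auto
  obtain mtP where mt: "reps (time_deriv T m t) mtP" and eq: "ldg_equations sch \<kappa> k N X (u t) (p t) (r t) (m t) (s t) (time_deriv T m t)"
    and d: "\<And>j q. j \<in> {1..N} \<Longrightarrow> ((\<lambda>s. cint j (\<lambda>x. poly (rep (m s) j) x * poly q x)) has_field_derivative cint j (\<lambda>x. poly (mtP j) x * poly q x)) (at t)"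
    by (rule scheme_at[OF t]) (rule that)
  have SR: "(\<Sum>j=1..N. cint j (\<lambda>x. poly (mtP j) x * poly (w j) x)) = SR sch \<kappa> (rep (u t)) w" if "fam w" for w
    by (rule ldg_momentum_deriv[OF eq reps_u[OF tI(1)] reps_pms(1)[OF t(1) tI(2)] reps_r[OF tI(1)] reps_pms(2,3)[OF t(1) tI(2)] mt that])
  have "((\<lambda>s. \<Sum>j=1..N. cint j (\<lambda>x. poly (rep (m s) j) x * poly (w j) x)) has_field_derivative
      (\<Sum>j=1..N. cint j (\<lambda>x. poly (mtP j) x * poly (w j) x))) (at t)"
    by (intro DERIV_sum d)
  then show "((\<lambda>t. aform (rep (u t)) w) has_field_derivative SR sch \<kappa> (rep (u t)) w) (at t)"
    unfolding SR[OF w]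
  proof (rule has_field_derivative_transform_within_open[OF _ open_greaterThanLessThan tI'])
    fix \<sigma> assume "\<sigma> \<in> {0<..<T}"
    then have \<sigma>: "0 < \<sigma>" "\<sigma> < T" "\<sigma> \<in> {0..T}" "\<sigma> \<le> T" by auto
    obtain Q where "reps (time_deriv T m \<sigma>) Q" "ldg_equations sch \<kappa> k N X (u \<sigma>) (p \<sigma>) (r \<sigma>) (m \<sigma>) (s \<sigma>) (time_deriv T m \<sigma>)"
      by (rule scheme_at[OF \<sigma>(1,2)]) (rule that)
    then show "(\<Sum>j=1..N. cint j (\<lambda>x. poly (rep (m \<sigma>) j) x * poly (w j) x)) = aform (rep (u \<sigma>)) w"
      by (intro ldg_momentum[OF _ reps_u[OF \<sigma>(3)] reps_pms(1)[OF \<sigma>(1,4)] reps_r[OF \<sigma>(3)] reps_pms(2,3)[OF \<sigma>(1,4)] _ w])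
  qed
  have "SR sch \<kappa> (rep (u t)) w = (\<Sum>j=1..N. cint j (\<lambda>x. poly (mtP j) x * poly (w j) x))" by (rule SR[OF w, symmetric])
  also have "\<dots> = (\<Sum>e\<in>idx. cf w e * (\<Sum>j=1..N. cint j (\<lambda>x. poly (mtP j) x * poly (phi e j) x)))"
    by (rule cint_expand[OF w]) (intro continuous_intros)
  also have "\<dots> = (\<Sum>e\<in>idx. cf w e * SR sch \<kappa> (rep (u t)) (phi e))"
    by (intro sum.cong refl) (simp only: SR[OF fam_phi])
  finally show "SR sch \<kappa> (rep (u t)) w = (\<Sum>e\<in>idx. cf w e * SR sch \<kappa> (rep (u t)) (phi e))" .
qed

lemma energy_nonincreasing:
  assumes t: "t \<in> {0..T}"
  shows "aform (rep (u t)) (rep (u t)) \<le> aform (rep (u 0)) (rep (u 0))"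
proof (cases "t = 0")
  case False
  have c: "continuous_on {0..T} (\<lambda>t. aform (rep (u t)) (rep (u t)))"
    by (rule energy_continuous[OF fam_u aform_u_continuous])
  show ?thesis
  proof (rule DERIV_nonpos_imp_decreasing_open[where f = "\<lambda>t. aform (rep (u t)) (rep (u t))"])
    show "0 \<le> t" using t by simp
    show "continuous_on {0..t} (\<lambda>t. aform (rep (u t)) (rep (u t)))"
      by (rule continuous_on_subset[OF c]) (use t in auto)
    fix \<tau> assume \<tau>: "0 < \<tau>" "\<tau> < t"
    then have \<tau>T: "\<tau> < T" "\<tau> \<in> {0<..<T}" using t by auto
    have "((\<lambda>t. aform (rep (u t)) (rep (u t))) has_field_derivative
      2 * (\<Sum>e\<in>idx. cf (rep (u \<tau>)) e * SR sch \<kappa> (rep (u \<tau>)) (phi e))) (at \<tau>)"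
      by (rule energy_derivative[OF fam_u open_greaterThanLessThan \<tau>T(2)])
        (auto intro!: aform_u_derivative(1) \<tau> \<tau>T fam_phi)
    moreover have "2 * (\<Sum>e\<in>idx. cf (rep (u \<tau>)) e * SR sch \<kappa> (rep (u \<tau>)) (phi e)) \<le> 0"
    proof -
      have "fam (rep (u \<tau>))" using \<tau>T by (intro fam_u) simp
      from aform_u_derivative(2)[OF \<tau>(1) \<tau>T(1) this] energy_dissipation[of sch \<kappa> "rep (u \<tau>)"] show ?thesis by simp
    qed
    ultimately show "\<exists>y. ((\<lambda>t. aform (rep (u t)) (rep (u t))) has_real_derivative y) (at \<tau>) \<and> y \<le> 0" by blast
  qed
qed simp

definition Z :: "real \<Rightarrow> nat \<Rightarrow> real poly" where
  "Z t = (SOME Z. fam Z \<and> (\<forall>w. fam w \<longrightarrow> aform Z w = (\<Sum>j=1..N. cint j (\<lambda>x. momentum (U t) x * poly (w j) x))))"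

definition \<zeta> :: "real \<Rightarrow> nat \<Rightarrow> real poly" where
  "\<zeta> t j = Z t j - rep (u t) j"

lemma momentum_cont: "t \<in> {0..T} \<Longrightarrow> continuous_on S (momentum (U t))"
  using continuous_on_slice[OF mCH_continuous(3)[OF sol]] continuous_on_subset by blast

lemma Mt_cont: "t \<in> {0..T} \<Longrightarrow> continuous_on S (Mt t)"
  using continuous_on_slice[OF mCH_continuous(5)[OF sol]] continuous_on_subset by blast

lemma Z:
  assumes t: "t \<in> {0..T}"
  shows "fam (Z t)" "fam w \<Longrightarrow> aform (Z t) w = (\<Sum>j=1..N. cint j (\<lambda>x. momentum (U t) x * poly (w j) x))"
  using someI_ex[OF Ritz_exists[OF momentum_cont[OF t]]] unfolding Z_def[symmetric] by blast+

lemma fam_zeta: "t \<in> {0..T} \<Longrightarrow> fam (\<zeta> t)"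
  using Z(1) fam_u unfolding fam_def \<zeta>_def by (auto intro: degree_diff_le)

lemma moment_derivative:
  assumes "t \<in> {0..T}"
  shows "((\<lambda>t. \<Sum>j=1..N. cint j (\<lambda>x. momentum (U t) x * poly (w j) x)) has_field_derivative
     (\<Sum>j=1..N. cint j (\<lambda>x. Mt t x * poly (w j) x))) (at t within {0..T})"
  by (intro DERIV_sum momentum_moment_der[OF sol assms] continuous_intros)

lemma aform_zeta:
  assumes "t \<in> {0..T}" "fam w"
  shows "aform (\<zeta> t) w = (\<Sum>j=1..N. cint j (\<lambda>x. momentum (U t) x * poly (w j) x)) - aform (rep (u t)) w"
  unfolding \<zeta>_def aform_diff_left Z(2)[OF assms] ..

lemma zeta_energy_continuous: "continuous_on {0..T} (\<lambda>t. aform (\<zeta> t) (\<zeta> t))"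
proof (rule energy_continuous[OF fam_zeta])
  fix e assume e: "e \<in> idx"
  have "continuous_on {0..T} (\<lambda>t. (\<Sum>j=1..N. cint j (\<lambda>x. momentum (U t) x * poly (phi e j) x)) - aform (rep (u t)) (phi e))"
    by (intro continuous_on_diff aform_u_continuous DERIV_continuous_on[OF moment_derivative])
  then show "continuous_on {0..T} (\<lambda>t. aform (\<zeta> t) (phi e))"
    by (rule continuous_on_eq) (simp add: aform_zeta[OF _ fam_phi[OF e]])
qed

lemma zeta_energy_derivative:
  assumes t: "0 < t" "t < T"
  shows "((\<lambda>t. aform (\<zeta> t) (\<zeta> t)) has_field_derivative
    2 * ((\<Sum>j=1..N. cint j (\<lambda>x. Mt t x * poly (\<zeta> t j) x)) - SR sch \<kappa> (rep (u t)) (\<zeta> t))) (at t)"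
proof -
  have tI: "t \<in> {0<..<T}" "t \<in> {0..T}" using t by auto
  have at: "at t within {0..T} = at t" using t by (simp add: at_within_Icc_at)
  let ?M = "\<lambda>w. \<Sum>j=1..N. cint j (\<lambda>x. Mt t x * poly (w j) x)"
  have "((\<lambda>t. aform (\<zeta> t) (phi e)) has_field_derivative ?M (phi e) - SR sch \<kappa> (rep (u t)) (phi e)) (at t)" if e: "e \<in> idx" for e
  proof -
    have "((\<lambda>t. (\<Sum>j=1..N. cint j (\<lambda>x. momentum (U t) x * poly (phi e j) x)) - aform (rep (u t)) (phi e)) has_field_derivative
        ?M (phi e) - SR sch \<kappa> (rep (u t)) (phi e)) (at t)"
      by (intro DERIV_diff moment_derivative[OF tI(2), unfolded at] aform_u_derivative(1)[OF t fam_phi[OF e]])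
    then show ?thesis
      by (rule has_field_derivative_transform_within_open[OF _ open_greaterThanLessThan tI(1)])
        (simp add: aform_zeta[OF _ fam_phi[OF e]])
  qed
  then have "((\<lambda>t. aform (\<zeta> t) (\<zeta> t)) has_field_derivative
    2 * (\<Sum>e\<in>idx. cf (\<zeta> t) e * (?M (phi e) - SR sch \<kappa> (rep (u t)) (phi e)))) (at t)"
    by (rule energy_derivative[OF fam_zeta open_greaterThanLessThan tI(1), rotated]) auto
  also have "(\<Sum>e\<in>idx. cf (\<zeta> t) e * (?M (phi e) - SR sch \<kappa> (rep (u t)) (phi e)))
    = (\<Sum>e\<in>idx. cf (\<zeta> t) e * ?M (phi e)) - (\<Sum>e\<in>idx. cf (\<zeta> t) e * SR sch \<kappa> (rep (u t)) (phi e))"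
    by (simp only: right_diff_distrib sum_subtractf)
  also have "\<dots> = ?M (\<zeta> t) - SR sch \<kappa> (rep (u t)) (\<zeta> t)"
    unfolding aform_u_derivative(2)[OF t fam_zeta[OF tI(2)]]
    by (subst cint_expand[OF fam_zeta[OF tI(2)] Mt_cont[OF tI(2)]]) simp_all
  finally show ?thesis .
qed

lemma initial_trace: "j \<in> {1..N} \<Longrightarrow> poly (rep (u 0) j) (X j) = U 0 (X j)"
proof -
  assume j: "j \<in> {1..N}"
  have z: "0 \<in> {0..T}" using T by simp
  have "left_trace N X (u 0) j = left_trace N X (U 0) j"
    using init_u j unfolding is_Gauss_Radau_projection_def by blast
  moreover have "left_trace N X (U 0) j = U 0 (X j)"
    using left_limit[OF j refl DERIV_isCont[OF mCH_der(1)[OF sol z]]] j by (auto simp: left_trace_def)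
  ultimately show ?thesis by (simp only: traces(1)[OF reps_u[OF z] j])
qed

text \<open>A test function supported in a single cell localises the global projection.\<close>

lemma initial_orthogonality:
  assumes j: "j \<in> {1..N}" and f: "degree f \<le> k"
  shows "cint j (\<lambda>x. (poly (D (rep (u 0)) j) x - deriv (U 0) x) * poly f x) = 0"
proof -
  have z: "0 \<in> {0..T}" using T by simp
  define w where "w = (\<lambda>i. if i = j then f else 0)"
  have w: "fam w" using f by (simp add: fam_def w_def)
  have cR: "continuous_on S (deriv (U 0))" for S
    using continuous_on_slice[OF mCH_continuous(2)[OF sol] z] continuous_on_subset by blast
  have e: "r 0 x - deriv (U 0) x = poly (rep (r 0) i) x - deriv (U 0) x" if "i \<in> {1..N}" "x \<in> cell X i" for i x
    using repsD[OF reps_r[OF z] that] by simp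
  have "0 = L2_inner {xl<..<xr} (\<lambda>x. r 0 x - deriv (U 0) x) (fn w)"
    using init_r fn_Vh[OF w] unfolding is_L2_projection_def X0 XN by simp
  also have "\<dots> = (\<Sum>i=1..N. cint i (\<lambda>x. (poly (rep (r 0) i) x - deriv (U 0) x) * poly (w i) x))"
    by (rule L2_inner_split[OF e repsD[OF fn_reps[OF w]]]) (auto intro!: continuous_intros cR)
  also have "\<dots> = (\<Sum>i=1..N. if i = j then cint j (\<lambda>x. (poly (rep (r 0) j) x - deriv (U 0) x) * poly f x) else 0)"
    by (intro sum.cong refl) (simp add: w_def)
  also have "\<dots> = cint j (\<lambda>x. (poly (rep (r 0) j) x - deriv (U 0) x) * poly f x)" using j by simp
  finally show ?thesis unfolding D_u[OF z j] by simp
qed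

end

section \<open>Error bounds\<close>

text \<open>The Gronwall rate; the leading 2 is that of the derivative of a quadratic form.\<close>

definition CF :: "real \<Rightarrow> nat \<Rightarrow> real \<Rightarrow> real \<Rightarrow> real \<Rightarrow> real" where
  "CF \<kappa> k L \<rho> G = 2 * (CM \<kappa> L G * (4 * Binv k / \<rho> + CZ k L \<rho> G + L / \<rho>))"

text \<open>The initial energy is of order h^(2k+2), at most L^2 h^(2k) up to the constants; the
  summand 1 is the forcing h^(2k) of the differential inequality.\<close>

definition CE :: "real \<Rightarrow> nat \<Rightarrow> real \<Rightarrow> real \<Rightarrow> real \<Rightarrow> real \<Rightarrow> real" where
  "CE \<kappa> k L \<rho> T G = ((2 * CA k L G + 2 * CI k L G) * L\<^sup>2 + 1) * exp (CF \<kappa> k L \<rho> G * T)"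

text \<open>The last two bounds make \<open>CZ h\<^bsup>2k+1\<^esup> \<le> 1\<close> and keep \<open>CE h\<^bsup>2k\<^esup>\<close> below the barrier \<open>\<rho> h / (4 Binv)\<close>.\<close>

definition H0 :: "real \<Rightarrow> nat \<Rightarrow> real \<Rightarrow> real \<Rightarrow> real \<Rightarrow> real \<Rightarrow> real" where
  "H0 \<kappa> k L \<rho> T G = min 1 (min (1 / (CZ k L \<rho> G + 1)) (\<rho> / (8 * Binv k * CE \<kappa> k L \<rho> T G)))"

text \<open>A bound on the error without any rate: 4 G^2 L for the exact solution, and twice a bound
  on the initial discrete energy.\<close>

definition CB :: "nat \<Rightarrow> real \<Rightarrow> real \<Rightarrow> real" where
  "CB k L G = 4 * G\<^sup>2 * L + 2 * (2 * (2 * L * (G + (Cv k L G + G) * L ^ (k + 1))\<^sup>2) + 2 * (CI k L G * L ^ (2 * k + 2)))"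

text \<open>The last summand serves meshes with h above \<open>H0\<close>, where dividing by H0^(2k)
  turns a constant bound into one proportional to h^(2k).\<close>

definition Cerr :: "real \<Rightarrow> nat \<Rightarrow> real \<Rightarrow> real \<Rightarrow> real \<Rightarrow> real \<Rightarrow> real" where
  "Cerr \<kappa> k L \<rho> T G = 4 * CZ k L \<rho> G * L\<^sup>2 + 2 * CE \<kappa> k L \<rho> T G + CB k L G / H0 \<kappa> k L \<rho> T G ^ (2 * k)"

context
  fixes \<kappa> L \<rho> T G :: real and k :: nat
  assumes pos: "0 < L" "0 < \<rho>" "0 < T" "1 \<le> G"
begin

lemma constants_nonneg:
  "0 \<le> CA k L G" "0 \<le> CZ k L \<rho> G" "0 \<le> CI k L G" "0 \<le> CF \<kappa> k L \<rho> G"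
proof -
  have B: "0 \<le> Binv k" using Binv_unit(1)[of k] by simp
  show CA: "0 \<le> CA k L G" and CI: "0 \<le> CI k L G" using pos B by (simp_all add: CA_def CI_def)
  show CZ: "0 \<le> CZ k L \<rho> G" using pos B CA by (simp add: CZ_def)
  have "0 \<le> CM \<kappa> L G" using pos by (simp add: CM_def)
  then show "0 \<le> CF \<kappa> k L \<rho> G" using pos B CZ by (simp add: CF_def)
qed

lemma CE_ge_1: "1 \<le> CE \<kappa> k L \<rho> T G"
proof -
  have "1 * 1 \<le> ((2 * CA k L G + 2 * CI k L G) * L\<^sup>2 + 1) * exp (CF \<kappa> k L \<rho> G * T)"
    using constants_nonneg pos by (intro mult_mono) auto
  then show ?thesis by (simp add: CE_def)
qed

lemma H0_pos: "0 < H0 \<kappa> k L \<rho> T G"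
proof -
  have "0 < 8 * Binv k * CE \<kappa> k L \<rho> T G" using CE_ge_1 Binv_unit(1)[of k] by (intro mult_pos_pos) auto
  then show ?thesis using constants_nonneg(2) pos by (simp add: H0_def)
qed

lemma CB_nonneg: "0 \<le> CB k L G"
  unfolding CB_def using pos constants_nonneg by (intro add_nonneg_nonneg mult_nonneg_nonneg) auto

end

lemma square_sum_le: "(a + b)\<^sup>2 \<le> 2 * a\<^sup>2 + 2 * (b::real)\<^sup>2"
  using zero_le_power2[of "a - b"] unfolding power2_sum power2_diff by linarith

lemma two_squares_le:
  fixes a b c d p q s :: real
  shows "p \<le> 2 * a + 2 * b \<Longrightarrow> q \<le> 2 * c + 2 * d \<Longrightarrow> a \<le> s \<Longrightarrow> c \<le> s \<Longrightarrow> p + q \<le> 4 * s + 2 * (b + d)"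
  unfolding distrib_left by linarith

context ldg_error
begin

lemma L_pos: "0 < L"
  using xl_xr by simp

lemmas const = L_pos rho T GG_ge(2)[OF B, of k]

lemma data_at:
  assumes t: "t \<in> {0..T}"
  obtains q \<pi>q where "dg_data xl xr \<rho> k N X \<kappa> G (U t) (deriv (U t)) (deriv (deriv (U t))) (Mt t) q \<pi>q"
  using dg_data_exists[OF sol t B smooth[OF t]] by (elim exE) (rule that)

lemma Z_ritz:
  assumes t: "t \<in> {0..T}" and d: "dg_data xl xr \<rho> k N X \<kappa> G (U t) (deriv (U t)) (deriv (deriv (U t))) (Mt t) q \<pi>q"
  shows "dg_data.ritz k N X (U t) (deriv (deriv (U t))) (Z t)"
  unfolding dg_data.ritz_def[OF d] using Z(2)[OF t] by (simp add: momentum_def)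

lemma initial_zeta: "aform (\<zeta> 0) (\<zeta> 0) \<le> (2 * CA k L G + 2 * CI k L G) * h ^ (2 * k + 2)"
  and initial_energy: "aform (rep (u 0)) (rep (u 0)) \<le> 2 * (2 * L * (G + (Cv k L G + G) * L ^ (k + 1))\<^sup>2) + 2 * (CI k L G * L ^ (2 * k + 2))"
proof -
  have z: "0 \<in> {0..T}" using T by simp
  obtain q \<pi>q where d: "dg_data xl xr \<rho> k N X \<kappa> G (U 0) (deriv (U 0)) (deriv (deriv (U 0))) (Mt 0) q \<pi>q"
    by (rule data_at[OF z])
  interpret d: dg_data xl xr \<rho> k N X \<kappa> G "U 0" "deriv (U 0)" "deriv (deriv (U 0))" "Mt 0" q \<pi>q by (rule d)
  have i: "aform (\<lambda>j. d.v j - rep (u 0) j) (\<lambda>j. d.v j - rep (u 0) j) \<le> CI k L G * h ^ (2 * k + 2)"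
    by (rule d.initial_error[OF fam_u[OF z] initial_trace initial_orthogonality])
  have e: "aform (\<lambda>j. Z 0 j - d.v j) (\<lambda>j. Z 0 j - d.v j) \<le> CA k L G * h ^ (2 * k + 2)"
    by (rule d.Ritz_error[OF Z(1)[OF z] Z_ritz[OF z d]])
  have "\<zeta> 0 = (\<lambda>j. (Z 0 j - d.v j) + (d.v j - rep (u 0) j))" by (simp add: fun_eq_iff \<zeta>_def)
  then have "aform (\<zeta> 0) (\<zeta> 0) \<le> 2 * aform (\<lambda>j. Z 0 j - d.v j) (\<lambda>j. Z 0 j - d.v j)
      + 2 * aform (\<lambda>j. d.v j - rep (u 0) j) (\<lambda>j. d.v j - rep (u 0) j)"
    by (simp only: aform_Cauchy_Schwarz_sq)
  also have "\<dots> \<le> 2 * (CA k L G * h ^ (2 * k + 2)) + 2 * (CI k L G * h ^ (2 * k + 2))" using i e by simp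
  finally show "aform (\<zeta> 0) (\<zeta> 0) \<le> (2 * CA k L G + 2 * CI k L G) * h ^ (2 * k + 2)"
    by (simp only: distrib_right mult.assoc)
  let ?w = "\<lambda>j. - (d.v j - rep (u 0) j)"
  have mw: "aform ?w ?w = aform (\<lambda>j. d.v j - rep (u 0) j) (\<lambda>j. d.v j - rep (u 0) j)"
    using aform_smult_left[of "-1" "\<lambda>j. d.v j - rep (u 0) j" ?w]
      aform_smult_left[of "-1" "\<lambda>j. d.v j - rep (u 0) j" "\<lambda>j. d.v j - rep (u 0) j"]
    by (simp add: aform_commute)
  have eq: "rep (u 0) = (\<lambda>j. d.v j + ?w j)" by (simp add: fun_eq_iff)
  have "aform (rep (u 0)) (rep (u 0)) = aform (\<lambda>j. d.v j + ?w j) (\<lambda>j. d.v j + ?w j)"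
    by (rule arg_cong2[where f = aform, OF eq eq])
  also have "\<dots> \<le> 2 * aform d.v d.v + 2 * aform ?w ?w" by (rule aform_Cauchy_Schwarz_sq)
  also have "\<dots> \<le> 2 * (2 * L * (G + (Cv k L G + G) * L ^ (k + 1))\<^sup>2) + 2 * (CI k L G * L ^ (2 * k + 2))"
  proof (intro add_mono mult_left_mono)
    show "aform d.v d.v \<le> 2 * L * (G + (Cv k L G + G) * L ^ (k + 1))\<^sup>2" by (rule d.interpolant_bound)
    have "CI k L G * h ^ (2 * k + 2) \<le> CI k L G * L ^ (2 * k + 2)"
      using h_pos h_le_L constants_nonneg(3)[OF const] by (intro mult_left_mono power_mono) auto
    then show "aform ?w ?w \<le> CI k L G * L ^ (2 * k + 2)" unfolding mw using i by linarith
  qed simp_all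
  finally show "aform (rep (u 0)) (rep (u 0)) \<le> 2 * (2 * L * (G + (Cv k L G + G) * L ^ (k + 1))\<^sup>2) + 2 * (CI k L G * L ^ (2 * k + 2))" .
qed

lemma zeta_bound:
  assumes small: "h \<le> H0 \<kappa> k L \<rho> T G" and t: "t \<in> {0..T}"
  shows "aform (\<zeta> t) (\<zeta> t) \<le> CE \<kappa> k L \<rho> T G * h ^ (2 * k)"
proof -
  let ?E = "CE \<kappa> k L \<rho> T G" and ?C = "CF \<kappa> k L \<rho> G" and ?K = "2 * CA k L G + 2 * CI k L G"
  have B0: "0 < Binv k" using Binv_unit(1)[of k] by simp
  have E: "1 \<le> ?E" by (rule CE_ge_1[OF const])
  have h: "0 < h" "h \<le> 1" "h \<le> 1 / (CZ k L \<rho> G + 1)" "h \<le> \<rho> / (8 * Binv k * ?E)"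
    using small h_pos by (auto simp: H0_def)
  note nn = constants_nonneg[OF const]
  have CZh: "CZ k L \<rho> G * h ^ (2 * k + 1) \<le> 1"
  proof -
    have "h ^ (2 * k + 1) \<le> h ^ 1" using h by (intro power_decreasing) auto
    then have "CZ k L \<rho> G * h ^ (2 * k + 1) \<le> CZ k L \<rho> G * h" using nn by (intro mult_left_mono) auto
    also have "\<dots> \<le> (CZ k L \<rho> G + 1) * h" using h by (simp add: distrib_right)
    also have "\<dots> \<le> 1"
    proof -
      have "0 < CZ k L \<rho> G + 1" using nn(2)[of k] by simp
      then show ?thesis using h(3) by (simp only: pos_le_divide_eq mult.commute)
    qed
    finally show ?thesis .
  qed
  have init: "aform (\<zeta> 0) (\<zeta> 0) + h ^ (2 * k) \<le> (?K * L\<^sup>2 + 1) * h ^ (2 * k)"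
  proof -
    have "?K * h ^ (2 * k + 2) = ?K * h\<^sup>2 * h ^ (2 * k)" by (simp only: power_add mult.assoc mult.commute[of "h ^ (2 * k)"])
    also have "\<dots> \<le> ?K * L\<^sup>2 * h ^ (2 * k)"
      using nn h h_le_L by (intro mult_right_mono mult_left_mono power_mono) auto
    finally show ?thesis using initial_zeta by (simp add: distrib_right)
  qed
  have iE: "(aform (\<zeta> 0) (\<zeta> 0) + h ^ (2 * k)) * exp (?C * T) \<le> ?E * h ^ (2 * k)"
  proof -
    have "(aform (\<zeta> 0) (\<zeta> 0) + h ^ (2 * k)) * exp (?C * T) \<le> (?K * L\<^sup>2 + 1) * h ^ (2 * k) * exp (?C * T)"
      by (rule mult_right_mono[OF init]) simp
    then show ?thesis by (simp only: CE_def mult.assoc mult.commute[of "h ^ (2 * k)"])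
  qed
  have eta: "?E * h ^ (2 * k) < \<rho> * h / (4 * Binv k)"
  proof -
    \<comment> \<open>Here k \<ge> 1 matters: h^(2k) has to stay below a barrier proportional to h.
      The 8 in \<open>H0\<close> against the 4 in the barrier makes the inequality strict.\<close>
    have "h ^ (2 * k) \<le> h ^ 2" using h k1 by (intro power_decreasing) auto
    then have "?E * h ^ (2 * k) \<le> ?E * h ^ 2" using E by (intro mult_left_mono) auto
    also have "\<dots> = (?E * h) * h" by (simp add: power2_eq_square)
    also have "\<dots> \<le> (\<rho> / (8 * Binv k)) * h"
    proof (rule mult_right_mono)
      have "?E * h \<le> ?E * (\<rho> / (8 * Binv k * ?E))" using h(4) E by (intro mult_left_mono) auto
      also have "\<dots> = \<rho> / (8 * Binv k)" using E by simp
      finally show "?E * h \<le> \<rho> / (8 * Binv k)" .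
    qed (use h in simp)
    also have "\<dots> < \<rho> * h / (4 * Binv k)" using rho h B0 by (simp add: field_simps)
    finally show ?thesis .
  qed
  have step: "2 * ((\<Sum>j=1..N. cint j (\<lambda>x. Mt \<tau> x * poly (\<zeta> \<tau> j) x)) - SR sch \<kappa> (rep (u \<tau>)) (\<zeta> \<tau>))
      \<le> ?C * (aform (\<zeta> \<tau>) (\<zeta> \<tau>) + h ^ (2 * k))"
    if \<tau>: "0 < \<tau>" "\<tau> < T" and le: "aform (\<zeta> \<tau>) (\<zeta> \<tau>) \<le> \<rho> * h / (4 * Binv k)" for \<tau>
  proof -
    have \<tau>I: "\<tau> \<in> {0..T}" using \<tau> by simp
    obtain q \<pi>q where d: "dg_data xl xr \<rho> k N X \<kappa> G (U \<tau>) (deriv (U \<tau>)) (deriv (deriv (U \<tau>))) (Mt \<tau>) q \<pi>q"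
      by (rule data_at[OF \<tau>I])
    have "4 * Binv k * aform (\<zeta> \<tau>) (\<zeta> \<tau>) \<le> \<rho> * h" using le B0 by (simp add: pos_le_divide_eq mult.commute)
    moreover have "rep (u \<tau>) = (\<lambda>j. Z \<tau> j - \<zeta> \<tau> j)" by (simp add: fun_eq_iff \<zeta>_def)
    ultimately have "(\<Sum>j=1..N. cint j (\<lambda>x. Mt \<tau> x * poly (\<zeta> \<tau> j) x)) - SR sch \<kappa> (rep (u \<tau>)) (\<zeta> \<tau>)
      \<le> CM \<kappa> L G * ((4 * Binv k / \<rho> + CZ k L \<rho> G + L / \<rho>) * (aform (\<zeta> \<tau>) (\<zeta> \<tau>) + h ^ (2 * k)))"
      by (intro dg_data.error_dissipation[OF d Z(1)[OF \<tau>I] Z_ritz[OF \<tau>I d] fam_zeta[OF \<tau>I] _ CZh])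
    then show ?thesis by (simp only: CF_def mult.assoc mult_le_cancel_left_pos zero_less_numeral)
  qed
  have Q0: "0 \<le> aform (\<zeta> 0) (\<zeta> 0)" and hk: "0 \<le> h ^ (2 * k)" using aform_nonneg h by auto
  have "aform (\<zeta> t) (\<zeta> t) + h ^ (2 * k) \<le> (aform (\<zeta> 0) (\<zeta> 0) + h ^ (2 * k)) * exp (?C * T)"
    by (rule gronwall_barrier(2)[where Q = "\<lambda>t. aform (\<zeta> t) (\<zeta> t)", OF T zeta_energy_continuous zeta_energy_derivative step
        nn(4) hk Q0 order.strict_trans1[OF iE eta] t])
  then show ?thesis using iE hk by linarith
qed

section \<open>From the energy to the error in L2\<close>

definition err :: "real \<Rightarrow> real" where
  "err t = (\<Sum>j=1..N. cint j (\<lambda>x. (U t x - poly (rep (u t) j) x)\<^sup>2 + (deriv (U t) x - poly (D (rep (u t)) j) x)\<^sup>2))"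

lemma exact_cont:
  assumes t: "t \<in> {0..T}"
  shows "continuous_on S (U t)" "continuous_on S (deriv (U t))"
  using continuous_on_slice[OF mCH_continuous(1)[OF sol] t] continuous_on_slice[OF mCH_continuous(2)[OF sol] t]
    continuous_on_subset by blast+

text \<open>Serves two comparisons: w = \<zeta> with the squared Ritz errors on fine meshes, and w =
  u with 4 G^2 on coarse ones.\<close>

lemma err_split:
  assumes t: "t \<in> {0..T}" and c: "\<And>j. j \<in> {1..N} \<Longrightarrow> 0 \<le> c j"
    and b: "\<And>j x. j \<in> {1..N} \<Longrightarrow> x \<in> {X (j - 1)..X j} \<Longrightarrow>
      (U t x - poly (rep (u t) j) x)\<^sup>2 + (deriv (U t) x - poly (D (rep (u t)) j) x)\<^sup>2 \<le> c j + 2 * ((poly (w j) x)\<^sup>2 + (poly (D w j) x)\<^sup>2)"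
  shows "err t \<le> (\<Sum>j=1..N. c j * len j) + 2 * aform w w"
proof -
  have "err t \<le> (\<Sum>j=1..N. c j * len j + 2 * en w j)"
    unfolding err_def
  proof (intro sum_mono)
    fix j assume j: "j \<in> {1..N}"
    have "cint j (\<lambda>x. (U t x - poly (rep (u t) j) x)\<^sup>2 + (deriv (U t) x - poly (D (rep (u t)) j) x)\<^sup>2)
      \<le> cint j (\<lambda>x. c j + 2 * ((poly (w j) x)\<^sup>2 + (poly (D w j) x)\<^sup>2))"
      by (rule cint_le[OF j _ _ b[OF j]]) (intro continuous_intros exact_cont[OF t])+
    also have "\<dots> = c j * len j + 2 * en w j"
      using X_le[OF j] by (subst cint_add) (auto intro!: continuous_intros simp: en_def len_def simp del: distrib_left_numeral)
    finally show "cint j (\<lambda>x. (U t x - poly (rep (u t) j) x)\<^sup>2 + (deriv (U t) x - poly (D (rep (u t)) j) x)\<^sup>2) \<le> c j * len j + 2 * en w j" .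
  qed
  also have "\<dots> = (\<Sum>j=1..N. c j * len j) + 2 * aform w w"
    by (simp only: sum.distrib aform_en sum_distrib_left)
  finally show ?thesis .
qed

lemma err_small:
  assumes small: "h \<le> H0 \<kappa> k L \<rho> T G" and t: "t \<in> {0..T}"
  shows "err t \<le> (4 * CZ k L \<rho> G * L\<^sup>2 + 2 * CE \<kappa> k L \<rho> T G) * h ^ (2 * k)"
proof -
  obtain q \<pi>q where d: "dg_data xl xr \<rho> k N X \<kappa> G (U t) (deriv (U t)) (deriv (deriv (U t))) (Mt t) q \<pi>q"
    by (rule data_at[OF t])
  obtain A where A: "\<And>j x. j \<in> {1..N} \<Longrightarrow> x \<in> {X (j - 1)..X j} \<Longrightarrow> \<bar>U t x - poly (Z t j) x\<bar> \<le> A j"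
    "\<And>j x. j \<in> {1..N} \<Longrightarrow> x \<in> {X (j - 1)..X j} \<Longrightarrow> \<bar>deriv (U t) x - poly (D (Z t) j) x\<bar> \<le> A j"
    and hA: "h * (\<Sum>j=1..N. (A j)\<^sup>2) \<le> CZ k L \<rho> G * h ^ (2 * k + 2)"
    and A0: "\<And>j. j \<in> {1..N} \<Longrightarrow> 0 \<le> A j"
    by (rule dg_data.Ritz_sup[OF d Z(1)[OF t] Z_ritz[OF t d]]) (rule that)
  note nn = constants_nonneg[OF const]
  have "err t \<le> (\<Sum>j=1..N. 4 * (A j)\<^sup>2 * len j) + 2 * aform (\<zeta> t) (\<zeta> t)"
  proof (rule err_split[OF t])
    fix j x assume j: "j \<in> {1..N}" and x: "x \<in> {X (j - 1)..X j}"
    have Dz: "D (\<zeta> t) j = D (Z t) j - D (rep (u t)) j" unfolding \<zeta>_def by (rule D_diff)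
    have 1: "U t x - poly (rep (u t) j) x = (U t x - poly (Z t j) x) + poly (\<zeta> t j) x"
      by (simp add: \<zeta>_def)
    have 2: "deriv (U t) x - poly (D (rep (u t)) j) x = (deriv (U t) x - poly (D (Z t) j) x) + poly (D (\<zeta> t) j) x"
      by (simp add: Dz)
    have sq: "y\<^sup>2 \<le> (A j)\<^sup>2" if "\<bar>y\<bar> \<le> A j" for y using power_mono[OF that abs_ge_zero, of 2] by simp
    show "(U t x - poly (rep (u t) j) x)\<^sup>2 + (deriv (U t) x - poly (D (rep (u t)) j) x)\<^sup>2
      \<le> 4 * (A j)\<^sup>2 + 2 * ((poly (\<zeta> t j) x)\<^sup>2 + (poly (D (\<zeta> t) j) x)\<^sup>2)"
      unfolding 1 2 by (rule two_squares_le[OF square_sum_le square_sum_le sq[OF A(1)[OF j x]] sq[OF A(2)[OF j x]]])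
  qed simp
  also have "(\<Sum>j=1..N. 4 * (A j)\<^sup>2 * len j) \<le> (\<Sum>j=1..N. 4 * (A j)\<^sup>2 * h)"
    using len_le_h by (intro sum_mono mult_left_mono) auto
  also have "\<dots> = 4 * (h * (\<Sum>j=1..N. (A j)\<^sup>2))" by (simp add: sum_distrib_left sum_distrib_right ac_simps)
  also have "\<dots> \<le> 4 * (CZ k L \<rho> G * h ^ (2 * k + 2))" using hA by simp
  also have "h ^ (2 * k + 2) = h\<^sup>2 * h ^ (2 * k)" by (simp only: power_add mult.commute)
  also have "4 * (CZ k L \<rho> G * (h\<^sup>2 * h ^ (2 * k))) \<le> 4 * (CZ k L \<rho> G * (L\<^sup>2 * h ^ (2 * k)))"
    using nn h_pos h_le_L by (intro mult_left_mono mult_right_mono power_mono) auto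
  also have "aform (\<zeta> t) (\<zeta> t) \<le> CE \<kappa> k L \<rho> T G * h ^ (2 * k)" by (rule zeta_bound[OF small t])
  finally show ?thesis by (simp add: distrib_right mult.assoc)
qed

lemma err_bounded: "t \<in> {0..T} \<Longrightarrow> err t \<le> CB k L G"
proof -
  assume t: "t \<in> {0..T}"
  obtain q \<pi>q where d: "dg_data xl xr \<rho> k N X \<kappa> G (U t) (deriv (U t)) (deriv (deriv (U t))) (Mt t) q \<pi>q"
    by (rule data_at[OF t])
  have "err t \<le> (\<Sum>j=1..N. 4 * G\<^sup>2 * len j) + 2 * aform (rep (u t)) (rep (u t))"
  proof (rule err_split[OF t])
    fix j x assume j: "j \<in> {1..N}" and x: "x \<in> {X (j - 1)..X j}"
    have xx: "x \<in> {xl..xr}" by (rule cell_subset[OF j x])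
    have sq: "y\<^sup>2 \<le> G\<^sup>2" if "\<bar>y\<bar> \<le> G" for y using power_mono[OF that abs_ge_zero, of 2] by simp
    show "(U t x - poly (rep (u t) j) x)\<^sup>2 + (deriv (U t) x - poly (D (rep (u t)) j) x)\<^sup>2
      \<le> 4 * G\<^sup>2 + 2 * ((poly (rep (u t) j) x)\<^sup>2 + (poly (D (rep (u t)) j) x)\<^sup>2)"
      using two_squares_le[OF square_sum_le[of "U t x" "- poly (rep (u t) j) x"] square_sum_le[of "deriv (U t) x" "- poly (D (rep (u t)) j) x"]
        sq[OF dg_data.U_G[OF d xx]] sq[OF dg_data.R_G[OF d xx]]] by simp
  qed simp
  also have "(\<Sum>j=1..N. 4 * G\<^sup>2 * len j) = 4 * G\<^sup>2 * L" by (simp only: sum_distrib_left[symmetric] sum_len)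
  also have "aform (rep (u t)) (rep (u t)) \<le> 2 * (2 * L * (G + (Cv k L G + G) * L ^ (k + 1))\<^sup>2) + 2 * (CI k L G * L ^ (2 * k + 2))"
    by (rule order.trans[OF energy_nonincreasing[OF t] initial_energy])
  finally show ?thesis unfolding CB_def by simp
qed

theorem error_bound:
  assumes t: "t \<in> {0..T}"
  shows "(L2_norm {xl<..<xr} (\<lambda>x. U t x - u t x))\<^sup>2 + (L2_norm {xl<..<xr} (\<lambda>x. deriv (U t) x - r t x))\<^sup>2
    \<le> Cerr \<kappa> k L \<rho> T G * mesh_size N X ^ (2 * k)"
proof -
  let ?H = "H0 \<kappa> k L \<rho> T G"
  note nn = constants_nonneg[OF const]
  have H: "0 < ?H" by (rule H0_pos[OF const])
  have CB: "0 \<le> CB k L G" by (rule CB_nonneg[OF const])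
  have E: "1 \<le> CE \<kappa> k L \<rho> T G" by (rule CE_ge_1[OF const])
  have hk: "0 \<le> h ^ (2 * k)" using h_pos by simp
  have "(L2_norm {xl<..<xr} (\<lambda>x. U t x - u t x))\<^sup>2 + (L2_norm {xl<..<xr} (\<lambda>x. deriv (U t) x - r t x))\<^sup>2 = err t"
    unfolding norm_cells[OF reps_u[OF t] exact_cont(1)[OF t]] norm_cells[OF reps_r[OF t] exact_cont(2)[OF t]] err_def sum.distrib[symmetric]
  proof (intro sum.cong refl)
    fix j assume j: "j \<in> {1..N}"
    show "cint j (\<lambda>x. (U t x - poly (rep (u t) j) x)\<^sup>2) + cint j (\<lambda>x. (deriv (U t) x - poly (rep (r t) j) x)\<^sup>2)
      = cint j (\<lambda>x. (U t x - poly (rep (u t) j) x)\<^sup>2 + (deriv (U t) x - poly (D (rep (u t)) j) x)\<^sup>2)"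
      unfolding D_u[OF t j] by (rule cint_add[symmetric]) (auto intro!: continuous_intros exact_cont[OF t])
  qed
  also have "err t \<le> Cerr \<kappa> k L \<rho> T G * h ^ (2 * k)"
  proof (cases "h \<le> ?H")
    case True
    have "(4 * CZ k L \<rho> G * L\<^sup>2 + 2 * CE \<kappa> k L \<rho> T G) * h ^ (2 * k) \<le> Cerr \<kappa> k L \<rho> T G * h ^ (2 * k)"
      unfolding Cerr_def using CB H hk by (intro mult_right_mono) auto
    then show ?thesis using err_small[OF True t] by linarith
  next
    case False
    have "CB k L G = CB k L G / ?H ^ (2 * k) * ?H ^ (2 * k)" using H by simp
    also have "\<dots> \<le> CB k L G / ?H ^ (2 * k) * h ^ (2 * k)"
      using CB H False by (intro mult_left_mono power_mono divide_nonneg_pos) auto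
    also have "\<dots> \<le> Cerr \<kappa> k L \<rho> T G * h ^ (2 * k)"
      unfolding Cerr_def using nn(2) E hk by (intro mult_right_mono) auto
    finally show ?thesis using err_bounded[OF t] by linarith
  qed
  finally show ?thesis unfolding h_def .
qed

end

section \<open>The convergence theorem\<close>

text \<open>The norm is an infimum of essential bounds; adding 1 leaves an admissible bound below
  it, whether or not the infimum is attained.\<close>

lemma Linf_sobolev_AE:
  assumes "w \<in> Linf_sobolev T n \<Omega>"
  shows "AE t in lebesgue_on {0..T}. w t \<in> sobolev n \<Omega> \<and> sobolev_norm n \<Omega> (w t) \<le> Linf_sobolev_norm T n \<Omega> w + 1"
proof -
  let ?S = "{K. 0 \<le> K \<and> (AE t in lebesgue_on {0..T}. sobolev_norm n \<Omega> (w t) \<le> K)}"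
  obtain K where K: "AE t in lebesgue_on {0..T}. w t \<in> sobolev n \<Omega> \<and> sobolev_norm n \<Omega> (w t) \<le> K"
    using assms unfolding Linf_sobolev_def by blast
  have "AE t in lebesgue_on {0..T}. sobolev_norm n \<Omega> (w t) \<le> max 0 K"
    using K by (rule AE_mp) (auto intro!: AE_I2)
  then have "max 0 K \<in> ?S" by simp
  then have "?S \<noteq> {}" by blast
  moreover have "Inf ?S < Linf_sobolev_norm T n \<Omega> w + 1" by (simp add: Linf_sobolev_norm_def)
  ultimately obtain K' where K': "K' \<in> ?S" "K' < Linf_sobolev_norm T n \<Omega> w + 1" by (rule cInf_lessD[THEN bexE])
  from K'(1) have "AE t in lebesgue_on {0..T}. sobolev_norm n \<Omega> (w t) \<le> K'" by simp
  with K show ?thesis by eventually_elim (use K'(2) in auto)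
qed

text \<open>A null set contains no nonempty open interval. The interval \<open>?J\<close> is cut off
  at 0 and T so that t may be an endpoint.\<close>

lemma AE_interval_dense:
  fixes T t d :: real
  assumes P: "AE t in lebesgue_on {0..T}. P t" and T: "0 < T" and t: "t \<in> {0..T}" and d: "0 < d"
  obtains t' where "t' \<in> {0..T}" "\<bar>t - t'\<bar> < d" "P t'"
proof -
  have "AE t in lebesgue. t \<in> {0..T} \<longrightarrow> P t" using P by (subst (asm) AE_restrict_space_iff) auto
  then obtain N where N: "{t. \<not> (t \<in> {0..T} \<longrightarrow> P t)} \<subseteq> N" "N \<in> null_sets lebesgue"
    by (auto elim!: AE_E simp: null_sets_def)
  let ?J = "{max 0 (t - d)<..<min T (t + d)}"
  have "(max 0 (t - d) + min T (t + d)) / 2 \<in> ?J" using T t d by (auto simp: max_def min_def field_simps)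
  then have ne: "?J \<noteq> {}" by blast
  have "negligible N" using N(2) by (simp add: negligible_iff_null_sets)
  then have "\<not> ?J \<subseteq> N" using open_not_negligible[OF open_greaterThanLessThan ne] negligible_subset by blast
  then obtain t' where "t' \<in> ?J" "t' \<notin> N" by blast
  then have "t' \<in> {0..T}" "\<bar>t - t'\<bar> < d" by auto
  moreover from this have "P t'" using N(1) \<open>t' \<notin> N\<close> by blast
  ultimately show thesis by (rule that)
qed

lemma continuous_slices_close:
  fixes f :: "real \<Rightarrow> real \<Rightarrow> real"
  assumes f: "continuous_on ({0..T} \<times> UNIV) (\<lambda>(t, x). f t x)" and e: "0 < e"
  obtains d where "0 < d" "\<And>t t' x. t \<in> {0..T} \<Longrightarrow> t' \<in> {0..T} \<Longrightarrow> x \<in> {a..b} \<Longrightarrow> \<bar>t - t'\<bar> < d \<Longrightarrow> \<bar>f t x - f t' x\<bar> \<le> e"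
proof -
  have "uniformly_continuous_on ({0..T} \<times> {a..b}) (\<lambda>(t, x). f t x)"
    by (intro compact_uniformly_continuous continuous_on_subset[OF f] compact_Times compact_Icc) auto
  then obtain d where d: "0 < d" "\<forall>z\<in>{0..T} \<times> {a..b}. \<forall>z'\<in>{0..T} \<times> {a..b}. dist z' z < d \<longrightarrow> dist (case z' of (t, x) \<Rightarrow> f t x) (case z of (t, x) \<Rightarrow> f t x) < e"
    unfolding uniformly_continuous_on_def using e by meson
  show thesis
  proof (rule that[OF d(1)])
    fix t t' x assume tx: "t \<in> {0..T}" "t' \<in> {0..T}" "x \<in> {a..b}" "\<bar>t - t'\<bar> < d"
    have "dist (f t x) (f t' x) < e"
      using d(2)[rule_format, of "(t', x)" "(t, x)"] tx by (simp add: dist_Pair_Pair dist_real_def)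
    then show "\<bar>f t x - f t' x\<bar> \<le> e" by (simp add: dist_real_def)
  qed
qed

lemma Csob_nonneg: "0 < L \<Longrightarrow> 0 \<le> Csob L K"
  unfolding Csob_def using Mbump_nonneg by (intro divide_nonneg_nonneg mult_nonneg_nonneg add_nonneg_nonneg) auto

text \<open>The Sobolev bound is available at almost every time. By joint continuity U, U_x and U_xx
  at t are uniformly close to those at a nearby good time, and the property passes to the
  limit.\<close>

lemma mCH_smooth_approximable:
  assumes sol: "mCH_solution \<kappa> T xl xr U" and T: "0 < T" and x: "xl < xr"
    and U: "U \<in> Linf_sobolev T n {xl<..<xr}" and t: "t \<in> {0..T}"
  shows "smooth_approximable xl xr n (Csob (xr - xl) (Linf_sobolev_norm T n {xl<..<xr} U + 1))
    (U t) (deriv (U t)) (deriv (deriv (U t)))"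
proof (rule smooth_approximable_limit)
  fix \<delta> :: real assume \<delta>: "0 < \<delta>"
  let ?K = "Linf_sobolev_norm T n {xl<..<xr} U + 1"
  obtain d0 where d0: "0 < d0" "\<And>t t' x. t \<in> {0..T} \<Longrightarrow> t' \<in> {0..T} \<Longrightarrow> x \<in> {xl..xr} \<Longrightarrow> \<bar>t - t'\<bar> < d0 \<Longrightarrow> \<bar>U t x - U t' x\<bar> \<le> \<delta>"
    by (rule continuous_slices_close[OF mCH_continuous(1)[OF sol] \<delta>]) (rule that)
  obtain d1 where d1: "0 < d1" "\<And>t t' x. t \<in> {0..T} \<Longrightarrow> t' \<in> {0..T} \<Longrightarrow> x \<in> {xl..xr} \<Longrightarrow> \<bar>t - t'\<bar> < d1 \<Longrightarrow> \<bar>deriv (U t) x - deriv (U t') x\<bar> \<le> \<delta>"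
    by (rule continuous_slices_close[OF mCH_continuous(2)[OF sol] \<delta>]) (rule that)
  obtain d2 where d2: "0 < d2" "\<And>t t' x. t \<in> {0..T} \<Longrightarrow> t' \<in> {0..T} \<Longrightarrow> x \<in> {xl..xr} \<Longrightarrow> \<bar>t - t'\<bar> < d2 \<Longrightarrow> \<bar>deriv (deriv (U t)) x - deriv (deriv (U t')) x\<bar> \<le> \<delta>"
    by (rule continuous_slices_close[OF mCH_continuous(4)[OF sol] \<delta>]) (rule that)
  have d: "0 < min d0 (min d1 d2)" using d0(1) d1(1) d2(1) by simp
  obtain t' where t': "t' \<in> {0..T}" "\<bar>t - t'\<bar> < min d0 (min d1 d2)"
    "U t' \<in> sobolev n {xl<..<xr} \<and> sobolev_norm n {xl<..<xr} (U t') \<le> ?K"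
    by (rule AE_interval_dense[OF Linf_sobolev_AE[OF U] T t d]) (rule that)
  have "smooth_approximable xl xr n (Csob (xr - xl) ?K) (U t') (deriv (U t')) (deriv (deriv (U t')))"
    unfolding smooth_approximable_def
    by (intro allI impI sobolev_smooth_approx[OF x mCH_der[OF sol t'(1)] continuous_on_slice[OF mCH_continuous(4)[OF sol] t'(1)]
      conjunct1[OF t'(3)] conjunct2[OF t'(3)]])
  moreover have "\<forall>x\<in>{xl..xr}. \<bar>U t x - U t' x\<bar> \<le> \<delta> \<and> \<bar>deriv (U t) x - deriv (U t') x\<bar> \<le> \<delta>
      \<and> \<bar>deriv (deriv (U t)) x - deriv (deriv (U t')) x\<bar> \<le> \<delta>"
    using t'(2) by (intro ballI conjI d0(2)[OF t t'(1)] d1(2)[OF t t'(1)] d2(2)[OF t t'(1)]) auto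
  ultimately show "\<exists>V S S2. smooth_approximable xl xr n (Csob (xr - xl) ?K) V S S2 \<and>
     (\<forall>x\<in>{xl..xr}. \<bar>U t x - V x\<bar> \<le> \<delta> \<and> \<bar>deriv (U t) x - S x\<bar> \<le> \<delta> \<and> \<bar>deriv (deriv (U t)) x - S2 x\<bar> \<le> \<delta>)"
    by (intro exI conjI)
qed

theorem theorem4p1:
  fixes \<kappa> xl xr T \<rho> :: real and k :: nat and sch :: scheme
  assumes "xl < xr" and "k \<ge> 1" and "T > 0" and "\<rho> > 0"
  shows "\<exists>C :: real \<Rightarrow> real. (\<forall>K. C K > 0) \<and>
    (\<forall>U :: real \<Rightarrow> real \<Rightarrow> real.
       mCH_solution \<kappa> T xl xr U \<longrightarrow>
       U \<in> Linf_sobolev T (k + 3) {xl<..<xr} \<longrightarrow>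
       time_deriv T U \<in> Linf_sobolev T (k + 3) {xl<..<xr} \<longrightarrow>
       (\<forall>N X u p r m s.
          is_mesh xl xr N X \<longrightarrow>
          quasi_uniform \<rho> N X \<longrightarrow>
          ldg_solution sch \<kappa> T k N X u p r m s \<longrightarrow>
          is_Gauss_Radau_projection k N X (U 0) (u 0) \<longrightarrow>
          is_L2_projection k N X (deriv (U 0)) (r 0) \<longrightarrow>
          (\<forall>t\<in>{0..T}.
             (L2_norm {xl<..<xr} (\<lambda>x. U t x - u t x))\<^sup>2
               + (L2_norm {xl<..<xr} (\<lambda>x. deriv (U t) x - r t x))\<^sup>2
             \<le> C (Linf_sobolev_norm T (k + 3) {xl<..<xr} U) * mesh_size N X ^ (2 * k))))"
proof -
  let ?B = "\<lambda>K. Csob (xr - xl) (K + 1)"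
  \<comment> \<open>The maximum with 1 gives positivity for every real argument. K enters only
    through \<open>Csob\<close>, shifted by 1 as in \<open>Linf_sobolev_AE\<close>.\<close>
  let ?C = "\<lambda>K. max 1 (Cerr \<kappa> k (xr - xl) \<rho> T (GG k (?B K)))"
  have B: "0 \<le> ?B K" for K using assms(1) by (intro Csob_nonneg) simp
  show ?thesis
  proof (rule exI[where x = ?C], intro conjI allI impI ballI)
    show "0 < ?C K" for K by simp
    fix U N X u p r m s t
    assume sol: "mCH_solution \<kappa> T xl xr U" and U: "U \<in> Linf_sobolev T (k + 3) {xl<..<xr}"
      and mesh: "is_mesh xl xr N X" "quasi_uniform \<rho> N X" and ldg: "ldg_solution sch \<kappa> T k N X u p r m s"
      and init: "is_Gauss_Radau_projection k N X (U 0) (u 0)" "is_L2_projection k N X (deriv (U 0)) (r 0)"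
      and t: "t \<in> {0..T}"
    let ?K = "Linf_sobolev_norm T (k + 3) {xl<..<xr} U"
    interpret ldg_error xl xr \<rho> k N X \<kappa> T "?B ?K" sch U u p r m s
      by unfold_locales (rule assms mesh B sol ldg init mCH_smooth_approximable[OF sol assms(3,1) U]; assumption?)+
    have "Cerr \<kappa> k (xr - xl) \<rho> T (GG k (?B ?K)) * mesh_size N X ^ (2 * k) \<le> ?C ?K * mesh_size N X ^ (2 * k)"
      using h_pos unfolding h_def[symmetric] by (intro mult_right_mono) auto
    then show "(L2_norm {xl<..<xr} (\<lambda>x. U t x - u t x))\<^sup>2 + (L2_norm {xl<..<xr} (\<lambda>x. deriv (U t) x - r t x))\<^sup>2
      \<le> ?C ?K * mesh_size N X ^ (2 * k)"
      by (rule order.trans[OF error_bound[OF t]])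
  qed
qed

end
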